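(* Let $(S_n)_{n\ge 0}$ be an ERWG process whose memory matrix $B$ is symmetric, let $T$ be a real orthogonal matrix with $T'BT=\mathrm{diag}(\lambda_1,\dots,\lambda_k)$, and suppose $\eta\le\frac12$. Then there exist (possibly on a different probability space where the entire process $(S_n)$ is redefined without changing its distribution) independent one-dimensional standard Brownian motions $\{W^{(1)}(s)\}_{s\ge0},\dots,\{W^{(k)}(s)\}_{s\ge0}$ such that $$S_nT=\left(n^{\lambda_1}W^{(1)}\Big(\sum_{j=1}^nj^{-2\lambda_1}\Big),\dots,n^{\lambda_k}W^{(k)}\Big(\sum_{j=1}^nj^{-2\lambda_k}\Big)\right)+\epsilon_n\quad\text{a.s.},$$ where $\epsilon_n=(\epsilon_n^{(1)},\dots,\epsilon_n^{(k)})$ satisfies $\epsilon_n^{(j)}=O(n^{\frac12-\delta_j})$ a.s. for all $j=1,\dots,k$, with $\delta_j>0$ if $\lambda_j<\frac12$ and $\delta_j=0$ if $\lambda_j=\frac12$.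
   Context: ERWG model. Let $k\ge1$, $V=\{1,\dots,k\}$, and let $(V,\overrightarrow{E})$, $\overrightarrow{E}\subseteq V\times V$, be a directed graph (self-loops allowed) in which every vertex $j$ has in-degree $d_j^{\rm in}=|\{i:(i,j)\in\overrightarrow{E}\}|\ge1$. Let $p_v,q_v\in[0,1]$ for $v\in V$. $\mathrm{Rad}(p)$ is the law on $\{-1,1\}$ giving mass $p$ to $1$. Let $\{\sigma^{(v)},\xi_n^{(v)},D_n^{(v)},u_n^{(v)}: n\ge1,v\in V\}$ be independent with $\sigma^{(v)}\sim\mathrm{Rad}(q_v)$, $\xi_n^{(v)}\sim\mathrm{Rad}(p_v)$, $D_n^{(v)}\sim\mathrm{Unif}\{1,\dots,n\}$, $u_n^{(v)}\sim\mathrm{Unif}\{v':(v',v)\in\overrightarrow{E}\}$. Define $X_1^{(v)}=\sigma^{(v)}$ and, for $n\ge1$, $X_{n+1}^{(v)}=\xi_n^{(v)}X^{(u_n^{(v)})}_{D_n^{(v)}}$; set $X_n=(X_n^{(1)},\dots,X_n^{(k)})$, $S_0=0$, $S_n=\sum_{j=1}^nX_j$. The process $(S_n)$ is called the ERWG process. Its memory matrix is the $k\times k$ matrix $B$ with $B_{i,j}=\frac{2p_j-1}{d_j^{\rm in}}\mathbf{1}_{\{(i,j)\in\overrightarrow{E}\}}$. Let $\lambda_1,\dots,\lambda_k$ be the eigenvalues of $B$ (with multiplicity) and $\eta=\max_j\Re(\lambda_j)$. All vectors are row vectors. $O(\cdot)$ is as $n\to\infty$, and "a.s." means the bound holds almost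 surely with a possibly random constant. (For a single vertex with a self-loop, $(S_n)$ is the classical elephant random walk with $B=2p_1-1$ and $T=1$.) *)

theory Defs
  imports "HOL-Probability.Probability" "HOL-Library.Landau_Symbols"
begin

definition diag_matrix :: "('n \<Rightarrow> 'b::zero) \<Rightarrow> 'b ^ 'n ^ 'n" where
  "diag_matrix d = (\<chi> i j. if i = j then d i else 0)"

definition eigenvalues :: "real ^ 'n ^ 'n \<Rightarrow> complex set" where
  "eigenvalues B = {z. \<exists>v. v \<noteq> 0 \<and> map_matrix complex_of_real B *v v = z *s v}"

definition max_Re_eigenvalue :: "real ^ 'n ^ 'n \<Rightarrow> real" where
  "max_Re_eigenvalue B = Max (Re ` eigenvalues B)"

text \<open>The vertex set is the universe of a finite type, and \<open>(i, j) \<in> E\<close> is an edge from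
  \<open>i\<close> to \<open>j\<close>.\<close>

definition in_nbrs :: "('k \<times> 'k) set \<Rightarrow> 'k \<Rightarrow> 'k set" where
  "in_nbrs E j = {i. (i, j) \<in> E}"

definition in_deg :: "('k \<times> 'k) set \<Rightarrow> 'k \<Rightarrow> nat" where
  "in_deg E j = card (in_nbrs E j)"

definition memory_matrix :: "('k \<times> 'k) set \<Rightarrow> ('k \<Rightarrow> real) \<Rightarrow> real ^ 'k ^ 'k" where
  "memory_matrix E p = (\<chi> i j. if (i, j) \<in> E then (2 * p j - 1) / real (in_deg E j) else 0)"

definition Rad :: "real \<Rightarrow> int pmf" where
  "Rad p = map_pmf (\<lambda>b. if b then 1 else - 1) (bernoulli_pmf p)"

datatype 'k source = Sigma_src 'k | Xi_src nat 'k | D_src nat 'k | U_src nat 'k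

definition sources :: "'k source set" where
  "sources = range Sigma_src \<union>
     {s. \<exists>n\<ge>1. \<exists>v. s = Xi_src n v \<or> s = D_src n v \<or> s = U_src n v}"

fun source_events ::
  "'a measure \<Rightarrow> ('k \<Rightarrow> 'a \<Rightarrow> int) \<Rightarrow> (nat \<Rightarrow> 'k \<Rightarrow> 'a \<Rightarrow> int) \<Rightarrow> (nat \<Rightarrow> 'k \<Rightarrow> 'a \<Rightarrow> nat) \<Rightarrow>
    (nat \<Rightarrow> 'k \<Rightarrow> 'a \<Rightarrow> 'k) \<Rightarrow> 'k source \<Rightarrow> 'a set set" where
  "source_events M \<sigma> \<xi> D u (Sigma_src v) =
     sets (vimage_algebra (space M) (\<sigma> v) (count_space UNIV))"
| "source_events M \<sigma> \<xi> D u (Xi_src n v) =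
     sets (vimage_algebra (space M) (\<xi> n v) (count_space UNIV))"
| "source_events M \<sigma> \<xi> D u (D_src n v) =
     sets (vimage_algebra (space M) (D n v) (count_space UNIV))"
| "source_events M \<sigma> \<xi> D u (U_src n v) =
     sets (vimage_algebra (space M) (u n v) (count_space UNIV))"

locale erwg = prob_space M
  for M :: "'a measure" +
  fixes E :: "('k::finite \<times> 'k) set"
    and p q :: "'k \<Rightarrow> real"
    and \<sigma> :: "'k \<Rightarrow> 'a \<Rightarrow> int"
    and \<xi> :: "nat \<Rightarrow> 'k \<Rightarrow> 'a \<Rightarrow> int"
    and D :: "nat \<Rightarrow> 'k \<Rightarrow> 'a \<Rightarrow> nat"
    and u :: "nat \<Rightarrow> 'k \<Rightarrow> 'a \<Rightarrow> 'k"
  assumes in_deg_ge_1: "in_deg E v \<ge> 1"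
    and p_range: "p v \<in> {0..1}"
    and q_range: "q v \<in> {0..1}"
    and measurable_sigma: "\<sigma> v \<in> measurable M (count_space UNIV)"
    and measurable_xi: "n \<ge> 1 \<Longrightarrow> \<xi> n v \<in> measurable M (count_space UNIV)"
    and measurable_D: "n \<ge> 1 \<Longrightarrow> D n v \<in> measurable M (count_space UNIV)"
    and measurable_u: "n \<ge> 1 \<Longrightarrow> u n v \<in> measurable M (count_space UNIV)"
    and law_sigma: "distr M (count_space UNIV) (\<sigma> v) = measure_pmf (Rad (q v))"
    and law_xi: "n \<ge> 1 \<Longrightarrow> distr M (count_space UNIV) (\<xi> n v) = measure_pmf (Rad (p v))"
    and law_D: "n \<ge> 1 \<Longrightarrow> distr M (count_space UNIV) (D n v) = measure_pmf (pmf_of_set {1..n})"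
    and law_u: "n \<ge> 1 \<Longrightarrow> distr M (count_space UNIV) (u n v) = measure_pmf (pmf_of_set (in_nbrs E v))"
    and indep: "indep_sets (source_events M \<sigma> \<xi> D u) sources"

text \<open>Almost surely \<open>D n v \<in> {1..n}\<close> for all \<open>n \<ge> 1\<close>; the value \<open>0\<close> in the \<open>else\<close> branch
  below (and at time \<open>0\<close>, where there is no step) only matters on the exceptional null set, where
  the recursion would otherwise not be well founded.\<close>

fun erwg_X ::
  "('k \<Rightarrow> 'a \<Rightarrow> int) \<Rightarrow> (nat \<Rightarrow> 'k \<Rightarrow> 'a \<Rightarrow> int) \<Rightarrow> (nat \<Rightarrow> 'k \<Rightarrow> 'a \<Rightarrow> nat) \<Rightarrow>
    (nat \<Rightarrow> 'k \<Rightarrow> 'a \<Rightarrow> 'k) \<Rightarrow> nat \<Rightarrow> 'k \<Rightarrow> 'a \<Rightarrow> int" where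
  "erwg_X \<sigma> \<xi> D u 0 v \<omega> = 0"
| "erwg_X \<sigma> \<xi> D u (Suc n) v \<omega> =
     (if n = 0 then \<sigma> v \<omega>
      else \<xi> n v \<omega> * (if D n v \<omega> \<le> n then erwg_X \<sigma> \<xi> D u (D n v \<omega>) (u n v \<omega>) \<omega> else 0))"

definition erwg_S ::
  "('k \<Rightarrow> 'a \<Rightarrow> int) \<Rightarrow> (nat \<Rightarrow> 'k \<Rightarrow> 'a \<Rightarrow> int) \<Rightarrow> (nat \<Rightarrow> 'k \<Rightarrow> 'a \<Rightarrow> nat) \<Rightarrow>
    (nat \<Rightarrow> 'k \<Rightarrow> 'a \<Rightarrow> 'k) \<Rightarrow> nat \<Rightarrow> 'a \<Rightarrow> real ^ 'k" where
  "erwg_S \<sigma> \<xi> D u n \<omega> = (\<Sum>j = 1..n. (\<chi> v. real_of_int (erwg_X \<sigma> \<xi> D u j v \<omega>)))"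

text \<open>Processes are indexed by \<open>real\<close>; only times \<open>t \<ge> 0\<close> are meaningful.\<close>

definition standard_brownian_motion :: "'b measure \<Rightarrow> (real \<Rightarrow> 'b \<Rightarrow> real) \<Rightarrow> bool" where
  "standard_brownian_motion N W \<longleftrightarrow>
     (\<forall>t\<ge>0. W t \<in> borel_measurable N) \<and>
     (AE \<omega> in N. W 0 \<omega> = 0) \<and>
     (\<forall>(n::nat) t. 0 \<le> t 0 \<and> (\<forall>i<n. t i \<le> t (Suc i)) \<longrightarrow>
        prob_space.indep_vars N (\<lambda>_. borel) (\<lambda>i \<omega>. W (t (Suc i)) \<omega> - W (t i) \<omega>) {..<n}) \<and>
     (\<forall>s t. 0 \<le> s \<and> s < t \<longrightarrow>
        distributed N lborel (\<lambda>\<omega>. W t \<omega> - W s \<omega>) (normal_density 0 (sqrt (t - s)))) \<and>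
     (AE \<omega> in N. continuous_on {0..} (\<lambda>t. W t \<omega>))"

definition independent_processes :: "'b measure \<Rightarrow> ('k \<Rightarrow> real \<Rightarrow> 'b \<Rightarrow> real) \<Rightarrow> bool" where
  "independent_processes N W \<longleftrightarrow>
     prob_space.indep_vars N (\<lambda>_. \<Pi>\<^sub>M t\<in>{0..}. borel) (\<lambda>j \<omega>. \<lambda>t\<in>{0..}. W j t \<omega>) UNIV"

definition same_process_law ::
  "'a measure \<Rightarrow> (nat \<Rightarrow> 'a \<Rightarrow> real ^ 'k) \<Rightarrow> 'b measure \<Rightarrow> (nat \<Rightarrow> 'b \<Rightarrow> real ^ 'k) \<Rightarrow> bool" where
  "same_process_law M S N S' \<longleftrightarrow>
     (\<forall>n. S n \<in> borel_measurable M) \<and> (\<forall>n. S' n \<in> borel_measurable N) \<and>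
     distr N (\<Pi>\<^sub>M n\<in>UNIV. borel) (\<lambda>\<omega> n. S' n \<omega>) = distr M (\<Pi>\<^sub>M n\<in>UNIV. borel) (\<lambda>\<omega> n. S n \<omega>)"

end

theory Submission
  imports Defs "HOL-Real_Asymp.Real_Asymp"
begin

text \<open>Since \<open>B T = T diag(\<lambda>)\<close>, the \<open>j\<close>-th coordinate of \<open>Z n = S n v* T\<close> satisfies
  \<open>Z (n + 1) = (1 + \<lambda>/n) Z n + x n\<close> with martingale differences \<open>x n\<close>, while
  \<open>V n = n powr \<lambda> * W (\<Sum>i\<le>n. i powr (-2\<lambda>))\<close> satisfies
  \<open>V (n + 1) = (1 + 1/n) powr \<lambda> * V n + g n\<close> with independent standard normal \<open>g n\<close>. If the sums of
  \<open>x n - g n\<close> are \<open>O(n powr (1/2 - c))\<close>, comparing the two recursions gives the claim.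

  The walk is therefore built from the Brownian motions. Steps are grouped in blocks; the orthogonal matrix
  \<open>T\<close> turns the normalized increments of the \<open>W j\<close> into independent normals indexed by vertices, and the sum
  of such normals over a block is transformed by quantiles into a vector of fair signs whose sum is close to it, by
  a quantitative central limit theorem. A step of vertex \<open>v\<close> with conditional mean \<open>m\<close> is the fair sign, replaced by
  the sign of \<open>m\<close> with probability \<open>\<bar>m\<bar>\<close>; since \<open>m\<close> is small in mean square, the replacements cost little. The
  resulting walk has the transition probabilities of the ERWG process, hence its law.\<close>

text \<open>Since the error only has to gain some power of \<open>n\<close> over the square root,
  and nothing at eigenvalue 1/2, every estimate may give away a small power. The laws may not be
  approximate, however: the \<open>W j\<close> must be exactly independent Brownian motions, and the
  walk must have exactly the ERWG law. Building the walk from the Brownian motions makes both exact.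
  The obstacle is that a single sign cannot follow a single normal increment: each step costs an
  error of order one, and these add up to order sqrt n. Only the sum over a long block can be
  followed, and one normal then decides all signs of the block. The signs therefore carry no drift
  when they are made, and are exactly independent over times and vertices; the drift, which needs
  the earlier steps of the same block, enters afterwards through \<open>push\<close> and separate
  uniforms. The price of \<open>push\<close> is seen in second moments. A replaced step changes the
  martingale difference by O(1) with probability E|m| = O(n^(-1/4)), and orthogonality makes the
  accumulated change of order n^(3/8) in mean square, well below n^(1/2).\<close>

section \<open>Almost sure bounds from moments\<close>

text \<open>A nonnegative series of finite expectation is finite almost surely. It takes the place
  of a Borel-Cantelli argument and is what controls the sum of the coupling errors over all
  blocks.\<close>

lemma AE_summable_of_nn_integral:
  fixes f :: "nat \<Rightarrow> 'a \<Rightarrow> real"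
  assumes meas: "\<And>n. f n \<in> borel_measurable M"
    and nn: "\<And>n \<omega>. 0 \<le> f n \<omega>"
    and le: "\<And>n. (\<integral>\<^sup>+\<omega>. ennreal (f n \<omega>) \<partial>M) \<le> ennreal (c n)"
    and c: "\<And>n. 0 \<le> c n" "summable c"
  shows "AE \<omega> in M. summable (\<lambda>n. f n \<omega>)"
proof -
  have [measurable]: "\<And>n. f n \<in> borel_measurable M" by (rule meas)
  have "(\<integral>\<^sup>+\<omega>. (\<Sum>n. ennreal (f n \<omega>)) \<partial>M) = (\<Sum>n. \<integral>\<^sup>+\<omega>. ennreal (f n \<omega>) \<partial>M)"
    by (intro nn_integral_suminf) measurable
  also have "\<dots> \<le> (\<Sum>n. ennreal (c n))"
    by (intro suminf_le le) auto
  also have "\<dots> = ennreal (\<Sum>n. c n)"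
    by (intro suminf_ennreal2 c)
  finally have "(\<integral>\<^sup>+\<omega>. (\<Sum>n. ennreal (f n \<omega>)) \<partial>M) \<noteq> \<infinity>"
    by (metis ennreal_neq_top infinity_ennreal_def top.extremum_uniqueI)
  then have "AE \<omega> in M. (\<Sum>n. ennreal (f n \<omega>)) \<noteq> \<infinity>"
    by (intro nn_integral_PInf_AE) measurable
  then show ?thesis
  proof eventually_elim
    case (elim \<omega>)
    then show ?case by (intro summable_suminf_not_top nn) simp
  qed
qed

text \<open>The weights 1/(n+1)^2 make the expectations summable, and a term of a convergent
  nonnegative series is at most its sum. The quadratic loss becomes harmless when \<open>f\<close>
  is a high power or an exponential of the quantity of interest.\<close>

lemma AE_bounded_of_nn_integral:
  fixes f :: "nat \<Rightarrow> 'a \<Rightarrow> real"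
  assumes meas: "\<And>n. f n \<in> borel_measurable M"
    and nn: "\<And>n \<omega>. 0 \<le> f n \<omega>"
    and le: "\<And>n. (\<integral>\<^sup>+\<omega>. ennreal (f n \<omega>) \<partial>M) \<le> ennreal C"
    and C: "0 \<le> C"
  shows "AE \<omega> in M. \<exists>K>0. \<forall>n. f n \<omega> \<le> K * (real n + 1)\<^sup>2"
proof -
  have [measurable]: "\<And>n. f n \<in> borel_measurable M" by (rule meas)
  have eq: "ennreal (f n \<omega> / (real n + 1)\<^sup>2) = ennreal (1 / (real n + 1)\<^sup>2) * ennreal (f n \<omega>)" for n \<omega>
    by (subst ennreal_mult[symmetric]) (auto simp: nn)
  have "AE \<omega> in M. summable (\<lambda>n. f n \<omega> / (real n + 1)\<^sup>2)"
  proof (rule AE_summable_of_nn_integral[where c="\<lambda>n. C / (real n + 1)\<^sup>2"])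
    fix n
    have "(\<integral>\<^sup>+\<omega>. ennreal (f n \<omega> / (real n + 1)\<^sup>2) \<partial>M) =
        ennreal (1 / (real n + 1)\<^sup>2) * (\<integral>\<^sup>+\<omega>. ennreal (f n \<omega>) \<partial>M)"
      unfolding eq by (rule nn_integral_cmult) measurable
    also have "\<dots> \<le> ennreal (1 / (real n + 1)\<^sup>2) * ennreal C"
      by (intro mult_left_mono le) auto
    also have "\<dots> = ennreal (C / (real n + 1)\<^sup>2)"
      by (subst ennreal_mult[symmetric]) (auto simp: C)
    finally show "(\<integral>\<^sup>+\<omega>. ennreal (f n \<omega> / (real n + 1)\<^sup>2) \<partial>M) \<le> ennreal (C / (real n + 1)\<^sup>2)" .
  next
    have "summable (\<lambda>n. C * (1 / (real (Suc n))\<^sup>2))"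
      using inverse_power_summable[of 2, where 'a=real]
      by (intro summable_mult, subst summable_Suc_iff[of "\<lambda>n. 1 / (real n)\<^sup>2"]) (simp add: field_simps)
    then show "summable (\<lambda>n. C / (real n + 1)\<^sup>2)" by (simp add: add.commute)
  qed (auto simp: nn C)
  then show ?thesis
  proof eventually_elim
    case (elim \<omega>)
    let ?K = "(\<Sum>n. f n \<omega> / (real n + 1)\<^sup>2) + 1"
    have "f n \<omega> \<le> ?K * (real n + 1)\<^sup>2" for n
    proof -
      have "f n \<omega> / (real n + 1)\<^sup>2 = (\<Sum>i\<in>{n}. f i \<omega> / (real i + 1)\<^sup>2)" by simp
      also have "\<dots> \<le> (\<Sum>n. f n \<omega> / (real n + 1)\<^sup>2)"
        by (intro sum_le_suminf elim) (auto simp: nn)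
      finally have "f n \<omega> / (real n + 1)\<^sup>2 \<le> ?K" by simp
      then show ?thesis by (simp add: field_simps)
    qed
    moreover have "0 < ?K"
      by (intro add_nonneg_pos suminf_nonneg elim) (auto simp: nn)
    ultimately show ?case by blast
  qed
qed

section \<open>Independence in groups\<close>

context prob_space
begin

text \<open>Independence on two levels: between the \<open>X i\<close>, and for fixed
  \<open>i\<close> between several functions of \<open>X i\<close>. Halves of dyadic increments,
  rotated normals and signs inside blocks all obtain their joint independence in this way.\<close>

lemma indep_vars_nested:
  assumes X: "indep_vars M' X I"
    and f: "\<And>i j. i \<in> I \<Longrightarrow> j \<in> J i \<Longrightarrow> f i j \<in> measurable (M' i) (N i j)"
    and inner: "\<And>i. i \<in> I \<Longrightarrow> indep_vars (N i) (\<lambda>j \<omega>. f i j (X i \<omega>)) (J i)"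
  shows "indep_vars (\<lambda>(i, j). N i j) (\<lambda>(i, j) \<omega>. f i j (X i \<omega>)) (Sigma I J)"
  unfolding indep_vars_def2
proof (intro conjI ballI indep_setsI)
  have Xm: "\<And>i. i \<in> I \<Longrightarrow> X i \<in> measurable M (M' i)"
    using X by (auto simp: indep_vars_def2)
  have fX: "\<And>i j. i \<in> I \<Longrightarrow> j \<in> J i \<Longrightarrow> (\<lambda>\<omega>. f i j (X i \<omega>)) \<in> measurable M (N i j)"
    using Xm f by (rule measurable_compose)
  then show "\<And>k. k \<in> Sigma I J \<Longrightarrow> random_variable (case k of (i, j) \<Rightarrow> N i j) (case k of (i, j) \<Rightarrow> \<lambda>\<omega>. f i j (X i \<omega>))"
    by auto
  then show "\<And>k. k \<in> Sigma I J \<Longrightarrow> {(case k of (i, j) \<Rightarrow> \<lambda>\<omega>. f i j (X i \<omega>)) -` A \<inter> space M |A. A \<in> sets (case k of (i, j) \<Rightarrow> N i j)} \<subseteq> events"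
    by auto
  fix A K
  assume K: "K \<noteq> {}" "K \<subseteq> Sigma I J" "finite K"
    and A: "\<forall>k\<in>K. A k \<in> {(case k of (i, j) \<Rightarrow> \<lambda>\<omega>. f i j (X i \<omega>)) -` A \<inter> space M |A. A \<in> sets (case k of (i, j) \<Rightarrow> N i j)}"
  have "\<forall>k\<in>K. \<exists>B. A k = (\<lambda>\<omega>. f (fst k) (snd k) (X (fst k) \<omega>)) -` B \<inter> space M \<and> B \<in> sets (N (fst k) (snd k))"
    using A by (force split: prod.splits)
  then obtain B where B: "\<And>k. k \<in> K \<Longrightarrow> A k = (\<lambda>\<omega>. f (fst k) (snd k) (X (fst k) \<omega>)) -` B k \<inter> space M"
      "\<And>k. k \<in> K \<Longrightarrow> B k \<in> sets (N (fst k) (snd k))"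
    by metis
  define I' where "I' = fst ` K"
  define J' where "J' i = {j. (i, j) \<in> K}" for i
  have I': "finite I'" "I' \<noteq> {}" "I' \<subseteq> I" using K by (auto simp: I'_def)
  have J': "finite (J' i)" "J' i \<subseteq> J i" "i \<in> I' \<Longrightarrow> J' i \<noteq> {}" for i
  proof -
    have "J' i \<subseteq> snd ` K" by (force simp: J'_def)
    then show "finite (J' i)" using K finite_surj by blast
  qed (use K in \<open>auto simp: J'_def I'_def\<close>)
  have KS: "K = Sigma I' J'" by (force simp: I'_def J'_def)
  \<comment> \<open>All conditions on the group \<open>i\<close> form one event for
    \<open>X i\<close>. The outer independence then factors over groups and the inner one within
    each group.\<close>
  define C where "C i = {x \<in> space (M' i). \<forall>j\<in>J' i. f i j x \<in> B (i, j)}" for i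
  have C: "C i \<in> sets (M' i)" if "i \<in> I'" for i
  proof -
    have "C i = (\<Inter>j\<in>J' i. f i j -` B (i, j) \<inter> space (M' i))"
      using J'(3)[OF that] by (auto simp: C_def)
    also have "\<dots> \<in> sets (M' i)"
      using that I' J'[of i] K B(2) f by (intro sets.finite_INT measurable_sets) (force simp: KS)+
    finally show ?thesis .
  qed
  have XC: "X i -` C i \<inter> space M = (\<Inter>j\<in>J' i. A (i, j))" if "i \<in> I'" for i
    using that J'(3)[OF that] I' Xm[THEN measurable_space] B(1) by (auto simp: C_def KS)
  have inner': "prob (\<Inter>j\<in>J' i. A (i, j)) = (\<Prod>j\<in>J' i. prob (A (i, j)))" if "i \<in> I'" for i
  proof -
    have "prob (\<Inter>j\<in>J' i. (\<lambda>\<omega>. f i j (X i \<omega>)) -` B (i, j) \<inter> space M)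
       = (\<Prod>j\<in>J' i. prob ((\<lambda>\<omega>. f i j (X i \<omega>)) -` B (i, j) \<inter> space M))"
      using that I' J'[of i] B(2) by (intro indep_varsD[OF inner]) (auto simp: KS)
    moreover have "A (i, j) = (\<lambda>\<omega>. f i j (X i \<omega>)) -` B (i, j) \<inter> space M" if "j \<in> J' i" for j
      using B(1)[of "(i, j)"] that by (auto simp: J'_def)
    ultimately show ?thesis by simp
  qed
  have "(\<Inter>k\<in>K. A k) = (\<Inter>i\<in>I'. \<Inter>j\<in>J' i. A (i, j))"
    by (auto simp: KS)
  also have "\<dots> = (\<Inter>i\<in>I'. X i -` C i \<inter> space M)"
    using XC by simp
  also have "prob \<dots> = (\<Prod>i\<in>I'. prob (X i -` C i \<inter> space M))"
    using I' C by (intro indep_varsD[OF X]) auto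
  also have "\<dots> = (\<Prod>i\<in>I'. \<Prod>j\<in>J' i. prob (A (i, j)))"
    using XC inner' by simp
  also have "\<dots> = (\<Prod>k\<in>K. prob (A k))"
    unfolding KS using I' J' by (subst prod.Sigma) auto
  finally show "prob (\<Inter>k\<in>K. A k) = (\<Prod>k\<in>K. prob (A k))" .
qed

lemma indep_vars_reindex:
  assumes h: "inj_on h J" and X: "indep_vars M' X (h ` J)"
  shows "indep_vars (\<lambda>j. M' (h j)) (\<lambda>j. X (h j)) J"
  unfolding indep_vars_def2
proof (intro conjI ballI indep_setsI)
  show rv: "\<And>j. j \<in> J \<Longrightarrow> random_variable (M' (h j)) (X (h j))"
    using X by (auto simp: indep_vars_def2)
  then show "\<And>j. j \<in> J \<Longrightarrow> {X (h j) -` A \<inter> space M |A. A \<in> sets (M' (h j))} \<subseteq> events"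
    by auto
  fix A K assume K: "K \<noteq> {}" "K \<subseteq> J" "finite K"
    and A: "\<forall>j\<in>K. A j \<in> {X (h j) -` A \<inter> space M |A. A \<in> sets (M' (h j))}"
  from A obtain B where B: "\<And>j. j \<in> K \<Longrightarrow> A j = X (h j) -` B j \<inter> space M" "\<And>j. j \<in> K \<Longrightarrow> B j \<in> sets (M' (h j))"
    by simp metis
  have hK: "inj_on h K" using h K inj_on_subset by blast
  define B' where "B' = (\<lambda>i. B (the_inv_into K h i))"
  have B': "B' (h j) = B j" if "j \<in> K" for j
    using that hK by (simp add: B'_def the_inv_into_f_f)
  have "prob (\<Inter>i\<in>h ` K. X i -` B' i \<inter> space M) = (\<Prod>i\<in>h ` K. prob (X i -` B' i \<inter> space M))"
    using K B B' by (intro indep_varsD[OF X]) auto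
  then show "prob (\<Inter>j\<in>K. A j) = (\<Prod>j\<in>K. prob (A j))"
    using B B' hK by (simp add: prod.reindex image_image)
qed

text \<open>Fubini for the product law of the pair: \<open>X\<close> is frozen while
  \<open>Y\<close> is integrated out. This serves later as conditioning on the past of the
  walk.\<close>

lemma indep_var_integral:
  fixes f :: "_ \<Rightarrow> real"
  assumes XY: "indep_var S X T Y" and [measurable]: "f \<in> borel_measurable (S \<Otimes>\<^sub>M T)"
    and int: "integrable M (\<lambda>\<omega>. f (X \<omega>, Y \<omega>))"
  shows "(\<integral>\<omega>. f (X \<omega>, Y \<omega>) \<partial>M) = (\<integral>\<omega>. (\<integral>y. f (X \<omega>, y) \<partial>distr M T Y) \<partial>M)"
proof -
  have [measurable]: "X \<in> measurable M S" "Y \<in> measurable M T"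
    using XY by (auto dest: indep_var_rv1 indep_var_rv2)
  interpret X: prob_space "distr M S X" by (rule prob_space_distr) simp
  interpret Y: prob_space "distr M T Y" by (rule prob_space_distr) simp
  interpret XY: pair_prob_space "distr M S X" "distr M T Y" ..
  have eq: "distr M S X \<Otimes>\<^sub>M distr M T Y = distr M (S \<Otimes>\<^sub>M T) (\<lambda>x. (X x, Y x))"
    using XY by (simp add: indep_var_distribution_eq)
  have "(\<integral>\<omega>. f (X \<omega>, Y \<omega>) \<partial>M) = (\<integral>z. f z \<partial>distr M (S \<Otimes>\<^sub>M T) (\<lambda>x. (X x, Y x)))"
    by (subst integral_distr) auto
  also have "\<dots> = (\<integral>x. (\<integral>y. f (x, y) \<partial>distr M T Y) \<partial>distr M S X)"
    unfolding eq[symmetric]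
  proof (rule XY.integral_fst'[symmetric])
    have "integrable (distr M (S \<Otimes>\<^sub>M T) (\<lambda>x. (X x, Y x))) f"
      using int by (subst integrable_distr_eq) auto
    then show "integrable (distr M S X \<Otimes>\<^sub>M distr M T Y) f"
      unfolding eq .
  qed
  also have "\<dots> = (\<integral>\<omega>. (\<integral>y. f (X \<omega>, y) \<partial>distr M T Y) \<partial>M)"
    by (subst integral_distr) (auto intro!: Y.borel_measurable_lebesgue_integral)
  finally show ?thesis .
qed

end

section \<open>Rotation invariance of independent normals\<close>

lemma nn_integral_lborel_translate:
  fixes f :: "'b::euclidean_space \<Rightarrow> ennreal"
  assumes [measurable]: "f \<in> borel_measurable borel"
  shows "(\<integral>\<^sup>+x. f (a + x) \<partial>lborel) = (\<integral>\<^sup>+x. f x \<partial>lborel)"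
proof -
  have "(\<integral>\<^sup>+x. f x \<partial>lborel) = (\<integral>\<^sup>+x. f x \<partial>distr lborel borel ((+) a))"
    by (simp add: lborel_distr_plus)
  also have "\<dots> = (\<integral>\<^sup>+x. f (a + x) \<partial>lborel)"
    by (subst nn_integral_distr) auto
  finally show ?thesis ..
qed

lemma nn_integral_lborel_reflect:
  fixes f :: "'b::euclidean_space \<Rightarrow> ennreal"
  assumes [measurable]: "f \<in> borel_measurable borel"
  shows "(\<integral>\<^sup>+x. f (a - x) \<partial>lborel) = (\<integral>\<^sup>+x. f x \<partial>lborel)"
proof -
  have "lborel = density (distr lborel borel (\<lambda>x::'b. 0 + (-1) *\<^sub>R x)) (\<lambda>_. \<bar>-1::real\<bar> ^ DIM('b))"
    by (rule lborel_affine) simp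
  moreover have "density (distr lborel borel uminus) (\<lambda>_. 1) = distr lborel borel (uminus :: 'b \<Rightarrow> 'b)"
    by (rule density_1)
  ultimately have m: "distr lborel borel uminus = (lborel :: 'b measure)"
    by (simp add: density_1)
  have "(\<integral>\<^sup>+x. f (a - x) \<partial>lborel) = (\<integral>\<^sup>+x. f (a + x) \<partial>distr lborel borel uminus)"
    by (subst nn_integral_distr) auto
  then show ?thesis
    by (simp add: m nn_integral_lborel_translate)
qed

text \<open>Uniqueness of Haar measure by Fubini: \<open>f \<mapsto> \<integral>f(Tx)dx\<close> is translation
  invariant, so it is a multiple of Lebesgue measure, and the unit ball fixes the constant.\<close>

lemma nn_integral_lborel_orthogonal:
  fixes T :: "'b::euclidean_space \<Rightarrow> 'b" and f :: "'b \<Rightarrow> ennreal"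
  assumes T: "orthogonal_transformation T" and [measurable]: "f \<in> borel_measurable borel"
  shows "(\<integral>\<^sup>+x. f (T x) \<partial>lborel) = (\<integral>\<^sup>+x. f x \<partial>lborel)"
proof -
  have lin: "linear T" using T by (rule orthogonal_transformation_linear)
  have [measurable]: "T \<in> borel_measurable borel"
    using lin by (intro borel_measurable_continuous_onI linear_continuous_on) (simp add: linear_conv_bounded_linear)
  obtain T' where T': "\<And>x. T (T' x) = x"
    using orthogonal_transformation_surj[OF T] by (metis surj_def)
  define g :: "'b \<Rightarrow> ennreal" where "g = indicator (ball 0 1)"
  have [measurable]: "g \<in> borel_measurable borel" unfolding g_def by (intro borel_measurable_indicator) simp
  have gT: "g (T x) = g x" for x
    using orthogonal_transformation_norm[OF T] by (simp add: g_def indicator_def)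
  have g: "(\<integral>\<^sup>+x. g x \<partial>lborel) = emeasure lborel (ball (0::'b) 1)"
    by (simp add: g_def)
  have g0: "emeasure lborel (ball (0::'b) 1) \<noteq> 0" "emeasure lborel (ball (0::'b) 1) \<noteq> \<infinity>"
  proof -
    show "emeasure lborel (ball (0::'b) 1) \<noteq> \<infinity>"
      using emeasure_bounded_finite[OF bounded_ball, of "0::'b" 1] by (simp add: less_top)
    show "emeasure lborel (ball (0::'b) 1) \<noteq> 0"
      using open_not_negligible[of "ball (0::'b) 1"]
      by (auto simp: negligible_iff_emeasure0 emeasure_completion)
  qed
  have "(\<integral>\<^sup>+x. f (T x) \<partial>lborel) * (\<integral>\<^sup>+x. g x \<partial>lborel)
      = (\<integral>\<^sup>+x. (\<integral>\<^sup>+y. f (T x) * g (T x + y) \<partial>lborel) \<partial>lborel)"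
    by (simp add: nn_integral_cmult nn_integral_multc nn_integral_lborel_translate)
  also have "\<dots> = (\<integral>\<^sup>+y. (\<integral>\<^sup>+x. f (T x) * g (T x + y) \<partial>lborel) \<partial>lborel)"
    by (intro lborel_pair.Fubini') measurable
  \<comment> \<open>After the exchange of integrals, the substitution of \<open>x - T' y\<close> for
    \<open>x\<close> moves the shift by \<open>y\<close> from \<open>g\<close> to \<open>f\<close>.
    Exchanging back, the integral over \<open>y\<close> removes \<open>T\<close> from
    \<open>f\<close>, and \<open>g\<close> ignores \<open>T\<close>.\<close>
  also have "\<dots> = (\<integral>\<^sup>+y. (\<integral>\<^sup>+x. f (T x - y) * g (T x) \<partial>lborel) \<partial>lborel)"
  proof (rule nn_integral_cong)
    fix y
    have "T (x - T' y) = T x - y" for x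
      using linear_diff[OF lin] T' by simp
    then show "(\<integral>\<^sup>+x. f (T x) * g (T x + y) \<partial>lborel) = (\<integral>\<^sup>+x. f (T x - y) * g (T x) \<partial>lborel)"
      using nn_integral_lborel_translate[of "\<lambda>x. f (T x) * g (T x + y)" "- T' y"] by simp
  qed
  also have "\<dots> = (\<integral>\<^sup>+x. (\<integral>\<^sup>+y. f (T x - y) * g (T x) \<partial>lborel) \<partial>lborel)"
    by (intro lborel_pair.Fubini') measurable
  also have "\<dots> = (\<integral>\<^sup>+x. f x \<partial>lborel) * (\<integral>\<^sup>+x. g x \<partial>lborel)"
    by (simp add: nn_integral_cmult nn_integral_multc nn_integral_lborel_reflect gT)
  finally have "(\<integral>\<^sup>+x. f (T x) \<partial>lborel) * emeasure lborel (ball (0::'b) 1)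
      = (\<integral>\<^sup>+x. f x \<partial>lborel) * emeasure lborel (ball (0::'b) 1)"
    unfolding g .
  then have "emeasure lborel (ball (0::'b) 1) * (\<integral>\<^sup>+x. f (T x) \<partial>lborel)
      = emeasure lborel (ball (0::'b) 1) * (\<integral>\<^sup>+x. f x \<partial>lborel)"
    by (simp only: mult.commute)
  then show ?thesis
    using g0 ennreal_mult_cancel_left[of "emeasure lborel (ball (0::'b) 1)" "\<integral>\<^sup>+x. f (T x) \<partial>lborel" "\<integral>\<^sup>+x. f x \<partial>lborel"]
    by simp
qed

lemma prod_Basis_vec:
  fixes F :: "real ^ 'k::finite \<Rightarrow> 'c::comm_monoid_mult"
  shows "(\<Prod>b\<in>Basis. F b) = (\<Prod>i\<in>UNIV. F (axis i (1::real) :: real ^ 'k))"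
proof -
  have B: "(Basis :: (real ^ 'k) set) = range (\<lambda>i. axis i 1)"
    by (auto simp: Basis_vec_def)
  have inj: "inj (\<lambda>i. axis i (1::real) :: real ^ 'k)"
    by (auto simp: inj_on_def axis_eq_axis)
  show ?thesis unfolding B prod.reindex[OF inj] comp_def ..
qed

lemma nn_integral_lborel_vec_prod:
  fixes f :: "'k::finite \<Rightarrow> real \<Rightarrow> ennreal"
  assumes "\<And>i. f i \<in> borel_measurable borel"
  shows "(\<integral>\<^sup>+x. (\<Prod>i\<in>UNIV. f i (x $ i)) \<partial>(lborel :: (real ^ 'k) measure)) = (\<Prod>i\<in>UNIV. \<integral>\<^sup>+x. f i x \<partial>lborel)"
proof -
  have "(\<integral>\<^sup>+x. (\<Prod>b\<in>Basis. f (axis_index b) (x \<bullet> b)) \<partial>(lborel :: (real ^ 'k) measure))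
      = (\<Prod>b\<in>(Basis::(real ^ 'k) set). \<integral>\<^sup>+x. f (axis_index b) x \<partial>lborel)"
    by (intro nn_integral_lborel_prod assms) auto
  moreover have "axis_index (axis i 1 :: real ^ 'k) = i" for i :: 'k
    by (simp add: axis_index_axis)
  ultimately show ?thesis
    by (simp add: prod_Basis_vec inner_axis)
qed

text \<open>The parameter is the standard deviation, as in \<open>normal_density\<close>;
  \<open>scaled_gauss\<close> below takes the variance.\<close>

definition gauss :: "real \<Rightarrow> real measure" where
  "gauss s = density lborel (normal_density 0 s)"

lemma gauss_simps[simp, measurable_cong]: "sets (gauss s) = sets borel"
  and space_gauss[simp]: "space (gauss s) = UNIV"
  by (simp_all add: gauss_def)

lemma prob_space_gauss: "0 < s \<Longrightarrow> prob_space (gauss s)"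
  unfolding gauss_def by (rule prob_space_normal_density)

lemma distributed_normal_iff:
  "distributed M lborel X (normal_density 0 s) \<longleftrightarrow> X \<in> borel_measurable M \<and> distr M borel X = gauss s"
proof -
  have "distr M lborel X = distr M borel X" by (rule distr_cong) auto
  then show ?thesis by (auto simp: distributed_def gauss_def)
qed

text \<open>A density on Euclidean space and not a product measure, so that rotations act on it;
  \<open>distr_gauss_vec_nth\<close> leads back to the product form.\<close>

definition gauss_vec :: "real \<Rightarrow> (real ^ 'k) measure" where
  "gauss_vec s = density lborel (\<lambda>x. ennreal (\<Prod>i\<in>UNIV. normal_density 0 s (x $ i)))"

lemma sets_gauss_vec[simp, measurable_cong]: "sets (gauss_vec s) = sets borel"
  and space_gauss_vec[simp]: "space (gauss_vec s) = UNIV"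
  by (simp_all add: gauss_vec_def)

lemma distr_gauss_vec_nth:
  assumes s: "0 < s"
  shows "distr (gauss_vec s) (\<Pi>\<^sub>M i\<in>(UNIV::'k::finite set). borel) (\<lambda>x i. x $ i) = (\<Pi>\<^sub>M i\<in>(UNIV::'k set). gauss s)"
proof -
  interpret G: prob_space "gauss s" using s by (rule prob_space_gauss)
  interpret product_sigma_finite "\<lambda>i::'k. gauss s" ..
  have m: "(\<lambda>x i. x $ i) \<in> measurable (gauss_vec s) (\<Pi>\<^sub>M i\<in>(UNIV::'k::finite set). borel)"
    by (intro measurable_PiM_single') (auto simp: gauss_vec_def)
  show ?thesis
  proof (rule PiM_eqI)
    show "sets (distr (gauss_vec s) (\<Pi>\<^sub>M i\<in>(UNIV::'k set). borel) (\<lambda>x i. x $ i)) = sets (\<Pi>\<^sub>M i\<in>(UNIV::'k set). gauss s)"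
      by (simp cong: sets_PiM_cong)
    fix A :: "'k \<Rightarrow> real set" assume A: "\<And>i. i \<in> UNIV \<Longrightarrow> A i \<in> sets (gauss s)"
    then have [measurable]: "A i \<in> sets borel" for i by simp
    have "distr (gauss_vec s) (\<Pi>\<^sub>M i\<in>(UNIV::'k set). borel) (\<lambda>x i. x $ i) (Pi\<^sub>E UNIV A)
        = emeasure (gauss_vec s) {x. \<forall>i. x $ i \<in> A i}"
    proof (subst emeasure_distr[OF m])
      show "Pi\<^sub>E UNIV A \<in> sets (\<Pi>\<^sub>M i\<in>(UNIV::'k set). borel)"
        by (intro sets_PiM_I_finite) auto
      show "emeasure (gauss_vec s) ((\<lambda>x i. x $ i) -` Pi\<^sub>E UNIV A \<inter> space (gauss_vec s))
          = emeasure (gauss_vec s) {x. \<forall>i. x $ i \<in> A i}"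
        by (rule arg_cong[where f="emeasure (gauss_vec s)"]) auto
    qed
    also have "\<dots> = (\<integral>\<^sup>+x. ennreal (\<Prod>i\<in>UNIV. normal_density 0 s (x $ i)) * indicator {x. \<forall>i. x $ i \<in> A i} x \<partial>lborel)"
      unfolding gauss_vec_def by (subst emeasure_density) auto
    also have "\<dots> = (\<integral>\<^sup>+x. (\<Prod>i\<in>UNIV. ennreal (normal_density 0 s (x $ i)) * indicator (A i) (x $ i)) \<partial>lborel)"
    proof (intro nn_integral_cong)
      fix x :: "real ^ 'k"
      have "(\<Prod>i\<in>UNIV. indicator (A i) (x $ i)) = (indicator {x. \<forall>i. x $ i \<in> A i} x :: ennreal)"
        by (auto simp: indicator_def intro!: prod.neutral)
      then show "ennreal (\<Prod>i\<in>UNIV. normal_density 0 s (x $ i)) * indicator {x. \<forall>i. x $ i \<in> A i} x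
          = (\<Prod>i\<in>UNIV. ennreal (normal_density 0 s (x $ i)) * indicator (A i) (x $ i))"
        by (simp add: prod.distrib prod_ennreal)
    qed
    also have "\<dots> = (\<Prod>i\<in>UNIV. \<integral>\<^sup>+x. ennreal (normal_density 0 s x) * indicator (A i) x \<partial>lborel)"
      by (rule nn_integral_lborel_vec_prod) measurable
    also have "\<dots> = (\<Prod>i\<in>UNIV. emeasure (gauss s) (A i))"
      unfolding gauss_def by (intro prod.cong refl, subst emeasure_density) auto
    finally show "distr (gauss_vec s) (\<Pi>\<^sub>M i\<in>(UNIV::'k set). borel) (\<lambda>x i. x $ i) (Pi\<^sub>E UNIV A) = (\<Prod>i\<in>UNIV. emeasure (gauss s) (A i))" .
  qed simp
qed

text \<open>The product of the normal densities depends on the vector only through its norm, and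
  orthogonal maps preserve the norm and Lebesgue measure.\<close>

lemma distr_gauss_vec_orthogonal:
  fixes T :: "real ^ 'k::finite \<Rightarrow> real ^ 'k"
  assumes T: "orthogonal_transformation T"
  shows "distr (gauss_vec s) borel T = gauss_vec s"
proof (rule measure_eqI)
  have lin: "linear T" using T by (rule orthogonal_transformation_linear)
  have [measurable]: "T \<in> borel_measurable borel"
    using lin by (intro borel_measurable_continuous_onI linear_continuous_on) (simp add: linear_conv_bounded_linear)
  let ?d = "\<lambda>x :: real ^ 'k. \<Prod>i\<in>UNIV. normal_density 0 s (x $ i)"
  have d: "?d x = (1 / sqrt (2 * pi * s\<^sup>2)) ^ CARD('k) * exp (- (norm x)\<^sup>2 / (2 * s\<^sup>2))" for x :: "real ^ 'k"
    by (simp add: normal_density_def prod_dividef exp_sum[symmetric] sum_negf sum_divide_distrib[symmetric]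
        norm_vec_def L2_set_def sum_nonneg power_one_over field_simps)
  have dT: "?d (T x) = ?d x" for x
    unfolding d using orthogonal_transformation_norm[OF T] by simp
  fix A assume "A \<in> sets (distr (gauss_vec s) borel T)"
  then have [measurable]: "A \<in> sets borel" by simp
  have "distr (gauss_vec s) borel T A = emeasure (gauss_vec s) (T -` A)"
    by (subst emeasure_distr) auto
  also have "\<dots> = (\<integral>\<^sup>+x. ennreal (?d (T x)) * indicator A (T x) \<partial>lborel)"
    unfolding gauss_vec_def dT
    by (subst emeasure_density) (auto simp: indicator_def intro!: measurable_sets_borel[of T borel])
  also have "\<dots> = (\<integral>\<^sup>+x. ennreal (?d x) * indicator A x \<partial>lborel)"
    by (rule nn_integral_lborel_orthogonal[OF T, of "\<lambda>x. ennreal (?d x) * indicator A x"]) measurable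
  also have "\<dots> = gauss_vec s A"
    unfolding gauss_vec_def by (subst emeasure_density) auto
  finally show "distr (gauss_vec s) borel T A = gauss_vec s A" .
qed simp

context prob_space
begin

text \<open>Translates between a family of random variables and the law of one random vector. Both
  directions are needed: one to enter the vector picture before a rotation, one to leave it
  afterwards.\<close>

lemma indep_normals_iff_gauss_vec:
  fixes g :: "'k::finite \<Rightarrow> 'a \<Rightarrow> real"
  assumes s: "0 < s" and [measurable]: "\<And>i. g i \<in> borel_measurable M"
  shows "indep_vars (\<lambda>_. borel) g UNIV \<and> (\<forall>i. distributed M lborel (g i) (normal_density 0 s))
    \<longleftrightarrow> distr M borel (\<lambda>\<omega>. \<chi> i. g i \<omega>) = gauss_vec s"
proof -
  interpret G: prob_space "gauss s" using s by (rule prob_space_gauss)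
  interpret P: product_prob_space "\<lambda>i::'k. gauss s" UNIV ..
  have eta_vec: "(\<lambda>\<omega>. ($) (\<chi> i. g i \<omega>)) = (\<lambda>\<omega> i. g i \<omega>)"
    by (simp add: fun_eq_iff)
  have vm: "(\<lambda>x. \<chi> i. x i) \<in> measurable (\<Pi>\<^sub>M i\<in>(UNIV::'k set). borel) (borel :: (real ^ 'k) measure)"
  proof (subst borel_measurable_euclidean_space, intro ballI)
    fix b :: "real ^ 'k" assume "b \<in> Basis"
    then obtain i where "b = axis i 1" by (auto simp: Basis_vec_def)
    then show "(\<lambda>x. (\<chi> i. x i) \<bullet> b) \<in> borel_measurable (\<Pi>\<^sub>M i\<in>(UNIV::'k set). borel)"
      by (simp add: inner_axis)
  qed
  have nm: "(\<lambda>x i. x $ i) \<in> measurable (borel :: (real ^ 'k) measure) (\<Pi>\<^sub>M i\<in>(UNIV::'k::finite set). borel)"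
    by (intro measurable_PiM_single') auto
  have gm: "(\<lambda>\<omega> i. g i \<omega>) \<in> measurable M (\<Pi>\<^sub>M i\<in>(UNIV::'k set). borel)"
    by (intro measurable_PiM_single') auto
  have gvm: "(\<lambda>\<omega>. \<chi> i. g i \<omega>) \<in> measurable M borel"
    using measurable_compose[OF gm vm] by simp
  have ind: "indep_vars (\<lambda>_. borel) g UNIV \<longleftrightarrow> distr M (\<Pi>\<^sub>M i\<in>(UNIV::'k set). borel) (\<lambda>\<omega> i. g i \<omega>) = (\<Pi>\<^sub>M i\<in>UNIV. distr M borel (g i))"
    by (subst indep_vars_iff_distr_eq_PiM) (auto simp: restrict_def)
  show ?thesis
  proof
    assume *: "indep_vars (\<lambda>_. borel) g UNIV \<and> (\<forall>i. distributed M lborel (g i) (normal_density 0 s))"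
    then have "distr M (\<Pi>\<^sub>M i\<in>(UNIV::'k set). borel) (\<lambda>\<omega> i. g i \<omega>) = (\<Pi>\<^sub>M i\<in>UNIV. gauss s)"
      using ind by (simp add: distributed_normal_iff)
    then have "distr M (\<Pi>\<^sub>M i\<in>(UNIV::'k set). borel) (\<lambda>\<omega> i. g i \<omega>)
        = distr (gauss_vec s) (\<Pi>\<^sub>M i\<in>(UNIV::'k::finite set). borel) (\<lambda>x i. x $ i)"
      by (simp add: distr_gauss_vec_nth s)
    then have "distr (distr M (\<Pi>\<^sub>M i\<in>(UNIV::'k set). borel) (\<lambda>\<omega> i. g i \<omega>)) borel (\<lambda>x. \<chi> i. x i)
        = distr (distr (gauss_vec s) (\<Pi>\<^sub>M i\<in>(UNIV::'k::finite set). borel) (\<lambda>x i. x $ i)) borel (\<lambda>x. \<chi> i. x i)"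
      by simp
    then show "distr M borel (\<lambda>\<omega>. \<chi> i. g i \<omega>) = gauss_vec s"
      using gm nm vm by (simp add: distr_distr comp_def measurable_cong_sets[OF sets_gauss_vec refl] vec_nth_inverse distr_id2)
  next
    assume *: "distr M borel (\<lambda>\<omega>. \<chi> i. g i \<omega>) = gauss_vec s"
    have "distr M (\<Pi>\<^sub>M i\<in>(UNIV::'k set). borel) (\<lambda>\<omega> i. g i \<omega>)
       = distr (distr M borel (\<lambda>\<omega>. \<chi> i. g i \<omega>)) (\<Pi>\<^sub>M i\<in>(UNIV::'k set). borel) (\<lambda>x i. x $ i)"
      using distr_distr[OF nm gvm] by (simp add: comp_def eta_vec)
    also have "\<dots> = (\<Pi>\<^sub>M i\<in>UNIV. gauss s)"
      unfolding * by (rule distr_gauss_vec_nth[OF s])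
    finally have D: "distr M (\<Pi>\<^sub>M i\<in>(UNIV::'k set). borel) (\<lambda>\<omega> i. g i \<omega>) = (\<Pi>\<^sub>M i\<in>UNIV. gauss s)" .
    have marg: "distr M borel (g i) = gauss s" for i
    proof -
      have "distr M borel (g i) = distr (distr M (\<Pi>\<^sub>M i\<in>(UNIV::'k set). borel) (\<lambda>\<omega> i. g i \<omega>)) borel (\<lambda>x. x i)"
        using gm by (simp add: distr_distr comp_def)
      also have "\<dots> = distr (\<Pi>\<^sub>M i\<in>(UNIV::'k set). gauss s) (gauss s) (\<lambda>x. x i)"
        unfolding D by (rule distr_cong) auto
      also have "\<dots> = gauss s"
        by (rule distr_PiM_component) (auto intro: G.prob_space_axioms)
      finally show ?thesis .
    qed
    show "indep_vars (\<lambda>_. borel) g UNIV \<and> (\<forall>i. distributed M lborel (g i) (normal_density 0 s))"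
      unfolding ind distributed_normal_iff using D marg by simp
  qed
qed

text \<open>Used twice: with \<open>haar_matrix\<close>, to split a dyadic increment into two
  halves, and with the eigenvector matrix, to pass from Brownian increments to noise indexed by
  vertices.\<close>

lemma rotate_normals:
  fixes g :: "'k::finite \<Rightarrow> 'a \<Rightarrow> real" and T :: "real ^ 'k ^ 'k"
  assumes T: "orthogonal_matrix T" and s: "0 < s"
    and g: "indep_vars (\<lambda>_. borel) g UNIV" "\<And>i. distributed M lborel (g i) (normal_density 0 s)"
  defines "h \<equiv> \<lambda>i \<omega>. \<Sum>j\<in>UNIV. T $ i $ j * g j \<omega>"
  shows "indep_vars (\<lambda>_. borel) h UNIV" "\<And>i. distributed M lborel (h i) (normal_density 0 s)"
proof -
  have gm[measurable]: "g i \<in> borel_measurable M" for i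
    using g(2) by (simp add: distributed_normal_iff)
  have hm: "h i \<in> borel_measurable M" for i
    unfolding h_def by measurable
  have OT: "orthogonal_transformation ((*v) T)"
    using T by (simp add: orthogonal_transformation_matrix)
  have gvm: "(\<lambda>\<omega>. \<chi> i. g i \<omega>) \<in> borel_measurable M"
  proof (subst borel_measurable_euclidean_space, intro ballI)
    fix b :: "real ^ 'k" assume "b \<in> Basis"
    then obtain i where "b = axis i 1" by (auto simp: Basis_vec_def)
    then show "(\<lambda>\<omega>. (\<chi> i. g i \<omega>) \<bullet> b) \<in> borel_measurable M"
      by (simp add: inner_axis)
  qed
  have "(\<lambda>\<omega>. \<chi> i. h i \<omega>) = (\<lambda>\<omega>. T *v (\<chi> i. g i \<omega>))"
    by (simp add: h_def fun_eq_iff matrix_vector_mult_def)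
  then have "distr M borel (\<lambda>\<omega>. \<chi> i. h i \<omega>) = distr (distr M borel (\<lambda>\<omega>. \<chi> i. g i \<omega>)) borel ((*v) T)"
    using gvm by (subst distr_distr) (auto simp: comp_def intro!: borel_measurable_continuous_onI linear_continuous_on matrix_vector_mul_bounded_linear)
  also have "\<dots> = gauss_vec s"
    using indep_normals_iff_gauss_vec[of s g, OF s gm] g distr_gauss_vec_orthogonal[OF OT] by simp
  finally have "indep_vars (\<lambda>_. borel) h UNIV \<and> (\<forall>i. distributed M lborel (h i) (normal_density 0 s))"
    using indep_normals_iff_gauss_vec[of s h, OF s hm] by simp
  then show "indep_vars (\<lambda>_. borel) h UNIV" "\<And>i. distributed M lborel (h i) (normal_density 0 s)"
    by auto
qed

end

section \<open>Independence and normal laws under almost sure limits\<close>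

text \<open>\<open>UNIV\<close> is included so that some coordinates can be left free when a
  marginal is read off a joint probability.\<close>

definition lower_sets :: "real set set" where
  "lower_sets = insert UNIV (range atMost)"

lemma sets_borel_lower_sets: "sets borel = sigma_sets UNIV lower_sets"
proof -
  have "sets (borel :: real measure) = sigma_sets UNIV (range atMost)"
    by (subst borel_eq_atMost) simp
  also have "\<dots> = sigma_sets UNIV lower_sets"
  proof (rule sigma_sets_eqI)
    show "a \<in> sigma_sets UNIV lower_sets" if "a \<in> range atMost" for a :: "real set"
      using that by (auto simp: lower_sets_def)
    show "b \<in> sigma_sets UNIV (range atMost)" if "b \<in> lower_sets" for b :: "real set"
      using that sigma_sets_top[of UNIV "range (atMost :: real \<Rightarrow> _)"] by (auto simp: lower_sets_def)
  qed
  finally show ?thesis .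
qed

lemma Int_stable_lower_sets: "Int_stable lower_sets"
  by (auto simp: Int_stable_def lower_sets_def)

lemma lower_sets_borel: "A \<in> lower_sets \<Longrightarrow> A \<in> sets borel"
  by (auto simp: lower_sets_def)

lemma lower_sets_approx:
  assumes "A \<in> lower_sets"
  obtains f :: "nat \<Rightarrow> real \<Rightarrow> real"
  where "\<And>m. continuous_on UNIV (f m)" "\<And>m x. 0 \<le> f m x" "\<And>m x. f m x \<le> 1"
    "\<And>x. (\<lambda>m. f m x) \<longlonglongrightarrow> indicator A x"
proof (cases "A = UNIV")
  case True
  show thesis by (rule that[of "\<lambda>_ _. 1"]) (auto simp: True)
next
  case False
  then obtain a where A: "A = {..a}" using assms by (auto simp: lower_sets_def)
  \<comment> \<open>A ramp that is 1 up to \<open>a\<close> and, for positive \<open>m\<close>,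
    falls to 0 over a distance of \<open>1 / m\<close>.\<close>
  define f where "f m x = max 0 (min 1 (1 - real m * (x - a)))" for m :: nat and x
  show thesis
  proof (rule that[of f])
    show "continuous_on UNIV (f m)" for m unfolding f_def by (intro continuous_intros)
    fix x
    show "(\<lambda>m. f m x) \<longlonglongrightarrow> indicator A x"
    proof (cases "x \<le> a")
      case True
      then have "f m x = 1" for m by (auto simp: f_def mult_nonneg_nonpos)
      then show ?thesis using True by (simp add: A)
    next
      case False
      then obtain n where n: "1 < real n * (x - a)" using reals_Archimedean3[of "x - a"] by auto
      have "f m x = 0" if "m \<ge> n" for m
      proof -
        have "real n * (x - a) \<le> real m * (x - a)" using that False by (intro mult_right_mono) auto
        then show ?thesis using n by (simp add: f_def)
      qed
      then show ?thesis using False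
        by (intro tendsto_eventually) (auto simp: A eventually_sequentially intro!: exI[of _ n])
    qed
  qed (auto simp: f_def)
qed

text \<open>Parametrized by the variance so that variance 0, the point mass at 0, is covered.
  Increments over dyadic approximations of a time interval may be empty sums.\<close>

definition scaled_gauss :: "real \<Rightarrow> real measure" where
  "scaled_gauss v = distr (gauss 1) borel (\<lambda>z. sqrt v * z)"

lemma sets_scaled_gauss[simp, measurable_cong]: "sets (scaled_gauss v) = sets borel"
  and space_scaled_gauss[simp]: "space (scaled_gauss v) = UNIV"
  by (simp_all add: scaled_gauss_def)

lemma prob_space_scaled_gauss: "prob_space (scaled_gauss v)"
proof -
  interpret prob_space "gauss 1" by (rule prob_space_gauss) simp
  show ?thesis unfolding scaled_gauss_def by (rule prob_space_distr) simp
qed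

lemma scaled_gauss_eq_gauss:
  assumes "0 < s"
  shows "scaled_gauss (s\<^sup>2) = gauss s"
proof -
  interpret prob_space "gauss 1" by (rule prob_space_gauss) simp
  have "distributed (gauss 1) lborel (\<lambda>z. z) (normal_density 0 1)"
    by (simp add: distributed_normal_iff distr_id2)
  then have "distributed (gauss 1) lborel (\<lambda>z. 0 + s * z) (normal_density (0 + s * 0) (\<bar>s\<bar> * 1))"
    using assms by (intro normal_density_affine) auto
  then show ?thesis using assms
    by (simp add: distributed_normal_iff scaled_gauss_def)
qed

context prob_space
begin

text \<open>Half-lines are limits of continuous ramps, so dominated convergence carries the product
  formula over to the generator \<open>lower_sets\<close>, which is stable under intersection. One
  hypothesis yields both the independence and the marginal laws.\<close>

lemma indep_vars_of_continuous:
  fixes X :: "'i \<Rightarrow> 'a \<Rightarrow> real"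
  assumes I: "finite I" and [measurable]: "\<And>i. i \<in> I \<Longrightarrow> X i \<in> borel_measurable M"
    and \<mu>: "\<And>i. i \<in> I \<Longrightarrow> prob_space (\<mu> i)" "\<And>i. i \<in> I \<Longrightarrow> sets (\<mu> i) = sets borel"
    and eq: "\<And>f :: 'i \<Rightarrow> real \<Rightarrow> real. (\<And>i. continuous_on UNIV (f i)) \<Longrightarrow> (\<And>i x. 0 \<le> f i x) \<Longrightarrow> (\<And>i x. f i x \<le> 1) \<Longrightarrow>
       expectation (\<lambda>\<omega>. \<Prod>i\<in>I. f i (X i \<omega>)) = (\<Prod>i\<in>I. \<integral>x. f i x \<partial>\<mu> i)"
  shows "indep_vars (\<lambda>_. borel) X I" and "\<And>i. i \<in> I \<Longrightarrow> distr M borel (X i) = \<mu> i"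
proof -
  have key: "prob (\<Inter>i\<in>I. X i -` A i \<inter> space M) = (\<Prod>i\<in>I. measure (\<mu> i) (A i))"
    if A: "\<And>i. i \<in> I \<Longrightarrow> A i \<in> lower_sets" and ne: "I \<noteq> {}" for A
  proof -
    have "\<forall>i. \<exists>f :: nat \<Rightarrow> real \<Rightarrow> real. (\<forall>m. continuous_on UNIV (f m)) \<and> (\<forall>m x. 0 \<le> f m x) \<and> (\<forall>m x. f m x \<le> 1) \<and>
        (i \<in> I \<longrightarrow> (\<forall>x. (\<lambda>m. f m x) \<longlonglongrightarrow> indicator (A i) x))"
    proof
      fix i
      show "\<exists>f :: nat \<Rightarrow> real \<Rightarrow> real. (\<forall>m. continuous_on UNIV (f m)) \<and> (\<forall>m x. 0 \<le> f m x) \<and> (\<forall>m x. f m x \<le> 1) \<and>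
        (i \<in> I \<longrightarrow> (\<forall>x. (\<lambda>m. f m x) \<longlonglongrightarrow> indicator (A i) x))"
      proof (cases "i \<in> I")
        case True
        show ?thesis
        proof (rule lower_sets_approx[OF A[OF True]])
          fix f :: "nat \<Rightarrow> real \<Rightarrow> real"
          assume "\<And>m. continuous_on UNIV (f m)" "\<And>m x. 0 \<le> f m x" "\<And>m x. f m x \<le> 1"
            "\<And>x. (\<lambda>m. f m x) \<longlonglongrightarrow> indicator (A i) x"
          then show ?thesis by (intro exI[of _ f]) auto
        qed
      qed (auto intro!: exI[of _ "\<lambda>_ _. 1"])
    qed
    from choice[OF this] obtain f :: "'i \<Rightarrow> nat \<Rightarrow> real \<Rightarrow> real" where
      "\<forall>i. (\<forall>m. continuous_on UNIV (f i m)) \<and> (\<forall>m x. 0 \<le> f i m x) \<and> (\<forall>m x. f i m x \<le> 1) \<and>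
        (i \<in> I \<longrightarrow> (\<forall>x. (\<lambda>m. f i m x) \<longlonglongrightarrow> indicator (A i) x))"
      by (rule exE)
    then have f: "\<And>i m. continuous_on UNIV (f i m)"
      "\<And>i m x. 0 \<le> f i m x" "\<And>i m x. f i m x \<le> 1"
      "\<And>i x. i \<in> I \<Longrightarrow> (\<lambda>m. f i m x) \<longlonglongrightarrow> indicator (A i) x"
      by simp_all
    have [measurable]: "f i m \<in> borel_measurable borel" for i m
      using f(1) by (rule borel_measurable_continuous_onI)
    have Am: "i \<in> I \<Longrightarrow> A i \<in> sets borel" for i using A lower_sets_borel by auto
    have L1: "(\<lambda>m. expectation (\<lambda>\<omega>. \<Prod>i\<in>I. f i m (X i \<omega>))) \<longlonglongrightarrow> expectation (\<lambda>\<omega>. \<Prod>i\<in>I. indicator (A i) (X i \<omega>))"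
    proof (rule integral_dominated_convergence[where w="\<lambda>_. 1"])
      show "AE x in M. (\<lambda>m. \<Prod>i\<in>I. f i m (X i x)) \<longlonglongrightarrow> (\<Prod>i\<in>I. indicator (A i) (X i x))"
        by (intro AE_I2 tendsto_prod f(4))
      show "AE x in M. norm (\<Prod>i\<in>I. f i m (X i x)) \<le> 1" for m
        using f by (intro AE_I2) (auto simp: abs_prod intro!: prod_le_1)
      show "(\<lambda>x. \<Prod>i\<in>I. indicator (A i) (X i x) :: real) \<in> borel_measurable M"
        using Am by (intro borel_measurable_prod) (auto intro!: measurable_compose[of _ _ borel])
    qed auto
    have E1: "(\<lambda>\<omega>. \<Prod>i\<in>I. indicator (A i) (X i \<omega>) :: real) = (\<lambda>\<omega>. indicator (\<Inter>i\<in>I. X i -` A i) \<omega>)"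
      using I by (auto simp: fun_eq_iff indicator_def intro!: prod.neutral)
    have E2: "expectation (\<lambda>\<omega>. indicator (\<Inter>i\<in>I. X i -` A i) \<omega>) = prob (\<Inter>i\<in>I. X i -` A i \<inter> space M)"
      using ne by (simp add: Int_commute)
    have L2: "(\<lambda>m. \<Prod>i\<in>I. \<integral>x. f i m x \<partial>\<mu> i) \<longlonglongrightarrow> (\<Prod>i\<in>I. \<integral>x. indicator (A i) x \<partial>\<mu> i)"
    proof (intro tendsto_prod)
      fix i assume i: "i \<in> I"
      interpret mu: prob_space "\<mu> i" using \<mu>(1)[OF i] .
      have [measurable_cong]: "sets (\<mu> i) = sets borel" using \<mu>(2)[OF i] .
      show "(\<lambda>m. \<integral>x. f i m x \<partial>\<mu> i) \<longlonglongrightarrow> (\<integral>x. indicator (A i) x \<partial>\<mu> i)"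
      proof (rule integral_dominated_convergence[where w="\<lambda>_. 1"])
        show "AE x in \<mu> i. (\<lambda>m. f i m x) \<longlonglongrightarrow> indicator (A i) x"
          by (intro AE_I2 f(4) i)
        show "AE x in \<mu> i. norm (f i m x) \<le> 1" for m
          using f by (intro AE_I2) auto
        show "(indicator (A i) :: real \<Rightarrow> real) \<in> borel_measurable (\<mu> i)"
          using Am[OF i] \<mu>(2)[OF i] by (intro borel_measurable_indicator) simp
      qed auto
    qed
    have E3: "(\<integral>x. indicator (A i) x \<partial>\<mu> i) = measure (\<mu> i) (A i)" if "i \<in> I" for i
      using Am[OF that] \<mu>(2)[OF that] sets_eq_imp_space_eq[OF \<mu>(2)[OF that]] by simp
    have E4: "expectation (\<lambda>\<omega>. \<Prod>i\<in>I. f i m (X i \<omega>)) = (\<Prod>i\<in>I. \<integral>x. f i m x \<partial>\<mu> i)" for m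
      by (intro eq f)
    have E5: "(\<Prod>i\<in>I. \<integral>x. indicator (A i) x \<partial>\<mu> i) = (\<Prod>i\<in>I. measure (\<mu> i) (A i))"
      by (intro prod.cong refl E3)
    show ?thesis
      using LIMSEQ_unique[OF L1[unfolded E4] L2] E5 unfolding E1 E2 by (rule trans)
  qed
  have marg: "prob (X i -` A \<inter> space M) = measure (\<mu> i) A" if i: "i \<in> I" and A: "A \<in> lower_sets" for i A
  proof -
    have sp: "measure (\<mu> j) UNIV = 1" if "j \<in> I" for j
      using prob_space.prob_space[OF \<mu>(1)[OF that]] sets_eq_imp_space_eq[OF \<mu>(2)[OF that]] by simp
    have "prob (X i -` A \<inter> space M) = prob (\<Inter>j\<in>I. X j -` (if j = i then A else UNIV) \<inter> space M)"
      using i by (intro arg_cong[where f=prob]) (auto split: if_splits)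
    also have "\<dots> = (\<Prod>j\<in>I. measure (\<mu> j) (if j = i then A else UNIV))"
      using i A by (intro key) (auto simp: lower_sets_def)
    also have "\<dots> = (\<Prod>j\<in>I. if j = i then measure (\<mu> j) A else 1)"
      using sp by (intro prod.cong) auto
    also have "\<dots> = measure (\<mu> i) A" using i I by simp
    finally show ?thesis .
  qed
  show "distr M borel (X i) = \<mu> i" if i: "i \<in> I" for i
  proof (rule measure_eqI_generator_eq[where E=lower_sets and \<Omega>=UNIV and A="\<lambda>_. UNIV"])
    interpret mu: prob_space "\<mu> i" using \<mu>(1)[OF i] .
    fix A assume A: "A \<in> lower_sets"
    show "emeasure (distr M borel (X i)) A = emeasure (\<mu> i) A"
      using marg[OF i A] i lower_sets_borel[OF A]
      by (simp add: emeasure_distr emeasure_eq_measure mu.emeasure_eq_measure)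
  next
    show "sets (distr M borel (X i)) = sigma_sets UNIV lower_sets" "sets (\<mu> i) = sigma_sets UNIV lower_sets"
      using \<mu>(2)[OF i] by (simp_all add: sets_borel_lower_sets)
    show "emeasure (distr M borel (X i)) UNIV \<noteq> \<infinity>" for k :: nat
      using i by (simp add: emeasure_distr)
  qed (auto simp: Int_stable_lower_sets lower_sets_def[THEN eqset_imp_iff])
  show "indep_vars (\<lambda>_. borel) X I"
  proof (cases "I = {}")
    case True
    then show ?thesis by (simp add: indep_vars_def2 indep_sets_def)
  next
    case False
    show ?thesis
    proof (subst indep_vars_finite[where E="\<lambda>_. lower_sets"])
      show "\<forall>A\<in>I \<rightarrow> lower_sets. prob (\<Inter>j\<in>I. X j -` A j \<inter> space M) = (\<Prod>j\<in>I. prob (X j -` A j \<inter> space M))"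
        using key False marg by (auto simp: Pi_iff cong: prod.cong)
    qed (use I False in \<open>auto simp: sets_borel_lower_sets Int_stable_lower_sets lower_sets_def[THEN eqset_imp_iff]\<close>)
  qed
qed

text \<open>Both sides of the product formula for continuous test functions pass to the limit: the
  left side along the almost sure convergence, the right side along the convergence of
  variances.\<close>

lemma indep_normal_limit:
  fixes X :: "'i \<Rightarrow> 'a \<Rightarrow> real" and Y :: "nat \<Rightarrow> 'i \<Rightarrow> 'a \<Rightarrow> real"
  assumes I: "finite I" and X: "\<And>i. i \<in> I \<Longrightarrow> X i \<in> borel_measurable M"
    and Y: "\<And>m. indep_vars (\<lambda>_. borel) (Y m) I"
    and law: "\<And>m i. i \<in> I \<Longrightarrow> distr M borel (Y m i) = scaled_gauss (v m i)"
    and lim: "AE \<omega> in M. \<forall>i\<in>I. (\<lambda>m. Y m i \<omega>) \<longlonglongrightarrow> X i \<omega>"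
    and v: "\<And>i. i \<in> I \<Longrightarrow> (\<lambda>m. v m i) \<longlonglongrightarrow> v' i"
  shows "indep_vars (\<lambda>_. borel) X I" and "\<And>i. i \<in> I \<Longrightarrow> distr M borel (X i) = scaled_gauss (v' i)"
proof -
  note X[measurable]
  have Ym[measurable]: "i \<in> I \<Longrightarrow> Y m i \<in> borel_measurable M" for m i
    using Y by (auto simp: indep_vars_def2)
  have *: "expectation (\<lambda>\<omega>. \<Prod>i\<in>I. f i (X i \<omega>)) = (\<Prod>i\<in>I. \<integral>x. f i x \<partial>scaled_gauss (v' i))"
    if f: "\<And>i. continuous_on UNIV (f i)" "\<And>i x. 0 \<le> f i x" "\<And>i x. f i x \<le> 1" for f :: "'i \<Rightarrow> real \<Rightarrow> real"
  proof -
    have [measurable]: "f i \<in> borel_measurable borel" for i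
      using f(1) by (rule borel_measurable_continuous_onI)
    have L1: "(\<lambda>m. expectation (\<lambda>\<omega>. \<Prod>i\<in>I. f i (Y m i \<omega>))) \<longlonglongrightarrow> expectation (\<lambda>\<omega>. \<Prod>i\<in>I. f i (X i \<omega>))"
    proof (rule integral_dominated_convergence[where w="\<lambda>_. 1"])
      show "AE x in M. (\<lambda>m. \<Prod>i\<in>I. f i (Y m i x)) \<longlonglongrightarrow> (\<Prod>i\<in>I. f i (X i x))"
        using lim
      proof eventually_elim
        case (elim \<omega>)
        show ?case
        proof (intro tendsto_prod)
          fix i assume "i \<in> I"
          then show "(\<lambda>m. f i (Y m i \<omega>)) \<longlonglongrightarrow> f i (X i \<omega>)"
            using elim f(1)[of i] by (intro continuous_on_tendsto_compose[of UNIV "f i"]) auto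
        qed
      qed
      show "AE x in M. norm (\<Prod>i\<in>I. f i (Y m i x)) \<le> 1" for m
        using f by (intro AE_I2) (auto simp: abs_prod intro!: prod_le_1)
    qed auto
    have E: "expectation (\<lambda>\<omega>. \<Prod>i\<in>I. f i (Y m i \<omega>)) = (\<Prod>i\<in>I. \<integral>x. f i x \<partial>scaled_gauss (v m i))" for m
    proof -
      have "indep_vars (\<lambda>_. borel) (\<lambda>i \<omega>. f i (Y m i \<omega>)) I"
        by (rule indep_vars_compose2[OF Y]) auto
      then have "expectation (\<lambda>\<omega>. \<Prod>i\<in>I. f i (Y m i \<omega>)) = (\<Prod>i\<in>I. expectation (\<lambda>\<omega>. f i (Y m i \<omega>)))"
        using f by (intro indep_vars_lebesgue_integral I) (auto intro!: integrable_const_bound[of _ 1])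
      also have "\<dots> = (\<Prod>i\<in>I. \<integral>x. f i x \<partial>distr M borel (Y m i))"
        by (intro prod.cong refl, subst integral_distr) auto
      finally show ?thesis using law by simp
    qed
    have L2: "(\<lambda>m. \<Prod>i\<in>I. \<integral>x. f i x \<partial>scaled_gauss (v m i)) \<longlonglongrightarrow> (\<Prod>i\<in>I. \<integral>x. f i x \<partial>scaled_gauss (v' i))"
    proof (intro tendsto_prod)
      fix i assume i: "i \<in> I"
      interpret G: prob_space "gauss 1" by (rule prob_space_gauss) simp
      \<comment> \<open>Over one fixed normal the variance enters only through the factor
        \<open>sqrt w\<close> in the argument, where continuity of \<open>f i\<close> can be
        used.\<close>
      have eq: "(\<integral>x. f i x \<partial>scaled_gauss w) = (\<integral>z. f i (sqrt w * z) \<partial>gauss 1)" for w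
        unfolding scaled_gauss_def by (subst integral_distr) auto
      show "(\<lambda>m. \<integral>x. f i x \<partial>scaled_gauss (v m i)) \<longlonglongrightarrow> (\<integral>x. f i x \<partial>scaled_gauss (v' i))"
        unfolding eq
      proof (rule integral_dominated_convergence[where w="\<lambda>_. 1"])
        show "AE x in gauss 1. (\<lambda>m. f i (sqrt (v m i) * x)) \<longlonglongrightarrow> f i (sqrt (v' i) * x)"
          using f(1)[of i] v[OF i]
          by (intro AE_I2 continuous_on_tendsto_compose[of UNIV "f i"] tendsto_intros) auto
        show "AE x in gauss 1. norm (f i (sqrt (v m i) * x)) \<le> 1" for m
          using f by (intro AE_I2) auto
      qed auto
    qed
    show ?thesis
      by (rule LIMSEQ_unique[OF L1[unfolded E] L2])
  qed
  show "indep_vars (\<lambda>_. borel) X I"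
    by (rule indep_vars_of_continuous(1)[where \<mu>="\<lambda>i. scaled_gauss (v' i)"])
       (use I X * in \<open>auto simp: prob_space_scaled_gauss\<close>)
  show "distr M borel (X i) = scaled_gauss (v' i)" if "i \<in> I" for i
    by (rule indep_vars_of_continuous(2)[where \<mu>="\<lambda>i. scaled_gauss (v' i)" and I=I])
       (use I X * that in \<open>auto simp: prob_space_scaled_gauss\<close>)
qed

lemma distr_sum_gauss:
  fixes X :: "'i \<Rightarrow> 'a \<Rightarrow> real"
  assumes I: "finite I" and X: "indep_vars (\<lambda>_. borel) X I" and s: "0 < s"
    and law: "\<And>i. i \<in> I \<Longrightarrow> distr M borel (X i) = gauss s"
  shows "distr M borel (\<lambda>\<omega>. \<Sum>i\<in>I. X i \<omega>) = scaled_gauss (real (card I) * s\<^sup>2)"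
proof (cases "I = {}")
  case True
  interpret G: prob_space "gauss 1" by (rule prob_space_gauss) simp
  have "(\<lambda>z::real. sqrt 0 * z) = (\<lambda>_. 0)" by auto
  then have "distr M borel (\<lambda>\<omega>. 0 :: real) = return borel 0" "scaled_gauss 0 = return borel 0"
    unfolding scaled_gauss_def by (simp_all only: distr_const G.distr_const space_borel UNIV_I)
  then show ?thesis using True by simp
next
  case False
  have Xm: "i \<in> I \<Longrightarrow> X i \<in> borel_measurable M" for i
    using X by (auto simp: indep_vars_def2)
  have "distributed M lborel (\<lambda>\<omega>. \<Sum>i\<in>I. X i \<omega>) (normal_density (\<Sum>i\<in>I. 0) (sqrt (\<Sum>i\<in>I. s\<^sup>2)))"
    using I False X s law Xm by (intro sum_indep_normal) (auto simp: distributed_normal_iff)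
  then have "distr M borel (\<lambda>\<omega>. \<Sum>i\<in>I. X i \<omega>) = gauss (sqrt (card I * s\<^sup>2))"
    by (simp add: distributed_normal_iff)
  also have "\<dots> = scaled_gauss (real (card I) * s\<^sup>2)"
    using False I s scaled_gauss_eq_gauss[of "sqrt (card I * s\<^sup>2)"] by (simp add: card_gt_0_iff)
  finally show ?thesis .
qed

end

lemma (in prob_space) indep_vars_singleton:
  assumes "X i \<in> measurable M (M' i)"
  shows "indep_vars M' X {i}"
  unfolding indep_vars_def2
proof (intro conjI indep_setsI)
  fix A J assume "J \<noteq> {}" "J \<subseteq> {i}" "finite J"
  then have "J = {i}" by auto
  then show "prob (\<Inter>j\<in>J. A j) = (\<Prod>j\<in>J. prob (A j))" by simp
qed (use assms in auto)

lemma gauss_moment: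
  obtains C where "0 \<le> C" "(\<integral>\<^sup>+x. ennreal (x ^ (2 * p)) \<partial>gauss 1) \<le> ennreal C"
proof -
  have "(\<integral>\<^sup>+x. ennreal (x ^ (2 * p)) \<partial>gauss 1) = (\<integral>\<^sup>+x. ennreal (std_normal_density x * x ^ (2 * p)) \<partial>lborel)"
    unfolding gauss_def by (subst nn_integral_density) (auto simp: ennreal_mult intro!: nn_integral_cong)
  also have "\<dots> = ennreal (integral\<^sup>L lborel (\<lambda>x. std_normal_density x * x ^ (2 * p)))"
    by (intro nn_integral_eq_integral integrable_std_normal_moment) auto
  finally show thesis
    using that[of "integral\<^sup>L lborel (\<lambda>x. std_normal_density x * x ^ (2 * p))"] by simp
qed

text \<open>No independence is assumed. Since \<open>p\<close> is free, taking roots makes the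
  growth of standard normals slower than any prescribed positive power of \<open>n\<close>.\<close>

lemma (in prob_space) AE_normal_bound:
  fixes g :: "nat \<Rightarrow> 'a \<Rightarrow> real"
  assumes [measurable]: "\<And>n. g n \<in> borel_measurable M" and law: "\<And>n. distr M borel (g n) = gauss 1"
  shows "AE \<omega> in M. \<exists>K>0. \<forall>n. (g n \<omega>) ^ (2 * p) \<le> K * (real n + 1)\<^sup>2"
proof -
  obtain C where C: "0 \<le> C" "(\<integral>\<^sup>+x. ennreal (x ^ (2 * p)) \<partial>gauss 1) \<le> ennreal C"
    by (rule gauss_moment[of p])
  show ?thesis
  proof (rule AE_bounded_of_nn_integral[OF _ _ _ C(1)])
    fix n
    have "(\<integral>\<^sup>+\<omega>. ennreal ((g n \<omega>) ^ (2 * p)) \<partial>M) = (\<integral>\<^sup>+x. ennreal (x ^ (2 * p)) \<partial>distr M borel (g n))"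
      by (subst nn_integral_distr) auto
    then show "(\<integral>\<^sup>+\<omega>. ennreal ((g n \<omega>) ^ (2 * p)) \<partial>M) \<le> ennreal C"
      using C(2) law by simp
  qed auto
qed

subsection \<open>Levy's construction of Brownian motion\<close>

text \<open>The normalized increment over the \<open>r\<close>-th dyadic interval of length
  \<open>2 ^ -m\<close>. Passing to the next level splits an increment into two halves, with a new
  normal as the other coordinate of a rotation by 45 degrees. All \<open>r\<close> are allowed, so
  the construction covers the whole half-line at once.\<close>

fun levy_xi :: "(nat \<Rightarrow> nat \<Rightarrow> real) \<Rightarrow> nat \<Rightarrow> nat \<Rightarrow> real" where
  "levy_xi z 0 r = z 0 r"
| "levy_xi z (Suc m) r = (levy_xi z m (r div 2) + (if even r then 1 else -1) * z (Suc m) (r div 2)) / sqrt 2"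

text \<open>The path at time \<open>r / 2 ^ m\<close>; \<open>levy_path\<close> interpolates
  linearly between these values.\<close>

definition levy_grid :: "(nat \<Rightarrow> nat \<Rightarrow> real) \<Rightarrow> nat \<Rightarrow> nat \<Rightarrow> real" where
  "levy_grid z m r = (\<Sum>l<r. levy_xi z m l / sqrt (2 ^ m))"

definition levy_path :: "(nat \<Rightarrow> nat \<Rightarrow> real) \<Rightarrow> nat \<Rightarrow> real \<Rightarrow> real" where
  "levy_path z m t = (let s = 2 ^ m * t; r = nat \<lfloor>s\<rfloor> in levy_grid z m r + (s - real r) * (levy_xi z m r / sqrt (2 ^ m)))"

definition levy_bm :: "(nat \<Rightarrow> nat \<Rightarrow> real) \<Rightarrow> real \<Rightarrow> real" where
  "levy_bm z t = lim (\<lambda>m. levy_path z m t)"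

text \<open>The new normal enters the two halves with opposite signs and cancels in their sum, so
  refinement leaves the old grid values unchanged.\<close>

lemma levy_grid_double: "levy_grid z (Suc m) (2 * r) = levy_grid z m r"
proof (induction r)
  case (Suc r)
  have "levy_xi z (Suc m) (2 * r) / sqrt (2 ^ Suc m) + levy_xi z (Suc m) (Suc (2 * r)) / sqrt (2 ^ Suc m)
     = levy_xi z m r / sqrt (2 ^ m)"
    by (simp add: real_sqrt_mult field_simps)
  then show ?case using Suc by (simp add: levy_grid_def)
qed (simp add: levy_grid_def)

lemma levy_grid_power: "levy_grid z (m + k) (2 ^ k * r) = levy_grid z m r"
proof (induction k)
  case (Suc k)
  then show ?case using levy_grid_double[of z "m + k" "2 ^ k * r"] by (simp add: mult.assoc)
qed simp

lemma levy_path_grid: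
  assumes "m \<le> m'" shows "levy_path z m' (real r / 2 ^ m) = levy_grid z m r"
proof -
  obtain k where k: "m' = m + k" using assms le_Suc_ex by blast
  have "2 ^ m' * (real r / 2 ^ m) = real (2 ^ k * r)" by (simp add: k power_add)
  then show ?thesis by (simp add: levy_path_def Let_def k levy_grid_power del: of_nat_mult)
qed

text \<open>Refinement adds a tent over each dyadic interval, with the new normal as amplitude: the
  coefficient \<open>c\<close> below is \<open>f\<close> on the first half and \<open>1 - f\<close>
  on the second, \<open>f\<close> being the position inside the interval.\<close>

lemma levy_path_diff:
  assumes "0 \<le> t"
  shows "\<bar>levy_path z (Suc m) t - levy_path z m t\<bar> \<le> \<bar>z (Suc m) (nat \<lfloor>2 ^ m * t\<rfloor>)\<bar> / sqrt (2 ^ m)"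
proof -
  define s where "s = 2 ^ m * t"
  define r where "r = nat \<lfloor>s\<rfloor>"
  define f where "f = s - real r"
  define h where "h = sqrt (2 ^ m)"
  have s: "0 \<le> s" using assms by (simp add: s_def)
  have h: "0 < h" by (simp add: h_def)
  have f: "0 \<le> f" "f < 1" using s by (simp_all add: f_def r_def) linarith+
  have sm: "2 ^ Suc m * t = 2 * real r + 2 * f" by (simp add: s_def f_def)
  have P: "levy_path z m t = levy_grid z m r + f * (levy_xi z m r / h)"
    by (simp add: levy_path_def Let_def s_def[symmetric] r_def[symmetric] f_def h_def)
  have h2: "sqrt (2 ^ Suc m) = sqrt 2 * h" by (simp add: h_def real_sqrt_mult)
  have q: "sqrt 2 * (sqrt 2 * h) = 2 * h" by simp
  have q': "(a + b) / (2 * h) + (2 * f - 1) * ((a - b) / (2 * h)) = f * (a / h) + (1 - f) * (b / h)" for a b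
    using h by (simp add: field_simps)
  have "\<exists>c. levy_path z (Suc m) t - levy_path z m t = c * (z (Suc m) r / h) \<and> \<bar>c\<bar> \<le> 1"
  proof (cases "f < 1 / 2")
    case True
    have fl: "nat \<lfloor>2 ^ Suc m * t\<rfloor> = 2 * r"
      unfolding sm using f True by linarith
    have "levy_path z (Suc m) t = levy_grid z m r + 2 * f * ((levy_xi z m r + z (Suc m) r) / (2 * h))"
      unfolding levy_path_def Let_def fl by (simp only: sm levy_grid_double h2) (simp add: q)
    then have "levy_path z (Suc m) t - levy_path z m t = f * (z (Suc m) r / h)"
      unfolding P using h by (simp add: field_simps)
    then show ?thesis using f by (intro exI[of _ f]) auto
  next
    case False
    have fl: "nat \<lfloor>2 ^ Suc m * t\<rfloor> = Suc (2 * r)"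
      unfolding sm using f False by linarith
    have "levy_grid z (Suc m) (Suc (2 * r)) = levy_grid z (Suc m) (2 * r) + levy_xi z (Suc m) (2 * r) / sqrt (2 ^ Suc m)"
      by (simp add: levy_grid_def)
    then have g: "levy_grid z (Suc m) (Suc (2 * r)) = levy_grid z m r + (levy_xi z m r + z (Suc m) r) / (2 * h)"
      by (simp only: levy_grid_double h2) (simp add: q)
    have "levy_path z (Suc m) t = levy_grid z m r + (levy_xi z m r + z (Suc m) r) / (2 * h)
        + (2 * f - 1) * ((levy_xi z m r - z (Suc m) r) / (2 * h))"
      unfolding levy_path_def Let_def fl by (simp only: sm g h2) (simp add: q)
    then have "levy_path z (Suc m) t - levy_path z m t = (1 - f) * (z (Suc m) r / h)"
      unfolding P add.assoc q' by simp
    then show ?thesis using f by (intro exI[of _ "1 - f"]) auto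
  qed
  then obtain c where c: "levy_path z (Suc m) t - levy_path z m t = c * (z (Suc m) r / h)" "\<bar>c\<bar> \<le> 1" by blast
  have "\<bar>c\<bar> * (\<bar>z (Suc m) r\<bar> / h) \<le> 1 * (\<bar>z (Suc m) r\<bar> / h)"
    using c(2) h by (intro mult_right_mono) auto
  then show ?thesis
    using c(1) h by (simp add: abs_mult r_def s_def h_def)
qed

lemma continuous_on_linear_interpolation:
  fixes a d :: "nat \<Rightarrow> real"
  assumes a: "\<And>n. a (Suc n) = a n + d n"
  shows "continuous_on {0..real N} (\<lambda>s. a (nat \<lfloor>s\<rfloor>) + (s - real (nat \<lfloor>s\<rfloor>)) * d (nat \<lfloor>s\<rfloor>))"
proof -
  \<comment> \<open>A manifestly continuous form of the interpolation:
    \<open>max 0 (min 1 (s - real l))\<close> is the part of the \<open>l\<close>-th step covered at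
    time \<open>s\<close>.\<close>
  have "continuous_on {0..real N} (\<lambda>s. a 0 + (\<Sum>l<Suc N. d l * max 0 (min 1 (s - real l))))"
    by (intro continuous_intros)
  moreover have "a 0 + (\<Sum>l<Suc N. d l * max 0 (min 1 (s - real l))) = a (nat \<lfloor>s\<rfloor>) + (s - real (nat \<lfloor>s\<rfloor>)) * d (nat \<lfloor>s\<rfloor>)"
    if s: "s \<in> {0..real N}" for s
  proof -
    define r where "r = nat \<lfloor>s\<rfloor>"
    have r: "real r \<le> s" "s < real r + 1" "r \<le> N" using s by (auto simp: r_def) linarith+
    have ar: "a n = a 0 + (\<Sum>l<n. d l)" for n by (induction n) (auto simp: a)
    have split: "{..<Suc N} = {..<r} \<union> {r} \<union> {r<..<Suc N}" using r by auto
    have "(\<Sum>l<Suc N. d l * max 0 (min 1 (s - real l))) = (\<Sum>l<r. d l * max 0 (min 1 (s - real l)))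
      + d r * max 0 (min 1 (s - real r)) + (\<Sum>l\<in>{r<..<Suc N}. d l * max 0 (min 1 (s - real l)))"
      unfolding split by (subst sum.union_disjoint, auto)+
    also have "(\<Sum>l<r. d l * max 0 (min 1 (s - real l))) = (\<Sum>l<r. d l)"
      using r by (intro sum.cong) (auto simp: min_def max_def)
    also have "(\<Sum>l\<in>{r<..<Suc N}. d l * max 0 (min 1 (s - real l))) = 0"
      using r by (intro sum.neutral) (auto simp: min_def max_def)
    finally show ?thesis using r ar[of r] by (simp add: r_def[symmetric])
  qed
  ultimately show ?thesis by (subst continuous_on_cong[OF refl]) auto
qed

lemma continuous_on_levy_path: "continuous_on {0..real N} (levy_path z m)"
proof -
  let ?f = "\<lambda>s. levy_grid z m (nat \<lfloor>s\<rfloor>) + (s - real (nat \<lfloor>s\<rfloor>)) * (levy_xi z m (nat \<lfloor>s\<rfloor>) / sqrt (2 ^ m))"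
  have f: "continuous_on {0..real (2 ^ m * N)} ?f"
    by (rule continuous_on_linear_interpolation[where d="\<lambda>r. levy_xi z m r / sqrt (2 ^ m)"]) (simp add: levy_grid_def)
  have "continuous_on {0..real N} (\<lambda>t. ?f (2 ^ m * t))"
    by (rule continuous_on_compose2[OF f]) (auto intro!: continuous_intros)
  then show ?thesis by (simp add: levy_path_def[abs_def] Let_def)
qed

lemma continuous_on_nonneg_reals:
  fixes f :: "real \<Rightarrow> real"
  assumes "\<And>N::nat. continuous_on {0..real N} f"
  shows "continuous_on {0..} f"
  unfolding continuous_on_sequentially
proof (intro allI ballI impI, elim conjE)
  fix x :: "nat \<Rightarrow> real" and a :: real assume a: "a \<in> {0..}" and x: "\<forall>n. x n \<in> {0..}" "x \<longlonglongrightarrow> a"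
  have "Bseq x" using x(2) convergent_imp_Bseq convergentI by blast
  then obtain K where K: "\<And>n. norm (x n) \<le> K" by (auto simp: Bseq_def)
  obtain N :: nat where N: "max K a \<le> real N" using real_arch_simple by blast
  have "x n \<in> {0..real N}" for n
    using x(1) K[of n] N by auto
  moreover have "a \<in> {0..real N}" using a N by auto
  ultimately show "(f \<circ> x) \<longlonglongrightarrow> f a"
    using assms[of N] x(2) unfolding continuous_on_sequentially by blast
qed

text \<open>The growth 2^(m/4) is chosen below the divisor 2^(m/2) in \<open>levy_path_diff\<close>,
  so that successive paths differ by a geometric sequence of ratio 2^(-1/4); normals satisfy it
  almost surely. \<open>T\<close> is a time horizon here, and \<open>r\<close> runs over the dyadic
  intervals up to it.\<close>

locale levy_bound =
  fixes z :: "nat \<Rightarrow> nat \<Rightarrow> real"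
  assumes bound: "\<And>T :: nat. \<exists>C. \<forall>m r. r \<le> T * 2 ^ m \<longrightarrow> \<bar>z m r\<bar> \<le> C * (2 powr (1/4)) ^ m"
begin

lemma levy_uniform:
  "uniform_limit {0..real N} (levy_path z) (levy_bm z) sequentially"
proof -
  obtain C where C: "\<And>m r. r \<le> N * 2 ^ m \<Longrightarrow> \<bar>z m r\<bar> \<le> C * (2 powr (1/4)) ^ m" using bound by blast
  define q :: real where "q = 2 powr (-1/4)"
  have q: "0 < q" "q < 1" by (simp_all add: q_def powr_less_one)
  have qeq: "(2 powr (1/4)) ^ Suc m / sqrt (2 ^ m) = 2 powr (1/4) * q ^ m" for m
  proof -
    have "sqrt (2 ^ m) = (2 powr (1/2)) ^ m" by (simp add: powr_half_sqrt real_sqrt_power)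
    moreover have "2 powr (1/4) = q * 2 powr (1/2 :: real)" unfolding q_def powr_add[symmetric] by simp
    ultimately show ?thesis by (simp add: power_mult_distrib)
  qed
  have d: "norm (levy_path z (Suc m) t - levy_path z m t) \<le> (C * 2 powr (1/4)) * q ^ m" if t: "t \<in> {0..real N}" for m t
  proof -
    have "nat \<lfloor>2 ^ m * t\<rfloor> \<le> N * 2 ^ Suc m"
    proof -
      define K where "K = N * 2 ^ Suc m"
      have "2 ^ m * t \<le> 2 ^ Suc m * real N" using t by (intro mult_mono) auto
      also have "\<dots> = real K" by (simp add: K_def)
      finally have "nat \<lfloor>2 ^ m * t\<rfloor> \<le> K" by linarith
      then show ?thesis by (simp only: K_def)
    qed
    then have "\<bar>z (Suc m) (nat \<lfloor>2 ^ m * t\<rfloor>)\<bar> \<le> C * (2 powr (1/4)) ^ Suc m" by (rule C)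
    then have "\<bar>z (Suc m) (nat \<lfloor>2 ^ m * t\<rfloor>)\<bar> / sqrt (2 ^ m) \<le> C * (2 powr (1/4)) ^ Suc m / sqrt (2 ^ m)"
      by (intro divide_right_mono) auto
    also have "\<dots> = C * ((2 powr (1/4)) ^ Suc m / sqrt (2 ^ m))" by simp
    also have "\<dots> = (C * 2 powr (1/4)) * q ^ m" unfolding qeq by simp
    finally show ?thesis using levy_path_diff[of t z m] t by simp
  qed
  have "uniform_limit {0..real N} (\<lambda>n t. \<Sum>m<n. levy_path z (Suc m) t - levy_path z m t)
     (\<lambda>t. \<Sum>m. levy_path z (Suc m) t - levy_path z m t) sequentially"
    by (rule Weierstrass_m_test[OF d]) (use q in \<open>auto intro!: summable_mult summable_geometric\<close>)
  then have "uniform_limit {0..real N} (\<lambda>n t. (\<Sum>m<n. levy_path z (Suc m) t - levy_path z m t) + levy_path z 0 t)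
     (\<lambda>t. (\<Sum>m. levy_path z (Suc m) t - levy_path z m t) + levy_path z 0 t) sequentially"
    by (intro uniform_limit_add uniform_limit_const)
  moreover have "(\<Sum>m<n. levy_path z (Suc m) t - levy_path z m t) + levy_path z 0 t = levy_path z n t" for n t
    by (simp add: sum_lessThan_telescope[of "\<lambda>m. levy_path z m t"])
  ultimately have U: "uniform_limit {0..real N} (levy_path z)
     (\<lambda>t. (\<Sum>m. levy_path z (Suc m) t - levy_path z m t) + levy_path z 0 t) sequentially"
    by simp
  have "levy_bm z t = (\<Sum>m. levy_path z (Suc m) t - levy_path z m t) + levy_path z 0 t" if "t \<in> {0..real N}" for t
    unfolding levy_bm_def using tendsto_uniform_limitI[OF U that] by (rule limI)
  then show ?thesis
    using U by (subst uniform_limit_cong'[where g="levy_path z"]) auto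
qed

lemma levy_tendsto: "0 \<le> t \<Longrightarrow> (\<lambda>m. levy_path z m t) \<longlonglongrightarrow> levy_bm z t"
  using tendsto_uniform_limitI[OF levy_uniform[of "nat \<lceil>t\<rceil>"], of t] by simp

lemma continuous_levy_bm: "continuous_on {0..} (levy_bm z)"
proof (rule continuous_on_nonneg_reals)
  show "continuous_on {0..real N} (levy_bm z)" for N
    by (rule uniform_limit_theorem[OF _ levy_uniform]) (auto simp: continuous_on_levy_path)
qed

lemma levy_bm_grid: "levy_bm z (real r / 2 ^ m) = levy_grid z m r"
proof (rule LIMSEQ_unique[OF levy_tendsto])
  show "(\<lambda>m'. levy_path z m' (real r / 2 ^ m)) \<longlonglongrightarrow> levy_grid z m r"
    by (rule tendsto_eventually) (auto simp: eventually_sequentially levy_path_grid intro!: exI[of _ m])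
qed simp

text \<open>Reaches an arbitrary time through dyadic times from below, where the path is a finite
  sum of independent normals; the limit uses continuity of the path.\<close>

lemma levy_grid_tendsto:
  assumes t: "0 \<le> t"
  shows "(\<lambda>m. levy_grid z m (nat \<lfloor>2 ^ m * t\<rfloor>)) \<longlonglongrightarrow> levy_bm z t"
proof -
  have "(\<lambda>m. real (nat \<lfloor>2 ^ m * t\<rfloor>) / 2 ^ m) \<longlonglongrightarrow> t"
  proof (rule tendsto_sandwich[of "\<lambda>m. t - 1 / 2 ^ m" _ _ "\<lambda>_. t"])
    show "\<forall>\<^sub>F m in sequentially. t - 1 / 2 ^ m \<le> real (nat \<lfloor>2 ^ m * t\<rfloor>) / 2 ^ m"
    proof (intro always_eventually allI)
      fix m :: nat
      have "2 ^ m * t - 1 \<le> real (nat \<lfloor>2 ^ m * t\<rfloor>)" by linarith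
      then have "(2 ^ m * t - 1) / 2 ^ m \<le> real (nat \<lfloor>2 ^ m * t\<rfloor>) / 2 ^ m" by (intro divide_right_mono) auto
      then show "t - 1 / 2 ^ m \<le> real (nat \<lfloor>2 ^ m * t\<rfloor>) / 2 ^ m" by (simp add: diff_divide_distrib)
    qed
    show "\<forall>\<^sub>F m in sequentially. real (nat \<lfloor>2 ^ m * t\<rfloor>) / 2 ^ m \<le> t"
    proof (intro always_eventually allI)
      fix m :: nat
      have "real (nat \<lfloor>2 ^ m * t\<rfloor>) \<le> 2 ^ m * t" using t by simp
      then show "real (nat \<lfloor>2 ^ m * t\<rfloor>) / 2 ^ m \<le> t" by (simp add: field_simps)
    qed
    have "(\<lambda>m. t - (1 / 2) ^ m) \<longlonglongrightarrow> t - 0" by (intro tendsto_intros) auto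
    then show "(\<lambda>m. t - 1 / 2 ^ m) \<longlonglongrightarrow> t" by (simp add: power_one_over)
  qed simp
  then have "(\<lambda>m. levy_bm z (real (nat \<lfloor>2 ^ m * t\<rfloor>) / 2 ^ m)) \<longlonglongrightarrow> levy_bm z t"
    using t continuous_levy_bm by (intro continuous_on_tendsto_compose[of "{0..}" "levy_bm z"]) auto
  then show ?thesis unfolding levy_bm_grid .
qed

end

text \<open>Column \<open>True\<close> multiplies the coarse increment and column
  \<open>False\<close> the new normal; the rows are the first and the second half.\<close>

definition haar_matrix :: "real ^ bool ^ bool" where
  "haar_matrix = (\<chi> b c. (if c \<or> b then 1 else -1) / sqrt 2)"

lemma orthogonal_haar_matrix: "orthogonal_matrix haar_matrix"
  by (auto simp: orthogonal_matrix haar_matrix_def matrix_matrix_mult_def transpose_def mat_def vec_eq_iff UNIV_bool)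

context prob_space
begin

lemma indep_vars_measurable: "indep_vars M' X I \<Longrightarrow> i \<in> I \<Longrightarrow> X i \<in> measurable M (M' i)"
  by (simp add: indep_vars_def2)

text \<open>The induction needs more than the increments of one level: they must also be independent
  of all normals not yet used.\<close>

lemma levy_xi_iid:
  assumes z: "indep_vars (\<lambda>_. borel) (\<lambda>(m, r) \<omega>. z \<omega> m r) (UNIV :: (nat \<times> nat) set)"
    and law: "\<And>m r. distr M borel (\<lambda>\<omega>. z \<omega> m r) = gauss 1"
  shows "indep_vars (\<lambda>_. borel) (\<lambda>r \<omega>. levy_xi (z \<omega>) m r) UNIV \<and> (\<forall>r. distr M borel (\<lambda>\<omega>. levy_xi (z \<omega>) m r) = gauss 1)"
proof -
  define C :: "nat \<Rightarrow> nat \<times> nat \<Rightarrow> 'a \<Rightarrow> real" where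
    "C m = (\<lambda>(l, r) \<omega>. if l = 0 then levy_xi (z \<omega>) m r else z \<omega> (m + l) r)" for m
  have main: "indep_vars (\<lambda>_. borel) (C m) UNIV \<and> (\<forall>i. distr M borel (C m i) = gauss 1)" for m
  proof (induction m)
    case 0
    have "C 0 = (\<lambda>(m, r) \<omega>. z \<omega> m r)" by (auto simp: C_def fun_eq_iff)
    then show ?case using z law by auto
  next
    case (Suc m)
    note ind = Suc[THEN conjunct1] and lawm = Suc[THEN conjunct2, rule_format]
    have Cm[measurable]: "C m i \<in> borel_measurable M" for i
      using indep_vars_measurable[OF ind] by simp
    define K :: "nat \<times> nat \<Rightarrow> (nat \<times> nat) set" where
      "K = (\<lambda>(l, r). if l = 0 then {(0, r), (1, r)} else {(Suc l, r)})"
    define J :: "nat \<times> nat \<Rightarrow> bool set" where "J g = (if fst g = 0 then UNIV else {True})" for g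
    define f :: "nat \<times> nat \<Rightarrow> bool \<Rightarrow> (nat \<times> nat \<Rightarrow> real) \<Rightarrow> real" where
      "f g b x = (if fst g = 0 then (x (0, snd g) + (if b then 1 else -1) * x (1, snd g)) / sqrt 2 else x (Suc (fst g), snd g))" for g b x
    have f: "f g b \<in> borel_measurable (\<Pi>\<^sub>M i\<in>K g. borel)" for g b
      unfolding f_def K_def by (cases g) (auto simp: case_prod_beta)
    have rot: "indep_vars (\<lambda>_. borel) (\<lambda>b \<omega>. (C m (0, r) \<omega> + (if b then 1 else -1) * C m (1, r) \<omega>) / sqrt 2) UNIV
       \<and> (\<forall>b. distributed M lborel (\<lambda>\<omega>. (C m (0, r) \<omega> + (if b then 1 else -1) * C m (1, r) \<omega>) / sqrt 2) (normal_density 0 1))" for r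
    proof -
      define h :: "bool \<Rightarrow> nat \<times> nat" where "h b = (if b then (0, r) else (1, r))" for b
      have i: "indep_vars (\<lambda>_. borel) (\<lambda>b. C m (h b)) UNIV"
        by (rule indep_vars_reindex) (auto simp: h_def inj_on_def intro: indep_vars_subset[OF ind])
      have l: "distributed M lborel (C m (h b)) (normal_density 0 1)" for b
        using lawm by (simp add: distributed_normal_iff)
      have e: "(\<lambda>\<omega>. \<Sum>j\<in>UNIV. haar_matrix $ b $ j * C m (h j) \<omega>) = (\<lambda>\<omega>. (C m (0, r) \<omega> + (if b then 1 else -1) * C m (1, r) \<omega>) / sqrt 2)" for b
        by (auto simp: UNIV_bool h_def haar_matrix_def fun_eq_iff field_simps)
      show ?thesis
        using rotate_normals[OF orthogonal_haar_matrix _ i l] unfolding e by simp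
    qed
    have nested: "indep_vars (\<lambda>(g, b). borel) (\<lambda>(g, b) \<omega>. f g b (restrict (\<lambda>i. C m i \<omega>) (K g))) (Sigma UNIV J)"
    proof (rule indep_vars_nested[where M'="\<lambda>g. \<Pi>\<^sub>M i\<in>K g. borel" and X="\<lambda>g \<omega>. restrict (\<lambda>i. C m i \<omega>) (K g)"])
      show "indep_vars (\<lambda>g. \<Pi>\<^sub>M i\<in>K g. borel) (\<lambda>g \<omega>. restrict (\<lambda>i. C m i \<omega>) (K g)) UNIV"
        by (rule indep_vars_restrict[OF ind]) (auto simp: disjoint_family_on_def K_def split: if_splits)
      show "f g b \<in> borel_measurable (\<Pi>\<^sub>M i\<in>K g. borel)" for g b by (rule f)
      show "indep_vars (\<lambda>b. borel) (\<lambda>b \<omega>. f g b (restrict (\<lambda>i. C m i \<omega>) (K g))) (J g)" for g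
      proof (cases "fst g = 0")
        case True
        then show ?thesis using rot[of "snd g"] by (cases g) (simp add: f_def K_def J_def)
      next
        case False
        then have "J g = {True}" by (simp add: J_def)
        moreover have "(\<lambda>\<omega>. f g True (restrict (\<lambda>i. C m i \<omega>) (K g))) \<in> borel_measurable M"
          using False by (cases g) (simp add: f_def K_def)
        ultimately show ?thesis by (simp add: indep_vars_singleton)
      qed
    qed
    \<comment> \<open>Finds each entry of \<open>C (Suc m)\<close> in the grouped family: increment
      \<open>r\<close> is the first half of its parent if \<open>r\<close> is even, the second
      otherwise.\<close>
    define h :: "nat \<times> nat \<Rightarrow> (nat \<times> nat) \<times> bool" where
      "h = (\<lambda>(l, r). if l = 0 then ((0, r div 2), even r) else ((l, r), True))"
    have hinj: "inj h"
      by (auto simp: inj_def h_def split: if_splits) presburger+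
    have "range h \<subseteq> Sigma UNIV J" by (auto simp: h_def J_def split: if_splits)
    then have sub: "indep_vars (\<lambda>(g, b). borel) (\<lambda>(g, b) \<omega>. f g b (restrict (\<lambda>i. C m i \<omega>) (K g))) (range h)"
      by (rule indep_vars_subset[OF nested])
    have hr: "indep_vars (\<lambda>_. borel) (\<lambda>i. case h i of (g, b) \<Rightarrow> \<lambda>\<omega>. f g b (restrict (\<lambda>i. C m i \<omega>) (K g))) UNIV"
      using indep_vars_reindex[OF hinj sub] by (simp add: case_prod_beta)
    have e: "(case h i of (g, b) \<Rightarrow> \<lambda>\<omega>. f g b (restrict (\<lambda>i. C m i \<omega>) (K g))) = C (Suc m) i" for i
      by (cases i) (auto simp: h_def f_def K_def C_def fun_eq_iff)
    have "distr M borel (C (Suc m) i) = gauss 1" for i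
    proof (cases i)
      case (Pair l r)
      show ?thesis
      proof (cases "l = 0")
        case True
        have "C (Suc m) i = (\<lambda>\<omega>. (C m (0, r div 2) \<omega> + (if even r then 1 else -1) * C m (1, r div 2) \<omega>) / sqrt 2)"
          using True Pair by (auto simp: C_def fun_eq_iff)
        then show ?thesis using rot[of "r div 2"] by (simp add: distributed_normal_iff)
      next
        case False
        then have "C (Suc m) i = C m (Suc l, r)"
          using Pair by (auto simp: C_def fun_eq_iff)
        then show ?thesis using lawm by simp
      qed
    qed
    then show ?case using hr unfolding e by simp
  qed
  have "indep_vars (\<lambda>_. borel) (\<lambda>r. C m (0, r)) UNIV"
    by (rule indep_vars_reindex) (auto simp: inj_on_def intro: indep_vars_subset[OF main[THEN conjunct1]])
  moreover have "C m (0, r) = (\<lambda>\<omega>. levy_xi (z \<omega>) m r)" for r by (simp add: C_def)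
  ultimately show ?thesis using main[of m] by (metis (no_types, lifting) ext)
qed

lemma AE_levy_bound:
  assumes [measurable]: "\<And>m r. (\<lambda>\<omega>. z \<omega> m r) \<in> borel_measurable M"
    and law: "\<And>m r. distr M borel (\<lambda>\<omega>. z \<omega> m r) = gauss 1"
  shows "AE \<omega> in M. levy_bound (z \<omega>)"
proof -
  \<comment> \<open>The sixteenth power fits the quarter in \<open>levy_bound\<close>: the pairing
    code is of order \<open>(m + r)^2\<close>, so the bound is of order \<open>(m + r)^4\<close>,
    that is 2^(4m) up to a fixed horizon, with sixteenth root 2^(m/4).\<close>
  have "AE \<omega> in M. \<exists>K>0. \<forall>n. (z \<omega> (fst (prod_decode n)) (snd (prod_decode n))) ^ (2 * 8) \<le> K * (real n + 1)\<^sup>2"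
    using law by (intro AE_normal_bound) auto
  then show ?thesis
  proof eventually_elim
    case (elim \<omega>)
    then obtain K where K: "K > 0" "\<And>n. (z \<omega> (fst (prod_decode n)) (snd (prod_decode n))) ^ 16 \<le> K * (real n + 1)\<^sup>2"
      by auto
    have b1: "(z \<omega> m r) ^ 16 \<le> K * (real m + real r + 2) ^ 4" for m r
    proof -
      have "prod_encode (m, r) + 1 \<le> (m + r + 2) ^ 2"
        by (simp add: prod_encode_def triangle_def power2_eq_square)
      then have "real (prod_encode (m, r)) + 1 \<le> (real m + real r + 2) ^ 2"
        by (metis (mono_tags, opaque_lifting) of_nat_1 of_nat_add of_nat_le_iff of_nat_numeral of_nat_power)
      then have "(real (prod_encode (m, r)) + 1)\<^sup>2 \<le> ((real m + real r + 2) ^ 2)\<^sup>2"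
        by (intro power_mono) auto
      then have "K * (real (prod_encode (m, r)) + 1)\<^sup>2 \<le> K * (real m + real r + 2) ^ 4"
        using K(1) by simp
      then show ?thesis using K(2)[of "prod_encode (m, r)"] by simp
    qed
    show ?case
    proof
      fix T :: nat
      let ?C = "(K * (real T + 4) ^ 4) powr (1 / 16)"
      show "\<exists>C. \<forall>m r. r \<le> T * 2 ^ m \<longrightarrow> \<bar>z \<omega> m r\<bar> \<le> C * (2 powr (1/4)) ^ m"
      proof (intro exI[of _ ?C] allI impI)
        fix m r :: nat assume r: "r \<le> T * 2 ^ m"
        define p where "p = (2::real) ^ m"
        have "real m \<le> p" unfolding p_def using of_nat_less_two_power[of m, where 'a=real] by linarith
        moreover have "real r \<le> real T * p" unfolding p_def using r by (metis of_nat_le_iff of_nat_mult of_nat_numeral of_nat_power)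
        moreover have "1 \<le> p" by (simp add: p_def)
        ultimately have "real m + real r + 2 \<le> (real T + 4) * p" unfolding distrib_right by linarith
        then have "real m + real r + 2 \<le> (real T + 4) * 2 ^ m" by (simp only: p_def)
        then have "(real m + real r + 2) ^ 4 \<le> ((real T + 4) * 2 ^ m) ^ 4" by (intro power_mono) auto
        then have "K * (real m + real r + 2) ^ 4 \<le> K * ((real T + 4) * 2 ^ m) ^ 4"
          using K(1) by (intro mult_left_mono) auto
        with b1[of m r] have "(z \<omega> m r) ^ 16 \<le> K * ((real T + 4) * 2 ^ m) ^ 4"
          by (rule order_trans)
        then have "\<bar>z \<omega> m r\<bar> ^ 16 \<le> K * ((real T + 4) * 2 ^ m) ^ 4"
          by (simp only: power_even_abs even_numeral)
        also have "\<dots> = (?C * (2 powr (1/4)) ^ m) ^ 16"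
        proof -
          have "?C ^ 16 = K * (real T + 4) ^ 4" using K(1) by (simp add: powr_power)
          moreover have "(2 powr (1/4) :: real) ^ 16 = 2 ^ 4" by (simp add: powr_power)
          ultimately show ?thesis
            by (simp add: power_mult_distrib power_mult[symmetric] mult.commute[of m] power_mult)
        qed
        finally show "\<bar>z \<omega> m r\<bar> \<le> ?C * (2 powr (1/4)) ^ m"
          by (rule power_le_imp_le_base[of _ 15, simplified]) simp
      qed
    qed
  qed
qed

end

lemma levy_path_measurable[measurable]:
  assumes [measurable]: "\<And>m r. (\<lambda>\<omega>. z \<omega> m r) \<in> borel_measurable M"
  shows "(\<lambda>\<omega>. levy_path (z \<omega>) m t) \<in> borel_measurable M" "(\<lambda>\<omega>. levy_bm (z \<omega>) t) \<in> borel_measurable M"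
proof -
  have [measurable]: "(\<lambda>\<omega>. levy_xi (z \<omega>) m r) \<in> borel_measurable M" for m r
    by (induction m arbitrary: r) auto
  show [measurable]: "(\<lambda>\<omega>. levy_path (z \<omega>) m t) \<in> borel_measurable M" for m t
    unfolding levy_path_def Let_def levy_grid_def by measurable
  show "(\<lambda>\<omega>. levy_bm (z \<omega>) t) \<in> borel_measurable M"
    unfolding levy_bm_def by measurable
qed

context prob_space
begin

text \<open>Increments between dyadic times are sums of independent normals over disjoint index
  ranges; the general case follows by approximating the times and
  \<open>indep_normal_limit\<close>.\<close>

theorem standard_brownian_motion_levy:
  assumes z: "indep_vars (\<lambda>_. borel) (\<lambda>(m, r) \<omega>. z \<omega> m r) (UNIV :: (nat \<times> nat) set)"
    and law: "\<And>m r. distr M borel (\<lambda>\<omega>. z \<omega> m r) = gauss 1"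
  shows "standard_brownian_motion M (\<lambda>t \<omega>. levy_bm (z \<omega>) t)"
proof -
  have zm[measurable]: "(\<lambda>\<omega>. z \<omega> m r) \<in> borel_measurable M" for m r
    using indep_vars_measurable[OF z, of "(m, r)"] by simp
  have bd: "AE \<omega> in M. levy_bound (z \<omega>)"
    by (rule AE_levy_bound) (auto simp: law)
  have W[measurable]: "(\<lambda>\<omega>. levy_bm (z \<omega>) t) \<in> borel_measurable M" for t
    by (rule levy_path_measurable) auto
  have incr: "indep_vars (\<lambda>_. borel) (\<lambda>i \<omega>. levy_bm (z \<omega>) (t (Suc i)) - levy_bm (z \<omega>) (t i)) {..<n} \<and>
      (\<forall>i<n. distr M borel (\<lambda>\<omega>. levy_bm (z \<omega>) (t (Suc i)) - levy_bm (z \<omega>) (t i)) = scaled_gauss (t (Suc i) - t i))"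
    if t0: "0 \<le> t 0" and tS: "\<And>i. i < n \<Longrightarrow> t i \<le> t (Suc i)" for n and t :: "nat \<Rightarrow> real"
  proof -
    have tpos: "0 \<le> t i" if "i \<le> n" for i
      using that
    proof (induction i)
      case (Suc i) then show ?case using tS[of i] by simp
    qed (use t0 in simp)
    \<comment> \<open>Rounding down keeps the order of the times, so the ranges from
      \<open>a m i\<close> to \<open>a m (Suc i)\<close> are disjoint.\<close>
    define a where "a m i = nat \<lfloor>2 ^ m * t i\<rfloor>" for m :: nat and i
    have aS: "a m i \<le> a m (Suc i)" if "i < n" for m i
      unfolding a_def using tS[OF that] by (intro nat_mono floor_mono mult_left_mono) auto
    have amono: "a m i \<le> a m j" if "i \<le> j" "j \<le> n" for m i j
      using that
    proof (induction j)
      case (Suc j) then show ?case using aS[of j m] by (cases "i = Suc j") auto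
    qed simp
    define Y where "Y m i \<omega> = levy_grid (z \<omega>) m (a m (Suc i)) - levy_grid (z \<omega>) m (a m i)" for m i \<omega>
    have Yeq: "Y m i \<omega> = (\<Sum>l\<in>{a m i..<a m (Suc i)}. levy_xi (z \<omega>) m l / sqrt (2 ^ m))" if "i < n" for m i \<omega>
      unfolding Y_def levy_grid_def lessThan_atLeast0 using aS[OF that] by (subst sum_diff_nat_ivl) auto
    have xi: "indep_vars (\<lambda>_. borel) (\<lambda>r \<omega>. levy_xi (z \<omega>) m r / sqrt (2 ^ m)) UNIV" for m
      using levy_xi_iid[OF z law, of m] by (intro indep_vars_compose2[where Y="\<lambda>_ x. x / sqrt (2 ^ m)" and M'="\<lambda>_. borel"]) auto
    have xil: "distr M borel (\<lambda>\<omega>. levy_xi (z \<omega>) m r / sqrt (2 ^ m)) = gauss (1 / sqrt (2 ^ m))" for m r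
    proof -
      have "distributed M lborel (\<lambda>\<omega>. levy_xi (z \<omega>) m r) (normal_density 0 1)"
        using levy_xi_iid[OF z law, of m] indep_vars_measurable[OF levy_xi_iid[OF z law, THEN conjunct1, of m], of r] by (simp add: distributed_normal_iff)
      then have "distributed M lborel (\<lambda>\<omega>. 0 + (1 / sqrt (2 ^ m)) * levy_xi (z \<omega>) m r) (normal_density (0 + (1 / sqrt (2 ^ m)) * 0) (\<bar>1 / sqrt (2 ^ m)\<bar> * 1))"
        by (intro normal_density_affine) auto
      then show ?thesis by (simp add: distributed_normal_iff)
    qed
    have Yind: "indep_vars (\<lambda>_. borel) (Y m) {..<n}" for m
    proof -
      have "indep_vars (\<lambda>i. \<Pi>\<^sub>M l\<in>{a m i..<a m (Suc i)}. borel) (\<lambda>i \<omega>. restrict (\<lambda>l. levy_xi (z \<omega>) m l / sqrt (2 ^ m)) {a m i..<a m (Suc i)}) {..<n}"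
      proof (rule indep_vars_restrict[OF xi])
        show "disjoint_family_on (\<lambda>i. {a m i..<a m (Suc i)}) {..<n}"
          unfolding disjoint_family_on_def
        proof (intro ballI impI)
          fix i j assume ij: "i \<in> {..<n}" "j \<in> {..<n}" "i \<noteq> j"
          have "a m (Suc i) \<le> a m j \<or> a m (Suc j) \<le> a m i"
            using ij amono[of "Suc i" j m] amono[of "Suc j" i m] by (cases "i < j") auto
          then show "{a m i..<a m (Suc i)} \<inter> {a m j..<a m (Suc j)} = {}" by auto
        qed
      qed auto
      then have "indep_vars (\<lambda>_. borel) (\<lambda>i \<omega>. (\<lambda>x. \<Sum>l\<in>{a m i..<a m (Suc i)}. x l) (restrict (\<lambda>l. levy_xi (z \<omega>) m l / sqrt (2 ^ m)) {a m i..<a m (Suc i)})) {..<n}"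
        by (rule indep_vars_compose2) auto
      then show ?thesis
        by (rule indep_vars_cong[THEN iffD1, rotated -1]) (auto simp: Yeq fun_eq_iff)
    qed
    have Ylaw: "distr M borel (Y m i) = scaled_gauss (real (a m (Suc i) - a m i) / 2 ^ m)" if i: "i \<in> {..<n}" for m i
    proof -
      have "distr M borel (\<lambda>\<omega>. \<Sum>l\<in>{a m i..<a m (Suc i)}. levy_xi (z \<omega>) m l / sqrt (2 ^ m)) = scaled_gauss (real (card {a m i..<a m (Suc i)}) * (1 / sqrt (2 ^ m))\<^sup>2)"
        by (rule distr_sum_gauss) (auto intro: indep_vars_subset[OF xi] simp: xil)
      moreover have "Y m i = (\<lambda>\<omega>. \<Sum>l\<in>{a m i..<a m (Suc i)}. levy_xi (z \<omega>) m l / sqrt (2 ^ m))"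
        using i by (auto simp: Yeq fun_eq_iff)
      ultimately show ?thesis by (simp add: power_divide)
    qed
    have alim: "(\<lambda>m. real (a m i) / 2 ^ m) \<longlonglongrightarrow> t i" if "i \<le> n" for i
    proof (rule tendsto_sandwich[of "\<lambda>m. t i - (1 / 2) ^ m" _ _ "\<lambda>_. t i"])
      show "\<forall>\<^sub>F m in sequentially. t i - (1 / 2) ^ m \<le> real (a m i) / 2 ^ m"
      proof (intro always_eventually allI)
        fix m :: nat
        have "2 ^ m * t i - 1 \<le> real (a m i)" unfolding a_def by linarith
        then have "(2 ^ m * t i - 1) / 2 ^ m \<le> real (a m i) / 2 ^ m" by (intro divide_right_mono) auto
        then show "t i - (1 / 2) ^ m \<le> real (a m i) / 2 ^ m" by (simp add: diff_divide_distrib power_one_over)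
      qed
      show "\<forall>\<^sub>F m in sequentially. real (a m i) / 2 ^ m \<le> t i"
      proof (intro always_eventually allI)
        fix m :: nat
        have "real (a m i) \<le> 2 ^ m * t i" unfolding a_def using tpos[OF that] by simp
        then show "real (a m i) / 2 ^ m \<le> t i" by (simp add: field_simps)
      qed
      have "(\<lambda>m. t i - (1 / 2) ^ m) \<longlonglongrightarrow> t i - 0" by (intro tendsto_intros) auto
      then show "(\<lambda>m. t i - (1 / 2) ^ m) \<longlonglongrightarrow> t i" by simp
    qed simp
    have vlim: "(\<lambda>m. real (a m (Suc i) - a m i) / 2 ^ m) \<longlonglongrightarrow> t (Suc i) - t i" if "i \<in> {..<n}" for i
    proof -
      have "(\<lambda>m. real (a m (Suc i)) / 2 ^ m - real (a m i) / 2 ^ m) \<longlonglongrightarrow> t (Suc i) - t i"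
        using that by (intro tendsto_diff alim) auto
      then show ?thesis using that aS by (simp add: of_nat_diff diff_divide_distrib)
    qed
    have lim: "AE \<omega> in M. \<forall>i\<in>{..<n}. (\<lambda>m. Y m i \<omega>) \<longlonglongrightarrow> levy_bm (z \<omega>) (t (Suc i)) - levy_bm (z \<omega>) (t i)"
      using bd
    proof eventually_elim
      case (elim \<omega>)
      show ?case
        unfolding Y_def a_def using tpos by (intro ballI tendsto_diff levy_bound.levy_grid_tendsto[OF elim]) auto
    qed
    show ?thesis
      using indep_normal_limit[OF _ _ Yind Ylaw lim vlim] W by auto
  qed
  show ?thesis
    unfolding standard_brownian_motion_def
  proof (intro conjI allI impI)
    show "AE \<omega> in M. levy_bm (z \<omega>) 0 = 0"
    proof (rule AE_I2)
      fix \<omega>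
      have "levy_path (z \<omega>) m 0 = 0" for m by (simp add: levy_path_def levy_grid_def)
      then show "levy_bm (z \<omega>) 0 = 0" by (simp add: levy_bm_def lim_const)
    qed
    show "AE \<omega> in M. continuous_on {0..} (\<lambda>t. levy_bm (z \<omega>) t)"
      using bd by eventually_elim (rule levy_bound.continuous_levy_bm)
    show "indep_vars (\<lambda>_. borel) (\<lambda>i \<omega>. levy_bm (z \<omega>) (t (Suc i)) - levy_bm (z \<omega>) (t i)) {..<n}"
      if "0 \<le> t 0 \<and> (\<forall>i<n. t i \<le> t (Suc i))" for n t
      using incr[of t n] that by auto
    fix s t :: real assume st: "0 \<le> s \<and> s < t"
    have "distr M borel (\<lambda>\<omega>. levy_bm (z \<omega>) t - levy_bm (z \<omega>) s) = scaled_gauss (t - s)"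
      using incr[of "\<lambda>i. if i = 0 then s else t" 1] st by simp
    then show "distributed M lborel (\<lambda>\<omega>. levy_bm (z \<omega>) t - levy_bm (z \<omega>) s) (normal_density 0 (sqrt (t - s)))"
      using scaled_gauss_eq_gauss[of "sqrt (t - s)"] st by (simp add: distributed_normal_iff)
  qed (rule W)
qed

end

subsection \<open>A quantitative central limit theorem for fair signs\<close>

lemma indep_vars_PiM_coordinates:
  assumes M: "\<And>i. prob_space (M i)"
  shows "prob_space.indep_vars (Pi\<^sub>M UNIV M) M (\<lambda>i \<omega>. \<omega> i) UNIV"
proof -
  interpret prob_space "Pi\<^sub>M UNIV M" by (rule prob_space_PiM) (rule M)
  have "distr (Pi\<^sub>M UNIV M) (M i) (\<lambda>\<omega>. \<omega> i) = M i" for i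
    by (rule distr_PiM_component) (auto intro: M)
  then show ?thesis
    by (subst indep_vars_iff_distr_eq_PiM) (auto simp: restrict_def distr_id2)
qed

lemma gauss_has_integral:
  assumes "has_bochner_integral lborel (\<lambda>x. std_normal_density x * f x) c" "f \<in> borel_measurable borel"
  shows "integrable (gauss 1) f" "integral\<^sup>L (gauss 1) f = c"
proof -
  have "has_bochner_integral (gauss 1) f c"
    unfolding gauss_def by (rule has_bochner_integral_density) (use assms in auto)
  then show "integrable (gauss 1) f" "integral\<^sup>L (gauss 1) f = c"
    by (simp_all add: has_bochner_integral_iff)
qed

lemma gauss_moments:
  shows "integrable (gauss 1) (\<lambda>x. x)" "(\<integral>x. x \<partial>gauss 1) = 0"
    and "integrable (gauss 1) (\<lambda>x. x\<^sup>2)" "(\<integral>x. x\<^sup>2 \<partial>gauss 1) = 1"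
    and "integrable (gauss 1) (\<lambda>x. \<bar>x\<bar> ^ 3)" "(\<integral>x. \<bar>x\<bar> ^ 3 \<partial>gauss 1) \<le> 2"
proof -
  show "integrable (gauss 1) (\<lambda>x. x)" "(\<integral>x. x \<partial>gauss 1) = 0"
    using std_normal_moment_odd[of 0] by (auto intro!: gauss_has_integral)
  show "integrable (gauss 1) (\<lambda>x. x\<^sup>2)" "(\<integral>x. x\<^sup>2 \<partial>gauss 1) = 1"
    using std_normal_moment_even[of 1] by (auto intro!: gauss_has_integral)
  have *: "integrable (gauss 1) (\<lambda>x. \<bar>x\<bar> ^ 3)" "(\<integral>x. \<bar>x\<bar> ^ 3 \<partial>gauss 1) = sqrt (2 / pi) * 2"
    using std_normal_moment_abs_odd[of 1] by (auto intro!: gauss_has_integral simp: numeral_3_eq_3)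
  show "integrable (gauss 1) (\<lambda>x. \<bar>x\<bar> ^ 3)" by (rule *)
  have "sqrt (2 / pi) \<le> 1" using pi_gt3 by simp
  then show "(\<integral>x. \<bar>x\<bar> ^ 3 \<partial>gauss 1) \<le> 2" unfolding *(2) by simp
qed

text \<open>A normal of variance \<open>n + 1\<close> is a standard normal plus an independent
  normal of variance \<open>n\<close>, realized by the coordinates of a product space. This is the
  Gaussian side of the exchange in \<open>lindeberg_rad_avg\<close>.\<close>

lemma integral_scaled_gauss_Suc:
  fixes h :: "real \<Rightarrow> real"
  assumes [measurable]: "h \<in> borel_measurable borel" and bd: "\<And>x. \<bar>h x\<bar> \<le> B"
  shows "(\<integral>y. h y \<partial>scaled_gauss (real (Suc n))) = (\<integral>z. (\<integral>y. h (z + y) \<partial>scaled_gauss (real n)) \<partial>gauss 1)"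
proof -
  interpret G: prob_space "gauss 1" by (rule prob_space_gauss) simp
  let ?P = "Pi\<^sub>M (UNIV :: nat set) (\<lambda>_. gauss 1)"
  interpret P: prob_space ?P by (rule prob_space_PiM) (rule G.prob_space_axioms)
  have "P.indep_vars (\<lambda>_. gauss 1) (\<lambda>i \<omega>. \<omega> i) (UNIV :: nat set)"
    by (rule indep_vars_PiM_coordinates) (rule G.prob_space_axioms)
  then have ind: "P.indep_vars (\<lambda>_. borel) (\<lambda>i \<omega>. \<omega> i) (UNIV :: nat set)"
    using P.indep_vars_compose2[of "\<lambda>_. gauss 1" "\<lambda>i \<omega>. \<omega> i" UNIV "\<lambda>_ x. x" "\<lambda>_. borel"] by simp
  have law: "distr ?P borel (\<lambda>\<omega>. \<omega> i) = gauss 1" for i :: nat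
  proof -
    have "distr ?P borel (\<lambda>\<omega>. \<omega> i) = distr ?P (gauss 1) (\<lambda>\<omega>. \<omega> i)" by (rule distr_cong) auto
    then show ?thesis using distr_PiM_component[of UNIV "\<lambda>_. gauss 1" i] G.prob_space_axioms by simp
  qed
  have S: "distr ?P borel (\<lambda>\<omega>. \<Sum>i<n. \<omega> i) = scaled_gauss (real n)" for n
    using P.distr_sum_gauss[of "{..<n}" "\<lambda>i \<omega>. \<omega> i" 1] law P.indep_vars_subset[OF ind, of "{..<n}"] by simp
  have "P.indep_var borel (\<lambda>\<omega>. \<omega> n) borel (\<lambda>\<omega>. \<Sum>i<n. \<omega> i)"
    by (rule P.indep_vars_sum) (auto intro: P.indep_vars_subset[OF ind])
  then have "(\<integral>\<omega>. (\<lambda>(a, b). h (a + b)) (\<omega> n, \<Sum>i<n. \<omega> i) \<partial>?P) = (\<integral>\<omega>. (\<integral>y. (\<lambda>(a, b). h (a + b)) (\<omega> n, y) \<partial>distr ?P borel (\<lambda>\<omega>. \<Sum>i<n. \<omega> i)) \<partial>?P)"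
    by (rule P.indep_var_integral) (auto intro!: P.integrable_const_bound[of _ B] simp: bd)
  then have eq: "(\<integral>\<omega>. h (\<omega> n + (\<Sum>i<n. \<omega> i)) \<partial>?P) = (\<integral>\<omega>. (\<integral>y. h (\<omega> n + y) \<partial>scaled_gauss (real n)) \<partial>?P)"
    by (simp add: S)
  interpret Gn: prob_space "scaled_gauss (real n)" by (rule prob_space_scaled_gauss)
  have m: "(\<lambda>z. \<integral>y. h (z + y) \<partial>scaled_gauss (real n)) \<in> borel_measurable borel"
    by (rule Gn.borel_measurable_lebesgue_integral) auto
  have "(\<integral>y. h y \<partial>scaled_gauss (real (Suc n))) = (\<integral>\<omega>. h (\<Sum>i<Suc n. \<omega> i) \<partial>?P)"
    unfolding S[of "Suc n", symmetric] by (subst integral_distr) auto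
  also have "\<dots> = (\<integral>\<omega>. (\<integral>y. h (\<omega> n + y) \<partial>scaled_gauss (real n)) \<partial>?P)"
    unfolding eq[symmetric] by (simp add: add.commute)
  also have "\<dots> = (\<integral>z. (\<integral>y. h (z + y) \<partial>scaled_gauss (real n)) \<partial>distr ?P borel (\<lambda>\<omega>. \<omega> n))"
    using m by (subst integral_distr) auto
  finally show ?thesis unfolding law .
qed

section \<open>Lindeberg exchange and smoothing\<close>

text \<open>The expectation of \<open>h\<close> at a sum of \<open>n\<close> independent fair signs.
  As a recursion it matches the induction that exchanges one sign at a time;
  \<open>rad_avg_eq_sum\<close> later identifies it with an average over sign vectors.\<close>

fun rad_avg :: "nat \<Rightarrow> (real \<Rightarrow> real) \<Rightarrow> real" where
  "rad_avg 0 h = h 0"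
| "rad_avg (Suc n) h = (rad_avg n (\<lambda>s. h (s + 1)) + rad_avg n (\<lambda>s. h (s - 1))) / 2"

lemma rad_avg_mono: "(\<And>s. h s \<le> h' s) \<Longrightarrow> rad_avg n h \<le> rad_avg n h'"
  by (induction n arbitrary: h h') (auto intro!: add_mono)

lemma rad_avg_add_const: "rad_avg n (\<lambda>s. h s + c) = rad_avg n h + c"
  by (induction n arbitrary: h) (auto simp: field_simps)

lemma rad_avg_square: "rad_avg n (\<lambda>s. (x + s)\<^sup>2) = x\<^sup>2 + real n"
proof (induction n arbitrary: x)
  case (Suc n)
  have "rad_avg n (\<lambda>s. (x + (s + 1))\<^sup>2) = (x + 1)\<^sup>2 + real n" "rad_avg n (\<lambda>s. (x + (s - 1))\<^sup>2) = (x - 1)\<^sup>2 + real n"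
    using Suc[of "x + 1"] Suc[of "x - 1"] by (simp_all add: algebra_simps)
  then show ?case by (simp add: power2_eq_square algebra_simps)
qed simp

text \<open>A sign and a standard normal have the same mean and variance, so the terms up to second
  order cancel in the exchange. The remainders are \<open>c\<close> for the sign and
  \<open>c\<close> times the third absolute moment, at most 2, for the normal: hence 3 per step. In
  the application \<open>h2\<close> is half of the second derivative.\<close>

lemma lindeberg_rad_avg:
  fixes h h1 h2 :: "real \<Rightarrow> real"
  assumes [measurable]: "h \<in> borel_measurable borel" "h1 \<in> borel_measurable borel" "h2 \<in> borel_measurable borel"
    and bd: "\<And>x. \<bar>h x\<bar> \<le> B" "\<And>x. \<bar>h1 x\<bar> \<le> B" "\<And>x. \<bar>h2 x\<bar> \<le> B"
    and taylor: "\<And>x y. \<bar>h (x + y) - h x - y * h1 x - y\<^sup>2 * h2 x\<bar> \<le> c * \<bar>y\<bar> ^ 3"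
  shows "\<bar>rad_avg n (\<lambda>s. h (x + s)) - (\<integral>y. h (x + y) \<partial>scaled_gauss (real n))\<bar> \<le> 3 * c * real n"
proof (induction n arbitrary: x)
  case 0
  interpret G: prob_space "gauss 1" by (rule prob_space_gauss) simp
  have "(\<integral>y. h (x + y) \<partial>scaled_gauss 0) = h x"
    unfolding scaled_gauss_def by (subst integral_distr) (use G.prob_space in auto)
  then show ?case by simp
next
  case (Suc n)
  interpret G: prob_space "gauss 1" by (rule prob_space_gauss) simp
  interpret Gn: prob_space "scaled_gauss (real n)" by (rule prob_space_scaled_gauss)
  \<comment> \<open>The test function averaged over the other \<open>n\<close> normals. It satisfies
    the Taylor estimate with the same constant, because the estimate holds at every
    translate.\<close>
  define u where "u x = (\<integral>y. h (x + y) \<partial>scaled_gauss (real n))" for x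
  have int: "integrable (scaled_gauss (real n)) (\<lambda>y. h (x + y))" "integrable (scaled_gauss (real n)) (\<lambda>y. h1 (x + y))"
     "integrable (scaled_gauss (real n)) (\<lambda>y. h2 (x + y))" for x
    by (auto intro!: Gn.integrable_const_bound[of _ B] simp: bd)
  define c1 where "c1 = (\<integral>y. h1 (x + y) \<partial>scaled_gauss (real n))"
  define c2 where "c2 = (\<integral>y. h2 (x + y) \<partial>scaled_gauss (real n))"
  have um[measurable]: "u \<in> borel_measurable borel"
    unfolding u_def by (rule Gn.borel_measurable_lebesgue_integral) auto
  have ub: "\<bar>u x\<bar> \<le> B" for x
  proof -
    have "\<bar>u x\<bar> \<le> (\<integral>y. B \<partial>scaled_gauss (real n))"
      unfolding u_def using bd(1) int(1)[of x]
      by (intro order_trans[OF integral_abs_bound] integral_mono) auto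
    then show ?thesis using Gn.prob_space by simp
  qed
  have ut: "\<bar>u (x + z) - u x - z * c1 - z\<^sup>2 * c2\<bar> \<le> c * \<bar>z\<bar> ^ 3" for z
  proof -
    have i: "integrable (scaled_gauss (real n)) (\<lambda>y. h (x + y + z) - h (x + y) - z * h1 (x + y) - z\<^sup>2 * h2 (x + y))"
      using int(1)[of "x + z"] int[of x] by (intro Bochner_Integration.integrable_diff integrable_mult_right) (auto simp: algebra_simps)
    have "u (x + z) - u x - z * c1 - z\<^sup>2 * c2 = (\<integral>y. h (x + y + z) - h (x + y) - z * h1 (x + y) - z\<^sup>2 * h2 (x + y) \<partial>scaled_gauss (real n))"
      using int(1)[of "x + z"] int[of x] by (simp add: u_def c1_def c2_def algebra_simps)
    also have "\<bar>\<dots>\<bar> \<le> (\<integral>y. c * \<bar>z\<bar> ^ 3 \<partial>scaled_gauss (real n))"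
      using i taylor by (intro order_trans[OF integral_abs_bound] integral_mono) auto
    also have "\<dots> = c * \<bar>z\<bar> ^ 3" using Gn.prob_space by simp
    finally show ?thesis .
  qed
  have c0: "0 \<le> c" using taylor[of 0 1] by (auto intro: order_trans[OF abs_ge_zero])
  have A: "\<bar>(u (x + 1) + u (x - 1)) / 2 - u x - c2\<bar> \<le> c"
  proof -
    have 1: "\<bar>u (x + 1) - u x - c1 - c2\<bar> \<le> c" and 2: "\<bar>u (x - 1) - u x + c1 - c2\<bar> \<le> c"
      using ut[of 1] ut[of "-1"] by simp_all
    then show ?thesis by argo
  qed
  have iu: "integrable (gauss 1) (\<lambda>z. u (x + z))"
    by (auto intro!: G.integrable_const_bound[of _ B] simp: ub)
  note gm = gauss_moments
  have "(\<integral>z. u (x + z) \<partial>gauss 1) - u x - c2 = (\<integral>z. u (x + z) - u x - z * c1 - z\<^sup>2 * c2 \<partial>gauss 1)"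
    using iu gm G.prob_space by simp
  also have "\<bar>\<dots>\<bar> \<le> (\<integral>z. c * \<bar>z\<bar> ^ 3 \<partial>gauss 1)"
    using iu gm ut by (intro order_trans[OF integral_abs_bound] integral_mono) auto
  also have "\<dots> \<le> c * 2" using gm c0 by (auto intro: mult_left_mono)
  finally have B: "\<bar>(\<integral>z. u (x + z) \<partial>gauss 1) - u x - c2\<bar> \<le> 2 * c" by simp
  have e: "(\<integral>y. h (x + y) \<partial>scaled_gauss (real (Suc n))) = (\<integral>z. u (x + z) \<partial>gauss 1)"
    using integral_scaled_gauss_Suc[of "\<lambda>y. h (x + y)" B n] bd by (simp add: u_def add.assoc)
  have 1: "\<bar>rad_avg n (\<lambda>s. h (x + (s + 1))) - u (x + 1)\<bar> \<le> 3 * c * real n"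
    and 2: "\<bar>rad_avg n (\<lambda>s. h (x + (s - 1))) - u (x - 1)\<bar> \<le> 3 * c * real n"
    using Suc[of "x + 1"] Suc[of "x - 1"] by (simp_all add: u_def algebra_simps)
  have 3: "3 * c * real (Suc n) = 3 * c * real n + 3 * c" by (simp add: algebra_simps)
  show ?case
    unfolding e rad_avg.simps 3
    using 1 2 A B by argo
qed

lemma one_plus_square_pos: "0 < 1 + (u::real)\<^sup>2"
  by (simp add: add_pos_nonneg)

lemma borel_measurable_arctan[measurable]: "arctan \<in> borel_measurable borel"
  by (intro borel_measurable_continuous_onI continuous_intros)

text \<open>The arctangent provides the smooth step that replaces an indicator. Its third derivative
  is bounded by 6, so the Lagrange remainder has constant 6 / 3! = 1.\<close>

lemma arctan_taylor:
  "\<bar>arctan (u + v) - arctan u - v * (1 / (1 + u\<^sup>2)) - v\<^sup>2 * (- u / (1 + u\<^sup>2)\<^sup>2)\<bar> \<le> \<bar>v\<bar> ^ 3"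
proof (cases "v = 0")
  case False
  define d :: "nat \<Rightarrow> real \<Rightarrow> real" where "d m = (if m = 0 then arctan else if m = 1 then (\<lambda>u. 1 / (1 + u\<^sup>2))
    else if m = 2 then (\<lambda>u. - 2 * u / (1 + u\<^sup>2)\<^sup>2) else (\<lambda>u. (6 * u\<^sup>2 - 2) / (1 + u\<^sup>2) ^ 3))" for m
  have pos: "1 + t\<^sup>2 > 0" for t :: real by (simp add: add_pos_nonneg)
  have D: "DERIV (d m) t :> d (Suc m) t" if m: "m < 3" for m t
  proof -
    have nz: "1 + t\<^sup>2 \<noteq> 0" using pos[of t] by simp
    consider "m = 0" | "m = 1" | "m = 2" using m by linarith
    then show ?thesis
    proof cases
      case 1 then show ?thesis by (auto simp: d_def inverse_eq_divide intro!: derivative_eq_intros)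
    next
      case 2
      have g: "DERIV (\<lambda>u. 1 + u\<^sup>2) t :> 2 * t" by (auto intro!: derivative_eq_intros)
      have "DERIV (\<lambda>u. 1 / (1 + u\<^sup>2)) t :> (0 * (1 + t\<^sup>2) - 1 * (2 * t)) / ((1 + t\<^sup>2) * (1 + t\<^sup>2))"
        by (rule DERIV_divide[OF DERIV_const g nz])
      then show ?thesis using 2 by (simp add: d_def power2_eq_square)
    next
      case 3
      have n: "DERIV (\<lambda>u. - 2 * u) t :> - 2" by (auto intro!: derivative_eq_intros)
      have g: "DERIV (\<lambda>u. (1 + u\<^sup>2)\<^sup>2) t :> 2 * (1 + t\<^sup>2) * (2 * t)" by (auto intro!: derivative_eq_intros)
      have "DERIV (\<lambda>u. - 2 * u / (1 + u\<^sup>2)\<^sup>2) t :> (- 2 * (1 + t\<^sup>2)\<^sup>2 - (- 2 * t) * (2 * (1 + t\<^sup>2) * (2 * t))) / ((1 + t\<^sup>2)\<^sup>2 * (1 + t\<^sup>2)\<^sup>2)"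
        by (rule DERIV_divide[OF n g]) (use nz in simp)
      also have "(- 2 * (1 + t\<^sup>2)\<^sup>2 - (- 2 * t) * (2 * (1 + t\<^sup>2) * (2 * t))) / ((1 + t\<^sup>2)\<^sup>2 * (1 + t\<^sup>2)\<^sup>2)
         = ((1 + t\<^sup>2) * (6 * t\<^sup>2 - 2)) / ((1 + t\<^sup>2) * (1 + t\<^sup>2) ^ 3)"
        by (rule arg_cong2[where f="(/)"]) (simp_all add: power2_eq_square power3_eq_cube algebra_simps)
      also have "\<dots> = (6 * t\<^sup>2 - 2) / (1 + t\<^sup>2) ^ 3" using nz by simp
      finally show ?thesis using 3 by (simp add: d_def)
    qed
  qed
  have d3: "\<bar>d 3 t\<bar> \<le> 6" for t
  proof -
    have "\<bar>6 * t\<^sup>2 - 2\<bar> \<le> 6 * (1 + t\<^sup>2)" by (auto simp: abs_le_iff)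
    also have "\<dots> \<le> 6 * (1 + t\<^sup>2) ^ 3"
      using power_increasing[of 1 3 "1 + t\<^sup>2"] by simp
    finally show ?thesis using pos[of t] by (simp add: d_def abs_divide divide_le_eq)
  qed
  have "\<exists>t. (if u + v < u then u + v < t \<and> t < u else u < t \<and> t < u + v) \<and>
      arctan (u + v) = (\<Sum>m<3. d m u / fact m * (u + v - u) ^ m) + d 3 t / fact 3 * (u + v - u) ^ 3"
    by (rule Taylor[where a="min u (u + v)" and b="max u (u + v)"]) (use False D in \<open>auto simp: d_def[of 0]\<close>)
  then obtain t where t: "arctan (u + v) = (\<Sum>m<3. d m u / fact m * v ^ m) + d 3 t / fact 3 * v ^ 3" by auto
  have "(\<Sum>m<3. d m u / fact m * v ^ m) = arctan u + v * (1 / (1 + u\<^sup>2)) + v\<^sup>2 * (- u / (1 + u\<^sup>2)\<^sup>2)"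
    by (simp add: numeral_3_eq_3 d_def power2_eq_square)
  then have "arctan (u + v) - arctan u - v * (1 / (1 + u\<^sup>2)) - v\<^sup>2 * (- u / (1 + u\<^sup>2)\<^sup>2) = d 3 t / 6 * v ^ 3"
    using t by (simp add: fact_numeral)
  also have "\<bar>\<dots>\<bar> = \<bar>d 3 t\<bar> / 6 * \<bar>v\<bar> ^ 3" by (simp add: abs_mult power_abs)
  also have "\<dots> \<le> 1 * \<bar>v\<bar> ^ 3" using d3[of t] by (intro mult_right_mono) auto
  finally show ?thesis by simp
qed simp

text \<open>At distance \<open>K * w\<close> from \<open>c\<close> the smooth step is within
  \<open>1 / K\<close> of its limit, because arctan K is pi/2 - arctan (1/K) and arctan (1/K) is at
  most \<open>1 / K\<close>.\<close>

lemma arctan_step_bounds: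
  fixes c w K s :: real
  assumes w: "0 < w" and K: "0 < K"
  defines "h \<equiv> 1 / 2 - arctan ((s - c) / w) / pi"
  shows "of_bool (s \<le> c - K * w) - 1 / K \<le> h" "h \<le> of_bool (s \<le> c + K * w) + 1 / K" "0 \<le> h" "h \<le> 1"
proof -
  have b: "- (pi / 2) < arctan u" "arctan u < pi / 2" for u
    using arctan_bounded[of u] by auto
  show h01: "0 \<le> h" "h \<le> 1"
    using b[of "(s - c) / w"] by (simp_all add: h_def field_simps)
  have aK: "arctan K = pi / 2 - arctan (1 / K)" using arctan_inverse[of K] K by (simp add: inverse_eq_divide)
  have "arctan (1 / K) \<le> 1 / K" using arctan_le_self[of "1 / K"] K by simp
  then have aK': "pi / 2 - 1 / K \<le> arctan K" using aK by simp
  have K1: "1 / K / pi \<le> 1 / K" using K pi_gt3 by (simp add: divide_le_eq)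
  show "of_bool (s \<le> c - K * w) - 1 / K \<le> h"
  proof (cases "s \<le> c - K * w")
    case True
    then have "(s - c) / w \<le> - K" using w by (simp add: field_simps)
    then have "arctan ((s - c) / w) \<le> - arctan K" by (metis arctan_le_iff arctan_minus)
    then have "arctan ((s - c) / w) / pi \<le> (1 / K - pi / 2) / pi"
      using aK' by (intro divide_right_mono) auto
    then show ?thesis using True K1 by (simp add: h_def diff_divide_distrib)
  qed (use h01 K in \<open>auto intro: order_trans[of _ 0]\<close>)
  show "h \<le> of_bool (s \<le> c + K * w) + 1 / K"
  proof (cases "s \<le> c + K * w")
    case False
    then have "K \<le> (s - c) / w" using w by (simp add: field_simps)
    then have "arctan K \<le> arctan ((s - c) / w)" by (simp add: arctan_le_iff)
    then have "(pi / 2 - 1 / K) / pi \<le> arctan ((s - c) / w) / pi"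
      using aK' by (intro divide_right_mono) auto
    then show ?thesis using False K1 by (simp add: h_def diff_divide_distrib)
  qed (use h01 K in \<open>auto intro: order_trans[of _ 1]\<close>)
qed

lemma gauss_measure_interval:
  assumes s: "0 < s" and ab: "a \<le> b"
  shows "measure (gauss s) {..b} - measure (gauss s) {..a} \<le> (b - a) / s"
proof -
  interpret prob_space "gauss s" using s by (rule prob_space_gauss)
  have "measure (gauss s) {..b} - measure (gauss s) {..a} = measure (gauss s) {a<..b}"
  proof -
    have "{a<..b} = {..b} - {..a}" by auto
    then show ?thesis using ab by (simp add: finite_measure_Diff)
  qed
  also have "ennreal \<dots> \<le> ennreal ((b - a) / s)"
  proof -
    have "normal_density 0 s x \<le> 1 / s" for x
    proof -
      have "exp (- x\<^sup>2 / (2 * s\<^sup>2)) \<le> 1" by simp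
      moreover have "s \<le> sqrt (2 * pi * s\<^sup>2)"
      proof (rule real_le_rsqrt)
        show "s\<^sup>2 \<le> 2 * pi * s\<^sup>2" using pi_gt3 by (simp add: mult_le_cancel_right1)
      qed
      ultimately have "exp (- x\<^sup>2 / (2 * s\<^sup>2)) * s \<le> 1 * sqrt (2 * pi * s\<^sup>2)"
        using s by (intro mult_mono) auto
      moreover have "0 < sqrt (2 * pi * s\<^sup>2)" using s by simp
      ultimately show ?thesis using s
        unfolding normal_density_def by (simp add: divide_le_eq le_divide_eq mult.commute)
    qed
    then have "emeasure (gauss s) {a<..b} \<le> (\<integral>\<^sup>+x. ennreal (1 / s) * indicator {a<..b} x \<partial>lborel)"
      unfolding gauss_def by (subst emeasure_density) (auto intro!: nn_integral_mono mult_right_mono ennreal_leI)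
    also have "\<dots> = ennreal (1 / s) * ennreal (b - a)"
      using ab by (subst nn_integral_cmult_indicator) auto
    also have "\<dots> = ennreal ((b - a) / s)"
      using ab s by (subst ennreal_mult[symmetric]) auto
    finally show ?thesis by (simp add: emeasure_eq_measure)
  qed
  finally show ?thesis using ab s by (simp add: ennreal_le_iff)
qed

text \<open>A smooth step is compared by Lindeberg and then turned back into an indicator. The power
  1/16 is weaker than the classical rate, but the coupling only asks for some negative
  power.\<close>

lemma kolmogorov_distance_rad_avg:
  assumes L: "1 \<le> L"
  shows "\<bar>rad_avg L (\<lambda>s. of_bool (s \<le> a)) - measure (scaled_gauss (real L)) {..a}\<bar> \<le> 7 * real L powr (- 1 / 16)"
proof -
  interpret G: prob_space "scaled_gauss (real L)" by (rule prob_space_scaled_gauss)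
  define l where "l = real L"
  have l: "1 \<le> l" using L by (simp add: l_def)
  \<comment> \<open>With r = l^(-1/16) the errors are: \<open>1 / K\<close> = r for the tails of the
    step, twice; 3 l / w^3 = 3 l^(-1/8), at most 3 r, from Lindeberg; and 2 K w / sqrt l = 2 r for
    the Gaussian mass of the window. Together they give 7 r.\<close>
  define w where "w = l powr (3 / 8)"
  define K where "K = l powr (1 / 16)"
  define h where "h c s = 1 / 2 - arctan ((s - c) / w) / pi" for c s
  have w: "1 \<le> w" and K: "1 \<le> K" using l by (auto simp: w_def K_def ge_one_powr_ge_zero)
  then have w0: "0 < w" and K0: "0 < K" by auto
  have hb: "of_bool (s \<le> c - K * w) - 1 / K \<le> h c s" "h c s \<le> of_bool (s \<le> c + K * w) + 1 / K" "0 \<le> h c s" "h c s \<le> 1" for c s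
    unfolding h_def by (rule arctan_step_bounds[OF w0 K0])+
  have hm[measurable]: "h c \<in> borel_measurable borel" for c
    unfolding h_def by measurable
  have lind: "\<bar>rad_avg L (h c) - (\<integral>y. h c y \<partial>scaled_gauss (real L))\<bar> \<le> 3 * (1 / w ^ 3) * real L" for c
  proof -
    define h1 where "h1 s = - (1 / (1 + ((s - c) / w)\<^sup>2)) / (pi * w)" for s
    define h2 where "h2 s = (((s - c) / w) / (1 + ((s - c) / w)\<^sup>2)\<^sup>2) / (pi * w\<^sup>2)" for s
    have h12: "h1 \<in> borel_measurable borel" "h2 \<in> borel_measurable borel"
      unfolding h1_def h2_def by measurable
    have "\<bar>h c (x + y) - h c x - y * h1 x - y\<^sup>2 * h2 x\<bar> \<le> (1 / w ^ 3) * \<bar>y\<bar> ^ 3" for x y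
    proof -
      define u where "u = (x - c) / w"
      define v where "v = y / w"
      have y: "y = v * w" using w0 by (simp add: v_def)
      have uv: "(x + y - c) / w = u + v" by (simp add: u_def v_def add_divide_distrib diff_divide_distrib)
      have 1: "y * h1 x = - (v * (1 / (1 + u\<^sup>2))) / pi"
        unfolding h1_def u_def[symmetric] y using w0 by simp
      have 2: "y\<^sup>2 * h2 x = (v\<^sup>2 * (u / (1 + u\<^sup>2)\<^sup>2)) / pi"
        unfolding h2_def u_def[symmetric] y using w0 by (simp add: power_mult_distrib)
      have e: "h c (x + y) - h c x - y * h1 x - y\<^sup>2 * h2 x
         = - (arctan (u + v) - arctan u - v * (1 / (1 + u\<^sup>2)) - v\<^sup>2 * (- u / (1 + u\<^sup>2)\<^sup>2)) / pi"
        unfolding h_def 1 2 uv u_def[symmetric] by (simp add: diff_divide_distrib add_divide_distrib)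
      have "\<bar>h c (x + y) - h c x - y * h1 x - y\<^sup>2 * h2 x\<bar> \<le> \<bar>v\<bar> ^ 3 / pi"
        unfolding e abs_divide abs_minus_cancel using arctan_taylor[of u v] by (simp add: divide_right_mono)
      also have "\<dots> \<le> \<bar>v\<bar> ^ 3 / 1" using pi_gt3 by (intro divide_left_mono) auto
      finally show ?thesis using w0 by (simp add: v_def power_divide abs_divide)
    qed
    moreover have "\<bar>h c x\<bar> \<le> 1" for x
      using hb(3,4)[of c x] by simp
    moreover have "\<bar>h1 x\<bar> \<le> 1" "\<bar>h2 x\<bar> \<le> 1" for x
    proof -
      have p: "1 \<le> pi * w" "1 \<le> pi * w\<^sup>2" using w pi_gt3 mult_mono[of 1 pi 1 w] mult_mono[of 1 pi 1 "w\<^sup>2"] by auto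
      have q: "1 / (1 + u\<^sup>2) \<le> 1" for u :: real using one_plus_square_pos[of u] by (simp add: divide_le_eq_1)
      have "1 / (1 + u\<^sup>2) / (pi * w) \<le> 1 / 1" for u
        using q[of u] p w0 by (intro frac_le) (auto simp: add_nonneg_nonneg)
      then show "\<bar>h1 x\<bar> \<le> 1" using w0 unfolding h1_def by (simp add: abs_mult add_nonneg_nonneg)
      have "\<bar>u\<bar> \<le> (1 + u\<^sup>2)\<^sup>2" for u :: real
      proof -
        have "\<bar>u\<bar> \<le> 1 + u\<^sup>2" using zero_le_power2[of "\<bar>u\<bar> - 1 / 2"] by (simp add: power2_eq_square algebra_simps)
        also have "\<dots> \<le> (1 + u\<^sup>2)\<^sup>2" using power_increasing[of 1 2 "1 + u\<^sup>2"] by simp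
        finally show ?thesis .
      qed
      then have "\<bar>u\<bar> / (1 + u\<^sup>2)\<^sup>2 \<le> 1" for u :: real by (simp add: divide_le_eq add_pos_nonneg)
      then have "\<bar>u\<bar> / (1 + u\<^sup>2)\<^sup>2 / (pi * w\<^sup>2) \<le> 1 / 1" for u :: real
        using p by (intro frac_le) auto
      from this[of "(x - c) / w"] show "\<bar>h2 x\<bar> \<le> 1" using w0 unfolding h2_def by (simp add: abs_mult abs_divide)
    qed
    ultimately show ?thesis
      using lindeberg_rad_avg[of "h c" h1 h2 1 "1 / w ^ 3" L 0] hm h12 by simp
  qed
  have hint: "integrable (scaled_gauss (real L)) (h c)" for c
    using hb(3,4) by (intro G.integrable_const_bound[of _ 1]) auto
  have ind: "(\<integral>y. of_bool (y \<le> b) \<partial>scaled_gauss (real L)) = measure (scaled_gauss (real L)) {..b}"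
    "integrable (scaled_gauss (real L)) (\<lambda>y. of_bool (y \<le> b) :: real)" for b
  proof -
    have e: "(\<lambda>y. of_bool (y \<le> b) :: real) = indicator {..b}" by (auto simp: indicator_def fun_eq_iff)
    show "(\<integral>y. of_bool (y \<le> b) \<partial>scaled_gauss (real L)) = measure (scaled_gauss (real L)) {..b}"
      "integrable (scaled_gauss (real L)) (\<lambda>y. of_bool (y \<le> b) :: real)"
      unfolding e by (auto intro!: G.integrable_const_bound[of _ 1])
  qed
  have gi: "measure (scaled_gauss (real L)) {..b} - measure (scaled_gauss (real L)) {..a} \<le> (b - a) / sqrt l" if "a \<le> b" for a b
    using gauss_measure_interval[of "sqrt l" a b] scaled_gauss_eq_gauss[of "sqrt l"] l that by (simp add: l_def)
  define r where "r = l powr (- 1 / 16)"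
  have r1: "1 / K = r" by (simp add: K_def r_def powr_minus_divide)
  have r2: "(2 * K * w) / sqrt l = 2 * r"
  proof -
    have "K * w / l powr (1 / 2) = r" by (simp add: K_def w_def r_def powr_add[symmetric] powr_diff[symmetric])
    then show ?thesis using l by (simp add: powr_half_sqrt)
  qed
  have r3: "3 * (1 / w ^ 3) * real L \<le> 3 * r"
  proof -
    have "1 / w ^ 3 * l = l powr 1 / l powr (9 / 8)"
      using l by (simp add: w_def powr_power)
    also have "\<dots> = l powr (1 - 9 / 8)" by (rule powr_diff[symmetric])
    also have "\<dots> \<le> r" unfolding r_def using l by (intro powr_mono) auto
    finally show ?thesis by (simp add: l_def)
  qed
  let ?F = "rad_avg L (\<lambda>s. of_bool (s \<le> a))"
  let ?G = "\<lambda>b. measure (scaled_gauss (real L)) {..b}"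
  \<comment> \<open>The step is centred at \<open>a + K * w\<close> so that it dominates the
    indicator up to \<open>1 / K\<close>; the matching upper bound reaches to
    \<open>a + 2 * K * w\<close>. The lower bound is the mirror image.\<close>
  have up: "?F \<le> ?G a + 7 * r"
  proof -
    have "?F \<le> rad_avg L (\<lambda>s. h (a + K * w) s + 1 / K)"
    proof (rule rad_avg_mono)
      fix s show "of_bool (s \<le> a) \<le> h (a + K * w) s + 1 / K"
        using hb(1)[of s "a + K * w"] by simp
    qed
    also have "\<dots> = rad_avg L (h (a + K * w)) + 1 / K" by (rule rad_avg_add_const)
    also have "rad_avg L (h (a + K * w)) \<le> (\<integral>y. h (a + K * w) y \<partial>scaled_gauss (real L)) + 3 * r"
      using lind[of "a + K * w"] r3 by linarith
    also have "(\<integral>y. h (a + K * w) y \<partial>scaled_gauss (real L)) \<le> (\<integral>y. of_bool (y \<le> a + K * w + K * w) + 1 / K \<partial>scaled_gauss (real L))"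
      using hb(2)[of "a + K * w"] hint by (intro integral_mono Bochner_Integration.integrable_add ind(2)) auto
    also have "\<dots> = ?G (a + K * w + K * w) + 1 / K"
      using ind(2)[of "a + K * w + K * w"] G.prob_space by (simp add: ind(1))
    also have "?G (a + K * w + K * w) \<le> ?G a + 2 * r"
      using gi[of a "a + K * w + K * w"] r2 w0 K0 by simp
    finally show ?thesis unfolding r1 by simp
  qed
  have lo: "?G a - 7 * r \<le> ?F"
  proof -
    have "?G a \<le> ?G (a - K * w - K * w) + 2 * r"
      using gi[of "a - K * w - K * w" a] r2 w0 K0 by simp
    also have "?G (a - K * w - K * w) = (\<integral>y. of_bool (y \<le> a - K * w - K * w) - 1 / K \<partial>scaled_gauss (real L)) + 1 / K"
      using ind(2)[of "a - K * w - K * w"] G.prob_space by (simp add: ind(1))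
    also have "(\<integral>y. of_bool (y \<le> a - K * w - K * w) - 1 / K \<partial>scaled_gauss (real L)) \<le> (\<integral>y. h (a - K * w) y \<partial>scaled_gauss (real L))"
      using hb(1)[of _ "a - K * w"] hint by (intro integral_mono Bochner_Integration.integrable_diff ind(2)) auto
    also have "\<dots> \<le> rad_avg L (h (a - K * w)) + 3 * r"
      using lind[of "a - K * w"] r3 by linarith
    also have "rad_avg L (h (a - K * w)) \<le> rad_avg L (\<lambda>s. of_bool (s \<le> a) + 1 / K)"
    proof (rule rad_avg_mono)
      fix s show "h (a - K * w) s \<le> of_bool (s \<le> a) + 1 / K"
        using hb(2)[of "a - K * w" s] by simp
    qed
    also have "\<dots> = ?F + 1 / K" by (rule rad_avg_add_const)
    finally show ?thesis unfolding r1 by simp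
  qed
  show ?thesis using up lo by (simp add: r_def l_def abs_le_iff)
qed

subsection \<open>Quantile coupling of a Gaussian with a vector of fair signs\<close>

abbreviation Phi :: "real \<Rightarrow> real" where "Phi \<equiv> cdf (gauss 1)"

interpretation gauss1: real_distribution "gauss 1"
  by (intro real_distribution.intro prob_space_gauss) (auto simp: real_distribution_axioms_def)

lemma Phi_diff: "a \<le> b \<Longrightarrow> Phi b - Phi a = measure (gauss 1) {a<..b}"
proof -
  assume ab: "a \<le> b"
  have "{a<..b} = {..b} - {..a}" by auto
  then show ?thesis using ab by (simp add: gauss1.finite_measure_Diff cdf_def)
qed

lemma Phi_lipschitz: "\<bar>Phi a - Phi b\<bar> \<le> \<bar>a - b\<bar>"
  using gauss_measure_interval[of 1 a b] gauss_measure_interval[of 1 b a]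
    gauss1.cdf_nondecreasing[of a b] gauss1.cdf_nondecreasing[of b a]
  by (cases "a \<le> b") (auto simp: cdf_def)

lemma continuous_Phi: "continuous_on UNIV Phi"
proof -
  have "1-lipschitz_on UNIV Phi"
    using Phi_lipschitz by (intro lipschitz_onI) (auto simp: dist_real_def)
  then show ?thesis by (rule lipschitz_on_continuous_on)
qed

lemma borel_measurable_Phi[measurable]: "Phi \<in> borel_measurable borel"
  by (rule borel_measurable_continuous_onI) (rule continuous_Phi)

lemma Phi_strict_mono: "a < b \<Longrightarrow> Phi a < Phi b"
proof -
  assume ab: "a < b"
  define c where "c = std_normal_density (max \<bar>a\<bar> \<bar>b\<bar>)"
  have c: "0 < c" unfolding c_def by (rule normal_density_pos) simp
  have "c \<le> std_normal_density x" if "x \<in> {a<..b}" for x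
  proof -
    have "\<bar>x\<bar> \<le> max \<bar>a\<bar> \<bar>b\<bar>" using that by auto
    then have "x\<^sup>2 \<le> (max \<bar>a\<bar> \<bar>b\<bar>)\<^sup>2" using abs_le_square_iff[of x "max \<bar>a\<bar> \<bar>b\<bar>"] by simp
    then show ?thesis unfolding c_def std_normal_density_def by (intro mult_left_mono) auto
  qed
  then have "(\<integral>\<^sup>+x. ennreal c * indicator {a<..b} x \<partial>lborel) \<le> emeasure (gauss 1) {a<..b}"
    unfolding gauss_def by (subst emeasure_density) (auto intro!: nn_integral_mono ennreal_leI split: split_indicator)
  also have "(\<integral>\<^sup>+x. ennreal c * indicator {a<..b} x \<partial>lborel) = ennreal c * ennreal (b - a)"
    using ab by (subst nn_integral_cmult_indicator) auto
  also have "\<dots> = ennreal (c * (b - a))"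
    using ab c by (subst ennreal_mult[symmetric]) auto
  finally have "c * (b - a) \<le> Phi b - Phi a"
    using ab c by (simp add: Phi_diff gauss1.emeasure_eq_measure ennreal_le_iff)
  moreover have "0 < c * (b - a)" using ab c by simp
  ultimately show ?thesis by linarith
qed

lemma Phi_le_iff: "Phi a \<le> Phi b \<longleftrightarrow> a \<le> b"
  using Phi_strict_mono[of b a] gauss1.cdf_nondecreasing[of a b] by (cases "a \<le> b") auto

lemma Phi_less_iff: "Phi a < Phi b \<longleftrightarrow> a < b"
  using Phi_le_iff[of b a] by auto

lemma Phi_pos: "0 < Phi x"
  using Phi_strict_mono[of "x - 1" x] gauss1.cdf_nonneg[of "x - 1"] by simp

lemma Phi_less_1: "Phi x < 1"
  using Phi_strict_mono[of x "x + 1"] gauss1.cdf_bounded_prob[of "x + 1"] by simp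

lemma Phi_surj:
  assumes "0 < u" "u < 1" obtains x where "Phi x = u"
proof -
  have "eventually (\<lambda>x. Phi x < u) at_bot"
    using order_tendstoD(2)[OF gauss1.cdf_lim_at_bot] assms by simp
  then obtain a where a: "Phi a < u" by (auto simp: eventually_at_bot_linorder)
  have "eventually (\<lambda>x. u < Phi x) at_top"
    using order_tendstoD(1)[OF gauss1.cdf_lim_at_top_prob] assms by simp
  then obtain b where b: "u < Phi b" by (auto simp: eventually_at_top_linorder)
  have "a \<le> b" using a b Phi_less_iff[of a b] by simp
  then have "\<exists>x. a \<le> x \<and> x \<le> b \<and> Phi x = u"
    using a b by (intro IVT') (auto intro: continuous_on_subset[OF continuous_Phi])
  then show thesis using that by auto
qed

text \<open>\<open>Phi\<close> of a standard normal is uniform. This drives the quantile transform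
  and also produces the uniforms for \<open>push\<close>. The endpoints are separate because
  \<open>Phi\<close> takes neither 0 nor 1.\<close>

lemma gauss_Phi_less:
  assumes "0 \<le> u" "u \<le> 1"
  shows "measure (gauss 1) {g. Phi g < u} = u"
proof (cases "u = 0 \<or> u = 1")
  case True
  have e: "{g. Phi g < 1} = UNIV" using Phi_less_1 by auto
  have e0: "{g. Phi g < 0} = {}" using Phi_pos by (auto simp: not_less less_imp_le)
  from True show ?thesis
  proof
    assume "u = 0" then show ?thesis by (simp add: e0)
  next
    assume "u = 1" then show ?thesis using gauss1.prob_space by (simp add: e)
  qed
next
  case False
  then obtain x where x: "Phi x = u" using Phi_surj[of u] assms by force
  have "{g. Phi g < u} = {..<x}" using x Phi_less_iff by auto
  moreover have "isCont Phi x" using continuous_Phi by (simp add: continuous_on_eq_continuous_at)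
  then have "measure (gauss 1) {x} = 0" by (simp add: gauss1.isCont_cdf)
  moreover have "{..x} = {..<x} \<union> {x}" by auto
  then have "measure (gauss 1) {..x} = measure (gauss 1) {..<x} + measure (gauss 1) {x}"
    by (simp only:) (rule gauss1.finite_measure_Union, auto)
  ultimately show ?thesis using x by (simp add: cdf_def)
qed

definition sign_vectors :: "nat \<Rightarrow> (nat \<Rightarrow> real) set" where
  "sign_vectors L = PiE {..<L} (\<lambda>_. {-1, 1})"

text \<open>Sorted by sum, so that reading the list at position \<open>2^L * Phi g\<close> is the quantile
  transform of the sum.\<close>

definition sign_list :: "nat \<Rightarrow> (nat \<Rightarrow> real) list" where
  "sign_list L = sort_key (\<lambda>y. \<Sum>r<L. y r) (SOME xs. distinct xs \<and> set xs = sign_vectors L)"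

definition signs :: "nat \<Rightarrow> real \<Rightarrow> nat \<Rightarrow> real" where
  "signs L g = sign_list L ! nat \<lfloor>2 ^ L * Phi g\<rfloor>"

lemma finite_sign_vectors[simp]: "finite (sign_vectors L)"
  unfolding sign_vectors_def by (intro finite_PiE) auto

lemma card_sign_vectors: "card (sign_vectors L) = 2 ^ L"
  unfolding sign_vectors_def by (subst card_PiE) (auto simp: numeral_2_eq_2)

lemma sign_list:
  shows "distinct (sign_list L)" "set (sign_list L) = sign_vectors L" "length (sign_list L) = 2 ^ L"
    and "sorted (map (\<lambda>y. \<Sum>r<L. y r) (sign_list L))"
proof -
  have "\<exists>xs. distinct xs \<and> set xs = sign_vectors L"
    using finite_distinct_list[OF finite_sign_vectors] by blast
  from someI_ex[OF this] show d: "distinct (sign_list L)" and s: "set (sign_list L) = sign_vectors L"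
    by (auto simp: sign_list_def)
  show "length (sign_list L) = 2 ^ L"
    using distinct_card[OF d] by (simp add: s card_sign_vectors)
  show "sorted (map (\<lambda>y. \<Sum>r<L. y r) (sign_list L))" by (simp add: sign_list_def)
qed

lemma signs_index: "nat \<lfloor>2 ^ L * Phi g\<rfloor> < 2 ^ L"
proof -
  have "2 ^ L * Phi g < 2 ^ L * 1" using Phi_less_1 by (intro mult_strict_left_mono) auto
  then have "\<lfloor>2 ^ L * Phi g\<rfloor> < int (2 ^ L)" unfolding floor_less_iff by simp
  then show ?thesis by (simp add: nat_less_iff)
qed

lemma signs_in: "signs L g \<in> sign_vectors L"
  using signs_index[of L g] sign_list(2,3)[of L] nth_mem[of _ "sign_list L"] by (simp add: signs_def)

lemma signs_cases: "r < L \<Longrightarrow> signs L g r = 1 \<or> signs L g r = -1"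
  using signs_in[of L g] by (auto simp: sign_vectors_def PiE_iff)

lemma signs_measurable: "(\<lambda>g. f (signs L g)) \<in> measurable borel (count_space UNIV)"
proof -
  have "(\<lambda>g. nat \<lfloor>2 ^ L * Phi g\<rfloor>) \<in> measurable borel (count_space UNIV)" by measurable
  then show ?thesis unfolding signs_def by (rule measurable_compose) simp
qed

lemma signs_borel_measurable: "(\<lambda>g. f (signs L g)) \<in> borel_measurable borel"
  using measurable_compose[OF signs_measurable[of "\<lambda>y. y" L], of f borel] by simp

lemma signs_sets: "{g. P (signs L g)} \<in> sets borel"
  using measurable_sets[OF signs_measurable[of P L], of "{True}"] by (simp add: vimage_def)

text \<open>A given list position is read exactly when \<open>Phi g\<close> lies in one interval of
  length \<open>1 / 2 ^ L\<close>. So the whole vector is uniform, whichever order was chosen among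
  vectors of equal sum.\<close>

lemma signs_prob:
  assumes y: "y \<in> sign_vectors L"
  shows "measure (gauss 1) {g. signs L g = y} = 1 / 2 ^ L"
proof -
  obtain i where i: "i < 2 ^ L" "sign_list L ! i = y"
    using y sign_list(2,3)[of L] by (metis in_set_conv_nth)
  have iff: "signs L g = y \<longleftrightarrow> real i / 2 ^ L \<le> Phi g \<and> Phi g < real (Suc i) / 2 ^ L" for g
  proof -
    have e1: "signs L g = y \<longleftrightarrow> nat \<lfloor>2 ^ L * Phi g\<rfloor> = i"
      unfolding signs_def i(2)[symmetric]
      by (rule nth_eq_iff_index_eq[OF sign_list(1)]) (simp_all only: sign_list(3) i(1) signs_index)
    have p: "0 \<le> 2 ^ L * Phi g" using Phi_pos[of g] by simp
    have e2: "nat \<lfloor>x\<rfloor> = i \<longleftrightarrow> real i \<le> x \<and> x < real i + 1" if "0 \<le> x" for x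
      using that by linarith
    have e3: "real i \<le> 2 ^ L * Phi g \<longleftrightarrow> real i / 2 ^ L \<le> Phi g" "2 ^ L * Phi g < real i + 1 \<longleftrightarrow> Phi g < real (Suc i) / 2 ^ L"
      by (simp_all add: divide_le_eq less_divide_eq mult.commute add.commute)
    show ?thesis unfolding e1 e2[OF p] e3 ..
  qed
  define a where "a = real i / 2 ^ L"
  define b where "b = real (Suc i) / 2 ^ L"
  have b1: "b \<le> 1"
  proof -
    have "Suc i \<le> 2 ^ L" using i(1) by simp
    then have "real (Suc i) \<le> real (2 ^ L)" by (simp only: of_nat_le_iff)
    then show ?thesis by (simp add: b_def divide_le_eq_1)
  qed
  have ab: "0 \<le> a" "a \<le> b" "b - a = 1 / 2 ^ L"
    by (simp_all add: a_def b_def divide_right_mono diff_divide_distrib[symmetric])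
  have m: "{g. Phi g < u} \<in> gauss1.events" for u by simp
  have eq: "{g. signs L g = y} = {g. Phi g < b} - {g. Phi g < a}"
  proof (rule set_eqI)
    fix g
    have "(g \<in> {g. signs L g = y}) = (a \<le> Phi g \<and> Phi g < b)"
      unfolding mem_Collect_eq iff a_def b_def ..
    also have "\<dots> = (g \<in> {g. Phi g < b} - {g. Phi g < a})"
      unfolding Diff_iff mem_Collect_eq not_less by (rule conj_commute)
    finally show "(g \<in> {g. signs L g = y}) = (g \<in> {g. Phi g < b} - {g. Phi g < a})" .
  qed
  have sub: "{g. Phi g < a} \<subseteq> {g. Phi g < b}" using ab(2) by auto
  have "measure (gauss 1) ({g. Phi g < b} - {g. Phi g < a}) = measure (gauss 1) {g. Phi g < b} - measure (gauss 1) {g. Phi g < a}"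
    by (rule gauss1.finite_measure_Diff[OF m m sub])
  moreover have "measure (gauss 1) {g. Phi g < b} = b" "measure (gauss 1) {g. Phi g < a} = a"
    using ab b1 by (auto intro!: gauss_Phi_less)
  ultimately show ?thesis using ab(3) unfolding eq by simp
qed

lemma signs_expectation:
  fixes f :: "(nat \<Rightarrow> real) \<Rightarrow> real"
  shows "integrable (gauss 1) (\<lambda>g. f (signs L g))"
    and "(\<integral>g. f (signs L g) \<partial>gauss 1) = (\<Sum>y\<in>sign_vectors L. f y) / 2 ^ L"
proof -
  have [measurable]: "{g. signs L g = y} \<in> sets borel" for y
    by (rule signs_sets[of "\<lambda>z. z = y"])
  have e: "(\<lambda>g. f (signs L g)) = (\<lambda>g. \<Sum>y\<in>sign_vectors L. f y * indicator {g. signs L g = y} g)"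
  proof
    fix g
    have "(\<Sum>y\<in>sign_vectors L. f y * indicator {g. signs L g = y} g) = (\<Sum>y\<in>sign_vectors L. if signs L g = y then f y else 0)"
      by (intro sum.cong refl) simp
    also have "\<dots> = f (signs L g)"
      by (subst sum.delta') (simp_all add: signs_in)
    finally show "f (signs L g) = (\<Sum>y\<in>sign_vectors L. f y * indicator {g. signs L g = y} g)" ..
  qed
  show "integrable (gauss 1) (\<lambda>g. f (signs L g))"
    unfolding e by (intro Bochner_Integration.integrable_sum integrable_mult_right gauss1.integrable_const_bound[of _ 1]) auto
  have "(\<integral>g. f (signs L g) \<partial>gauss 1) = (\<Sum>y\<in>sign_vectors L. \<integral>g. f y * indicator {g. signs L g = y} g \<partial>gauss 1)"
    unfolding e by (intro Bochner_Integration.integral_sum integrable_mult_right gauss1.integrable_const_bound[of _ 1]) auto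
  also have "\<dots> = (\<Sum>y\<in>sign_vectors L. f y * (1 / 2 ^ L))"
    by (intro sum.cong refl) (simp add: signs_prob)
  finally show "(\<integral>g. f (signs L g) \<partial>gauss 1) = (\<Sum>y\<in>sign_vectors L. f y) / 2 ^ L"
    by (simp add: sum_divide_distrib)
qed

lemma sum_sign_vectors_Suc:
  "(\<Sum>y\<in>sign_vectors (Suc L). f y) = (\<Sum>y\<in>sign_vectors L. f (y(L := -1)) + f (y(L := 1)))"
proof -
  have S: "sign_vectors (Suc L) = (\<lambda>(b, y). y(L := b)) ` ({-1, 1} \<times> sign_vectors L)"
    unfolding sign_vectors_def lessThan_Suc by (rule PiE_insert_eq)
  have inj: "inj_on (\<lambda>(b, y). y(L := b)) ({-1, 1} \<times> sign_vectors L)"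
    unfolding sign_vectors_def by (rule inj_combinator) simp
  have "(\<Sum>y\<in>sign_vectors (Suc L). f y) = (\<Sum>(b, y)\<in>{-1, 1::real} \<times> sign_vectors L. f (y(L := b)))"
    unfolding S sum.reindex[OF inj] comp_def by (simp add: case_prod_beta)
  also have "\<dots> = (\<Sum>b\<in>{-1, 1::real}. \<Sum>y\<in>sign_vectors L. f (y(L := b)))"
    by (rule sum.cartesian_product[symmetric])
  finally show ?thesis by (simp add: sum.distrib)
qed

lemma rad_avg_eq_sum: "rad_avg L h = (\<Sum>y\<in>sign_vectors L. h (\<Sum>r<L. y r)) / 2 ^ L"
proof (induction L arbitrary: h)
  case 0
  then show ?case by (simp add: sign_vectors_def)
next
  case (Suc L)
  have "(\<Sum>y\<in>sign_vectors (Suc L). h (\<Sum>r<Suc L. y r)) = (\<Sum>y\<in>sign_vectors L. h ((\<Sum>r<L. y r) - 1) + h ((\<Sum>r<L. y r) + 1))"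
    unfolding sum_sign_vectors_Suc by (intro sum.cong refl) simp
  then show ?case by (simp add: Suc sum.distrib field_simps)
qed

lemma prod_indicator_all:
  fixes L :: nat
  shows "(\<Prod>r<L. indicator (A r) (y r) :: real) = of_bool (\<forall>r<L. y r \<in> A r)"
  by (induction L) (auto simp: less_Suc_eq indicator_def)

text \<open>Uniformity on a product set factors over the coordinates; \<open>signs_marginal\<close>
  and \<open>signs_indep\<close> are read off from it.\<close>

lemma signs_joint:
  fixes A :: "nat \<Rightarrow> real set"
  assumes A: "\<And>r. r < L \<Longrightarrow> A r \<in> sets borel"
  shows "measure (gauss 1) {g. \<forall>r<L. signs L g r \<in> A r} = (\<Prod>r<L. indicat_real (A r) (-1) / 2 + indicat_real (A r) 1 / 2)"
proof -
  have m: "{g. \<forall>r<L. signs L g r \<in> A r} \<in> sets borel"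
    by (rule signs_sets[of "\<lambda>y. \<forall>r<L. y r \<in> A r"])
  have "measure (gauss 1) {g. \<forall>r<L. signs L g r \<in> A r} = (\<integral>g. (\<Prod>r<L. indicat_real (A r) (signs L g r)) \<partial>gauss 1)"
  proof -
    have e: "(\<lambda>g. \<Prod>r<L. indicat_real (A r) (signs L g r)) = indicator {g. \<forall>r<L. signs L g r \<in> A r}"
    proof
      fix g show "(\<Prod>r<L. indicat_real (A r) (signs L g r)) = indicator {g. \<forall>r<L. signs L g r \<in> A r} g"
        by (subst prod_indicator_all) (simp add: indicator_def)
    qed
    show ?thesis by (simp only: e Bochner_Integration.integral_indicator space_gauss Int_UNIV_right)
  qed
  also have "\<dots> = (\<Sum>y\<in>sign_vectors L. \<Prod>r<L. indicat_real (A r) (y r)) / 2 ^ L"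
    using signs_expectation(2)[of "\<lambda>y. \<Prod>r<L. indicat_real (A r) (y r)" L] by simp
  also have "(\<Sum>y\<in>sign_vectors L. \<Prod>r<L. indicat_real (A r) (y r)) = (\<Prod>r<L. \<Sum>b\<in>{-1, 1}. indicat_real (A r) b)"
    unfolding sign_vectors_def by (rule prod_sum_PiE[symmetric]) auto
  finally show ?thesis by (simp add: prod_dividef add_divide_distrib[symmetric])
qed

lemma signs_marginal:
  fixes A :: "real set"
  assumes r: "r < L" and A: "A \<in> sets borel"
  shows "measure (gauss 1) {g. signs L g r \<in> A} = indicat_real A (-1) / 2 + indicat_real A 1 / 2"
proof -
  have "{g. signs L g r \<in> A} = {g. \<forall>q<L. signs L g q \<in> (if q = r then A else UNIV)}"
    using r by auto
  then have "measure (gauss 1) {g. signs L g r \<in> A} =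
     (\<Prod>q<L. indicat_real (if q = r then A else UNIV) (-1) / 2 + indicat_real (if q = r then A else UNIV) 1 / 2)"
    using signs_joint[of L "\<lambda>q. if q = r then A else UNIV"] A by simp
  also have "\<dots> = (\<Prod>q<L. if q = r then indicat_real A (-1) / 2 + indicat_real A 1 / 2 else 1)"
    by (intro prod.cong refl) auto
  finally show ?thesis using r by simp
qed

lemma signs_indep: "gauss1.indep_vars (\<lambda>_. borel) (\<lambda>r g. signs L g r) {..<L}"
proof (cases "L = 0")
  case True
  then show ?thesis by (simp add: gauss1.indep_vars_def2 gauss1.indep_sets_def)
next
  case False
  have sm: "(\<lambda>g. signs L g i) \<in> borel_measurable (gauss 1)" for i
    using signs_borel_measurable[of "\<lambda>y. y i" L] by (simp cong: measurable_cong_sets)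
  have se: "sets borel = sigma_sets (space borel) (sets (borel :: real measure))"
    by (rule sets.sigma_sets_eq[symmetric])
  show ?thesis
  proof (subst gauss1.indep_vars_finite[where E="\<lambda>_. sets borel"])
    show "\<forall>A\<in>{..<L} \<rightarrow> sets borel. gauss1.prob (\<Inter>j\<in>{..<L}. (\<lambda>g. signs L g j) -` A j \<inter> space (gauss 1))
        = (\<Prod>j<L. gauss1.prob ((\<lambda>g. signs L g j) -` A j \<inter> space (gauss 1)))"
    proof
      fix A :: "nat \<Rightarrow> real set" assume A: "A \<in> {..<L} \<rightarrow> sets borel"
      have "(\<Inter>j\<in>{..<L}. (\<lambda>g. signs L g j) -` A j \<inter> space (gauss 1)) = {g. \<forall>r<L. signs L g r \<in> A r}"
        using False by auto
      then show "gauss1.prob (\<Inter>j\<in>{..<L}. (\<lambda>g. signs L g j) -` A j \<inter> space (gauss 1))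
        = (\<Prod>j<L. gauss1.prob ((\<lambda>g. signs L g j) -` A j \<inter> space (gauss 1)))"
        using A signs_joint[of L A] by (auto simp: vimage_def signs_marginal Pi_iff intro!: prod.cong)
    qed
  qed (use False sm se sets.space_closed[of borel] in \<open>auto simp: Int_stable_def\<close>)
qed

lemma signs_sum_mono: "g \<le> g' \<Longrightarrow> (\<Sum>r<L. signs L g r) \<le> (\<Sum>r<L. signs L g' r)"
proof -
  assume g: "g \<le> g'"
  have "nat \<lfloor>2 ^ L * Phi g\<rfloor> \<le> nat \<lfloor>2 ^ L * Phi g'\<rfloor>"
    using g by (intro nat_mono floor_mono mult_left_mono gauss1.cdf_nondecreasing) auto
  then show ?thesis
    using sorted_nth_mono[OF sign_list(4)[of L], of "nat \<lfloor>2 ^ L * Phi g\<rfloor>" "nat \<lfloor>2 ^ L * Phi g'\<rfloor>"] signs_index[of L g] signs_index[of L g']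
    by (simp add: signs_def sign_list(3))
qed

text \<open>Sum and normal are both nondecreasing in \<open>g\<close>, so the two events are initial
  segments of the line and one contains the other. The probability of a mismatch is then just the
  difference of the distribution functions.\<close>

lemma signs_coupling_level:
  assumes L: "1 \<le> L"
  shows "measure (gauss 1) {g. ((\<Sum>r<L. signs L g r) \<le> t) \<noteq> (sqrt L * g \<le> t)} \<le> 7 * real L powr (- 1 / 16)"
proof -
  define P where "P = {g. (\<Sum>r<L. signs L g r) \<le> t}"
  define Q where "Q = {g. sqrt L * g \<le> t}"
  have Pm: "P \<in> sets borel"
    unfolding P_def by (rule signs_sets[of "\<lambda>y. (\<Sum>r<L. y r) \<le> t"])
  have Qm: "Q \<in> sets borel" unfolding Q_def by measurable
  have nest: "P \<subseteq> Q \<or> Q \<subseteq> P"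
  proof (rule ccontr)
    assume "\<not> (P \<subseteq> Q \<or> Q \<subseteq> P)"
    then obtain a b where ab: "a \<in> P" "a \<notin> Q" "b \<in> Q" "b \<notin> P" by auto
    show False
    proof (cases "a \<le> b")
      case True
      then have "sqrt L * a \<le> sqrt L * b" by (intro mult_left_mono) auto
      then show False using ab by (simp add: Q_def)
    next
      case False
      then show False using ab signs_sum_mono[of b a L] by (simp add: P_def)
    qed
  qed
  have mP: "measure (gauss 1) P = rad_avg L (\<lambda>s. of_bool (s \<le> t))"
  proof -
    have "measure (gauss 1) P = (\<integral>g. of_bool ((\<Sum>r<L. signs L g r) \<le> t) \<partial>gauss 1)"
    proof -
      have "(\<lambda>g. of_bool ((\<Sum>r<L. signs L g r) \<le> t) :: real) = indicator P" by (auto simp: P_def fun_eq_iff)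
      then show ?thesis using Pm by simp
    qed
    then show ?thesis
      using signs_expectation(2)[of "\<lambda>y. of_bool ((\<Sum>r<L. y r) \<le> t)" L] by (simp add: rad_avg_eq_sum)
  qed
  have mQ: "measure (gauss 1) Q = measure (scaled_gauss (real L)) {..t}"
    unfolding scaled_gauss_def by (subst measure_distr) (auto simp: Q_def vimage_def)
  have "{g. ((\<Sum>r<L. signs L g r) \<le> t) \<noteq> (sqrt L * g \<le> t)} = (P - Q) \<union> (Q - P)"
    by (auto simp: P_def Q_def)
  moreover have "measure (gauss 1) ((P - Q) \<union> (Q - P)) = \<bar>measure (gauss 1) P - measure (gauss 1) Q\<bar>"
    using nest
  proof
    assume "P \<subseteq> Q"
    then show ?thesis using Pm Qm gauss1.finite_measure_Diff[of Q P] gauss1.finite_measure_mono[of P Q]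
      by (simp add: Diff_eq_empty_iff[THEN iffD2])
  next
    assume "Q \<subseteq> P"
    then show ?thesis using Pm Qm gauss1.finite_measure_Diff[of P Q] gauss1.finite_measure_mono[of Q P]
      by (simp add: Diff_eq_empty_iff[THEN iffD2])
  qed
  ultimately show ?thesis
    unfolding mP mQ using kolmogorov_distance_rad_avg[OF L, of t] by simp
qed

text \<open>The distance of two numbers is the length of the set of levels \<open>t\<close>
  separating them. Clipping to \<open>{-A..A}\<close> makes the range of levels finite, at a cost of
  \<open>v\<^sup>2 / A\<close> for each number \<open>v\<close>.\<close>

lemma abs_diff_le_level_sets:
  fixes s x A :: real
  assumes A: "0 < A"
  shows "ennreal \<bar>s - x\<bar> \<le> (\<integral>\<^sup>+t. indicator {-A..A} t * of_bool ((s \<le> t) \<noteq> (x \<le> t)) \<partial>lborel) + ennreal (s\<^sup>2 / A) + ennreal (x\<^sup>2 / A)"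
proof -
  define clip where "clip v = max (- A) (min A v)" for v
  have clip: "\<bar>v - clip v\<bar> \<le> v\<^sup>2 / A" for v
  proof (cases "\<bar>v\<bar> \<le> A")
    case True then show ?thesis using A by (auto simp: clip_def abs_le_iff)
  next
    case False
    then have "\<bar>v - clip v\<bar> \<le> \<bar>v\<bar>" using A by (auto simp: clip_def abs_if split: if_splits)
    also have "\<bar>v\<bar> \<le> v\<^sup>2 / A"
    proof -
      have "\<bar>v\<bar> * A \<le> \<bar>v\<bar> * \<bar>v\<bar>" using False by (intro mult_left_mono) auto
      then show ?thesis using A by (simp add: le_divide_eq power2_eq_square)
    qed
    finally show ?thesis .
  qed
  have main: "ennreal \<bar>clip s - clip x\<bar> \<le> (\<integral>\<^sup>+t. indicator {-A..A} t * of_bool ((s \<le> t) \<noteq> (x \<le> t)) \<partial>lborel)"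
  proof -
    define a where "a = min (clip s) (clip x)"
    define b where "b = max (clip s) (clip x)"
    have "ennreal \<bar>clip s - clip x\<bar> = ennreal (b - a)" by (auto simp: a_def b_def min_def max_def)
    also have "\<dots> = (\<integral>\<^sup>+t. indicator {a..<b} t \<partial>lborel)" by (simp add: a_def b_def)
    also have "\<dots> \<le> (\<integral>\<^sup>+t. indicator {-A..A} t * of_bool ((s \<le> t) \<noteq> (x \<le> t)) \<partial>lborel)"
    proof (intro nn_integral_mono)
      fix t
      have "t \<in> {-A..A} \<and> (s \<le> t) \<noteq> (x \<le> t)" if "t \<in> {a..<b}"
        using that A unfolding a_def b_def clip_def by (auto simp: min_def max_def split: if_splits)
      then show "(indicator {a..<b} t :: ennreal) \<le> indicator {-A..A} t * of_bool ((s \<le> t) \<noteq> (x \<le> t))"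
        by (auto simp: indicator_def)
    qed
    finally show ?thesis .
  qed
  have "ennreal \<bar>s - x\<bar> \<le> ennreal (\<bar>clip s - clip x\<bar> + s\<^sup>2 / A + x\<^sup>2 / A)"
    using clip[of s] clip[of x] by (intro ennreal_leI) linarith
  also have "\<dots> = ennreal \<bar>clip s - clip x\<bar> + ennreal (s\<^sup>2 / A) + ennreal (x\<^sup>2 / A)"
    using A by (simp add: ennreal_plus)
  finally show ?thesis using main by (meson add_right_mono order_trans)
qed

text \<open>Integrates the mismatch probability over the levels, which turns a Kolmogorov bound into
  a mean distance of smaller order than sqrt L.\<close>

theorem signs_coupling:
  assumes L: "1 \<le> L"
  shows "(\<integral>\<^sup>+g. ennreal \<bar>(\<Sum>r<L. signs L g r) - sqrt L * g\<bar> \<partial>gauss 1) \<le> ennreal (16 * real L powr (1 / 2 - 1 / 32))"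
proof -
  define s where "s g = (\<Sum>r<L. signs L g r)" for g
  define l where "l = real L"
  have l: "1 \<le> l" using L by (simp add: l_def)
  \<comment> \<open>Balances the two costs: 2 A times the level error 7 l^(-1/16) is 14 l^(1/2 -
    1/32), and the two clipping terms, with second moments l, are l / A = l^(1/2 - 1/32) each.
    Together this gives 16.\<close>
  define A where "A = l powr (1 / 2 + 1 / 32)"
  have A: "0 < A" using l by (simp add: A_def)
  have sm[measurable]: "s \<in> borel_measurable borel"
    unfolding s_def by (rule signs_borel_measurable[of "\<lambda>y. \<Sum>r<L. y r"])
  have Al: "l / A = l powr (1 / 2 - 1 / 32)"
  proof -
    have "l / A = l powr 1 / l powr (1 / 2 + 1 / 32)" using l by (simp add: A_def)
    also have "\<dots> = l powr (1 - (1 / 2 + 1 / 32))" by (rule powr_diff[symmetric])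
    finally show ?thesis by simp
  qed
  have Am: "2 * A * (7 * l powr (- 1 / 16)) = 14 * l powr (1 / 2 - 1 / 32)"
    by (simp add: A_def powr_add[symmetric])
  interpret pair_sigma_finite "gauss 1" "lborel :: real measure" ..
  have T1: "(\<integral>\<^sup>+g. (\<integral>\<^sup>+t. indicator {-A..A} t * of_bool ((s g \<le> t) \<noteq> (sqrt L * g \<le> t)) \<partial>lborel) \<partial>gauss 1) \<le> ennreal (14 * l powr (1 / 2 - 1 / 32))"
  proof -
    have "(\<integral>\<^sup>+g. (\<integral>\<^sup>+t. indicator {-A..A} t * of_bool ((s g \<le> t) \<noteq> (sqrt L * g \<le> t)) \<partial>lborel) \<partial>gauss 1)
       = (\<integral>\<^sup>+t. (\<integral>\<^sup>+g. indicator {-A..A} t * of_bool ((s g \<le> t) \<noteq> (sqrt L * g \<le> t)) \<partial>gauss 1) \<partial>lborel)"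
      by (rule Fubini'[symmetric]) measurable
    also have "\<dots> \<le> (\<integral>\<^sup>+t. ennreal (7 * l powr (- 1 / 16)) * indicator {-A..A} t \<partial>lborel)"
    proof (intro nn_integral_mono)
      fix t
      have "(\<integral>\<^sup>+g. of_bool ((s g \<le> t) \<noteq> (sqrt L * g \<le> t)) \<partial>gauss 1) = emeasure (gauss 1) {g. (s g \<le> t) \<noteq> (sqrt L * g \<le> t)}"
      proof -
        have e: "(\<lambda>g. of_bool ((s g \<le> t) \<noteq> (sqrt L * g \<le> t)) :: ennreal) = indicator {g. (s g \<le> t) \<noteq> (sqrt L * g \<le> t)}"
          by (auto simp: fun_eq_iff)
        show ?thesis unfolding e by (rule nn_integral_indicator) simp
      qed
      also have "\<dots> \<le> ennreal (7 * l powr (- 1 / 16))"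
        using signs_coupling_level[OF L, of t] by (simp add: gauss1.emeasure_eq_measure s_def l_def ennreal_leI)
      finally show "(\<integral>\<^sup>+g. indicator {-A..A} t * of_bool ((s g \<le> t) \<noteq> (sqrt L * g \<le> t)) \<partial>gauss 1) \<le> ennreal (7 * l powr (- 1 / 16)) * indicator {-A..A} t"
        by (auto simp: indicator_def)
    qed
    also have "\<dots> = ennreal (7 * l powr (- 1 / 16)) * ennreal (2 * A)"
      using A by (subst nn_integral_cmult_indicator) auto
    also have "\<dots> = ennreal (2 * A * (7 * l powr (- 1 / 16)))"
      using A by (subst ennreal_mult) (simp_all add: mult.commute)
    also have "\<dots> = ennreal (14 * l powr (1 / 2 - 1 / 32))"
      unfolding Am ..
    finally show ?thesis .
  qed
  have T2: "(\<integral>\<^sup>+g. ennreal ((s g)\<^sup>2 / A) \<partial>gauss 1) = ennreal (l powr (1 / 2 - 1 / 32))"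
  proof -
    have i: "integrable (gauss 1) (\<lambda>g. (s g)\<^sup>2 / A)" "(\<integral>g. (s g)\<^sup>2 / A \<partial>gauss 1) = rad_avg L (\<lambda>v. v\<^sup>2) / A"
      using signs_expectation[of "\<lambda>y. (\<Sum>r<L. y r)\<^sup>2 / A" L]
      by (simp_all add: s_def rad_avg_eq_sum sum_divide_distrib[symmetric])
    have "rad_avg L (\<lambda>v. v\<^sup>2) = l" using rad_avg_square[of L 0] by (simp add: l_def)
    then show ?thesis using i A Al by (subst nn_integral_eq_integral) auto
  qed
  have T3: "(\<integral>\<^sup>+g. ennreal ((sqrt L * g)\<^sup>2 / A) \<partial>gauss 1) = ennreal (l powr (1 / 2 - 1 / 32))"
    using gauss_moments(3,4) A Al by (subst nn_integral_eq_integral) (auto simp: power_mult_distrib l_def)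
  have "(\<integral>\<^sup>+g. ennreal \<bar>s g - sqrt L * g\<bar> \<partial>gauss 1)
     \<le> (\<integral>\<^sup>+g. (\<integral>\<^sup>+t. indicator {-A..A} t * of_bool ((s g \<le> t) \<noteq> (sqrt L * g \<le> t)) \<partial>lborel) + ennreal ((s g)\<^sup>2 / A) + ennreal ((sqrt L * g)\<^sup>2 / A) \<partial>gauss 1)"
    by (intro nn_integral_mono abs_diff_le_level_sets A)
  also have "\<dots> = (\<integral>\<^sup>+g. (\<integral>\<^sup>+t. indicator {-A..A} t * of_bool ((s g \<le> t) \<noteq> (sqrt L * g \<le> t)) \<partial>lborel) \<partial>gauss 1)
      + (\<integral>\<^sup>+g. ennreal ((s g)\<^sup>2 / A) \<partial>gauss 1) + (\<integral>\<^sup>+g. ennreal ((sqrt L * g)\<^sup>2 / A) \<partial>gauss 1)"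
    by (subst nn_integral_add; (measurable)?)+
  also have "\<dots> \<le> ennreal (14 * l powr (1 / 2 - 1 / 32)) + ennreal (l powr (1 / 2 - 1 / 32)) + ennreal (l powr (1 / 2 - 1 / 32))"
    unfolding T2 T3 by (intro add_right_mono T1)
  also have "\<dots> = ennreal (16 * l powr (1 / 2 - 1 / 32))"
    by (subst ennreal_plus[symmetric]; simp)+
  finally show ?thesis by (simp add: s_def l_def)
qed

subsection \<open>Growth of solutions of linear recursions\<close>

text \<open>The homogeneous recursion grows like n^mu, and forcing of order n^(beta - 1) raises this
  to n^beta. The comparison with K n^beta works by induction because
  \<open>(1 + 1 / n) powr \<beta>\<close> eventually exceeds 1 + gamma/n for every gamma below
  beta.\<close>

lemma recursion_rate:
  fixes a :: "nat \<Rightarrow> real"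
  assumes nn: "\<And>n. 0 \<le> a n" and \<mu>: "\<mu> < \<beta>"
    and rec: "eventually (\<lambda>n. a (Suc n) \<le> (1 + \<mu> / real n) * a n + C * real n powr (\<beta> - 1)) sequentially"
  shows "\<exists>K\<ge>0. \<forall>n\<ge>1. a n \<le> K * real n powr \<beta>"
proof -
  \<comment> \<open>Strictly between the two exponents: one gap makes the power inequality hold
    eventually, the other leaves \<open>K * (\<gamma> - \<mu>)\<close> to absorb the
    forcing.\<close>
  define \<gamma> where "\<gamma> = (\<mu> + \<beta>) / 2"
  have \<gamma>: "\<mu> < \<gamma>" "\<gamma> < \<beta>" using \<mu> by (simp_all add: \<gamma>_def)
  have "((\<lambda>x. x * ((1 + 1 / x) powr \<beta> - 1)) \<longlongrightarrow> \<beta>) at_top" by real_asymp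
  then have "eventually (\<lambda>x. \<gamma> < x * ((1 + 1 / x) powr \<beta> - 1)) at_top"
    by (rule order_tendstoD(1)[OF _ \<gamma>(2)])
  then have ev1: "eventually (\<lambda>n. \<gamma> < real n * ((1 + 1 / real n) powr \<beta> - 1)) sequentially"
    by (rule eventually_compose_filterlim[OF _ filterlim_real_sequentially])
  have "((\<lambda>x. 1 + \<mu> / x) \<longlongrightarrow> 1) at_top" by real_asymp
  then have "eventually (\<lambda>x. 0 < 1 + \<mu> / x) at_top"
    by (rule order_tendstoD(1)) simp
  then have ev2: "eventually (\<lambda>n. 0 < 1 + \<mu> / real n) sequentially"
    by (rule eventually_compose_filterlim[OF _ filterlim_real_sequentially])
  have "eventually (\<lambda>n. 1 \<le> n \<and> 0 < 1 + \<mu> / real n \<and> \<gamma> < real n * ((1 + 1 / real n) powr \<beta> - 1)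
     \<and> a (Suc n) \<le> (1 + \<mu> / real n) * a n + C * real n powr (\<beta> - 1)) sequentially"
    by (intro eventually_conj rec ev1 ev2 eventually_ge_at_top)
  then obtain n0 where n0: "\<And>n. n \<ge> n0 \<Longrightarrow> 1 \<le> n \<and> 0 < 1 + \<mu> / real n \<and> \<gamma> < real n * ((1 + 1 / real n) powr \<beta> - 1)
     \<and> a (Suc n) \<le> (1 + \<mu> / real n) * a n + C * real n powr (\<beta> - 1)"
    unfolding eventually_sequentially by blast
  define K where "K = \<bar>C\<bar> / (\<gamma> - \<mu>) + (\<Sum>n\<le>n0. a n / real n powr \<beta>)"
  have terms: "0 \<le> a n / real n powr \<beta>" for n using nn by simp
  have K1: "\<bar>C\<bar> \<le> K * (\<gamma> - \<mu>)"
    using \<gamma> sum_nonneg[of "{..n0}" "\<lambda>n. a n / real n powr \<beta>"] terms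
    by (simp add: K_def distrib_right)
  have K0: "0 \<le> K" unfolding K_def using \<gamma> by (intro add_nonneg_nonneg sum_nonneg terms) auto
  have small: "a n \<le> K * real n powr \<beta>" if "1 \<le> n" "n \<le> n0" for n
  proof -
    have "a n / real n powr \<beta> \<le> (\<Sum>n\<le>n0. a n / real n powr \<beta>)"
      using that by (intro member_le_sum) (auto simp: nn)
    also have "\<dots> \<le> K" using \<gamma> by (simp add: K_def)
    finally show ?thesis using that by (simp add: divide_le_eq)
  qed
  have "a n \<le> K * real n powr \<beta>" if "1 \<le> n" for n
    using that
  proof (induction n)
    case (Suc n)
    show ?case
    proof (cases "Suc n \<le> n0")
      case True
      then show ?thesis by (intro small) auto
    next
      case False
      then have n: "n \<ge> n0" by simp
      note h = n0[OF n]
      have np: "0 < real n" using h by simp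
      have IH: "a n \<le> K * real n powr \<beta>" using Suc h by simp
      have "a (Suc n) \<le> (1 + \<mu> / real n) * (K * real n powr \<beta>) + \<bar>C\<bar> * real n powr (\<beta> - 1)"
        using h IH
        by (intro order_trans[OF _ add_mono[OF mult_left_mono[OF IH] mult_right_mono[of C "\<bar>C\<bar>"]]]) auto
      also have "\<bar>C\<bar> * real n powr (\<beta> - 1) \<le> K * (\<gamma> - \<mu>) * real n powr (\<beta> - 1)"
        using K1 by (intro mult_right_mono) auto
      also have "real n powr (\<beta> - 1) = real n powr \<beta> / real n"
        using np by (simp add: powr_diff)
      also have "(1 + \<mu> / real n) * (K * real n powr \<beta>) + K * (\<gamma> - \<mu>) * (real n powr \<beta> / real n)
          = K * (real n powr \<beta> * (1 + \<gamma> / real n))"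
        using np by (simp add: field_simps)
      also have "\<dots> \<le> K * (real n powr \<beta> * (1 + 1 / real n) powr \<beta>)"
      proof (intro mult_left_mono K0)
        show "1 + \<gamma> / real n \<le> (1 + 1 / real n) powr \<beta>"
          using h np by (simp add: field_simps)
      qed auto
      also have "real n powr \<beta> * (1 + 1 / real n) powr \<beta> = real (Suc n) powr \<beta>"
      proof -
        have "real (Suc n) = real n * (1 + 1 / real n)" using np by (simp add: field_simps)
        then show ?thesis using np by (simp add: powr_mult)
      qed
      finally show ?thesis by simp
    qed
  qed simp
  then show ?thesis using K0 by blast
qed

text \<open>The multiplier grows at exactly the target rate sqrt n, so there is no gap to absorb
  errors. After division by sqrt n the relative errors are 1/n^2 and n^(alpha - 3/2), which are
  summable because alpha < 1/2; a convergent product remains.\<close>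

lemma recursion_rate_critical:
  fixes a :: "nat \<Rightarrow> real"
  assumes nn: "\<And>n. 0 \<le> a n" and \<alpha>: "\<alpha> < 1 / 2"
    and rec: "eventually (\<lambda>n. a (Suc n) \<le> (1 + 1 / (2 * real n)) * a n + C * real n powr (\<alpha> - 1)) sequentially"
  shows "\<exists>K\<ge>0. \<forall>n\<ge>1. a n \<le> K * real n powr (1 / 2)"
proof -
  obtain n0 where n0: "\<And>n. n \<ge> n0 \<Longrightarrow> 1 \<le> n \<and> a (Suc n) \<le> (1 + 1 / (2 * real n)) * a n + C * real n powr (\<alpha> - 1)"
    using eventually_conj[OF eventually_ge_at_top[of 1] rec] unfolding eventually_sequentially by blast
  \<comment> \<open>The added 1 turns the additive forcing into a multiplicative error:
    \<open>(1 + d) * x + c + 1\<close> is at most \<open>(1 + (d + c)) * (x + 1)\<close>.\<close>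
  define g where "g n = a n / sqrt (real n) + 1" for n
  define s where "s n = 1 / (real n)\<^sup>2 + \<bar>C\<bar> * real n powr (\<alpha> - 3 / 2)" for n
  have g1: "1 \<le> g n" for n using nn[of n] by (simp add: g_def)
  have s0: "0 \<le> s n" for n by (simp add: s_def)
  have gstep: "g (Suc n) \<le> (1 + s n) * g n" if n: "n \<ge> n0" for n
  proof -
    note h = n0[OF n]
    have np: "0 < real n" using h by simp
    have sq: "(1 + 1 / (2 * real n)) * sqrt (real n) \<le> (1 + 1 / (real n)\<^sup>2) * sqrt (real (Suc n))"
    proof (rule power2_le_imp_le)
      have "((1 + 1 / (2 * real n)) * sqrt (real n))\<^sup>2 = real n + 1 + 1 / (4 * real n)"
        using np by (simp add: power_mult_distrib power2_eq_square field_simps)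
      also have "\<dots> \<le> (1 + 2 / (real n)\<^sup>2) * (real n + 1)"
      proof -
        have "1 / (4 * real n) \<le> 2 / (real n)\<^sup>2 * real n" using np by (simp add: power2_eq_square field_simps)
        also have "\<dots> \<le> 2 / (real n)\<^sup>2 * (real n + 1)" by (intro mult_left_mono) auto
        finally show ?thesis by (simp add: distrib_right)
      qed
      also have "\<dots> \<le> (1 + 1 / (real n)\<^sup>2)\<^sup>2 * (real n + 1)"
        by (intro mult_right_mono) (auto simp: power2_eq_square algebra_simps)
      also have "\<dots> = ((1 + 1 / (real n)\<^sup>2) * sqrt (real (Suc n)))\<^sup>2"
        by (simp add: power_mult_distrib add.commute)
      finally show "((1 + 1 / (2 * real n)) * sqrt (real n))\<^sup>2 \<le> ((1 + 1 / (real n)\<^sup>2) * sqrt (real (Suc n)))\<^sup>2" .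
    qed auto
    have Cb: "C * real n powr (\<alpha> - 1) \<le> \<bar>C\<bar> * real n powr (\<alpha> - 3 / 2) * sqrt (real (Suc n))"
    proof -
      have "C * real n powr (\<alpha> - 1) \<le> \<bar>C\<bar> * (real n powr (\<alpha> - 3 / 2) * real n powr (1 / 2))"
        by (intro mult_mono) (auto simp: powr_add[symmetric])
      also have "real n powr (1 / 2) = sqrt (real n)" by (simp add: powr_half_sqrt)
      also have "\<bar>C\<bar> * (real n powr (\<alpha> - 3 / 2) * sqrt (real n)) \<le> \<bar>C\<bar> * (real n powr (\<alpha> - 3 / 2) * sqrt (real (Suc n)))"
        by (intro mult_left_mono) auto
      finally show ?thesis by (simp add: mult.assoc)
    qed
    have "a (Suc n) \<le> (1 + 1 / (2 * real n)) * a n + C * real n powr (\<alpha> - 1)" using h by simp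
    also have "(1 + 1 / (2 * real n)) * a n = ((1 + 1 / (2 * real n)) * sqrt (real n)) * (a n / sqrt (real n))"
      using np by simp
    also have "\<dots> \<le> ((1 + 1 / (real n)\<^sup>2) * sqrt (real (Suc n))) * (a n / sqrt (real n))"
      using sq nn[of n] by (intro mult_right_mono) auto
    also have "\<dots> + C * real n powr (\<alpha> - 1) \<le> ((1 + 1 / (real n)\<^sup>2) * sqrt (real (Suc n))) * (a n / sqrt (real n)) + \<bar>C\<bar> * real n powr (\<alpha> - 3 / 2) * sqrt (real (Suc n))"
      using Cb by simp
    also have "\<dots> = ((1 + 1 / (real n)\<^sup>2) * (a n / sqrt (real n)) + \<bar>C\<bar> * real n powr (\<alpha> - 3 / 2)) * sqrt (real (Suc n))"
      by (simp add: algebra_simps)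
    finally have *: "a (Suc n) / sqrt (real (Suc n)) \<le> (1 + 1 / (real n)\<^sup>2) * (a n / sqrt (real n)) + \<bar>C\<bar> * real n powr (\<alpha> - 3 / 2)"
      by (subst divide_le_eq) simp
    have "(1 + d) * x + c + 1 \<le> (1 + (d + c)) * (x + 1)" if "0 \<le> d" "0 \<le> c * x" for d c x :: real
      using that by (simp add: algebra_simps)
    from this[of "1 / (real n)\<^sup>2" "\<bar>C\<bar> * real n powr (\<alpha> - 3 / 2)" "a n / sqrt (real n)"]
    have "(1 + 1 / (real n)\<^sup>2) * (a n / sqrt (real n)) + \<bar>C\<bar> * real n powr (\<alpha> - 3 / 2) + 1
        \<le> (1 + (1 / (real n)\<^sup>2 + \<bar>C\<bar> * real n powr (\<alpha> - 3 / 2))) * (a n / sqrt (real n) + 1)"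
      using nn[of n] by simp
    with * show ?thesis unfolding g_def s_def by linarith
  qed
  have ssum: "summable s"
  proof -
    have "summable (\<lambda>n. 1 / (real n)\<^sup>2)" using inverse_power_summable[of 2, where 'a=real] by (simp add: inverse_eq_divide)
    moreover have "summable (\<lambda>n. \<bar>C\<bar> * real n powr (\<alpha> - 3 / 2))"
      using \<alpha> by (intro summable_mult) (simp add: summable_real_powr_iff)
    ultimately show ?thesis unfolding s_def by (rule summable_add)
  qed
  have prod: "g n \<le> g n0 * exp (\<Sum>i=n0..<n. s i)" if "n \<ge> n0" for n
    using that
  proof (induction n rule: dec_induct)
    case (step n)
    have "g (Suc n) \<le> (1 + s n) * g n" using step.hyps by (intro gstep)
    also have "\<dots> \<le> exp (s n) * (g n0 * exp (\<Sum>i=n0..<n. s i))"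
      using exp_ge_add_one_self[of "s n"] step.IH g1[of n] by (intro mult_mono) auto
    also have "\<dots> = g n0 * exp (\<Sum>i=n0..<Suc n. s i)"
      using step.hyps by (simp add: exp_add mult.commute mult.left_commute)
    finally show ?case .
  qed simp
  define K where "K = g n0 * exp (\<Sum>i. s i) + (\<Sum>n\<le>n0. g n)"
  have gK: "g n \<le> K" for n
  proof (cases "n \<le> n0")
    case True
    have "g n \<le> (\<Sum>n\<le>n0. g n)" using True g1 by (intro member_le_sum) (auto intro: order_trans[of 0 1])
    then show ?thesis using g1[of n0] by (simp add: K_def add_nonneg_nonneg) (meson add_increasing exp_ge_zero mult_nonneg_nonneg order_trans zero_le_one)
  next
    case False
    then have "g n \<le> g n0 * exp (\<Sum>i=n0..<n. s i)" by (intro prod) simp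
    also have "\<dots> \<le> g n0 * exp (\<Sum>i. s i)"
      using g1[of n0] by (intro mult_left_mono iffD2[OF exp_le_cancel_iff] sum_le_suminf ssum) (auto simp: s0)
    also have "\<dots> \<le> K"
      using g1 unfolding K_def by (simp add: sum_nonneg order_trans[of 0 1])
    finally show ?thesis .
  qed
  have "a n \<le> K * real n powr (1 / 2)" if n: "1 \<le> n" for n
  proof -
    have "a n / sqrt (real n) \<le> K" using gK[of n] by (simp add: g_def)
    then show ?thesis using n by (simp add: divide_le_eq powr_half_sqrt)
  qed
  moreover have "0 \<le> K" using gK[of 0] g1[of 0] by simp
  ultimately show ?thesis by blast
qed

text \<open>The exponent achieved is the larger of 499/1000, just above the exponent 498/1000 of the
  noise difference, and the midpoint of \<open>l\<close> and 1/2, which exceeds the homogeneous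
  growth exponent \<open>l\<close>.\<close>

definition rate_gap :: "real \<Rightarrow> real" where
  "rate_gap l = (if l < 1 / 2 then 1 / 2 - max (499 / 1000) ((l + 1 / 2) / 2) else 0)"

lemma rate_gap: "l < 1 / 2 \<Longrightarrow> 0 < rate_gap l" "l = 1 / 2 \<Longrightarrow> rate_gap l = 0"
  by (auto simp: rate_gap_def max_def)

text \<open>\<open>Z\<close> and \<open>V\<close> solve the same recursion up to \<open>O(1/n\<^sup>2)\<close> in the coefficient; \<open>H\<close> is the
  accumulated difference of their driving noises.\<close>

lemma recursion_comparison:
  fixes Z V H :: "nat \<Rightarrow> real"
  assumes l: "l \<le> 1 / 2"
    and Z: "\<And>n. 1 \<le> n \<Longrightarrow> Z (Suc n) = (1 + l / real n) * Z n + x n"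
    and V: "\<And>n. 1 \<le> n \<Longrightarrow> V (Suc n) = (1 + 1 / real n) powr l * V n + g n"
    and H: "\<And>n. H (Suc n) = H n + (x n - g n)"
    and HB: "\<And>n. 1 \<le> n \<Longrightarrow> \<bar>H n\<bar> \<le> K * real n powr (498 / 1000)"
    and VB: "\<And>n. 1 \<le> n \<Longrightarrow> \<bar>V n\<bar> \<le> K * real n"
  shows "(\<lambda>n. Z n - V n) \<in> O(\<lambda>n. real n powr (1 / 2 - rate_gap l))"
proof -
  \<comment> \<open>Subtracting \<open>H\<close> cancels the driving noises, so only
    \<open>l / n * H n\<close> and the coefficient mismatch \<open>r n * V n\<close> remain as
    forcing; both are of order n^(498/1000 - 1).\<close>
  define f where "f n = \<bar>Z n - V n - H n\<bar>" for n
  define r where "r n = (1 + l / real n) - (1 + 1 / real n) powr l" for n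
  \<comment> \<open>The limit of \<open>(real n)\<^sup>2 * r n\<close>, from the second order term
    of the binomial expansion. Hence \<open>r n\<close> is of order 1/n^2, and linear growth of
    \<open>V\<close> is a sufficient bound.\<close>
  define c where "c = - (l * (l - 1) / 2)"
  have K0: "0 \<le> K" using HB[of 1] by simp
  have "((\<lambda>x. x\<^sup>2 * ((1 + l / x) - (1 + 1 / x) powr l)) \<longlongrightarrow> c) at_top"
    unfolding c_def by real_asymp
  then have "((\<lambda>x. \<bar>x\<^sup>2 * ((1 + l / x) - (1 + 1 / x) powr l)\<bar>) \<longlongrightarrow> \<bar>c\<bar>) at_top"
    by (rule tendsto_rabs)
  then have "eventually (\<lambda>x. \<bar>x\<^sup>2 * ((1 + l / x) - (1 + 1 / x) powr l)\<bar> < \<bar>c\<bar> + 1) at_top"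
    by (rule order_tendstoD(2)) simp
  then have ev1: "eventually (\<lambda>n. \<bar>(real n)\<^sup>2 * r n\<bar> < \<bar>c\<bar> + 1) sequentially"
    unfolding r_def by (rule eventually_compose_filterlim[OF _ filterlim_real_sequentially])
  have "((\<lambda>x. 1 + l / x) \<longlongrightarrow> 1) at_top" by real_asymp
  then have "eventually (\<lambda>x. 0 < 1 + l / x) at_top"
    by (rule order_tendstoD(1)) simp
  then have ev2: "eventually (\<lambda>n. 0 < 1 + l / real n) sequentially"
    by (rule eventually_compose_filterlim[OF _ filterlim_real_sequentially])
  define C where "C = \<bar>l\<bar> * K + (\<bar>c\<bar> + 1) * K"
  have C0: "0 \<le> C" using K0 by (simp add: C_def)
  have rec: "eventually (\<lambda>n. f (Suc n) \<le> (1 + l / real n) * f n + C * real n powr (498 / 1000 - 1)) sequentially"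
    using ev1 ev2 eventually_ge_at_top[of 1]
  proof eventually_elim
    case (elim n)
    have np: "0 < real n" using elim by simp
    have "Z (Suc n) - V (Suc n) - H (Suc n) = (1 + l / real n) * (Z n - V n - H n) + l / real n * H n + r n * V n"
      using elim by (simp add: Z V H r_def algebra_simps)
    then have "f (Suc n) \<le> \<bar>(1 + l / real n) * (Z n - V n - H n)\<bar> + \<bar>l / real n * H n\<bar> + \<bar>r n * V n\<bar>"
      unfolding f_def by (simp only:) (rule order_trans[OF abs_triangle_ineq add_right_mono[OF abs_triangle_ineq]])
    also have "\<bar>(1 + l / real n) * (Z n - V n - H n)\<bar> = (1 + l / real n) * f n"
      using elim by (simp add: abs_mult f_def)
    also have "\<bar>l / real n * H n\<bar> \<le> \<bar>l\<bar> / real n * (K * real n powr (498 / 1000))"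
      using HB[of n] elim by (simp add: abs_mult) (intro mult_left_mono divide_right_mono, auto)
    also have "\<bar>l\<bar> / real n * (K * real n powr (498 / 1000)) = \<bar>l\<bar> * K * real n powr (498 / 1000 - 1)"
    proof -
      have e: "real n powr (498 / 1000 - 1) = real n powr (498 / 1000) / real n"
        using np by (subst powr_diff) simp
      show ?thesis unfolding e by simp
    qed
    also have "\<bar>r n * V n\<bar> \<le> (\<bar>c\<bar> + 1) * K * real n powr (498 / 1000 - 1)"
    proof -
      have "\<bar>r n\<bar> \<le> (\<bar>c\<bar> + 1) / (real n)\<^sup>2"
        using elim(1) np by (simp add: abs_mult le_divide_eq mult.commute)
      then have "\<bar>r n\<bar> * \<bar>V n\<bar> \<le> (\<bar>c\<bar> + 1) / (real n)\<^sup>2 * (K * real n)"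
        using VB[of n] elim by (intro mult_mono) auto
      also have "\<dots> = (\<bar>c\<bar> + 1) * K * real n powr (- 1)"
        using np by (simp add: power2_eq_square powr_minus_divide)
      also have "\<dots> \<le> (\<bar>c\<bar> + 1) * K * real n powr (498 / 1000 - 1)"
        using K0 elim by (intro mult_left_mono powr_mono) auto
      finally show ?thesis by (simp add: abs_mult)
    qed
    finally show ?case by (simp add: C_def algebra_simps)
  qed
  have "\<exists>K'\<ge>0. \<forall>n\<ge>1. f n \<le> K' * real n powr (1 / 2 - rate_gap l)"
  proof (cases "l < 1 / 2")
    case True
    define \<beta> where "\<beta> = max (499 / 1000) ((l + 1 / 2) / 2)"
    have \<beta>: "l < \<beta>" "498 / 1000 \<le> \<beta>" "1 / 2 - rate_gap l = \<beta>" using True by (auto simp: \<beta>_def rate_gap_def max_def)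
    show ?thesis unfolding \<beta>(3)
    proof (rule recursion_rate[OF _ \<beta>(1)])
      show "eventually (\<lambda>n. f (Suc n) \<le> (1 + l / real n) * f n + C * real n powr (\<beta> - 1)) sequentially"
        using rec eventually_ge_at_top[of 1]
      proof eventually_elim
        case (elim n)
        have "C * real n powr (498 / 1000 - 1) \<le> C * real n powr (\<beta> - 1)"
          using C0 elim \<beta> by (intro mult_left_mono powr_mono) auto
        then show ?case using elim by linarith
      qed
    qed (simp add: f_def)
  next
    case False
    then have l2: "l = 1 / 2" using l by simp
    show ?thesis unfolding rate_gap(2)[OF l2] diff_zero
      by (rule recursion_rate_critical[where \<alpha>="498 / 1000"]) (use rec in \<open>simp_all add: f_def l2\<close>)
  qed
  then obtain K' where K': "0 \<le> K'" "\<And>n. 1 \<le> n \<Longrightarrow> f n \<le> K' * real n powr (1 / 2 - rate_gap l)" by blast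
  have e: "498 / 1000 \<le> 1 / 2 - rate_gap l" by (auto simp: rate_gap_def max_def)
  show ?thesis
  proof (rule bigoI[where c="K' + K"])
    show "eventually (\<lambda>n. norm (Z n - V n) \<le> (K' + K) * norm (real n powr (1 / 2 - rate_gap l))) sequentially"
      using eventually_ge_at_top[of 1]
    proof eventually_elim
      case (elim n)
      have "\<bar>Z n - V n\<bar> \<le> f n + \<bar>H n\<bar>" unfolding f_def by linarith
      also have "f n \<le> K' * real n powr (1 / 2 - rate_gap l)" by (rule K'(2)[OF elim])
      also have "\<bar>H n\<bar> \<le> K * real n powr (498 / 1000)" by (rule HB[OF elim])
      also have "K * real n powr (498 / 1000) \<le> K * real n powr (1 / 2 - rate_gap l)"
        using e elim K0 by (intro mult_left_mono powr_mono) auto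
      finally show ?case by (simp add: distrib_right)
    qed
  qed
qed

subsection \<open>The walk driven by fair signs\<close>

text \<open>The conditional mean of step \<open>n + 1\<close> given the steps up to
  \<open>n\<close>: the mean of \<open>\<xi>\<close> times the average over a uniform past time and
  a uniform in-neighbour; for \<open>n = 0\<close> the mean of \<open>\<sigma>\<close>.\<close>

definition drift :: "('k \<times> 'k) set \<Rightarrow> ('k \<Rightarrow> real) \<Rightarrow> ('k \<Rightarrow> real) \<Rightarrow> (nat \<Rightarrow> 'k \<Rightarrow> real) \<Rightarrow> nat \<Rightarrow> 'k \<Rightarrow> real" where
  "drift E p q x n v = (if n = 0 then 2 * q v - 1
     else (2 * p v - 1) * (\<Sum>u\<in>in_nbrs E v. \<Sum>i=1..n. x i u) / (real (in_deg E v) * real n))"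

text \<open>For a fair sign \<open>y\<close> and an independent uniform \<open>w\<close>, \<open>push m y w\<close> is a sign of mean \<open>m\<close> that
  differs from \<open>y\<close> with probability at most \<open>\<bar>m\<bar>\<close>.\<close>

definition push :: "real \<Rightarrow> real \<Rightarrow> real \<Rightarrow> real" where
  "push m y w = (if w < \<bar>m\<bar> then sgn m else y)"

text \<open>Stage \<open>n\<close> carries all steps up to \<open>n\<close>, because the drift of
  the next step needs every one of them. Noise with index \<open>n\<close> drives step
  \<open>n + 1\<close>, so stage \<open>n\<close> uses only noise of smaller index.\<close>

primrec driven_hist :: "('k \<times> 'k) set \<Rightarrow> ('k \<Rightarrow> real) \<Rightarrow> ('k \<Rightarrow> real) \<Rightarrow> (nat \<Rightarrow> 'k \<Rightarrow> real) \<Rightarrow> (nat \<Rightarrow> 'k \<Rightarrow> real) \<Rightarrow> nat \<Rightarrow> nat \<Rightarrow> 'k \<Rightarrow> real" where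
  "driven_hist E p q y w 0 = (\<lambda>_ _. 0)"
| "driven_hist E p q y w (Suc n) = (driven_hist E p q y w n)
     (Suc n := (\<lambda>v. push (drift E p q (driven_hist E p q y w n) n v) (y n v) (w n v)))"

lemma drift_cong: "(\<And>i u. 1 \<le> i \<Longrightarrow> i \<le> n \<Longrightarrow> x i u = x' i u) \<Longrightarrow> drift E p q x n v = drift E p q x' n v"
  by (simp add: drift_def)

lemma drift_bound:
  assumes "p v \<in> {0..1}" "q v \<in> {0..1}" and x: "\<And>i u. 1 \<le> i \<Longrightarrow> i \<le> n \<Longrightarrow> \<bar>x i u\<bar> \<le> 1"
  shows "\<bar>drift E p q x n v\<bar> \<le> 1"
proof (cases "n = 0 \<or> in_deg E v = 0")
  case True
  then show ?thesis using assms(2) by (auto simp: drift_def abs_le_iff)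
next
  case False
  have "\<bar>\<Sum>u\<in>in_nbrs E v. \<Sum>i=1..n. x i u\<bar> \<le> (\<Sum>u\<in>in_nbrs E v. \<Sum>i=1..n. 1)"
    using x by (intro order_trans[OF sum_abs] sum_mono order_trans[OF sum_abs]) auto
  also have "\<dots> = real (in_deg E v) * real n" by (simp add: in_deg_def)
  finally have s: "\<bar>\<Sum>u\<in>in_nbrs E v. \<Sum>i=1..n. x i u\<bar> \<le> real (in_deg E v) * real n" .
  have "\<bar>2 * p v - 1\<bar> * \<bar>\<Sum>u\<in>in_nbrs E v. \<Sum>i=1..n. x i u\<bar> \<le> 1 * (real (in_deg E v) * real n)"
    using assms(1) s by (intro mult_mono) (auto simp: abs_le_iff)
  then show ?thesis using False by (simp add: drift_def abs_mult divide_le_eq)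
qed

lemma driven_hist_le: "i \<le> n \<Longrightarrow> driven_hist E p q y w n i = driven_hist E p q y w i i"
  by (induction n) (auto simp: le_Suc_eq)

lemma driven_hist_cong:
  assumes "\<And>i u. i < n \<Longrightarrow> y i u = y' i u" "\<And>i u. i < n \<Longrightarrow> w i u = w' i u"
  shows "driven_hist E p q y w n = driven_hist E p q y' w' n"
  using assms
proof (induction n)
  case (Suc n)
  then have "driven_hist E p q y w n = driven_hist E p q y' w' n" by simp
  then show ?case using Suc.prems by simp
qed simp

lemma driven_hist_measurable:
  assumes "\<And>i u. i < n \<Longrightarrow> (\<lambda>\<omega>. y \<omega> i u) \<in> borel_measurable M" "\<And>i u. i < n \<Longrightarrow> (\<lambda>\<omega>. w \<omega> i u) \<in> borel_measurable M"
  shows "(\<lambda>\<omega>. driven_hist E p q (y \<omega>) (w \<omega>) n i v) \<in> borel_measurable M"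
  using assms
proof (induction n arbitrary: i v)
  case (Suc n)
  have [measurable]: "(\<lambda>\<omega>. driven_hist E p q (y \<omega>) (w \<omega>) n i v) \<in> borel_measurable M" for i v
    using Suc by simp
  have [measurable]: "(\<lambda>\<omega>. y \<omega> n v) \<in> borel_measurable M" "(\<lambda>\<omega>. w \<omega> n v) \<in> borel_measurable M" for v
    using Suc by simp_all
  have [measurable]: "(\<lambda>\<omega>. drift E p q (driven_hist E p q (y \<omega>) (w \<omega>) n) n v) \<in> borel_measurable M" for v
    unfolding drift_def by (cases "n = 0") simp_all
  show ?case
    unfolding driven_hist.simps fun_upd_apply push_def by (cases "i = Suc n") simp_all
qed simp

text \<open>A sign of mean \<open>m\<close>, once centred, ranges over an interval of length 2, and
  Hoeffding's lemma bounds its exponential moment. Negative values of theta follow by reflecting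
  \<open>m\<close> and theta.\<close>

lemma hoeffding_two_point:
  fixes m \<theta> :: real
  assumes m: "\<bar>m\<bar> \<le> 1"
  shows "(1 + m) / 2 * exp (\<theta> * (1 - m)) + (1 - m) / 2 * exp (\<theta> * (- 1 - m)) \<le> exp (\<theta>\<^sup>2 / 2)"
proof -
  have pos: "(1 + m) / 2 * exp (\<theta> * (1 - m)) + (1 - m) / 2 * exp (\<theta> * (- 1 - m)) \<le> exp (\<theta>\<^sup>2 / 2)"
    if m: "\<bar>m\<bar> \<le> 1" and \<theta>: "0 \<le> \<theta>" for m \<theta> :: real
  proof -
    define P where "P = (1 + m) / 2"
    have P: "0 \<le> P" using m by (simp add: P_def abs_le_iff)
    have pos: "0 < 1 + P * (exp (2 * \<theta>) - 1)"
      using P \<theta> by (intro add_pos_nonneg mult_nonneg_nonneg) auto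
    have m': "m = 2 * P - 1" by (simp add: P_def field_simps)
    have "(1 + m) / 2 * exp (\<theta> * (1 - m)) + (1 - m) / 2 * exp (\<theta> * (- 1 - m)) = exp (- (2 * \<theta>) * P) * (1 + P * (exp (2 * \<theta>) - 1))"
    proof -
      have 1: "exp (\<theta> * (1 - m)) = exp (- (2 * \<theta>) * P) * exp (2 * \<theta>)"
        unfolding m' by (simp add: exp_add[symmetric] algebra_simps)
      have 2: "exp (\<theta> * (- 1 - m)) = exp (- (2 * \<theta>) * P)"
        unfolding m' by (simp add: algebra_simps)
      have 3: "(1 + m) / 2 = P" "(1 - m) / 2 = 1 - P" by (simp_all add: m')
      show ?thesis unfolding 1 2 3 by (simp add: algebra_simps)
    qed
    also have "\<dots> = exp (- (2 * \<theta>) * P + ln (1 + P * (exp (2 * \<theta>) - 1)))"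
      by (simp only: exp_add exp_ln[OF pos])
    also have "\<dots> \<le> exp ((2 * \<theta>)\<^sup>2 / 8)"
      using Hoeffdings_lemma_aux[of "2 * \<theta>" P] P \<theta> by simp
    finally show ?thesis by (simp add: power_mult_distrib)
  qed
  show ?thesis
  proof (cases "0 \<le> \<theta>")
    case True then show ?thesis using pos[OF m] by simp
  next
    case False
    then show ?thesis using pos[of "- m" "- \<theta>"] m by (simp add: algebra_simps)
  qed
qed

text \<open>The walk over abstract noise: fair signs \<open>Y\<close> and uniforms \<open>V\<close>,
  all independent. Neither its law nor its moments depend on how the signs arise from Brownian
  motions, so that link is left out here.\<close>

locale driven = prob_space M
  for M :: "'a measure" +
  fixes E :: "('k::finite \<times> 'k) set" and p q :: "'k \<Rightarrow> real"
    and Y V :: "nat \<Rightarrow> 'k \<Rightarrow> 'a \<Rightarrow> real"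
  assumes p_range: "p v \<in> {0..1}" and q_range: "q v \<in> {0..1}"
    and noise_indep: "indep_vars (\<lambda>_. borel) (\<lambda>(i, v, b). if b then Y i v else V i v) (UNIV :: (nat \<times> 'k \<times> bool) set)"
    and Y_val: "Y i v \<omega> = 1 \<or> Y i v \<omega> = -1"
    and Y_prob: "prob {\<omega> \<in> space M. Y i v \<omega> = 1} = 1 / 2"
    and V_nonneg: "0 \<le> V i v \<omega>"
    and V_prob: "0 \<le> u \<Longrightarrow> u \<le> 1 \<Longrightarrow> prob {\<omega> \<in> space M. V i v \<omega> < u} = u"
begin

definition "noise \<omega> = (\<lambda>(i, v, b). if b then Y i v \<omega> else V i v \<omega>)"

lemma noise_indep': "indep_vars (\<lambda>_. borel) (\<lambda>k \<omega>. noise \<omega> k) (UNIV :: (nat \<times> 'k \<times> bool) set)"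
proof -
  have "(\<lambda>k \<omega>. noise \<omega> k) = (\<lambda>(i, v, b). if b then Y i v else V i v)"
    by (auto simp: noise_def fun_eq_iff)
  then show ?thesis using noise_indep by simp
qed

text \<open>These indices determine the walk up to time \<open>n\<close>, by
  \<open>hist_of_past\<close>. The restricted noise \<open>past n\<close> below plays the part of a
  filtration, disjoint from the noise \<open>cur_idx n v\<close> of the next step.\<close>

definition past_idx :: "nat \<Rightarrow> (nat \<times> 'k \<times> bool) set" where
  "past_idx n = {..<n} \<times> UNIV \<times> UNIV"

definition cur_idx :: "nat \<Rightarrow> 'k \<Rightarrow> (nat \<times> 'k \<times> bool) set" where
  "cur_idx n v = {(n, v, True), (n, v, False)}"

definition hist_of :: "(nat \<times> 'k \<times> bool \<Rightarrow> real) \<Rightarrow> nat \<Rightarrow> nat \<Rightarrow> 'k \<Rightarrow> real" where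
  "hist_of c = driven_hist E p q (\<lambda>i u. c (i, u, True)) (\<lambda>i u. c (i, u, False))"

definition X :: "nat \<Rightarrow> 'k \<Rightarrow> 'a \<Rightarrow> real" where
  "X n v \<omega> = hist_of (noise \<omega>) n n v"

definition m :: "nat \<Rightarrow> 'k \<Rightarrow> 'a \<Rightarrow> real" where
  "m n v \<omega> = drift E p q (\<lambda>i u. X i u \<omega>) n v"

definition past :: "nat \<Rightarrow> 'a \<Rightarrow> nat \<times> 'k \<times> bool \<Rightarrow> real" where
  "past n \<omega> = restrict (noise \<omega>) (past_idx n)"

abbreviation "past_space n \<equiv> \<Pi>\<^sub>M i\<in>past_idx n. (borel :: real measure)"

lemma Y_measurable[measurable]: "Y i v \<in> borel_measurable M"
  and V_measurable[measurable]: "V i v \<in> borel_measurable M"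
  using indep_vars_measurable[OF noise_indep, of "(i, v, True)"] indep_vars_measurable[OF noise_indep, of "(i, v, False)"]
  by simp_all

lemma hist_of_noise: "i \<le> n \<Longrightarrow> hist_of (noise \<omega>) n i v = X i v \<omega>"
  unfolding X_def hist_of_def by (simp only: driven_hist_le[of i n])

lemma hist_of_past: "i \<le> n \<Longrightarrow> n \<le> n' \<Longrightarrow> hist_of (past n' \<omega>) n i v = X i v \<omega>"
proof -
  assume "i \<le> n" "n \<le> n'"
  then have "hist_of (past n' \<omega>) n = hist_of (noise \<omega>) n"
    unfolding hist_of_def by (intro driven_hist_cong) (auto simp: past_def past_idx_def)
  then show ?thesis by (simp add: hist_of_noise \<open>i \<le> n\<close>)
qed

lemma hist_of_measurable: "n \<le> n' \<Longrightarrow> (\<lambda>c. hist_of c n i v) \<in> borel_measurable (past_space n')"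
  unfolding hist_of_def by (intro driven_hist_measurable) (auto simp: past_idx_def)

definition m_of :: "nat \<Rightarrow> 'k \<Rightarrow> (nat \<times> 'k \<times> bool \<Rightarrow> real) \<Rightarrow> real" where
  "m_of n v c = drift E p q (hist_of c n) n v"

lemma m_of_measurable: "n \<le> n' \<Longrightarrow> m_of n v \<in> borel_measurable (past_space n')"
proof -
  assume n: "n \<le> n'"
  have [measurable]: "(\<lambda>c. hist_of c n i u) \<in> borel_measurable (past_space n')" for i u
    using n by (rule hist_of_measurable)
  show ?thesis unfolding m_of_def drift_def by (cases "n = 0") simp_all
qed

lemma m_of_past: "n \<le> n' \<Longrightarrow> m_of n v (past n' \<omega>) = m n v \<omega>"
  unfolding m_of_def m_def by (intro drift_cong) (simp add: hist_of_past)

lemma past_measurable: "past n \<in> measurable M (past_space n)"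
  unfolding past_def noise_def by (intro measurable_restrict) (auto split: prod.splits)

lemma X_measurable[measurable]: "X n v \<in> borel_measurable M"
proof -
  have "(\<lambda>\<omega>. hist_of (past n \<omega>) n n v) \<in> borel_measurable M"
    by (rule measurable_compose[OF past_measurable hist_of_measurable]) simp
  then show ?thesis by (simp add: hist_of_past)
qed

lemma m_measurable[measurable]: "m n v \<in> borel_measurable M"
proof -
  have "(\<lambda>\<omega>. m_of n v (past n \<omega>)) \<in> borel_measurable M"
    by (rule measurable_compose[OF past_measurable m_of_measurable]) simp
  then show ?thesis by (simp add: m_of_past)
qed

lemma X_0: "X 0 v \<omega> = 0"
  by (simp add: X_def hist_of_def)

lemma X_Suc: "X (Suc n) v \<omega> = push (m n v \<omega>) (Y n v \<omega>) (V n v \<omega>)"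
proof -
  have "drift E p q (hist_of (noise \<omega>) n) n v = m n v \<omega>"
    unfolding m_def by (intro drift_cong) (simp add: hist_of_noise)
  then show ?thesis by (simp add: X_def hist_of_def noise_def)
qed

lemma X_bound: "\<bar>X n v \<omega>\<bar> \<le> 1"
proof (cases n)
  case (Suc k)
  then show ?thesis using Y_val[of k v \<omega>] by (auto simp: X_Suc push_def sgn_real_def)
qed (simp add: X_0)

lemma m_bound: "\<bar>m n v \<omega>\<bar> \<le> 1"
  unfolding m_def by (intro drift_bound p_range q_range X_bound)

lemma X_val: "X (Suc n) v \<omega> = 1 \<or> X (Suc n) v \<omega> = -1"
  using Y_val[of n v \<omega>] V_nonneg[of n v \<omega>] by (auto simp: X_Suc push_def sgn_real_def)

lemma prob_Y_V:
  assumes u: "0 \<le> u" "u \<le> 1"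
  shows "prob {\<omega> \<in> space M. Y n v \<omega> = 1 \<and> \<not> V n v \<omega> < u} = (1 - u) / 2"
proof -
  define A where "A k = (if snd (snd k) then {1} else {u..})" for k :: "nat \<times> 'k \<times> bool"
  have "prob (\<Inter>k\<in>cur_idx n v. (case k of (i, v, b) \<Rightarrow> if b then Y i v else V i v) -` A k \<inter> space M)
     = (\<Prod>k\<in>cur_idx n v. prob ((case k of (i, v, b) \<Rightarrow> if b then Y i v else V i v) -` A k \<inter> space M))"
    by (rule indep_varsD[OF noise_indep]) (auto simp: cur_idx_def A_def)
  moreover have "(\<Inter>k\<in>cur_idx n v. (case k of (i, v, b) \<Rightarrow> if b then Y i v else V i v) -` A k \<inter> space M)
     = {\<omega> \<in> space M. Y n v \<omega> = 1 \<and> \<not> V n v \<omega> < u}"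
    by (auto simp: cur_idx_def A_def)
  moreover have "(\<Prod>k\<in>cur_idx n v. prob ((case k of (i, v, b) \<Rightarrow> if b then Y i v else V i v) -` A k \<inter> space M))
    = prob {\<omega> \<in> space M. Y n v \<omega> = 1} * prob {\<omega> \<in> space M. \<not> V n v \<omega> < u}"
    by (simp add: cur_idx_def A_def vimage_def Int_def conj_commute not_less)
  moreover have "prob {\<omega> \<in> space M. \<not> V n v \<omega> < u} = 1 - u"
    using prob_neg[of "\<lambda>\<omega>. V n v \<omega> < u"] V_prob[OF u, of n v] by simp
  ultimately show ?thesis by (simp add: Y_prob)
qed

lemma prob_push:
  assumes x: "\<bar>x\<bar> \<le> 1" and s: "s = 1 \<or> s = -1"
  shows "prob {\<omega> \<in> space M. push x (Y n v \<omega>) (V n v \<omega>) = s} = (1 + s * x) / 2"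
proof -
  have one: "prob {\<omega> \<in> space M. push x (Y n v \<omega>) (V n v \<omega>) = 1} = (1 + x) / 2"
  proof (cases "0 < x")
    case True
    have "{\<omega> \<in> space M. push x (Y n v \<omega>) (V n v \<omega>) = 1}
       = {\<omega> \<in> space M. V n v \<omega> < x} \<union> {\<omega> \<in> space M. Y n v \<omega> = 1 \<and> \<not> V n v \<omega> < x}"
      using True by (auto simp: push_def)
    also have "prob \<dots> = prob {\<omega> \<in> space M. V n v \<omega> < x} + prob {\<omega> \<in> space M. Y n v \<omega> = 1 \<and> \<not> V n v \<omega> < x}"
      by (rule finite_measure_Union) auto
    also have "\<dots> = (1 + x) / 2" using True x by (simp add: V_prob prob_Y_V field_simps)
    finally show ?thesis .
  next
    case False
    have "{\<omega> \<in> space M. push x (Y n v \<omega>) (V n v \<omega>) = 1} = {\<omega> \<in> space M. Y n v \<omega> = 1 \<and> \<not> V n v \<omega> < \<bar>x\<bar>}"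
      using False by (auto simp: push_def sgn_real_def)
    then show ?thesis using False x by (simp add: prob_Y_V)
  qed
  from s show ?thesis
  proof
    assume "s = -1"
    have "{\<omega> \<in> space M. push x (Y n v \<omega>) (V n v \<omega>) = -1} = {\<omega> \<in> space M. \<not> push x (Y n v \<omega>) (V n v \<omega>) = 1}"
      using Y_val[of n v] V_nonneg[of n v] by (auto simp: push_def sgn_real_def) (smt (verit) V_nonneg)+
    moreover have "prob {\<omega> \<in> space M. \<not> push x (Y n v \<omega>) (V n v \<omega>) = 1} = 1 - (1 + x) / 2"
    proof (subst prob_neg)
      show "{\<omega> \<in> space M. push x (Y n v \<omega>) (V n v \<omega>) = 1} \<in> events" unfolding push_def by measurable
    qed (simp add: one)
    ultimately show ?thesis using \<open>s = -1\<close> by (simp add: field_simps)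
  qed (use one in simp)
qed

text \<open>Conditioning on the past: the noise of step \<open>n\<close> at vertex \<open>v\<close>
  is independent of \<open>past n\<close>, so the drift \<open>m n v\<close> is held fixed while
  this noise is integrated out. Every martingale property below comes from here.\<close>

lemma step_integral:
  fixes g :: "real \<Rightarrow> real \<Rightarrow> real \<Rightarrow> real"
  assumes a: "a \<in> borel_measurable (past_space n)"
    and g: "(\<lambda>(x, y, w). g x y w) \<in> borel_measurable (borel \<Otimes>\<^sub>M borel \<Otimes>\<^sub>M borel)"
    and bd: "\<And>\<omega>. \<bar>a (past n \<omega>) * g (m n v \<omega>) (Y n v \<omega>) (V n v \<omega>)\<bar> \<le> C"
  shows "expectation (\<lambda>\<omega>. a (past n \<omega>) * g (m n v \<omega>) (Y n v \<omega>) (V n v \<omega>))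
    = expectation (\<lambda>\<omega>. a (past n \<omega>) * expectation (\<lambda>\<omega>'. g (m n v \<omega>) (Y n v \<omega>') (V n v \<omega>')))"
proof -
  let ?cs = "\<Pi>\<^sub>M i\<in>cur_idx n v. (borel :: real measure)"
  define cur where "cur \<omega> = restrict (noise \<omega>) (cur_idx n v)" for \<omega>
  have ind: "indep_var (past_space n) (past n) ?cs cur"
  proof -
    have "past_idx n \<inter> cur_idx n v = {}" by (auto simp: past_idx_def cur_idx_def)
    then show ?thesis
      unfolding past_def[abs_def] cur_def[abs_def] by (rule indep_var_restrict[OF noise_indep']) auto
  qed
  define f where "f = (\<lambda>(c, d). a c * g (m_of n v c) (d (n, v, True)) (d (n, v, False)))"
  have [measurable]: "a \<in> borel_measurable (past_space n)" "m_of n v \<in> borel_measurable (past_space n)"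
    using a by (simp_all add: m_of_measurable)
  have fm: "f \<in> borel_measurable (past_space n \<Otimes>\<^sub>M ?cs)"
  proof -
    have [measurable]: "(\<lambda>d. d (n, v, b)) \<in> borel_measurable ?cs" for b
      by (rule measurable_component_singleton) (cases b, auto simp: cur_idx_def)
    have "(\<lambda>z. (m_of n v (fst z), snd z (n, v, True), snd z (n, v, False))) \<in> measurable (past_space n \<Otimes>\<^sub>M ?cs) (borel \<Otimes>\<^sub>M borel \<Otimes>\<^sub>M borel)"
      by measurable
    from measurable_compose[OF this g]
    have h1: "(\<lambda>z. g (m_of n v (fst z)) (snd z (n, v, True)) (snd z (n, v, False))) \<in> borel_measurable (past_space n \<Otimes>\<^sub>M ?cs)"
      by simp
    have h2: "(\<lambda>z. a (fst z)) \<in> borel_measurable (past_space n \<Otimes>\<^sub>M ?cs)" by measurable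
    have "f = (\<lambda>z. a (fst z) * g (m_of n v (fst z)) (snd z (n, v, True)) (snd z (n, v, False)))"
      by (auto simp: f_def)
    then show ?thesis using borel_measurable_times[OF h2 h1] by simp
  qed
  have fe: "f (past n \<omega>, cur \<omega>') = a (past n \<omega>) * g (m n v \<omega>) (Y n v \<omega>') (V n v \<omega>')" for \<omega> \<omega>'
    by (simp add: f_def cur_def cur_idx_def noise_def m_of_past)
  have curm: "cur \<in> measurable M ?cs" using ind by (rule indep_var_rv2)
  have "(\<integral>\<omega>. f (past n \<omega>, cur \<omega>) \<partial>M) = (\<integral>\<omega>. (\<integral>y. f (past n \<omega>, y) \<partial>distr M ?cs cur) \<partial>M)"
  proof (rule indep_var_integral[OF ind fm])
    have "(\<lambda>\<omega>. f (past n \<omega>, cur \<omega>)) \<in> borel_measurable M"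
      using measurable_compose[OF measurable_Pair[OF past_measurable curm] fm] by simp
    then show "integrable M (\<lambda>\<omega>. f (past n \<omega>, cur \<omega>))"
      using bd by (intro integrable_const_bound[of _ C]) (auto simp: fe)
  qed
  also have "\<dots> = (\<integral>\<omega>. (\<integral>\<omega>'. f (past n \<omega>, cur \<omega>') \<partial>M) \<partial>M)"
  proof (rule Bochner_Integration.integral_cong[OF refl])
    fix \<omega> assume "\<omega> \<in> space M"
    then have "past n \<omega> \<in> space (past_space n)" using past_measurable by (rule measurable_space[rotated])
    then have "(\<lambda>y. f (past n \<omega>, y)) \<in> borel_measurable ?cs"
      using measurable_compose[OF measurable_Pair1' fm] by simp
    then show "(\<integral>y. f (past n \<omega>, y) \<partial>distr M ?cs cur) = (\<integral>\<omega>'. f (past n \<omega>, cur \<omega>') \<partial>M)"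
      using curm by (intro integral_distr)
  qed
  finally show ?thesis unfolding fe by simp
qed

lemma expectation_push:
  fixes h :: "real \<Rightarrow> real"
  assumes x: "\<bar>x\<bar> \<le> 1"
  shows "expectation (\<lambda>\<omega>. h (push x (Y n v \<omega>) (V n v \<omega>))) = (1 + x) / 2 * h 1 + (1 - x) / 2 * h (-1)"
proof -
  let ?A = "\<lambda>s. {\<omega> \<in> space M. push x (Y n v \<omega>) (V n v \<omega>) = s}"
  have [measurable]: "?A s \<in> events" for s unfolding push_def by measurable
  have pv: "push x (Y n v \<omega>) (V n v \<omega>) = 1 \<or> push x (Y n v \<omega>) (V n v \<omega>) = -1" for \<omega>
    using Y_val[of n v \<omega>] V_nonneg[of n v \<omega>] by (auto simp: push_def sgn_real_def)
  have "expectation (\<lambda>\<omega>. h (push x (Y n v \<omega>) (V n v \<omega>))) = expectation (\<lambda>\<omega>. h 1 * indicator (?A 1) \<omega> + h (-1) * indicator (?A (-1)) \<omega>)"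
  proof (rule Bochner_Integration.integral_cong[OF refl])
    fix \<omega> assume "\<omega> \<in> space M"
    then show "h (push x (Y n v \<omega>) (V n v \<omega>)) = h 1 * indicator (?A 1) \<omega> + h (-1) * indicator (?A (-1)) \<omega>"
      using pv[of \<omega>] by (auto simp: indicator_def)
  qed
  also have "\<dots> = h 1 * prob (?A 1) + h (-1) * prob (?A (-1))"
    by (subst Bochner_Integration.integral_add) (auto intro!: integrable_const_bound[of _ 1])
  finally show ?thesis using prob_push[OF x, of 1 n v] prob_push[OF x, of "-1" n v] by (simp add: mult.commute)
qed

lemma step_expectation:
  fixes h :: "real \<Rightarrow> real \<Rightarrow> real"
  assumes a: "a \<in> borel_measurable (past_space n)"
    and h: "(\<lambda>(x, s). h x s) \<in> borel_measurable (borel \<Otimes>\<^sub>M borel)"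
    and bd: "\<And>\<omega>. \<bar>a (past n \<omega>) * h (m n v \<omega>) (X (Suc n) v \<omega>)\<bar> \<le> C"
  shows "expectation (\<lambda>\<omega>. a (past n \<omega>) * h (m n v \<omega>) (X (Suc n) v \<omega>))
    = expectation (\<lambda>\<omega>. a (past n \<omega>) * ((1 + m n v \<omega>) / 2 * h (m n v \<omega>) 1 + (1 - m n v \<omega>) / 2 * h (m n v \<omega>) (-1)))"
proof -
  have "(\<lambda>(x, y, w). (x, push x y w)) \<in> measurable (borel \<Otimes>\<^sub>M borel \<Otimes>\<^sub>M borel) (borel \<Otimes>\<^sub>M borel)"
    unfolding push_def by measurable
  from measurable_compose[OF this h]
  have g: "(\<lambda>(x, y, w). h x (push x y w)) \<in> borel_measurable (borel \<Otimes>\<^sub>M borel \<Otimes>\<^sub>M borel)"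
    by (simp add: case_prod_beta)
  show ?thesis
    using step_integral[OF a g, of v C] bd by (simp add: X_Suc expectation_push[OF m_bound, of "h (m n v _)"])
qed

text \<open>On the event that the history is \<open>x\<close>, the drift is a constant, and the
  vertices then move by disjoint parts of the noise. The event splits into independent ones.\<close>

lemma step_law:
  assumes x: "\<And>i v. 1 \<le> i \<Longrightarrow> i \<le> Suc n \<Longrightarrow> x i v = 1 \<or> x i v = -1"
  shows "prob {\<omega> \<in> space M. \<forall>i\<in>{1..Suc n}. \<forall>v. X i v \<omega> = x i v}
    = prob {\<omega> \<in> space M. \<forall>i\<in>{1..n}. \<forall>v. X i v \<omega> = x i v} * (\<Prod>v\<in>UNIV. (1 + x (Suc n) v * drift E p q x n v) / 2)"
proof -
  \<comment> \<open>\<open>None\<close> stands for the past, \<open>Some v\<close> for the current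
    noise of vertex \<open>v\<close>; one independent family then contains all factors.\<close>
  define K :: "'k option \<Rightarrow> (nat \<times> 'k \<times> bool) set" where "K = case_option (past_idx n) (cur_idx n)"
  define R where "R j \<omega> = restrict (noise \<omega>) (K j)" for j \<omega>
  have ind: "indep_vars (\<lambda>j. \<Pi>\<^sub>M i\<in>K j. borel) R UNIV"
    unfolding R_def[abs_def]
    by (rule indep_vars_restrict[OF noise_indep'])
       (auto simp: K_def disjoint_family_on_def past_idx_def cur_idx_def split: option.splits)
  define d where "d v = drift E p q x n v" for v
  define A :: "'k option \<Rightarrow> (nat \<times> 'k \<times> bool \<Rightarrow> real) set" where
    "A = case_option {c \<in> space (past_space n). \<forall>i\<in>{1..n}. \<forall>v. hist_of c n i v = x i v}
      (\<lambda>v. {c \<in> space (\<Pi>\<^sub>M i\<in>cur_idx n v. borel). push (d v) (c (n, v, True)) (c (n, v, False)) = x (Suc n) v})"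
  have Am: "A j \<in> sets (\<Pi>\<^sub>M i\<in>K j. borel)" for j
  proof (cases j)
    case None
    have [measurable]: "(\<lambda>c. hist_of c n i v) \<in> borel_measurable (past_space n)" for i v
      by (rule hist_of_measurable) simp
    show ?thesis unfolding None A_def K_def option.case by measurable
  next
    case (Some v)
    have [measurable]: "(\<lambda>d. d (n, v, b)) \<in> borel_measurable (\<Pi>\<^sub>M i\<in>cur_idx n v. borel)" for b
      by (rule measurable_component_singleton) (cases b, auto simp: cur_idx_def)
    show ?thesis unfolding Some A_def K_def option.case push_def by measurable
  qed
  have pre_None: "R None -` A None \<inter> space M = {\<omega> \<in> space M. \<forall>i\<in>{1..n}. \<forall>v. X i v \<omega> = x i v}"
    using hist_of_past[of _ n n] measurable_space[OF past_measurable, of _ n]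
    by (auto simp: R_def A_def K_def past_def)
  have pre_Some: "R (Some v) -` A (Some v) \<inter> space M = {\<omega> \<in> space M. push (d v) (Y n v \<omega>) (V n v \<omega>) = x (Suc n) v}" for v
    by (auto simp: R_def A_def K_def cur_idx_def noise_def space_PiM)
  have db: "\<bar>d v\<bar> \<le> 1" for v
  proof -
    have "\<bar>x i u\<bar> \<le> 1" if "1 \<le> i" "i \<le> n" for i u using x[of i u] that by auto
    then show ?thesis unfolding d_def by (intro drift_bound p_range q_range)
  qed
  have "{\<omega> \<in> space M. \<forall>i\<in>{1..Suc n}. \<forall>v. X i v \<omega> = x i v} = (\<Inter>j\<in>UNIV. R j -` A j \<inter> space M)"
  proof -
    have "m n v \<omega> = d v" if "\<forall>i\<in>{1..n}. \<forall>v. X i v \<omega> = x i v" for \<omega> v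
      unfolding m_def d_def using that by (intro drift_cong) auto
    then have "{\<omega> \<in> space M. \<forall>i\<in>{1..Suc n}. \<forall>v. X i v \<omega> = x i v}
      = {\<omega> \<in> space M. \<forall>i\<in>{1..n}. \<forall>v. X i v \<omega> = x i v} \<inter> (\<Inter>v. {\<omega> \<in> space M. push (d v) (Y n v \<omega>) (V n v \<omega>) = x (Suc n) v})"
      by (auto simp: atLeastAtMostSuc_conv X_Suc)
    also have "\<dots> = (\<Inter>j\<in>UNIV. R j -` A j \<inter> space M)"
      by (simp only: UNIV_option_conv INT_insert image_image pre_None pre_Some[symmetric])
    finally show ?thesis .
  qed
  then have "prob {\<omega> \<in> space M. \<forall>i\<in>{1..Suc n}. \<forall>v. X i v \<omega> = x i v} = (\<Prod>j\<in>UNIV. prob (R j -` A j \<inter> space M))"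
    using indep_varsD[OF ind, of UNIV A] Am by simp
  also have "\<dots> = prob (R None -` A None \<inter> space M) * (\<Prod>v\<in>UNIV. prob (R (Some v) -` A (Some v) \<inter> space M))"
    by (simp add: UNIV_option_conv prod.reindex)
  also have "(\<Prod>v\<in>UNIV. prob (R (Some v) -` A (Some v) \<inter> space M)) = (\<Prod>v\<in>UNIV. (1 + x (Suc n) v * d v) / 2)"
    unfolding pre_Some by (intro prod.cong refl prob_push db x) auto
  finally show ?thesis unfolding pre_None d_def .
qed

end

section \<open>Fluctuations of the martingale differences\<close>

lemma abs_le_half_sum_square: "0 < c \<Longrightarrow> \<bar>x\<bar> \<le> (c + x\<^sup>2 / c) / 2" for c x :: real
proof -
  assume c: "0 < c"
  have "0 \<le> (\<bar>x\<bar> - c)\<^sup>2" by simp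
  then have "2 * \<bar>x\<bar> * c \<le> c * c + x\<^sup>2" by (simp add: power2_eq_square algebra_simps)
  then show ?thesis using c by (simp add: field_simps power2_eq_square)
qed

lemma sq_le_of_abs_le: "\<bar>x\<bar> \<le> c \<Longrightarrow> x\<^sup>2 \<le> c\<^sup>2" for x c :: real
  using power_mono[of "\<bar>x\<bar>" c 2] by simp

lemma abs_mult_le: "\<bar>x\<bar> \<le> a \<Longrightarrow> \<bar>y\<bar> \<le> b \<Longrightarrow> \<bar>x * y\<bar> \<le> a * b" for x y a b :: real
  unfolding abs_mult by (rule mult_mono') auto

lemma (in prob_space) integrable_bounded:
  fixes f :: "'a \<Rightarrow> real"
  assumes "f \<in> borel_measurable M" "\<And>\<omega>. \<bar>f \<omega>\<bar> \<le> C"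
  shows "integrable M f"
  using assms by (intro integrable_const_bound[of _ C]) auto

lemma push_0: "0 \<le> w \<Longrightarrow> push 0 y w = y"
  by (simp add: push_def)

context driven
begin

definition eps :: "nat \<Rightarrow> 'k \<Rightarrow> 'a \<Rightarrow> real" where
  "eps n v \<omega> = X (Suc n) v \<omega> - m n v \<omega>"

lemma eps_measurable[measurable]: "eps n v \<in> borel_measurable M"
  unfolding eps_def by measurable

lemma eps_bound: "\<bar>eps n v \<omega>\<bar> \<le> 2"
  using X_bound[of "Suc n" v \<omega>] m_bound[of n v \<omega>] by (simp add: eps_def abs_le_iff)

lemma eps_of_past:
  assumes "i < n"
  shows "eps i v \<omega> = hist_of (past n \<omega>) (Suc i) (Suc i) v - m_of i v (past n \<omega>)"
  using assms by (simp add: eps_def hist_of_past m_of_past)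

lemma Y_of_past: "i < n \<Longrightarrow> past n \<omega> (i, v, True) = Y i v \<omega>"
  by (simp add: past_def past_idx_def noise_def)

lemma expectation_mult_eps:
  assumes a: "a \<in> borel_measurable (past_space n)" and bd: "\<And>\<omega>. \<bar>a (past n \<omega>)\<bar> \<le> C"
  shows "expectation (\<lambda>\<omega>. a (past n \<omega>) * eps n v \<omega>) = 0"
proof -
  have "expectation (\<lambda>\<omega>. a (past n \<omega>) * eps n v \<omega>) = expectation (\<lambda>\<omega>. a (past n \<omega>) * ((\<lambda>x s. s - x) (m n v \<omega>) (X (Suc n) v \<omega>)))"
    by (simp add: eps_def)
  also have "\<dots> = expectation (\<lambda>\<omega>. a (past n \<omega>) * ((1 + m n v \<omega>) / 2 * (1 - m n v \<omega>) + (1 - m n v \<omega>) / 2 * (-1 - m n v \<omega>)))"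
  proof (rule step_expectation[OF a, where C="C * 2"])
    show "\<bar>a (past n \<omega>) * (X (Suc n) v \<omega> - m n v \<omega>)\<bar> \<le> C * 2" for \<omega>
      unfolding abs_mult using bd[of \<omega>] eps_bound[of n v \<omega>] by (intro mult_mono) (auto simp: eps_def)
  qed measurable
  also have "\<dots> = 0" by (simp add: field_simps)
  finally show ?thesis .
qed

lemma expectation_mult_Y:
  assumes a: "a \<in> borel_measurable (past_space n)" and bd: "\<And>\<omega>. \<bar>a (past n \<omega>)\<bar> \<le> C"
  shows "expectation (\<lambda>\<omega>. a (past n \<omega>) * Y n v \<omega>) = 0"
proof -
  have EY: "expectation (Y n v) = 0"
  proof -
    have "expectation (Y n v) = expectation (\<lambda>\<omega>. push 0 (Y n v \<omega>) (V n v \<omega>))"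
      by (intro Bochner_Integration.integral_cong refl) (simp add: push_0 V_nonneg)
    then show ?thesis using expectation_push[of 0 "\<lambda>s. s" n v] by simp
  qed
  have "expectation (\<lambda>\<omega>. a (past n \<omega>) * (\<lambda>x y w. y) (m n v \<omega>) (Y n v \<omega>) (V n v \<omega>))
    = expectation (\<lambda>\<omega>. a (past n \<omega>) * expectation (\<lambda>\<omega>'. (\<lambda>x y w. y) (m n v \<omega>) (Y n v \<omega>') (V n v \<omega>')))"
  proof (rule step_integral[OF a, where C="C * 1"])
    show "\<bar>a (past n \<omega>) * Y n v \<omega>\<bar> \<le> C * 1" for \<omega>
      unfolding abs_mult using bd[of \<omega>] Y_val[of n v \<omega>] by (intro mult_mono) auto
  qed measurable
  then show ?thesis using EY by simp
qed

text \<open>The left side is the probability that step \<open>n\<close> is subject to replacement,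
  so the cost of \<open>push\<close> is measured by the mean size of the drift.\<close>

lemma prob_V_less_m: "expectation (\<lambda>\<omega>. indicator {..<\<bar>m n v \<omega>\<bar>} (V n v \<omega>)) = expectation (\<lambda>\<omega>. \<bar>m n v \<omega>\<bar>)"
proof -
  have "expectation (\<lambda>\<omega>. (\<lambda>_. 1) (past n \<omega>) * (\<lambda>x y w. if w < \<bar>x\<bar> then 1 else 0 :: real) (m n v \<omega>) (Y n v \<omega>) (V n v \<omega>))
    = expectation (\<lambda>\<omega>. (\<lambda>_. 1) (past n \<omega>) * expectation (\<lambda>\<omega>'. (\<lambda>x y w. if w < \<bar>x\<bar> then 1 else 0 :: real) (m n v \<omega>) (Y n v \<omega>') (V n v \<omega>')))"
  proof (rule step_integral[where C=1])
    show "(\<lambda>(x :: real, y :: real, w :: real). if w < \<bar>x\<bar> then 1 else 0 :: real) \<in> borel_measurable (borel \<Otimes>\<^sub>M borel \<Otimes>\<^sub>M borel)"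
      by measurable
  qed auto
  moreover have "expectation (\<lambda>\<omega>'. if V n v \<omega>' < \<bar>m n v \<omega>\<bar> then 1 else 0 :: real) = \<bar>m n v \<omega>\<bar>" for \<omega>
  proof -
    have "expectation (\<lambda>\<omega>'. if V n v \<omega>' < \<bar>m n v \<omega>\<bar> then 1 else 0 :: real) = expectation (indicator {\<omega>' \<in> space M. V n v \<omega>' < \<bar>m n v \<omega>\<bar>})"
      by (intro Bochner_Integration.integral_cong) (auto simp: indicator_def)
    also have "\<dots> = \<bar>m n v \<omega>\<bar>" using V_prob[of "\<bar>m n v \<omega>\<bar>" n v] m_bound[of n v \<omega>] by simp
    finally show ?thesis .
  qed
  ultimately show ?thesis by (simp add: indicator_def of_bool_def)
qed

text \<open>The Azuma-Hoeffding bound: the last step is integrated out given the past, and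
  \<open>hoeffding_two_point\<close> costs a factor \<open>exp (\<theta>\<^sup>2 / 2)\<close> per
  step.\<close>

lemma expectation_exp_eps_sum:
  assumes "s \<le> n"
  shows "expectation (\<lambda>\<omega>. exp (\<theta> * (\<Sum>i=s..<n. eps i v \<omega>))) \<le> exp (\<theta>\<^sup>2 / 2 * real (n - s))"
  using assms
proof (induction n rule: dec_induct)
  case base
  then show ?case using prob_space by simp
next
  case (step n)
  define a where "a c = exp (\<theta> * (\<Sum>i=s..<n. hist_of c (Suc i) (Suc i) v - m_of i v c))" for c
  have [measurable]: "(\<lambda>c. hist_of c (Suc i) (Suc i) v) \<in> borel_measurable (past_space n)" "m_of i v \<in> borel_measurable (past_space n)"
    if "i \<in> {s..<n}" for i
    using that by (auto intro: hist_of_measurable m_of_measurable)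
  have am: "a \<in> borel_measurable (past_space n)" unfolding a_def by measurable
  have ap: "a (past n \<omega>) = exp (\<theta> * (\<Sum>i=s..<n. eps i v \<omega>))" for \<omega>
    unfolding a_def by (intro arg_cong[where f="\<lambda>x. exp (\<theta> * x)"] sum.cong refl) (auto simp: eps_of_past[of _ n])
  have sb: "\<bar>\<Sum>i=s..<n. eps i v \<omega>\<bar> \<le> real (n - s) * 2" for \<omega> n
    using order_trans[OF sum_abs sum_bounded_above[of "{s..<n}" "\<lambda>i. \<bar>eps i v \<omega>\<bar>" 2]] eps_bound by simp
  have eb: "exp (\<theta> * (\<Sum>i=s..<n. eps i v \<omega>)) \<le> exp (\<bar>\<theta>\<bar> * (real (n - s) * 2))" for \<omega> n
  proof -
    have "\<theta> * (\<Sum>i=s..<n. eps i v \<omega>) \<le> \<bar>\<theta>\<bar> * \<bar>\<Sum>i=s..<n. eps i v \<omega>\<bar>" by (metis abs_ge_self abs_mult)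
    also have "\<dots> \<le> \<bar>\<theta>\<bar> * (real (n - s) * 2)" by (intro mult_left_mono sb) auto
    finally show ?thesis by simp
  qed
  have "expectation (\<lambda>\<omega>. exp (\<theta> * (\<Sum>i=s..<Suc n. eps i v \<omega>))) = expectation (\<lambda>\<omega>. a (past n \<omega>) * (\<lambda>x s. exp (\<theta> * (s - x))) (m n v \<omega>) (X (Suc n) v \<omega>))"
    using step.hyps by (simp add: ap exp_add[symmetric] eps_def distrib_left)
  also have "\<dots> = expectation (\<lambda>\<omega>. a (past n \<omega>) * ((1 + m n v \<omega>) / 2 * exp (\<theta> * (1 - m n v \<omega>)) + (1 - m n v \<omega>) / 2 * exp (\<theta> * (- 1 - m n v \<omega>))))"
  proof (rule step_expectation[OF am, where C="exp (\<bar>\<theta>\<bar> * (real (Suc n - s) * 2))"])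
    fix \<omega>
    have "a (past n \<omega>) * exp (\<theta> * (X (Suc n) v \<omega> - m n v \<omega>)) = exp (\<theta> * (\<Sum>i=s..<Suc n. eps i v \<omega>))"
      using step.hyps by (simp add: ap exp_add[symmetric] eps_def distrib_left)
    then have "a (past n \<omega>) * exp (\<theta> * (X (Suc n) v \<omega> - m n v \<omega>)) \<le> exp (\<bar>\<theta>\<bar> * (real (Suc n - s) * 2))"
      using eb[of \<omega> "Suc n"] by (simp only:)
    moreover have "0 \<le> a (past n \<omega>) * exp (\<theta> * (X (Suc n) v \<omega> - m n v \<omega>))" by (simp add: ap)
    ultimately show "\<bar>a (past n \<omega>) * exp (\<theta> * (X (Suc n) v \<omega> - m n v \<omega>))\<bar> \<le> exp (\<bar>\<theta>\<bar> * (real (Suc n - s) * 2))"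
      by (simp only: abs_of_nonneg)
  qed measurable
  also have "\<dots> \<le> expectation (\<lambda>\<omega>. a (past n \<omega>) * exp (\<theta>\<^sup>2 / 2))"
  proof (rule integral_mono')
    show "integrable M (\<lambda>\<omega>. a (past n \<omega>) * exp (\<theta>\<^sup>2 / 2))"
      unfolding ap
    proof (intro integrable_mult_left integrable_bounded)
      show "\<bar>exp (\<theta> * (\<Sum>i=s..<n. eps i v \<omega>))\<bar> \<le> exp (\<bar>\<theta>\<bar> * (real (n - s) * 2))" for \<omega>
        using eb[of \<omega> n] by (simp only: abs_exp_cancel)
    qed measurable
    fix \<omega>
    show "a (past n \<omega>) * ((1 + m n v \<omega>) / 2 * exp (\<theta> * (1 - m n v \<omega>)) + (1 - m n v \<omega>) / 2 * exp (\<theta> * (- 1 - m n v \<omega>))) \<le> a (past n \<omega>) * exp (\<theta>\<^sup>2 / 2)"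
      by (intro mult_left_mono hoeffding_two_point m_bound) (simp add: ap)
    show "0 \<le> a (past n \<omega>) * exp (\<theta>\<^sup>2 / 2)" by (simp add: ap)
  qed
  also have "\<dots> = exp (\<theta>\<^sup>2 / 2) * expectation (\<lambda>\<omega>. exp (\<theta> * (\<Sum>i=s..<n. eps i v \<omega>)))"
    by (simp add: ap mult.commute)
  also have "\<dots> \<le> exp (\<theta>\<^sup>2 / 2) * exp (\<theta>\<^sup>2 / 2 * real (n - s))"
    using step.IH by (intro mult_left_mono) auto
  also have "\<dots> = exp (\<theta>\<^sup>2 / 2 * real (Suc n - s))"
  proof -
    have "real (Suc n - s) = 1 + real (n - s)" using step.hyps(1) by (simp add: Suc_diff_le)
    then show ?thesis by (simp only: exp_add[symmetric] distrib_left mult_1_right)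
  qed
  finally show ?case .
qed

text \<open>Scaled by sqrt (L n), the window sums have exponential moments bounded uniformly in
  \<open>n\<close>. The polynomial almost sure bound on the exponentials becomes logarithmic for the
  sums themselves.\<close>

lemma AE_eps_fluctuation:
  assumes s: "\<And>n. s n \<le> n" and L: "\<And>n. real (n - s n) \<le> L n" "\<And>n. 0 < L n"
  shows "AE \<omega> in M. \<exists>K>0. \<forall>n. \<bar>\<Sum>i=s n..<n. eps i v \<omega>\<bar> \<le> sqrt (L n) * (K + 2 * ln (real n + 1))"
proof -
  define D where "D n \<omega> = (\<Sum>i=s n..<n. eps i v \<omega>) / sqrt (L n)" for n \<omega>
  have [measurable]: "D n \<in> borel_measurable M" for n unfolding D_def by measurable
  have sb: "\<bar>\<Sum>i=s n..<n. eps i v \<omega>\<bar> \<le> real (n - s n) * 2" for \<omega> n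
    using order_trans[OF sum_abs sum_bounded_above[of "{s n..<n}" "\<lambda>i. \<bar>eps i v \<omega>\<bar>" 2]] eps_bound by simp
  have Db: "\<bar>D n \<omega>\<bar> \<le> real (n - s n) * 2 / sqrt (L n)" for n \<omega>
    unfolding D_def abs_divide using sb[of \<omega> n] L(2)[of n] by (simp add: divide_right_mono)
  have E1: "expectation (\<lambda>\<omega>. exp (c * D n \<omega>)) \<le> exp (1 / 2)" if c: "c\<^sup>2 = 1" for c n
  proof -
    have "expectation (\<lambda>\<omega>. exp (c * D n \<omega>)) = expectation (\<lambda>\<omega>. exp ((c / sqrt (L n)) * (\<Sum>i=s n..<n. eps i v \<omega>)))"
      by (simp add: D_def)
    also have "\<dots> \<le> exp ((c / sqrt (L n))\<^sup>2 / 2 * real (n - s n))" by (rule expectation_exp_eps_sum[OF s])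
    also have "(c / sqrt (L n))\<^sup>2 / 2 * real (n - s n) = real (n - s n) / L n / 2"
      using c L(2)[of n] by (simp add: power_divide)
    also have "\<dots> \<le> 1 / 2" using L[of n] by simp
    finally show ?thesis by simp
  qed
  have Ei: "integrable M (\<lambda>\<omega>. exp (c * D n \<omega>))" if c: "\<bar>c\<bar> \<le> 1" for c n
  proof (rule integrable_const_bound[of _ "exp (real (n - s n) * 2 / sqrt (L n))"])
    show "AE \<omega> in M. norm (exp (c * D n \<omega>)) \<le> exp (real (n - s n) * 2 / sqrt (L n))"
    proof (rule AE_I2)
      fix \<omega>
      have "c * D n \<omega> \<le> \<bar>c\<bar> * \<bar>D n \<omega>\<bar>" by (metis abs_ge_self abs_mult)
      also have "\<dots> \<le> 1 * \<bar>D n \<omega>\<bar>" using c by (intro mult_right_mono) auto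
      finally show "norm (exp (c * D n \<omega>)) \<le> exp (real (n - s n) * 2 / sqrt (L n))" using Db[of n \<omega>] by simp
    qed
  qed measurable
  have "AE \<omega> in M. \<exists>K>0. \<forall>n. exp (D n \<omega>) + exp (- D n \<omega>) \<le> K * (real n + 1)\<^sup>2"
  proof (rule AE_bounded_of_nn_integral[where C="2 * exp (1 / 2)"])
    fix n
    have i: "integrable M (\<lambda>\<omega>. exp (D n \<omega>))" "integrable M (\<lambda>\<omega>. exp (- D n \<omega>))"
      using Ei[of 1 n] Ei[of "-1" n] by simp_all
    have "(\<integral>\<^sup>+\<omega>. ennreal (exp (D n \<omega>) + exp (- D n \<omega>)) \<partial>M) = ennreal (expectation (\<lambda>\<omega>. exp (D n \<omega>) + exp (- D n \<omega>)))"
      using i by (intro nn_integral_eq_integral) (auto simp: add_nonneg_nonneg)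
    also have "\<dots> \<le> ennreal (2 * exp (1 / 2))"
      using i E1[of 1 n] E1[of "-1" n] by (intro ennreal_leI) simp
    finally show "(\<integral>\<^sup>+\<omega>. ennreal (exp (D n \<omega>) + exp (- D n \<omega>)) \<partial>M) \<le> ennreal (2 * exp (1 / 2))" .
  qed (auto simp: add_nonneg_nonneg)
  then show ?thesis
  proof eventually_elim
    case (elim \<omega>)
    then obtain K where K: "K > 0" "\<And>n. exp (D n \<omega>) + exp (- D n \<omega>) \<le> K * (real n + 1)\<^sup>2" by blast
    have "\<bar>\<Sum>i=s n..<n. eps i v \<omega>\<bar> \<le> sqrt (L n) * ((\<bar>ln K\<bar> + 1) + 2 * ln (real n + 1))" for n
    proof -
      have "exp \<bar>D n \<omega>\<bar> \<le> exp (D n \<omega>) + exp (- D n \<omega>)" by (cases "0 \<le> D n \<omega>") auto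
      also have "\<dots> \<le> K * (real n + 1)\<^sup>2" by (rule K(2))
      finally have "ln (exp \<bar>D n \<omega>\<bar>) \<le> ln (K * (real n + 1)\<^sup>2)"
        using K(1) by (intro iffD2[OF ln_le_cancel_iff]) auto
      also have "\<dots> = ln K + 2 * ln (real n + 1)" using K(1) by (simp add: ln_mult ln_realpow)
      finally have "\<bar>D n \<omega>\<bar> \<le> (\<bar>ln K\<bar> + 1) + 2 * ln (real n + 1)" by simp
      then show ?thesis using L(2)[of n] by (simp add: D_def abs_divide divide_le_eq mult.commute)
    qed
    then show ?case by (intro exI[of _ "\<bar>ln K\<bar> + 1"]) auto
  qed
qed

end

section \<open>Second moments in the eigenbasis\<close>

locale driven_eig = driven +
  fixes T :: "'b \<Rightarrow> 'b \<Rightarrow> real" and lam :: "'b \<Rightarrow> real"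
  assumes eig: "\<And>u j. (\<Sum>v\<in>UNIV. (if (u, v) \<in> E then (2 * p v - 1) / real (in_deg E v) else 0) * T v j) = lam j * T u j"
    and orth: "\<And>u v. (\<Sum>j\<in>UNIV. T u j * T v j) = (if u = v then 1 else 0)"
    and lam_le: "lam j \<le> 1 / 2"
begin

definition S :: "nat \<Rightarrow> 'b \<Rightarrow> 'a \<Rightarrow> real" where
  "S n v \<omega> = (\<Sum>i=1..n. X i v \<omega>)"

definition Z :: "nat \<Rightarrow> 'b \<Rightarrow> 'a \<Rightarrow> real" where
  "Z n j \<omega> = (\<Sum>v\<in>UNIV. S n v \<omega> * T v j)"

lemma Z_measurable[measurable]: "Z n j \<in> borel_measurable M"
  unfolding Z_def S_def by measurable

lemma m_eq: "1 \<le> n \<Longrightarrow> m n v \<omega> = (\<Sum>u\<in>UNIV. S n u \<omega> * (if (u, v) \<in> E then (2 * p v - 1) / real (in_deg E v) else 0)) / real n"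
proof -
  assume n: "1 \<le> n"
  have "(\<Sum>u\<in>UNIV. S n u \<omega> * (if (u, v) \<in> E then (2 * p v - 1) / real (in_deg E v) else 0))
    = (\<Sum>u\<in>in_nbrs E v. S n u \<omega> * ((2 * p v - 1) / real (in_deg E v)))"
    unfolding in_nbrs_def by (rule sum.mono_neutral_cong_right) auto
  also have "\<dots> = (2 * p v - 1) * (\<Sum>u\<in>in_nbrs E v. S n u \<omega>) / real (in_deg E v)"
    unfolding sum_distrib_left sum_divide_distrib by (intro sum.cong refl) simp
  finally show ?thesis using n by (simp add: m_def drift_def S_def)
qed

text \<open>The drift vector is S B / n, and multiplying by an eigenvector of \<open>B\<close> turns
  it into a multiple of \<open>Z n j\<close>.\<close>

lemma Z_Suc:
  assumes n: "1 \<le> n"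
  shows "Z (Suc n) j \<omega> = (1 + lam j / real n) * Z n j \<omega> + (\<Sum>v\<in>UNIV. eps n v \<omega> * T v j)"
proof -
  define B where "B u v = (if (u, v) \<in> E then (2 * p v - 1) / real (in_deg E v) else 0)" for u v
  have eig': "(\<Sum>v\<in>UNIV. B u v * T v j) = lam j * T u j" for u
    using eig by (simp only: B_def)
  have m_eq': "m n v \<omega> = (\<Sum>u\<in>UNIV. S n u \<omega> * B u v) / real n" for v
    using m_eq[OF n] by (simp only: B_def)
  have "Z (Suc n) j \<omega> = Z n j \<omega> + (\<Sum>v\<in>UNIV. X (Suc n) v \<omega> * T v j)"
    by (simp add: Z_def S_def distrib_right sum.distrib)
  also have "(\<Sum>v\<in>UNIV. X (Suc n) v \<omega> * T v j) = (\<Sum>v\<in>UNIV. m n v \<omega> * T v j) + (\<Sum>v\<in>UNIV. eps n v \<omega> * T v j)"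
    by (simp add: eps_def sum.distrib[symmetric] algebra_simps)
  also have "(\<Sum>v\<in>UNIV. m n v \<omega> * T v j) = (\<Sum>v\<in>UNIV. \<Sum>u\<in>UNIV. S n u \<omega> * (B u v * T v j) / real n)"
    unfolding m_eq' by (intro sum.cong refl) (simp add: sum_divide_distrib sum_distrib_right mult.assoc)
  also have "\<dots> = (\<Sum>u\<in>UNIV. \<Sum>v\<in>UNIV. S n u \<omega> * (B u v * T v j) / real n)"
    by (rule sum.swap)
  also have "\<dots> = (\<Sum>u\<in>UNIV. S n u \<omega> * (lam j * T u j) / real n)"
    unfolding eig'[symmetric] by (intro sum.cong refl) (simp add: sum_divide_distrib sum_distrib_left)
  also have "\<dots> = lam j / real n * Z n j \<omega>"
    unfolding Z_def sum_distrib_left by (intro sum.cong refl) simp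
  finally show ?thesis by (simp add: algebra_simps)
qed

definition "tau j = (\<Sum>v\<in>UNIV. \<bar>T v j\<bar>)"

lemma Z_bound: "\<bar>Z n j \<omega>\<bar> \<le> real n * tau j"
proof -
  have "\<bar>S n v \<omega>\<bar> \<le> real n" for v
    unfolding S_def using X_bound order_trans[OF sum_abs sum_bounded_above[of "{1..n}" "\<lambda>i. \<bar>X i v \<omega>\<bar>" 1]] by simp
  then have "\<bar>Z n j \<omega>\<bar> \<le> (\<Sum>v\<in>UNIV. real n * \<bar>T v j\<bar>)"
    unfolding Z_def by (intro order_trans[OF sum_abs] sum_mono) (simp add: abs_mult mult_right_mono)
  then show ?thesis by (simp add: tau_def sum_distrib_left)
qed

lemma S_eq: "S n u \<omega> = (\<Sum>j\<in>UNIV. Z n j \<omega> * T u j)"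
proof -
  have "(\<Sum>j\<in>UNIV. Z n j \<omega> * T u j) = (\<Sum>v\<in>UNIV. S n v \<omega> * (\<Sum>j\<in>UNIV. T v j * T u j))"
    unfolding Z_def sum_distrib_right sum_distrib_left by (subst sum.swap) (simp add: mult.assoc)
  then show ?thesis by (simp add: orth if_distrib cong: if_cong)
qed

text \<open>The martingale part is orthogonal to \<open>Z n j\<close>, so the second moment obeys a
  recursion with multiplier (1 + lam/n)^2 and bounded forcing. As 2 lam is at most 1, the multiplier
  is eventually below 1 + (5/4)/n; growth n^(3/2) leaves room above 5/4 and avoids logarithms at lam
  = 1/2.\<close>

lemma second_moment_Z: "\<exists>K\<ge>0. \<forall>n\<ge>1. expectation (\<lambda>\<omega>. (Z n j \<omega>)\<^sup>2) \<le> K * real n powr (3 / 2)"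
proof (rule recursion_rate[where \<mu>="5 / 4" and C="(2 * tau j)\<^sup>2"])
  show "0 \<le> expectation (\<lambda>\<omega>. (Z n j \<omega>)\<^sup>2)" for n by (intro integral_nonneg_AE) auto
  have "((\<lambda>x. 4 * x * ((1 + lam j / x)\<^sup>2 - 1)) \<longlongrightarrow> 8 * lam j) at_top" by real_asymp
  then have "eventually (\<lambda>x. 4 * x * ((1 + lam j / x)\<^sup>2 - 1) < 5) at_top"
    using lam_le[of j] by (intro order_tendstoD(2)) auto
  then have ev: "eventually (\<lambda>n. 4 * real n * ((1 + lam j / real n)\<^sup>2 - 1) < 5) sequentially"
    by (rule eventually_compose_filterlim[OF _ filterlim_real_sequentially])
  show "eventually (\<lambda>n. expectation (\<lambda>\<omega>. (Z (Suc n) j \<omega>)\<^sup>2) \<le> (1 + 5 / 4 / real n) * expectation (\<lambda>\<omega>. (Z n j \<omega>)\<^sup>2)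
      + (2 * tau j)\<^sup>2 * real n powr (3 / 2 - 1)) sequentially"
    using ev eventually_ge_at_top[of 1]
  proof eventually_elim
    case (elim n)
    define e where "e \<omega> = (\<Sum>v\<in>UNIV. eps n v \<omega> * T v j)" for \<omega>
    have em[measurable]: "e \<in> borel_measurable M" unfolding e_def by measurable
    have eb: "\<bar>e \<omega>\<bar> \<le> 2 * tau j" for \<omega>
    proof -
      have "\<bar>e \<omega>\<bar> \<le> (\<Sum>v\<in>UNIV. 2 * \<bar>T v j\<bar>)"
        unfolding e_def by (intro order_trans[OF sum_abs] sum_mono) (simp add: abs_mult mult_right_mono eps_bound)
      then show ?thesis by (simp add: tau_def sum_distrib_left)
    qed
    have t0: "0 \<le> tau j" by (simp add: tau_def sum_nonneg)
    define c where "c = 1 + lam j / real n"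
    have i1: "integrable M (\<lambda>\<omega>. (Z n j \<omega>)\<^sup>2)"
      by (rule integrable_bounded[where C="(real n * tau j)\<^sup>2"]) (measurable, simp only: abs_power2, rule sq_le_of_abs_le[OF Z_bound])
    have i2: "integrable M (\<lambda>\<omega>. Z n j \<omega> * e \<omega>)"
      by (rule integrable_bounded[where C="(real n * tau j) * (2 * tau j)"]) (measurable, rule abs_mult_le[OF Z_bound eb])
    have i3: "integrable M (\<lambda>\<omega>. (e \<omega>)\<^sup>2)"
      by (rule integrable_bounded[where C="(2 * tau j)\<^sup>2"]) (measurable, simp only: abs_power2, rule sq_le_of_abs_le[OF eb])
    have Ze: "expectation (\<lambda>\<omega>. Z n j \<omega> * e \<omega>) = 0"
    proof -
      define a where "a c = (\<Sum>v\<in>UNIV. (\<Sum>i=1..n. hist_of c n i v) * T v j)" for c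
      have [measurable]: "(\<lambda>c. hist_of c n i v) \<in> borel_measurable (past_space n)" for i v by (rule hist_of_measurable) simp
      have am: "a \<in> borel_measurable (past_space n)" unfolding a_def by measurable
      have ap: "a (past n \<omega>) = Z n j \<omega>" for \<omega>
        by (simp add: a_def Z_def S_def hist_of_past)
      have z: "expectation (\<lambda>\<omega>. Z n j \<omega> * eps n v \<omega>) = 0" for v
        using expectation_mult_eps[OF am, of "real n * tau j" v] Z_bound[of n j] by (simp add: ap)
      have "expectation (\<lambda>\<omega>. Z n j \<omega> * e \<omega>) = expectation (\<lambda>\<omega>. \<Sum>v\<in>UNIV. T v j * (Z n j \<omega> * eps n v \<omega>))"
        by (simp add: e_def sum_distrib_left algebra_simps)
      also have "\<dots> = (\<Sum>v\<in>UNIV. T v j * expectation (\<lambda>\<omega>. Z n j \<omega> * eps n v \<omega>))"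
      proof -
        have "integrable M (\<lambda>\<omega>. Z n j \<omega> * eps n v \<omega>)" for v
          by (rule integrable_bounded[where C="(real n * tau j) * 2"]) (measurable, rule abs_mult_le[OF Z_bound eps_bound])
        then show ?thesis by (subst Bochner_Integration.integral_sum) auto
      qed
      finally show ?thesis by (simp add: z)
    qed
    have "(Z (Suc n) j \<omega>)\<^sup>2 = c\<^sup>2 * (Z n j \<omega>)\<^sup>2 + 2 * c * (Z n j \<omega> * e \<omega>) + (e \<omega>)\<^sup>2" for \<omega>
      using Z_Suc[OF elim(2), of j \<omega>] by (simp add: c_def e_def power2_eq_square algebra_simps)
    then have "expectation (\<lambda>\<omega>. (Z (Suc n) j \<omega>)\<^sup>2) = c\<^sup>2 * expectation (\<lambda>\<omega>. (Z n j \<omega>)\<^sup>2) + expectation (\<lambda>\<omega>. (e \<omega>)\<^sup>2)"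
      using i1 i2 i3 by (simp add: Ze)
    also have "expectation (\<lambda>\<omega>. (e \<omega>)\<^sup>2) \<le> (2 * tau j)\<^sup>2"
    proof -
      have "expectation (\<lambda>\<omega>. (e \<omega>)\<^sup>2) \<le> expectation (\<lambda>\<omega>. (2 * tau j)\<^sup>2)"
        by (rule integral_mono[OF i3]) (simp, rule sq_le_of_abs_le[OF eb])
      then show ?thesis using prob_space by simp
    qed
    also have "(2 * tau j)\<^sup>2 \<le> (2 * tau j)\<^sup>2 * real n powr (3 / 2 - 1)"
      using elim ge_one_powr_ge_zero[of "real n" "3 / 2 - 1"] by (simp add: mult_le_cancel_left1)
    also have "c\<^sup>2 * expectation (\<lambda>\<omega>. (Z n j \<omega>)\<^sup>2) \<le> (1 + 5 / 4 / real n) * expectation (\<lambda>\<omega>. (Z n j \<omega>)\<^sup>2)"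
    proof (intro mult_right_mono)
      show "c\<^sup>2 \<le> 1 + 5 / 4 / real n" using elim by (simp add: c_def field_simps)
    qed (auto intro!: integral_nonneg_AE)
    finally show ?case by simp
  qed
qed simp

text \<open>The drift is a linear combination of the \<open>Z n j\<close> divided by
  \<open>n\<close>. A second moment of order n^(3/2) gives a first moment of order n^(3/4), here
  through \<open>abs_le_half_sum_square\<close> with c = n^(3/4).\<close>

lemma expectation_abs_m: "\<exists>K\<ge>0. \<forall>n\<ge>1. expectation (\<lambda>\<omega>. \<bar>m n v \<omega>\<bar>) \<le> K * real n powr (- 1 / 4)"
proof -
  obtain K where K: "\<And>j. 0 \<le> K j" "\<And>j n. 1 \<le> n \<Longrightarrow> expectation (\<lambda>\<omega>. (Z n j \<omega>)\<^sup>2) \<le> K j * real n powr (3 / 2)"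
    using second_moment_Z by metis
  define b where "b u = \<bar>if (u, v) \<in> E then (2 * p v - 1) / real (in_deg E v) else 0\<bar>" for u
  define C where "C = (\<Sum>u\<in>UNIV. \<Sum>j\<in>UNIV. b u * \<bar>T u j\<bar> * ((1 + K j) / 2))"
  have C0: "0 \<le> C" unfolding C_def by (intro sum_nonneg mult_nonneg_nonneg) (auto simp: b_def K add_nonneg_nonneg)
  have "expectation (\<lambda>\<omega>. \<bar>m n v \<omega>\<bar>) \<le> C * real n powr (- 1 / 4)" if n: "1 \<le> n" for n
  proof -
    have iZ: "integrable M (\<lambda>\<omega>. \<bar>Z n j \<omega>\<bar>)" for j
      using Z_bound[of n j] by (intro integrable_const_bound[of _ "real n * tau j"]) (auto intro!: AE_I2)
    have iZ2: "integrable M (\<lambda>\<omega>. (Z n j \<omega>)\<^sup>2)" for j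
      by (rule integrable_bounded[where C="(real n * tau j)\<^sup>2"]) (measurable, simp only: abs_power2, rule sq_le_of_abs_le[OF Z_bound])
    have EZ: "expectation (\<lambda>\<omega>. \<bar>Z n j \<omega>\<bar>) \<le> (1 + K j) / 2 * real n powr (3 / 4)" for j
    proof -
      have c: "0 < real n powr (3 / 4)" using n by simp
      have "expectation (\<lambda>\<omega>. \<bar>Z n j \<omega>\<bar>) \<le> expectation (\<lambda>\<omega>. (real n powr (3 / 4) + (Z n j \<omega>)\<^sup>2 / real n powr (3 / 4)) / 2)"
        using iZ iZ2 by (intro integral_mono abs_le_half_sum_square c) auto
      also have "\<dots> = (real n powr (3 / 4) + expectation (\<lambda>\<omega>. (Z n j \<omega>)\<^sup>2) / real n powr (3 / 4)) / 2"
        using iZ2 prob_space by simp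
      also have "\<dots> \<le> (real n powr (3 / 4) + K j * real n powr (3 / 2) / real n powr (3 / 4)) / 2"
        using K(2)[OF n, of j] c by (intro divide_right_mono add_left_mono) auto
      also have "K j * real n powr (3 / 2) / real n powr (3 / 4) = K j * real n powr (3 / 4)"
      proof -
        have "real n powr (3 / 2) / real n powr (3 / 4) = real n powr (3 / 4)"
          by (subst powr_diff[symmetric]) simp
        then show ?thesis by (metis times_divide_eq_right)
      qed
      finally show ?thesis by (simp add: algebra_simps)
    qed
    have mb: "\<bar>m n v \<omega>\<bar> \<le> (\<Sum>u\<in>UNIV. \<Sum>j\<in>UNIV. b u * \<bar>T u j\<bar> * \<bar>Z n j \<omega>\<bar>) / real n" for \<omega>
    proof -
      have "\<bar>m n v \<omega>\<bar> = \<bar>\<Sum>u\<in>UNIV. S n u \<omega> * (if (u, v) \<in> E then (2 * p v - 1) / real (in_deg E v) else 0)\<bar> / real n"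
        using n by (simp add: m_eq)
      also have "\<dots> \<le> (\<Sum>u\<in>UNIV. \<bar>S n u \<omega>\<bar> * b u) / real n"
        by (intro divide_right_mono order_trans[OF sum_abs]) (auto simp: abs_mult b_def)
      also have "\<dots> \<le> (\<Sum>u\<in>UNIV. (\<Sum>j\<in>UNIV. \<bar>Z n j \<omega>\<bar> * \<bar>T u j\<bar>) * b u) / real n"
        unfolding S_eq by (intro divide_right_mono sum_mono mult_right_mono order_trans[OF sum_abs]) (auto simp: abs_mult b_def)
      also have "\<dots> = (\<Sum>u\<in>UNIV. \<Sum>j\<in>UNIV. b u * \<bar>T u j\<bar> * \<bar>Z n j \<omega>\<bar>) / real n"
        unfolding sum_distrib_right by (intro arg_cong2[where f="(/)"] sum.cong refl) (simp add: ac_simps)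
      finally show ?thesis .
    qed
    have "expectation (\<lambda>\<omega>. \<bar>m n v \<omega>\<bar>) \<le> expectation (\<lambda>\<omega>. (\<Sum>u\<in>UNIV. \<Sum>j\<in>UNIV. b u * \<bar>T u j\<bar> * \<bar>Z n j \<omega>\<bar>) / real n)"
      using mb iZ m_bound[of n v]
      by (intro integral_mono) (auto intro!: integrable_const_bound[of _ 1] AE_I2 Bochner_Integration.integrable_sum)
    also have "\<dots> = (\<Sum>u\<in>UNIV. \<Sum>j\<in>UNIV. b u * \<bar>T u j\<bar> * expectation (\<lambda>\<omega>. \<bar>Z n j \<omega>\<bar>)) / real n"
      using iZ by (simp add: Bochner_Integration.integral_sum)
    also have "\<dots> \<le> (\<Sum>u\<in>UNIV. \<Sum>j\<in>UNIV. b u * \<bar>T u j\<bar> * ((1 + K j) / 2 * real n powr (3 / 4))) / real n"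
      using EZ by (intro divide_right_mono sum_mono mult_left_mono) (auto simp: b_def)
    also have "\<dots> = C * (real n powr (3 / 4) / real n)"
      by (simp add: C_def sum_distrib_right sum_divide_distrib mult.assoc)
    also have "real n powr (3 / 4) / real n = real n powr (- 1 / 4)"
    proof -
      have "real n powr (3 / 4) / real n powr 1 = real n powr (3 / 4 - 1)" by (rule powr_diff[symmetric])
      then show ?thesis using n by simp
    qed
    finally show ?thesis .
  qed
  then show ?thesis using C0 by blast
qed

text \<open>The accumulated difference between the actual martingale differences and the fair signs
  behind them, itself a martingale.\<close>

definition Q :: "nat \<Rightarrow> 'b \<Rightarrow> 'a \<Rightarrow> real" where
  "Q n v \<omega> = (\<Sum>i<n. eps i v \<omega> - Y i v \<omega>)"

lemma Q_measurable[measurable]: "Q n v \<in> borel_measurable M"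
  unfolding Q_def by measurable

lemma Q_bound: "\<bar>Q n v \<omega>\<bar> \<le> real n * 3"
proof -
  have "\<bar>eps i v \<omega> - Y i v \<omega>\<bar> \<le> 3" for i
    using eps_bound[of i v \<omega>] Y_val[of i v \<omega>] by (auto simp: abs_le_iff)
  then show ?thesis unfolding Q_def
    using order_trans[OF sum_abs sum_bounded_above[of "{..<n}" "\<lambda>i. \<bar>eps i v \<omega> - Y i v \<omega>\<bar>" 3]] by simp
qed

text \<open>Increments of \<open>Q\<close> are orthogonal, and each has second moment at most 10
  E|m|, of order n^(-1/4). Summation gives n^(3/4).\<close>

lemma second_moment_Q: "\<exists>K\<ge>0. \<forall>n\<ge>1. expectation (\<lambda>\<omega>. (Q n v \<omega>)\<^sup>2) \<le> K * real n powr (3 / 4)"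
proof -
  obtain K where K: "0 \<le> K" "\<And>n. 1 \<le> n \<Longrightarrow> expectation (\<lambda>\<omega>. \<bar>m n v \<omega>\<bar>) \<le> K * real n powr (- 1 / 4)"
    using expectation_abs_m[of v] by blast
  show ?thesis
  proof (rule recursion_rate[where \<mu>=0 and C="10 * K"])
    show "0 \<le> expectation (\<lambda>\<omega>. (Q n v \<omega>)\<^sup>2)" for n by (intro integral_nonneg_AE) auto
    show "eventually (\<lambda>n. expectation (\<lambda>\<omega>. (Q (Suc n) v \<omega>)\<^sup>2) \<le> (1 + 0 / real n) * expectation (\<lambda>\<omega>. (Q n v \<omega>)\<^sup>2)
        + 10 * K * real n powr (3 / 4 - 1)) sequentially"
      using eventually_ge_at_top[of 1]
    proof eventually_elim
      case (elim n)
      define d where "d \<omega> = eps n v \<omega> - Y n v \<omega>" for \<omega>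
      have [measurable]: "d \<in> borel_measurable M" unfolding d_def by measurable
      have db: "\<bar>d \<omega>\<bar> \<le> 3" for \<omega>
        using eps_bound[of n v \<omega>] Y_val[of n v \<omega>] by (auto simp: abs_le_iff d_def)
      have i1: "integrable M (\<lambda>\<omega>. (Q n v \<omega>)\<^sup>2)"
        by (rule integrable_bounded[where C="(real n * 3)\<^sup>2"]) (measurable, simp only: abs_power2, rule sq_le_of_abs_le[OF Q_bound])
      have i2: "integrable M (\<lambda>\<omega>. Q n v \<omega> * d \<omega>)"
        by (rule integrable_bounded[where C="(real n * 3) * 3"]) (measurable, rule abs_mult_le[OF Q_bound db])
      have i3: "integrable M (\<lambda>\<omega>. (d \<omega>)\<^sup>2)"
        by (rule integrable_bounded[where C="3\<^sup>2"]) (measurable, simp only: abs_power2, rule sq_le_of_abs_le[OF db])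
      have Qd: "expectation (\<lambda>\<omega>. Q n v \<omega> * d \<omega>) = 0"
      proof -
        define a where "a c = (\<Sum>i<n. hist_of c (Suc i) (Suc i) v - m_of i v c - c (i, v, True))" for c
        have [measurable]: "(\<lambda>c. hist_of c (Suc i) (Suc i) v) \<in> borel_measurable (past_space n)" "m_of i v \<in> borel_measurable (past_space n)"
          "(\<lambda>c. c (i, v, True)) \<in> borel_measurable (past_space n)" if "i \<in> {..<n}" for i
          by (rule hist_of_measurable m_of_measurable measurable_component_singleton; use that in \<open>simp add: past_idx_def\<close>)+
        have am: "a \<in> borel_measurable (past_space n)" unfolding a_def by measurable
        have ap: "a (past n \<omega>) = Q n v \<omega>" for \<omega>
          unfolding a_def Q_def by (intro sum.cong refl) (simp add: eps_of_past Y_of_past)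
        have 1: "expectation (\<lambda>\<omega>. Q n v \<omega> * eps n v \<omega>) = 0"
          using expectation_mult_eps[OF am, of "real n * 3" v] Q_bound[of n v] by (simp add: ap)
        have 2: "expectation (\<lambda>\<omega>. Q n v \<omega> * Y n v \<omega>) = 0"
          using expectation_mult_Y[OF am, of "real n * 3" v] Q_bound[of n v] by (simp add: ap)
        have "integrable M (\<lambda>\<omega>. Q n v \<omega> * eps n v \<omega>)"
          by (rule integrable_bounded[where C="(real n * 3) * 2"]) (measurable, rule abs_mult_le[OF Q_bound eps_bound])
        moreover have Yb: "\<bar>Y n v \<omega>\<bar> \<le> 1" for \<omega> using Y_val[of n v \<omega>] by auto
        have "integrable M (\<lambda>\<omega>. Q n v \<omega> * Y n v \<omega>)"
          by (rule integrable_bounded[where C="(real n * 3) * 1"]) (measurable, rule abs_mult_le[OF Q_bound Yb])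
        ultimately show ?thesis using 1 2 by (simp add: d_def right_diff_distrib)
      qed
      \<comment> \<open>\<open>d\<close> is a jump minus the drift. The jump vanishes unless
        \<open>V\<close> falls below \<open>\<bar>m\<bar>\<close>, has size at most 2 otherwise, and
        the squared drift is at most \<open>\<bar>m\<bar>\<close>.\<close>
      have dsq: "(d \<omega>)\<^sup>2 \<le> 8 * indicator {..<\<bar>m n v \<omega>\<bar>} (V n v \<omega>) + 2 * \<bar>m n v \<omega>\<bar>" for \<omega>
      proof -
        define y where "y = X (Suc n) v \<omega> - Y n v \<omega>"
        have d: "d \<omega> = y - m n v \<omega>" by (simp add: d_def eps_def y_def)
        have "0 \<le> (y + m n v \<omega>)\<^sup>2" by simp
        then have "(d \<omega>)\<^sup>2 \<le> 2 * y\<^sup>2 + 2 * (m n v \<omega>)\<^sup>2" unfolding d by (simp add: power2_eq_square algebra_simps)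
        moreover have "(m n v \<omega>)\<^sup>2 \<le> \<bar>m n v \<omega>\<bar>"
          using mult_left_mono[OF m_bound[of n v \<omega>], of "\<bar>m n v \<omega>\<bar>"] by (simp add: power2_eq_square abs_mult_self_eq)
        moreover have "y\<^sup>2 \<le> 4 * indicator {..<\<bar>m n v \<omega>\<bar>} (V n v \<omega>)"
        proof (cases "V n v \<omega> < \<bar>m n v \<omega>\<bar>")
          case True
          have "\<bar>y\<bar> \<le> 2" using X_bound[of "Suc n" v \<omega>] Y_val[of n v \<omega>] by (auto simp: y_def abs_le_iff)
          then have "\<bar>y\<bar>\<^sup>2 \<le> 2\<^sup>2" by (intro power_mono) auto
          then show ?thesis using True by simp
        qed (simp add: y_def X_Suc push_def)
        ultimately show ?thesis by linarith
      qed
      have im: "integrable M (\<lambda>\<omega>. \<bar>m n v \<omega>\<bar>)"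
        using m_bound[of n v] by (intro integrable_const_bound[of _ 1]) (auto intro!: AE_I2)
      have iv: "integrable M (\<lambda>\<omega>. indicator {..<\<bar>m n v \<omega>\<bar>} (V n v \<omega>) :: real)"
      proof (rule integrable_const_bound[of _ 1])
        have "(\<lambda>\<omega>. indicator {..<\<bar>m n v \<omega>\<bar>} (V n v \<omega>) :: real) = (\<lambda>\<omega>. if V n v \<omega> < \<bar>m n v \<omega>\<bar> then 1 else 0)"
          by (auto simp: fun_eq_iff)
        then show "(\<lambda>\<omega>. indicator {..<\<bar>m n v \<omega>\<bar>} (V n v \<omega>) :: real) \<in> borel_measurable M" by simp
      qed auto
      have "expectation (\<lambda>\<omega>. (d \<omega>)\<^sup>2) \<le> expectation (\<lambda>\<omega>. 8 * indicator {..<\<bar>m n v \<omega>\<bar>} (V n v \<omega>) + 2 * \<bar>m n v \<omega>\<bar>)"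
        using i3 im iv by (intro integral_mono dsq) auto
      also have "\<dots> = 10 * expectation (\<lambda>\<omega>. \<bar>m n v \<omega>\<bar>)"
        using im iv by (simp add: prob_V_less_m)
      also have "\<dots> \<le> 10 * (K * real n powr (- 1 / 4))"
        using K(2)[OF elim] by (intro mult_left_mono) auto
      finally have Ed: "expectation (\<lambda>\<omega>. (d \<omega>)\<^sup>2) \<le> 10 * K * real n powr (- 1 / 4)" by simp
      have "(Q (Suc n) v \<omega>)\<^sup>2 = (Q n v \<omega>)\<^sup>2 + 2 * (Q n v \<omega> * d \<omega>) + (d \<omega>)\<^sup>2" for \<omega>
        by (simp add: Q_def d_def power2_eq_square algebra_simps)
      then have "expectation (\<lambda>\<omega>. (Q (Suc n) v \<omega>)\<^sup>2) = expectation (\<lambda>\<omega>. (Q n v \<omega>)\<^sup>2) + expectation (\<lambda>\<omega>. (d \<omega>)\<^sup>2)"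
        using i1 i2 i3 by (simp add: Qd)
      then show ?case using Ed by simp
    qed
  qed simp
qed

end

subsection \<open>The law of the walk\<close>

text \<open>Transition probabilities in multiplied form on cylinder events, so that histories of
  probability zero need no separate treatment. The driven walk and the ERWG process both satisfy it,
  and their laws are compared through it.\<close>

definition has_drift_law ::
  "'a measure \<Rightarrow> ('k::finite \<times> 'k) set \<Rightarrow> ('k \<Rightarrow> real) \<Rightarrow> ('k \<Rightarrow> real) \<Rightarrow> (nat \<Rightarrow> 'k \<Rightarrow> 'a \<Rightarrow> real) \<Rightarrow> bool" where
  "has_drift_law M E p q X \<longleftrightarrow>
     (\<forall>n v. X n v \<in> borel_measurable M) \<and>
     (AE \<omega> in M. \<forall>n\<ge>1. \<forall>v. X n v \<omega> = 1 \<or> X n v \<omega> = -1) \<and>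
     (\<forall>n (x :: nat \<Rightarrow> 'k \<Rightarrow> int). (\<forall>i\<in>{1..Suc n}. \<forall>v. x i v = 1 \<or> x i v = -1) \<longrightarrow>
        measure M {\<omega> \<in> space M. \<forall>i\<in>{1..Suc n}. \<forall>v. X i v \<omega> = real_of_int (x i v)}
        = measure M {\<omega> \<in> space M. \<forall>i\<in>{1..n}. \<forall>v. X i v \<omega> = real_of_int (x i v)}
          * (\<Prod>v\<in>UNIV. (1 + real_of_int (x (Suc n) v) * drift E p q (\<lambda>i u. real_of_int (x i u)) n v) / 2))"

lemma drift_law_history:
  assumes M: "prob_space M" "has_drift_law M E p q X" and N: "prob_space N" "has_drift_law N E p q X'"
    and x: "\<forall>i\<in>{1..n}. \<forall>v. x i v = 1 \<or> x i v = (-1 :: int)"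
  shows "measure M {\<omega> \<in> space M. \<forall>i\<in>{1..n}. \<forall>v. X i v \<omega> = real_of_int (x i v)}
    = measure N {\<omega> \<in> space N. \<forall>i\<in>{1..n}. \<forall>v. X' i v \<omega> = real_of_int (x i v)}"
  using x
proof (induction n)
  case 0
  then show ?case using prob_space.prob_space[OF M(1)] prob_space.prob_space[OF N(1)] by simp
next
  case (Suc n)
  then have "\<forall>i\<in>{1..n}. \<forall>v. x i v = 1 \<or> x i v = -1" by auto
  then have IH: "measure M {\<omega> \<in> space M. \<forall>i\<in>{1..n}. \<forall>v. X i v \<omega> = real_of_int (x i v)}
    = measure N {\<omega> \<in> space N. \<forall>i\<in>{1..n}. \<forall>v. X' i v \<omega> = real_of_int (x i v)}" by (rule Suc.IH)
  have "measure M {\<omega> \<in> space M. \<forall>i\<in>{1..Suc n}. \<forall>v. X i v \<omega> = real_of_int (x i v)}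
        = measure M {\<omega> \<in> space M. \<forall>i\<in>{1..n}. \<forall>v. X i v \<omega> = real_of_int (x i v)}
          * (\<Prod>v\<in>UNIV. (1 + real_of_int (x (Suc n) v) * drift E p q (\<lambda>i u. real_of_int (x i u)) n v) / 2)"
    using M(2) Suc.prems unfolding has_drift_law_def by blast
  moreover have "measure N {\<omega> \<in> space N. \<forall>i\<in>{1..Suc n}. \<forall>v. X' i v \<omega> = real_of_int (x i v)}
        = measure N {\<omega> \<in> space N. \<forall>i\<in>{1..n}. \<forall>v. X' i v \<omega> = real_of_int (x i v)}
          * (\<Prod>v\<in>UNIV. (1 + real_of_int (x (Suc n) v) * drift E p q (\<lambda>i u. real_of_int (x i u)) n v) / 2)"
    using N(2) Suc.prems unfolding has_drift_law_def by blast
  ultimately show ?case using IH by simp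
qed

text \<open>The value 0 off the times 1 to \<open>n\<close> makes the set finite and forces distinct
  members to differ at one of these times, which gives disjoint events below.\<close>

definition sign_histories :: "nat \<Rightarrow> (nat \<Rightarrow> 'k::finite \<Rightarrow> int) set" where
  "sign_histories n = {x. \<forall>i. (i \<in> {1..n} \<longrightarrow> x i \<in> {g. range g \<subseteq> {1, -1}}) \<and> (i \<notin> {1..n} \<longrightarrow> x i = (\<lambda>_. 0))}"

lemma finite_sign_histories: "finite (sign_histories n :: (nat \<Rightarrow> 'k::finite \<Rightarrow> int) set)"
proof -
  have "finite {g :: 'k \<Rightarrow> int. \<forall>v. (v \<in> UNIV \<longrightarrow> g v \<in> {1, -1}) \<and> (v \<notin> UNIV \<longrightarrow> g v = 0)}"
    by (rule finite_set_of_finite_funs) auto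
  moreover have "{g :: 'k \<Rightarrow> int. \<forall>v. (v \<in> UNIV \<longrightarrow> g v \<in> {1, -1}) \<and> (v \<notin> UNIV \<longrightarrow> g v = 0)} = {g. range g \<subseteq> {1, -1}}"
    by auto
  ultimately have "finite {g :: 'k \<Rightarrow> int. range g \<subseteq> {1, -1}}" by (simp only:)
  then show ?thesis unfolding sign_histories_def by (intro finite_set_of_finite_funs) auto
qed

lemma prob_history_event:
  fixes X :: "nat \<Rightarrow> 'k::finite \<Rightarrow> 'a \<Rightarrow> real"
  assumes M: "prob_space M" and Xm: "\<And>n v. X n v \<in> borel_measurable M"
    and Xv: "AE \<omega> in M. \<forall>n\<ge>1. \<forall>v. X n v \<omega> = 1 \<or> X n v \<omega> = (-1 :: real)"
    and P: "\<And>x x'. (\<And>i v. i \<in> {1..n} \<Longrightarrow> x i v = x' i v) \<Longrightarrow> P x \<longleftrightarrow> P x'"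
    and Pm: "{\<omega> \<in> space M. P (\<lambda>i v. X i v \<omega>)} \<in> sets M"
  shows "measure M {\<omega> \<in> space M. P (\<lambda>i v. X i v \<omega>)}
    = (\<Sum>x\<in>{x \<in> sign_histories n. P (\<lambda>i v. real_of_int (x i v))}. measure M {\<omega> \<in> space M. \<forall>i\<in>{1..n}. \<forall>v. X i v \<omega> = real_of_int (x i v)})"
proof -
  interpret prob_space M by (rule M)
  note Xm[measurable]
  let ?H = "{x \<in> sign_histories n. P (\<lambda>i v. real_of_int (x i v))}"
  let ?A = "\<lambda>x. {\<omega> \<in> space M. \<forall>i\<in>{1..n}. \<forall>v. X i v \<omega> = real_of_int (x i v)}"
  have Am: "?A x \<in> events" for x by measurable
  have fH: "finite ?H" by (rule finite_subset[OF _ finite_sign_histories[of n]]) auto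
  have "measure M {\<omega> \<in> space M. P (\<lambda>i v. X i v \<omega>)} = measure M (\<Union>x\<in>?H. ?A x)"
  proof (rule measure_eq_AE)
    show "AE \<omega> in M. (\<omega> \<in> {\<omega> \<in> space M. P (\<lambda>i v. X i v \<omega>)}) = (\<omega> \<in> (\<Union>x\<in>?H. ?A x))"
      using Xv AE_space
    proof eventually_elim
      case (elim \<omega>)
      define x where "x i v = (if i \<in> {1..n} then (if X i v \<omega> = 1 then 1 else -1) else 0 :: int)" for i v
      have xX: "X i v \<omega> = real_of_int (x i v)" if "i \<in> {1..n}" for i v
        using elim(1) that by (auto simp: x_def)
      have xH: "x \<in> sign_histories n" by (auto simp: sign_histories_def x_def)
      show ?case
      proof
        assume "\<omega> \<in> {\<omega> \<in> space M. P (\<lambda>i v. X i v \<omega>)}"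
        then have "P (\<lambda>i v. real_of_int (x i v))" using P[of "\<lambda>i v. X i v \<omega>" "\<lambda>i v. real_of_int (x i v)"] xX by simp
        then show "\<omega> \<in> (\<Union>x\<in>?H. ?A x)" using xH xX elim(2) by (intro UN_I[of x]) auto
      next
        assume "\<omega> \<in> (\<Union>x\<in>?H. ?A x)"
        then obtain y where y: "P (\<lambda>i v. real_of_int (y i v))" "\<forall>i\<in>{1..n}. \<forall>v. X i v \<omega> = real_of_int (y i v)" by auto
        then show "\<omega> \<in> {\<omega> \<in> space M. P (\<lambda>i v. X i v \<omega>)}"
          using P[of "\<lambda>i v. X i v \<omega>" "\<lambda>i v. real_of_int (y i v)"] elim(2) by simp
      qed
    qed
    show "(\<Union>x\<in>?H. ?A x) \<in> events" using fH Am by (intro sets.finite_UN)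
  qed (rule Pm)
  also have "\<dots> = (\<Sum>x\<in>?H. measure M (?A x))"
  proof (rule finite_measure_finite_Union)
    show "finite ?H" by (rule fH)
    show "disjoint_family_on ?A ?H"
      unfolding disjoint_family_on_def
    proof (intro ballI impI)
      fix x y assume xy: "x \<in> ?H" "y \<in> ?H" "x \<noteq> y"
      then obtain i v where iv: "x i v \<noteq> y i v" by (auto simp: fun_eq_iff)
      then have "i \<in> {1..n}" using xy by (auto simp: sign_histories_def)
      then have "\<omega> \<notin> ?A x" if "\<omega> \<in> ?A y" for \<omega>
      proof -
        have "X i v \<omega> = real_of_int (y i v)" using that \<open>i \<in> {1..n}\<close> by blast
        then have "X i v \<omega> \<noteq> real_of_int (x i v)" using iv by simp
        then show ?thesis using \<open>i \<in> {1..n}\<close> by blast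
      qed
      then show "?A x \<inter> ?A y = {}" by blast
    qed
  qed (use Am in auto)
  finally show ?thesis .
qed

lemma borel_measurable_vec:
  fixes Y :: "'k::finite \<Rightarrow> 'a \<Rightarrow> real"
  assumes "\<And>v. Y v \<in> borel_measurable M"
  shows "(\<lambda>\<omega>. \<chi> v. Y v \<omega>) \<in> borel_measurable M"
proof (subst borel_measurable_euclidean_space, intro ballI)
  fix b :: "real ^ 'k" assume "b \<in> Basis"
  then obtain i where "b = axis i 1" by (auto simp: Basis_vec_def)
  then show "(\<lambda>\<omega>. (\<chi> v. Y v \<omega>) \<bullet> b) \<in> borel_measurable M"
    using assms by (simp add: inner_axis)
qed

text \<open>Finite-dimensional boxes determine a law on sequences, and such an event depends on
  finitely many steps. It is then a finite sum of history probabilities, which the drift law fixes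
  by induction.\<close>

lemma drift_law_unique:
  fixes X :: "nat \<Rightarrow> 'k::finite \<Rightarrow> 'a \<Rightarrow> real" and X' :: "nat \<Rightarrow> 'k \<Rightarrow> 'b \<Rightarrow> real"
  assumes M: "prob_space M" "has_drift_law M E p q X" and N: "prob_space N" "has_drift_law N E p q X'"
  shows "same_process_law M (\<lambda>n \<omega>. \<Sum>j=1..n. (\<chi> v. X j v \<omega>)) N (\<lambda>n \<omega>. \<Sum>j=1..n. (\<chi> v. X' j v \<omega>))"
proof -
  have XM: "X n v \<in> borel_measurable M" and XN: "X' n v \<in> borel_measurable N" for n v
    using M(2) N(2) by (auto simp: has_drift_law_def)
  have vM: "AE \<omega> in M. \<forall>n\<ge>1. \<forall>v. X n v \<omega> = 1 \<or> X n v \<omega> = -1" and vN: "AE \<omega> in N. \<forall>n\<ge>1. \<forall>v. X' n v \<omega> = 1 \<or> X' n v \<omega> = -1"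
    using M(2) N(2) by (auto simp: has_drift_law_def)
  define S where "S = (\<lambda>n \<omega>. \<Sum>j=1..n. (\<chi> v. X j v \<omega>))"
  define S' where "S' = (\<lambda>n \<omega>. \<Sum>j=1..n. (\<chi> v. X' j v \<omega>))"
  have SM: "S n \<in> borel_measurable M" and SN: "S' n \<in> borel_measurable N" for n
    unfolding S_def S'_def by (auto intro!: borel_measurable_sum borel_measurable_vec XM XN)
  have pm: "(\<lambda>\<omega> n. S n \<omega>) \<in> measurable M (\<Pi>\<^sub>M n\<in>UNIV. borel)" "(\<lambda>\<omega> n. S' n \<omega>) \<in> measurable N (\<Pi>\<^sub>M n\<in>UNIV. borel)"
    by (auto intro!: measurable_PiM_single' SM SN)
  interpret N: prob_space N by (rule N)
  interpret M: prob_space M by (rule M)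
  interpret DN: prob_space "distr N (\<Pi>\<^sub>M n\<in>UNIV. borel) (\<lambda>\<omega> n. S' n \<omega>)" by (rule N.prob_space_distr[OF pm(2)])
  have "distr N (\<Pi>\<^sub>M n\<in>UNIV. borel) (\<lambda>\<omega> n. S' n \<omega>) = distr M (\<Pi>\<^sub>M n\<in>UNIV. borel) (\<lambda>\<omega> n. S n \<omega>)"
  proof (rule measure_eqI_PiM_infinite)
    fix A :: "nat \<Rightarrow> (real ^ 'k) set" and J :: "nat set"
    assume J: "finite J" "J \<subseteq> UNIV" and A: "\<And>j. j \<in> J \<Longrightarrow> A j \<in> sets borel"
    \<comment> \<open>The inserted 0 covers an empty set of times.\<close>
    define n where "n = Max (insert 0 J)"
    have Jn: "j \<le> n" if "j \<in> J" for j using that J by (simp add: n_def)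
    define P where "P x \<longleftrightarrow> (\<forall>j\<in>J. (\<Sum>i=1..j. (\<chi> v. x i v)) \<in> A j)" for x :: "nat \<Rightarrow> 'k \<Rightarrow> real"
    have Pc: "P x \<longleftrightarrow> P x'" if "\<And>i v. i \<in> {1..n} \<Longrightarrow> x i v = x' i v" for x x'
    proof -
      have "(\<Sum>i=1..j. (\<chi> v. x i v)) = (\<Sum>i=1..j. (\<chi> v. x' i v))" if "j \<in> J" for j
        using Jn[OF that] by (intro sum.cong refl) (simp add: vec_eq_iff \<open>\<And>i v. i \<in> {1..n} \<Longrightarrow> x i v = x' i v\<close>)
      then show ?thesis by (simp add: P_def)
    qed
    have PM: "{\<omega> \<in> space M. P (\<lambda>i v. X i v \<omega>)} \<in> sets M"
    proof -
      have "{\<omega> \<in> space M. P (\<lambda>i v. X i v \<omega>)} = {\<omega> \<in> space M. \<forall>j\<in>J. S j \<omega> \<in> A j}" by (simp add: P_def S_def)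
      also have "\<dots> \<in> sets M" using J A SM by (intro sets.sets_Collect_finite_All) (auto intro: measurable_sets_Collect)
      finally show ?thesis .
    qed
    have PN: "{\<omega> \<in> space N. P (\<lambda>i v. X' i v \<omega>)} \<in> sets N"
    proof -
      have "{\<omega> \<in> space N. P (\<lambda>i v. X' i v \<omega>)} = {\<omega> \<in> space N. \<forall>j\<in>J. S' j \<omega> \<in> A j}" by (simp add: P_def S'_def)
      also have "\<dots> \<in> sets N" using J A SN by (intro sets.sets_Collect_finite_All) (auto intro: measurable_sets_Collect)
      finally show ?thesis .
    qed
    have that': "measure M {\<omega> \<in> space M. \<forall>i\<in>{1..n}. \<forall>v. X i v \<omega> = real_of_int (x i v)}
      = measure N {\<omega> \<in> space N. \<forall>i\<in>{1..n}. \<forall>v. X' i v \<omega> = real_of_int (x i v)}"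
      if "x \<in> sign_histories n" for x
      by (rule drift_law_history[OF M N]) (use that in \<open>force simp: sign_histories_def\<close>)
    have eq: "measure M {\<omega> \<in> space M. P (\<lambda>i v. X i v \<omega>)} = measure N {\<omega> \<in> space N. P (\<lambda>i v. X' i v \<omega>)}"
    proof -
      let ?H = "{x \<in> sign_histories n. P (\<lambda>i v. real_of_int (x i v))}"
      have "measure M {\<omega> \<in> space M. P (\<lambda>i v. X i v \<omega>)} = (\<Sum>x\<in>?H. measure M {\<omega> \<in> space M. \<forall>i\<in>{1..n}. \<forall>v. X i v \<omega> = real_of_int (x i v)})"
        by (rule prob_history_event[where n=n, OF M(1) XM vM Pc PM])
      also have "\<dots> = (\<Sum>x\<in>?H. measure N {\<omega> \<in> space N. \<forall>i\<in>{1..n}. \<forall>v. X' i v \<omega> = real_of_int (x i v)})"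
        by (rule sum.cong[OF refl], rule that') simp
      also have "\<dots> = measure N {\<omega> \<in> space N. P (\<lambda>i v. X' i v \<omega>)}"
        by (rule prob_history_event[where n=n, OF N(1) XN vN Pc PN, symmetric])
      finally show ?thesis .
    qed
    have emb: "prod_emb UNIV (\<lambda>_. borel) J (Pi\<^sub>E J A) \<in> sets (\<Pi>\<^sub>M n\<in>(UNIV :: nat set). (borel :: (real ^ 'k) measure))"
      using J A by (intro sets_PiM_I) auto
    have "emeasure (distr N (\<Pi>\<^sub>M n\<in>UNIV. borel) (\<lambda>\<omega> n. S' n \<omega>)) (prod_emb UNIV (\<lambda>_. borel) J (Pi\<^sub>E J A)) = emeasure N {\<omega> \<in> space N. P (\<lambda>i v. X' i v \<omega>)}"
      using pm(2) emb by (subst emeasure_distr) (auto simp: prod_emb_def P_def S'_def space_PiM intro!: arg_cong[where f="emeasure N"])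
    moreover have "emeasure (distr M (\<Pi>\<^sub>M n\<in>UNIV. borel) (\<lambda>\<omega> n. S n \<omega>)) (prod_emb UNIV (\<lambda>_. borel) J (Pi\<^sub>E J A)) = emeasure M {\<omega> \<in> space M. P (\<lambda>i v. X i v \<omega>)}"
      using pm(1) emb by (subst emeasure_distr) (auto simp: prod_emb_def P_def S_def space_PiM intro!: arg_cong[where f="emeasure M"])
    ultimately show "emeasure (distr N (\<Pi>\<^sub>M n\<in>UNIV. borel) (\<lambda>\<omega> n. S' n \<omega>)) (prod_emb UNIV (\<lambda>_. borel) J (Pi\<^sub>E J A))
      = emeasure (distr M (\<Pi>\<^sub>M n\<in>UNIV. borel) (\<lambda>\<omega> n. S n \<omega>)) (prod_emb UNIV (\<lambda>_. borel) J (Pi\<^sub>E J A))"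
      using eq by (simp add: M.emeasure_eq_measure N.emeasure_eq_measure)
  qed (auto simp: DN.finite_measure_axioms)
  then show ?thesis
    unfolding same_process_law_def using SM SN by (simp add: S_def S'_def)
qed

lemma (in driven) driven_has_drift_law: "has_drift_law M E p q X"
  unfolding has_drift_law_def
proof (intro conjI allI impI)
  show "AE \<omega> in M. \<forall>n\<ge>1. \<forall>v. X n v \<omega> = 1 \<or> X n v \<omega> = -1"
  proof (intro AE_I2 allI impI)
    fix \<omega> n v assume "1 \<le> (n :: nat)"
    then obtain k where "n = Suc k" by (cases n) auto
    then show "X n v \<omega> = 1 \<or> X n v \<omega> = -1" using X_val by simp
  qed
  fix n and x :: "nat \<Rightarrow> 'k \<Rightarrow> int" assume x: "\<forall>i\<in>{1..Suc n}. \<forall>v. x i v = 1 \<or> x i v = -1"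
  show "measure M {\<omega> \<in> space M. \<forall>i\<in>{1..Suc n}. \<forall>v. X i v \<omega> = real_of_int (x i v)}
        = measure M {\<omega> \<in> space M. \<forall>i\<in>{1..n}. \<forall>v. X i v \<omega> = real_of_int (x i v)}
          * (\<Prod>v\<in>UNIV. (1 + real_of_int (x (Suc n) v) * drift E p q (\<lambda>i u. real_of_int (x i u)) n v) / 2)"
    by (rule step_law) (use x in force)
qed (rule X_measurable)

section \<open>The transition law of the ERWG process\<close>

lemma erwg_X_cong:
  assumes "\<And>v. \<sigma> v \<omega> = \<sigma>' v \<omega>'"
    and "\<And>k v. 1 \<le> k \<Longrightarrow> k < i \<Longrightarrow> \<xi> k v \<omega> = \<xi>' k v \<omega>'"
    and "\<And>k v. 1 \<le> k \<Longrightarrow> k < i \<Longrightarrow> D k v \<omega> = D' k v \<omega>'"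
    and "\<And>k v. 1 \<le> k \<Longrightarrow> k < i \<Longrightarrow> u k v \<omega> = u' k v \<omega>'"
  shows "erwg_X \<sigma> \<xi> D u i v \<omega> = erwg_X \<sigma>' \<xi>' D' u' i v \<omega>'"
  using assms(2-)
proof (induction i arbitrary: v rule: less_induct)
  case (less i)
  show ?case
  proof (cases i)
    case (Suc k)
    show ?thesis
    proof (cases "k = 0")
      case False
      have "erwg_X \<sigma> \<xi> D u d w \<omega> = erwg_X \<sigma>' \<xi>' D' u' d w \<omega>'" if "d \<le> k" for d w
        using that Suc by (intro less.IH less.prems) auto
      then show ?thesis using Suc False less.prems[of k] by simp
    qed (simp add: Suc assms(1))
  qed simp
qed

lemma measurable_count_space_combine:
  assumes f: "f \<in> measurable M (count_space UNIV)" and g: "g \<in> measurable M (count_space (UNIV :: 'c::countable set))"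
  shows "(\<lambda>\<omega>. F (f \<omega>) (g \<omega>)) \<in> measurable M (count_space UNIV)"
  by (rule measurable_compose_countable[where f="\<lambda>i \<omega>. F (f \<omega>) i", OF measurable_compose[OF f] g]) simp

lemma erwg_X_measurable:
  assumes \<sigma>: "\<And>v. \<sigma> v \<in> measurable M (count_space UNIV)"
    and "\<And>k v. 1 \<le> k \<Longrightarrow> k < i \<Longrightarrow> \<xi> k v \<in> measurable M (count_space UNIV)"
    and "\<And>k v. 1 \<le> k \<Longrightarrow> k < i \<Longrightarrow> D k v \<in> measurable M (count_space UNIV)"
    and "\<And>k v. 1 \<le> k \<Longrightarrow> k < i \<Longrightarrow> u k v \<in> measurable M (count_space (UNIV :: 'k::countable set))"
  shows "erwg_X \<sigma> \<xi> D u i v \<in> measurable M (count_space UNIV)"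
  using assms(2-)
proof (induction i arbitrary: v rule: less_induct)
  case (less i)
  show ?case
  proof (cases i)
    case 0
    have "erwg_X \<sigma> \<xi> D u i v = (\<lambda>_. 0)" unfolding 0 by (rule ext) (rule erwg_X.simps)
    then show ?thesis by simp
  next
    case (Suc k)
    show ?thesis
    proof (cases "k = 0")
      case True
      have "erwg_X \<sigma> \<xi> D u i v = \<sigma> v" unfolding Suc True by (rule ext) simp
      then show ?thesis using \<sigma>[of v] by (simp only:)
    next
      case False
      have k: "1 \<le> k" "k < i" using False Suc by auto
      define f where "f d w = (if d \<le> k then erwg_X \<sigma> \<xi> D u d w else (\<lambda>_. 0))" for d :: nat and w :: 'k
      have IH: "erwg_X \<sigma> \<xi> D u d w \<in> measurable M (count_space UNIV)" if "d \<le> k" for d w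
      proof -
        have d: "d < i" using that Suc by simp
        show ?thesis
          by (rule less.IH[OF d]) (rule less.prems, assumption, erule less_trans[OF _ d])+
      qed
      have f: "f d w \<in> measurable M (count_space UNIV)" for d w
        using IH[of d w] by (cases "d \<le> k") (simp_all only: f_def if_True if_False measurable_const space_count_space UNIV_I)
      have fd: "(\<lambda>\<omega>. f d (u k v \<omega>) \<omega>) \<in> measurable M (count_space UNIV)" for d
        by (rule measurable_compose_countable[OF f less.prems(3)[OF k]])
      have h: "(\<lambda>\<omega>. f (D k v \<omega>) (u k v \<omega>) \<omega>) \<in> measurable M (count_space UNIV)"
        by (rule measurable_compose_countable[where f="\<lambda>d \<omega>. f d (u k v \<omega>) \<omega>", OF fd less.prems(2)[OF k]])
      have e: "erwg_X \<sigma> \<xi> D u i v = (\<lambda>\<omega>. \<xi> k v \<omega> * f (D k v \<omega>) (u k v \<omega>) \<omega>)"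
        unfolding Suc f_def using False by (intro ext) simp
      show ?thesis
        unfolding e by (rule measurable_count_space_combine[OF less.prems(1)[OF k] h])
    qed
  qed
qed

lemma pmf_Rad:
  assumes p: "p \<in> {0..1}" and s: "s = 1 \<or> s = -1"
  shows "pmf (Rad p) s = (1 + real_of_int s * (2 * p - 1)) / 2"
proof -
  let ?f = "\<lambda>b. if b then 1 else - 1 :: int"
  have "pmf (map_pmf ?f (bernoulli_pmf p)) (?f b) = pmf (bernoulli_pmf p) b" for b
    by (rule pmf_map_inj') (simp add: inj_def)
  note e = this[of True] this[of False]
  from s show ?thesis
  proof
    assume "s = 1"
    then show ?thesis using e(1) p by (simp add: Rad_def)
  next
    assume "s = -1"
    then show ?thesis using e(2) p by (simp add: Rad_def field_simps)
  qed
qed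

lemma measurable_component_compose:
  "s \<in> I \<Longrightarrow> (\<lambda>c. f (c s)) \<in> measurable (\<Pi>\<^sub>M i\<in>I. count_space UNIV) (count_space UNIV)"
  by (rule measurable_compose[OF measurable_component_singleton]) simp_all

context erwg
begin

text \<open>Codes the four families of sources as variables with one common value space.\<close>

fun enc :: "'k source \<Rightarrow> 'a \<Rightarrow> int \<times> nat \<times> 'k" where
  "enc (Sigma_src v) \<omega> = (\<sigma> v \<omega>, 0, v)"
| "enc (Xi_src n v) \<omega> = (\<xi> n v \<omega>, 0, v)"
| "enc (D_src n v) \<omega> = (0, D n v \<omega>, v)"
| "enc (U_src n v) \<omega> = (0, 0, u n v \<omega>)"

lemma enc_indep: "indep_vars (\<lambda>_. count_space UNIV) enc (sources :: 'k source set)"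
  unfolding indep_vars_def2
proof (intro conjI ballI)
  have sub: "{enc s -` A \<inter> space M |A. A \<in> sets (count_space UNIV)} \<subseteq> source_events M \<sigma> \<xi> D u s" for s :: "'k source"
  proof safe
    fix A
    show "enc s -` A \<inter> space M \<in> source_events M \<sigma> \<xi> D u s"
    proof (cases s)
      case (Sigma_src v)
      have "enc s -` A \<inter> space M = \<sigma> v -` {x. (x, 0, v) \<in> A} \<inter> space M" by (auto simp: Sigma_src)
      then show ?thesis using in_vimage_algebra[of "{x. (x, 0, v) \<in> A}" "count_space UNIV" "\<sigma> v" "space M"] by (simp add: Sigma_src)
    next
      case (Xi_src n v)
      have "enc s -` A \<inter> space M = \<xi> n v -` {x. (x, 0, v) \<in> A} \<inter> space M" by (auto simp: Xi_src)
      then show ?thesis using in_vimage_algebra[of "{x. (x, 0, v) \<in> A}" "count_space UNIV" "\<xi> n v" "space M"] by (simp add: Xi_src)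
    next
      case (D_src n v)
      have "enc s -` A \<inter> space M = D n v -` {x. (0, x, v) \<in> A} \<inter> space M" by (auto simp: D_src)
      then show ?thesis using in_vimage_algebra[of "{x. (0, x, v) \<in> A}" "count_space UNIV" "D n v" "space M"] by (simp add: D_src)
    next
      case (U_src n v)
      have "enc s -` A \<inter> space M = u n v -` {x. (0, 0, x) \<in> A} \<inter> space M" by (auto simp: U_src)
      then show ?thesis using in_vimage_algebra[of "{x. (0, 0, x) \<in> A}" "count_space UNIV" "u n v" "space M"] by (simp add: U_src)
    qed
  qed
  then show "indep_sets (\<lambda>i. {enc i -` A \<inter> space M |A. A \<in> sets (count_space UNIV)}) sources"
    by (intro indep_sets_mono_sets[OF indep]) auto
  fix s :: "'k source" assume s: "s \<in> sources"
  have "source_events M \<sigma> \<xi> D u s \<subseteq> events" using indep s by (auto simp: indep_sets_def)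
  with sub[of s] show "enc s \<in> measurable M (count_space UNIV)"
    by (auto simp: measurable_def)
qed

text \<open>The sources behind step \<open>n + 1\<close>, with the same shift of index as for the
  driven walk: index 0 stands for the initial \<open>\<sigma>\<close>.\<close>

definition cur_src :: "nat \<Rightarrow> 'k \<Rightarrow> 'k source set" where
  "cur_src n v = (if n = 0 then {Sigma_src v} else {Xi_src n v, D_src n v, U_src n v})"

definition past_src :: "nat \<Rightarrow> 'k source set" where
  "past_src n = (\<Union>i<n. \<Union>v. cur_src i v)"

definition XI :: "nat \<Rightarrow> 'k \<Rightarrow> 'a \<Rightarrow> int" where
  "XI = erwg_X \<sigma> \<xi> D u"

text \<open>The same recursion, read as a function of coded source values in place of a function of
  the sample point. Restricting its argument to \<open>past_src n\<close> shows that the steps up to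
  \<open>n\<close> depend on these sources alone.\<close>

definition XC :: "nat \<Rightarrow> 'k \<Rightarrow> ('k source \<Rightarrow> int \<times> nat \<times> 'k) \<Rightarrow> int" where
  "XC = erwg_X (\<lambda>v c. fst (c (Sigma_src v))) (\<lambda>n v c. fst (c (Xi_src n v)))
     (\<lambda>n v c. fst (snd (c (D_src n v)))) (\<lambda>n v c. snd (snd (c (U_src n v))))"

lemma XC_restrict:
  assumes "i \<le> n"
  shows "XC i v (restrict (\<lambda>s. enc s \<omega>) (past_src n)) = XI i v \<omega>"
proof (cases "n = 0")
  case True
  then show ?thesis using assms by (simp add: XC_def XI_def)
next
  case False
  have s: "Sigma_src v \<in> past_src n" for v using False by (auto simp: past_src_def cur_src_def)
  have k: "Xi_src k v \<in> past_src n" "D_src k v \<in> past_src n" "U_src k v \<in> past_src n" if "1 \<le> k" "k < i" for k v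
    using that assms by (auto simp: past_src_def cur_src_def intro!: bexI[of _ k] exI[of _ v])
  show ?thesis
    unfolding XC_def XI_def by (rule erwg_X_cong) (simp_all add: s k)
qed

lemma XC_measurable:
  assumes "i \<le> n"
  shows "XC i v \<in> measurable (\<Pi>\<^sub>M s\<in>past_src n. count_space UNIV) (count_space UNIV)"
proof (cases "n = 0")
  case True
  then have "XC i v = (\<lambda>_. 0)" using assms by (simp add: XC_def fun_eq_iff)
  then show ?thesis by simp
next
  case False
  have s: "Sigma_src v \<in> past_src n" for v using False by (auto simp: past_src_def cur_src_def)
  have k: "Xi_src k v \<in> past_src n" "D_src k v \<in> past_src n" "U_src k v \<in> past_src n" if "1 \<le> k" "k < i" for k v
    using that assms by (auto simp: past_src_def cur_src_def intro!: bexI[of _ k] exI[of _ v])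
  show ?thesis
    unfolding XC_def
    by (rule erwg_X_measurable; rule measurable_component_compose; rule s k; assumption)
qed

lemma XI_measurable: "XI n v \<in> measurable M (count_space UNIV)"
  unfolding XI_def
  by (rule erwg_X_measurable) (assumption | rule measurable_sigma measurable_xi measurable_D measurable_u)+

lemma prob_eq_pmf:
  assumes "Z \<in> measurable M (count_space UNIV)" "distr M (count_space UNIV) Z = measure_pmf \<mu>"
  shows "prob {\<omega> \<in> space M. Z \<omega> = s} = pmf \<mu> s"
proof -
  have "prob (Z -` {s} \<inter> space M) = measure (distr M (count_space UNIV) Z) {s}"
    by (rule measure_distr[symmetric]) (simp_all add: assms(1))
  moreover have "Z -` {s} \<inter> space M = {\<omega> \<in> space M. Z \<omega> = s}" by blast
  ultimately show ?thesis by (simp add: assms(2) measure_pmf_single)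
qed

lemma AE_in_set_pmf:
  assumes "Z \<in> measurable M (count_space UNIV)" "distr M (count_space UNIV) Z = measure_pmf \<mu>"
  shows "AE \<omega> in M. Z \<omega> \<in> set_pmf \<mu>"
proof -
  have "AE z in distr M (count_space UNIV) Z. z \<in> set_pmf \<mu>"
    unfolding assms(2) by (rule AE_measure_pmf)
  then show ?thesis by (subst (asm) AE_distr_iff) (simp_all add: assms(1))
qed

text \<open>Step \<open>n + 1\<close> with the history frozen to \<open>y\<close>, so that it
  depends only on the current sources and is independent of the past.\<close>

definition cur_val :: "nat \<Rightarrow> 'k \<Rightarrow> (nat \<Rightarrow> 'k \<Rightarrow> int) \<Rightarrow> ('k source \<Rightarrow> int \<times> nat \<times> 'k) \<Rightarrow> int" where
  "cur_val n v y c = (if n = 0 then fst (c (Sigma_src v))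
     else fst (c (Xi_src n v)) * y (fst (snd (c (D_src n v)))) (snd (snd (c (U_src n v)))))"

lemma cur_val_measurable:
  "cur_val n v y \<in> measurable (\<Pi>\<^sub>M s\<in>cur_src n v. count_space UNIV) (count_space UNIV)"
proof (cases "n = 0")
  case True
  then have "cur_val n v y = (\<lambda>c. fst (c (Sigma_src v)))" by (simp add: cur_val_def fun_eq_iff)
  then show ?thesis using True by (simp only: cur_src_def if_True) (rule measurable_component_compose, simp)
next
  case False
  then have e: "cur_val n v y = (\<lambda>c. fst (c (Xi_src n v)) * y (fst (snd (c (D_src n v)))) (snd (snd (c (U_src n v)))))"
    by (simp add: cur_val_def fun_eq_iff)
  show ?thesis unfolding e
    by (rule measurable_count_space_combine[where F="(*)"], rule measurable_component_compose,
        simp add: cur_src_def False, rule measurable_count_space_combine[where F=y])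
       (rule measurable_component_compose, simp add: cur_src_def False)+
qed

lemma prob_choice:
  assumes n: "1 \<le> n"
  shows "prob {\<omega> \<in> space M. \<xi> n v \<omega> = a \<and> D n v \<omega> = d \<and> u n v \<omega> = w}
    = pmf (Rad (p v)) a * pmf (pmf_of_set {1..n}) d * pmf (pmf_of_set (in_nbrs E v)) w"
proof -
  define A :: "'k source \<Rightarrow> (int \<times> nat \<times> 'k) set" where
    "A s = (case s of Sigma_src _ \<Rightarrow> UNIV | Xi_src _ _ \<Rightarrow> {z. fst z = a} | D_src _ _ \<Rightarrow> {z. fst (snd z) = d} | U_src _ _ \<Rightarrow> {z. snd (snd z) = w})" for s
  have "prob (\<Inter>s\<in>{Xi_src n v, D_src n v, U_src n v}. enc s -` A s \<inter> space M)
    = (\<Prod>s\<in>{Xi_src n v, D_src n v, U_src n v}. prob (enc s -` A s \<inter> space M))"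
    by (rule indep_varsD[OF enc_indep]) (use n in \<open>auto simp: sources_def\<close>)
  moreover have "(\<Inter>s\<in>{Xi_src n v, D_src n v, U_src n v}. enc s -` A s \<inter> space M)
    = {\<omega> \<in> space M. \<xi> n v \<omega> = a \<and> D n v \<omega> = d \<and> u n v \<omega> = w}"
    by (auto simp: A_def)
  moreover have "enc (Xi_src n v) -` A (Xi_src n v) \<inter> space M = {\<omega> \<in> space M. \<xi> n v \<omega> = a}"
    "enc (D_src n v) -` A (D_src n v) \<inter> space M = {\<omega> \<in> space M. D n v \<omega> = d}"
    "enc (U_src n v) -` A (U_src n v) \<inter> space M = {\<omega> \<in> space M. u n v \<omega> = w}"
    by (auto simp: A_def)
  ultimately show ?thesis
    by (simp add: prob_eq_pmf[OF measurable_xi[OF n] law_xi[OF n]] prob_eq_pmf[OF measurable_D[OF n] law_D[OF n]]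
      prob_eq_pmf[OF measurable_u[OF n] law_u[OF n]] mult_ac del: One_nat_def)
qed

text \<open>The choices of \<open>D\<close> and \<open>u\<close> bound the probabilities of both signs from below by numbers that
  already add up to 1, so that the null sets where \<open>D\<close> or \<open>u\<close> leave their range need no attention.\<close>

lemma prob_cur_val:
  assumes y: "\<And>i v. 1 \<le> i \<Longrightarrow> i \<le> n \<Longrightarrow> y i v = 1 \<or> y i v = -1" and s: "s = 1 \<or> s = -1"
  shows "prob {\<omega> \<in> space M. cur_val n v y (\<lambda>s. enc s \<omega>) = s}
    = (1 + real_of_int s * drift E p q (\<lambda>i u. real_of_int (y i u)) n v) / 2"
proof (cases "n = 0")
  case True
  then show ?thesis
    using prob_eq_pmf[OF measurable_sigma law_sigma, of v s] pmf_Rad[OF q_range s, of v]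
    by (simp add: cur_val_def drift_def)
next
  case False
  then have n: "1 \<le> n" by simp
  let ?d = "drift E p q (\<lambda>i u. real_of_int (y i u)) n v"
  let ?C = "\<lambda>s. {\<omega> \<in> space M. cur_val n v y (\<lambda>s. enc s \<omega>) = s}"
  have cv: "cur_val n v y (\<lambda>s. enc s \<omega>) = \<xi> n v \<omega> * y (D n v \<omega>) (u n v \<omega>)" for \<omega>
    using False by (simp add: cur_val_def)
  have cm: "(\<lambda>\<omega>. \<xi> n v \<omega> * y (D n v \<omega>) (u n v \<omega>)) \<in> measurable M (count_space UNIV)"
    by (rule measurable_count_space_combine[where F="(*)"], rule measurable_xi[OF n],
        rule measurable_count_space_combine[where F=y], rule measurable_D[OF n], rule measurable_u[OF n])
  have Cm: "?C s \<in> events" for s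
  proof -
    have "?C s = (\<lambda>\<omega>. \<xi> n v \<omega> * y (D n v \<omega>) (u n v \<omega>)) -` {s} \<inter> space M" unfolding cv by blast
    then show ?thesis using measurable_sets[OF cm, of "{s}"] by simp
  qed
  have deg: "0 < real (in_deg E v)" using in_deg_ge_1[of v] by simp
  have nb: "finite (in_nbrs E v)" "in_nbrs E v \<noteq> {}" using in_deg_ge_1[of v] by (auto simp: in_deg_def)
  have lower: "(1 + real_of_int s * ?d) / 2 \<le> prob (?C s)" if s: "s = 1 \<or> s = -1" for s
  proof -
    let ?J = "{1..n} \<times> in_nbrs E v"
    \<comment> \<open>Since \<open>y d w\<close> squares to 1, the choice of \<open>(d, w)\<close>
      together with \<open>\<xi> = s * y d w\<close> produces the step \<open>s\<close>; summing the
      product probabilities over all pairs gives the drift.\<close>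
    let ?B = "\<lambda>(d, w). {\<omega> \<in> space M. \<xi> n v \<omega> = s * y d w \<and> D n v \<omega> = d \<and> u n v \<omega> = w}"
    have Bm: "?B z \<in> events" for z
    proof (cases z)
      case (Pair d w)
      have "(\<lambda>\<omega>. (\<xi> n v \<omega>, (D n v \<omega>, u n v \<omega>))) \<in> measurable M (count_space UNIV)"
        by (rule measurable_count_space_combine[where F=Pair], rule measurable_xi[OF n],
            rule measurable_count_space_combine[where F=Pair], rule measurable_D[OF n], rule measurable_u[OF n])
      from measurable_sets[OF this, of "{(s * y d w, (d, w))}"]
      have "(\<lambda>\<omega>. (\<xi> n v \<omega>, (D n v \<omega>, u n v \<omega>))) -` {(s * y d w, (d, w))} \<inter> space M \<in> events" by simp
      moreover have "?B z = (\<lambda>\<omega>. (\<xi> n v \<omega>, (D n v \<omega>, u n v \<omega>))) -` {(s * y d w, (d, w))} \<inter> space M"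
        unfolding Pair by auto
      ultimately show ?thesis by (simp only:)
    qed
    have yy: "y d w = 1 \<or> y d w = -1" if "(d, w) \<in> ?J" for d w using that y[of d w] by simp
    have pB: "prob (?B z) = (1 + real_of_int s * ((2 * p v - 1) * real_of_int (y (fst z) (snd z)))) / 2 / (real n * real (in_deg E v))" if z: "z \<in> ?J" for z
    proof (cases z)
      case (Pair d w)
      have dw: "d \<in> {1..n}" "w \<in> in_nbrs E v" using z Pair by auto
      have sy: "s * y d w = 1 \<or> s * y d w = -1" using s yy[of d w] z Pair by auto
      have "prob (?B z) = pmf (Rad (p v)) (s * y d w) * pmf (pmf_of_set {1..n}) d * pmf (pmf_of_set (in_nbrs E v)) w"
        unfolding Pair prod.case by (rule prob_choice[OF n])
      also have "pmf (pmf_of_set {1..n}) d = 1 / real n" using dw by (subst pmf_of_set) auto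
      also have "pmf (pmf_of_set (in_nbrs E v)) w = 1 / real (in_deg E v)"
        using dw nb by (subst pmf_of_set) (auto simp: in_deg_def)
      also have "pmf (Rad (p v)) (s * y d w) = (1 + real_of_int (s * y d w) * (2 * p v - 1)) / 2"
        by (rule pmf_Rad[OF p_range sy])
      finally show ?thesis unfolding Pair by (simp add: mult_ac)
    qed
    have "(1 + real_of_int s * ?d) / 2 = (\<Sum>z\<in>?J. prob (?B z))"
    proof -
      have "(\<Sum>z\<in>?J. prob (?B z)) = (\<Sum>z\<in>?J. (1 + real_of_int s * ((2 * p v - 1) * real_of_int (y (fst z) (snd z)))) / 2 / (real n * real (in_deg E v)))"
        by (rule sum.cong[OF refl]) (rule pB)
      also have "\<dots> = (\<Sum>z\<in>?J. 1 + real_of_int s * ((2 * p v - 1) * real_of_int (y (fst z) (snd z)))) / 2 / (real n * real (in_deg E v))"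
        by (simp only: sum_divide_distrib)
      also have "(\<Sum>z\<in>?J. 1 + real_of_int s * ((2 * p v - 1) * real_of_int (y (fst z) (snd z))))
        = real n * real (in_deg E v) + real_of_int s * ((2 * p v - 1) * (\<Sum>z\<in>?J. real_of_int (y (fst z) (snd z))))"
        by (simp add: sum.distrib sum_distrib_left in_deg_def)
      also have "(\<Sum>z\<in>?J. real_of_int (y (fst z) (snd z))) = (\<Sum>u\<in>in_nbrs E v. \<Sum>i=1..n. real_of_int (y i u))"
        by (subst sum.swap) (simp add: sum.cartesian_product case_prod_beta)
      also have "(real n * real (in_deg E v) + real_of_int s * ((2 * p v - 1) * (\<Sum>u\<in>in_nbrs E v. \<Sum>i=1..n. real_of_int (y i u)))) / 2 / (real n * real (in_deg E v))
         = (1 + real_of_int s * ((2 * p v - 1) * (\<Sum>u\<in>in_nbrs E v. \<Sum>i=1..n. real_of_int (y i u)) / (real (in_deg E v) * real n))) / 2"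
        using n deg by (simp add: field_simps)
      finally show ?thesis using False by (simp add: drift_def)
    qed
    also have "\<dots> = prob (\<Union>z\<in>?J. ?B z)"
      by (rule finite_measure_finite_Union[symmetric]) (use nb Bm in \<open>auto simp: disjoint_family_on_def\<close>)
    also have "\<dots> \<le> prob (?C s)"
    proof (rule finite_measure_mono)
      show "(\<Union>z\<in>?J. ?B z) \<subseteq> ?C s"
      proof
        fix \<omega> assume "\<omega> \<in> (\<Union>z\<in>?J. ?B z)"
        then obtain d w where dw: "(d, w) \<in> ?J" "\<omega> \<in> space M" "\<xi> n v \<omega> = s * y d w" "D n v \<omega> = d" "u n v \<omega> = w" by auto
        have "s * y d w * y d w = s" using yy[OF dw(1)] by auto
        then show "\<omega> \<in> ?C s" using dw(2-5) by (simp add: cv)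
      qed
    qed (rule Cm)
    finally show ?thesis .
  qed
  have "prob (?C 1) + prob (?C (-1)) = prob (?C 1 \<union> ?C (-1))"
    by (rule finite_measure_Union[symmetric]) (use Cm in auto)
  also have "\<dots> \<le> 1" by simp
  finally have up: "prob (?C 1) + prob (?C (-1)) \<le> 1" .
  have low1: "(1 + ?d) / 2 \<le> prob (?C 1)" "(1 - ?d) / 2 \<le> prob (?C (-1))" using lower[of 1] lower[of "-1"] by simp_all
  have "(1 + ?d) / 2 + (1 - ?d) / 2 = 1" by (simp add: field_simps)
  then have "prob (?C 1) = (1 + ?d) / 2" "prob (?C (-1)) = (1 - ?d) / 2"
    using up low1 by argo+
  then show ?thesis using s by auto
qed

lemma erwg_step_law:
  assumes x: "\<And>i v. 1 \<le> i \<Longrightarrow> i \<le> Suc n \<Longrightarrow> x i v = 1 \<or> x i v = -1"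
  shows "prob {\<omega> \<in> space M. \<forall>i\<in>{1..Suc n}. \<forall>v. XI i v \<omega> = x i v}
    = prob {\<omega> \<in> space M. \<forall>i\<in>{1..n}. \<forall>v. XI i v \<omega> = x i v}
      * (\<Prod>v\<in>UNIV. (1 + real_of_int (x (Suc n) v) * drift E p q (\<lambda>i u. real_of_int (x i u)) n v) / 2)"
proof -
  \<comment> \<open>Extending the history by 0 agrees with the default values in
    \<open>erwg_X\<close>, so the identity with \<open>cur_val\<close> holds at every sample point
    of the history event, including those where \<open>D\<close> leaves its range.\<close>
  define y where "y i v = (if 1 \<le> i \<and> i \<le> n then x i v else 0)" for i v
  define K :: "'k option \<Rightarrow> 'k source set" where "K = case_option (past_src n) (cur_src n)"
  define R where "R j \<omega> = restrict (\<lambda>s. enc s \<omega>) (K j)" for j \<omega>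
  have sub: "cur_src i v \<subseteq> sources" for i v by (auto simp: cur_src_def sources_def)
  have KS: "K j \<subseteq> sources" for j
    using sub by (cases j) (auto simp: K_def past_src_def)
  have dj: "cur_src i v \<inter> cur_src i' v' = {}" if "(i, v) \<noteq> (i', v')" for i i' v v'
    using that by (auto simp: cur_src_def)
  have dp: "past_src n \<inter> cur_src n v = {}" for v
  proof -
    have "cur_src i w \<inter> cur_src n v = {}" if "i < n" for i w by (rule dj) (use that in simp)
    then show ?thesis unfolding past_src_def by blast
  qed
  have disj: "disjoint_family_on K UNIV"
    unfolding disjoint_family_on_def
  proof (intro ballI impI)
    fix a b :: "'k option" assume "a \<noteq> b"
    then show "K a \<inter> K b = {}"
      using dp dj[of n _ n] by (cases a; cases b) (auto simp: K_def)
  qed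
  have ind: "indep_vars (\<lambda>j. \<Pi>\<^sub>M s\<in>K j. count_space UNIV) R UNIV"
    unfolding R_def[abs_def] by (rule indep_vars_restrict[OF enc_indep]) (use KS disj in auto)
  define A :: "'k option \<Rightarrow> ('k source \<Rightarrow> int \<times> nat \<times> 'k) set" where
    "A = case_option {c \<in> space (\<Pi>\<^sub>M s\<in>past_src n. count_space UNIV). \<forall>i\<in>{1..n}. \<forall>v. XC i v c = x i v}
      (\<lambda>v. {c \<in> space (\<Pi>\<^sub>M s\<in>cur_src n v. count_space UNIV). cur_val n v y c = x (Suc n) v})"
  have Am: "A j \<in> sets (\<Pi>\<^sub>M s\<in>K j. count_space UNIV)" for j
  proof (cases j)
    case None
    have "{c \<in> space (\<Pi>\<^sub>M s\<in>past_src n. count_space UNIV). XC i v c = x i v} \<in> sets (\<Pi>\<^sub>M s\<in>past_src n. count_space UNIV)"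
      if "i \<in> {1..n}" for i v
      using measurable_sets[OF XC_measurable[of i n v], of "{x i v}"] that by (simp add: vimage_def Int_def conj_commute)
    then show ?thesis unfolding None A_def K_def option.case
      by (intro sets.sets_Collect_finite_All) simp_all
  next
    case (Some v)
    show ?thesis unfolding Some A_def K_def option.case
      using measurable_sets[OF cur_val_measurable[of n v y], of "{x (Suc n) v}"] by (simp add: vimage_def Int_def conj_commute)
  qed
  have pre_None: "R None -` A None \<inter> space M = {\<omega> \<in> space M. \<forall>i\<in>{1..n}. \<forall>v. XI i v \<omega> = x i v}"
  proof -
    have "XC i v (R None \<omega>) = XI i v \<omega>" if "i \<in> {1..n}" for i v \<omega>
      unfolding R_def K_def option.case by (rule XC_restrict) (use that in simp)
    moreover have "R None \<omega> \<in> space (\<Pi>\<^sub>M s\<in>past_src n. count_space UNIV)" for \<omega>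
      by (simp add: R_def K_def space_PiM)
    ultimately show ?thesis unfolding A_def option.case by auto
  qed
  have pre_Some: "R (Some v) -` A (Some v) \<inter> space M = {\<omega> \<in> space M. cur_val n v y (\<lambda>s. enc s \<omega>) = x (Suc n) v}" for v
  proof -
    have "cur_val n v y (R (Some v) \<omega>) = cur_val n v y (\<lambda>s. enc s \<omega>)" for \<omega>
      by (simp add: R_def K_def cur_val_def cur_src_def)
    moreover have "R (Some v) \<omega> \<in> space (\<Pi>\<^sub>M s\<in>cur_src n v. count_space UNIV)" for \<omega>
      by (simp add: R_def K_def space_PiM)
    ultimately show ?thesis unfolding A_def option.case by auto
  qed
  have "XI (Suc n) v \<omega> = cur_val n v y (\<lambda>s. enc s \<omega>)" if h: "\<forall>i\<in>{1..n}. \<forall>v. XI i v \<omega> = x i v" for \<omega> v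
  proof -
    have "(if d \<le> n then XI d w \<omega> else 0) = y d w" for d w
    proof (cases "d = 0")
      case True
      have "XI 0 w \<omega> = 0" by (simp add: XI_def)
      then show ?thesis unfolding True by (simp add: y_def)
    next
      case False
      then show ?thesis using h by (cases "d \<le> n") (auto simp: y_def)
    qed
    note e = this
    have "XI (Suc n) v \<omega> = (if n = 0 then \<sigma> v \<omega> else \<xi> n v \<omega> * (if D n v \<omega> \<le> n then XI (D n v \<omega>) (u n v \<omega>) \<omega> else 0))"
      unfolding XI_def by (rule erwg_X.simps)
    then show ?thesis unfolding e by (simp add: cur_val_def)
  qed
  then have "{\<omega> \<in> space M. \<forall>i\<in>{1..Suc n}. \<forall>v. XI i v \<omega> = x i v}
      = {\<omega> \<in> space M. \<forall>i\<in>{1..n}. \<forall>v. XI i v \<omega> = x i v} \<inter> (\<Inter>v. {\<omega> \<in> space M. cur_val n v y (\<lambda>s. enc s \<omega>) = x (Suc n) v})"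
    by (auto simp: atLeastAtMostSuc_conv)
  also have "\<dots> = (\<Inter>j\<in>UNIV. R j -` A j \<inter> space M)"
    by (simp only: UNIV_option_conv INT_insert image_image pre_None pre_Some[symmetric])
  finally have "prob {\<omega> \<in> space M. \<forall>i\<in>{1..Suc n}. \<forall>v. XI i v \<omega> = x i v} = (\<Prod>j\<in>UNIV. prob (R j -` A j \<inter> space M))"
    using indep_varsD[OF ind, of UNIV A] Am by simp
  also have "\<dots> = prob (R None -` A None \<inter> space M) * (\<Prod>v\<in>UNIV. prob (R (Some v) -` A (Some v) \<inter> space M))"
    by (simp add: UNIV_option_conv prod.reindex)
  also have "(\<Prod>v\<in>UNIV. prob (R (Some v) -` A (Some v) \<inter> space M))
    = (\<Prod>v\<in>UNIV. (1 + real_of_int (x (Suc n) v) * drift E p q (\<lambda>i u. real_of_int (x i u)) n v) / 2)"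
  proof (rule prod.cong[OF refl])
    fix v
    have "drift E p q (\<lambda>i u. real_of_int (y i u)) n v = drift E p q (\<lambda>i u. real_of_int (x i u)) n v"
      by (rule drift_cong) (simp add: y_def)
    moreover have "prob {\<omega> \<in> space M. cur_val n v y (\<lambda>s. enc s \<omega>) = x (Suc n) v}
      = (1 + real_of_int (x (Suc n) v) * drift E p q (\<lambda>i u. real_of_int (y i u)) n v) / 2"
      by (rule prob_cur_val) (use x in \<open>simp_all add: y_def\<close>)
    ultimately show "prob (R (Some v) -` A (Some v) \<inter> space M)
      = (1 + real_of_int (x (Suc n) v) * drift E p q (\<lambda>i u. real_of_int (x i u)) n v) / 2"
      unfolding pre_Some by (simp only:)
  qed
  finally show ?thesis unfolding pre_None .
qed

lemma set_Rad: "set_pmf (Rad r) \<subseteq> {1, -1}"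
  by (auto simp: Rad_def)

lemma AE_XI_val: "AE \<omega> in M. \<forall>n\<ge>1. \<forall>v. XI n v \<omega> = 1 \<or> XI n v \<omega> = -1"
proof -
  have 1: "AE \<omega> in M. \<forall>v. \<sigma> v \<omega> \<in> {1, -1}"
  proof (subst AE_all_countable, rule allI)
    fix v show "AE \<omega> in M. \<sigma> v \<omega> \<in> {1, -1}"
      using AE_in_set_pmf[OF measurable_sigma law_sigma, of v] by (rule eventually_mono) (use set_Rad in blast)
  qed
  have 2: "AE \<omega> in M. \<forall>n\<ge>1. \<forall>v. \<xi> n v \<omega> \<in> {1, -1} \<and> D n v \<omega> \<in> {1..n}"
  proof (subst AE_all_countable, rule allI)
    fix n show "AE \<omega> in M. 1 \<le> n \<longrightarrow> (\<forall>v. \<xi> n v \<omega> \<in> {1, -1} \<and> D n v \<omega> \<in> {1..n})"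
    proof (cases "1 \<le> n")
      case True
      have "AE \<omega> in M. \<forall>v. \<xi> n v \<omega> \<in> {1, -1} \<and> D n v \<omega> \<in> {1..n}"
      proof (subst AE_all_countable, rule allI)
        fix v
        have "AE \<omega> in M. \<xi> n v \<omega> \<in> set_pmf (Rad (p v))" by (rule AE_in_set_pmf[OF measurable_xi law_xi]) (rule True)+
        moreover have "AE \<omega> in M. D n v \<omega> \<in> set_pmf (pmf_of_set {1..n})" by (rule AE_in_set_pmf[OF measurable_D law_D]) (rule True)+
        moreover have "set_pmf (pmf_of_set {1..n}) = {1..n}" using True by (intro set_pmf_of_set) auto
        ultimately show "AE \<omega> in M. \<xi> n v \<omega> \<in> {1, -1} \<and> D n v \<omega> \<in> {1..n}"
          using set_Rad by (auto elim!: eventually_elim2)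
      qed
      then show ?thesis by (rule eventually_mono) simp
    qed simp
  qed
  from 1 2 show ?thesis
  proof eventually_elim
    case (elim \<omega>)
    have "1 \<le> n \<Longrightarrow> XI n v \<omega> = 1 \<or> XI n v \<omega> = -1" for n v
    proof (induction n arbitrary: v rule: less_induct)
      case (less n)
      obtain k where k: "n = Suc k" using less.prems by (cases n) auto
      show ?case
      proof (cases "k = 0")
        case True
        then show ?thesis using elim(1) by (simp add: XI_def k)
      next
        case False
        have d: "1 \<le> D k v \<omega>" "D k v \<omega> \<le> k" and x: "\<xi> k v \<omega> = 1 \<or> \<xi> k v \<omega> = -1"
          using elim(2)[rule_format, of k v] False by simp_all
        have "XI (D k v \<omega>) (u k v \<omega>) \<omega> = 1 \<or> XI (D k v \<omega>) (u k v \<omega>) \<omega> = -1"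
          by (rule less.IH) (use d k in simp_all)
        moreover have "XI n v \<omega> = \<xi> k v \<omega> * XI (D k v \<omega>) (u k v \<omega>) \<omega>"
          using False d by (simp add: XI_def k)
        ultimately show ?thesis using x by auto
      qed
    qed
    then show ?case by blast
  qed
qed

lemma erwg_has_drift_law: "has_drift_law M E p q (\<lambda>n v \<omega>. real_of_int (erwg_X \<sigma> \<xi> D u n v \<omega>))"
  unfolding has_drift_law_def XI_def[symmetric]
proof (intro conjI allI impI)
  show "(\<lambda>\<omega>. real_of_int (XI n v \<omega>)) \<in> borel_measurable M" for n v
    by (rule measurable_compose[OF XI_measurable]) simp
  show "AE \<omega> in M. \<forall>n\<ge>1. \<forall>v. real_of_int (XI n v \<omega>) = 1 \<or> real_of_int (XI n v \<omega>) = -1"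
    using AE_XI_val
  proof (rule eventually_mono)
    fix \<omega> assume h: "\<forall>n\<ge>1. \<forall>v. XI n v \<omega> = 1 \<or> XI n v \<omega> = -1"
    show "\<forall>n\<ge>1. \<forall>v. real_of_int (XI n v \<omega>) = 1 \<or> real_of_int (XI n v \<omega>) = -1"
    proof (intro allI impI)
      fix n :: nat and v assume "1 \<le> n"
      then show "real_of_int (XI n v \<omega>) = 1 \<or> real_of_int (XI n v \<omega>) = -1" using h[rule_format, of n v] by auto
    qed
  qed
  fix n and x :: "nat \<Rightarrow> 'k \<Rightarrow> int" assume x: "\<forall>i\<in>{1..Suc n}. \<forall>v. x i v = 1 \<or> x i v = -1"
  show "prob {\<omega> \<in> space M. \<forall>i\<in>{1..Suc n}. \<forall>v. real_of_int (XI i v \<omega>) = real_of_int (x i v)}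
        = prob {\<omega> \<in> space M. \<forall>i\<in>{1..n}. \<forall>v. real_of_int (XI i v \<omega>) = real_of_int (x i v)}
          * (\<Prod>v\<in>UNIV. (1 + real_of_int (x (Suc n) v) * drift E p q (\<lambda>i u. real_of_int (x i u)) n v) / 2)"
    unfolding of_int_eq_iff by (rule erwg_step_law) (use x in force)
qed

end

subsection \<open>Blocks\<close>

text \<open>The exponent is a compromise: the coupling errors of all blocks up to \<open>b\<close> and the fluctuation
  inside one block are both of order \<open>b^32\<close>, just below the square root of \<open>b^65\<close>.\<close>

definition block_start :: "nat \<Rightarrow> nat" where "block_start b = b ^ 65"

definition block_len :: "nat \<Rightarrow> nat" where "block_len b = block_start (Suc b) - block_start b"

definition block_of :: "nat \<Rightarrow> nat" where "block_of n = (LEAST b. n < block_start (Suc b))"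

abbreviation block :: "nat \<Rightarrow> nat set" where "block b \<equiv> {block_start b..<block_start (Suc b)}"

lemma block_start_0: "block_start 0 = 0"
  by (simp add: block_start_def)

lemma block_start_strict: "block_start b < block_start (Suc b)"
  unfolding block_start_def by (rule power_strict_mono) auto

lemma block_start_mono: "a \<le> b \<Longrightarrow> block_start a \<le> block_start b"
  unfolding block_start_def by (rule power_mono) auto

lemma block_start_ge: "b \<le> block_start b"
  unfolding block_start_def by (cases "b = 0") (simp_all add: self_le_power)

lemma block_len_pos: "0 < block_len b"
  using block_start_strict[of b] by (simp add: block_len_def)

lemma card_block: "card (block b) = block_len b"
  by (simp add: block_len_def)

lemma block_of_less: "n < block_start (Suc (block_of n))"
  unfolding block_of_def
proof (rule LeastI)
  show "n < block_start (Suc n)" using block_start_ge[of "Suc n"] by simp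
qed

lemma block_start_blk_le: "block_start (block_of n) \<le> n"
proof (cases "block_of n")
  case (Suc b)
  then have "\<not> n < block_start (Suc b)" unfolding block_of_def by (intro not_less_Least) simp
  then show ?thesis using Suc by simp
qed (simp add: block_start_0)

lemma block_of_eq: "n \<in> block b \<Longrightarrow> block_of n = b"
proof (rule ccontr)
  assume n: "n \<in> block b" and ne: "block_of n \<noteq> b"
  then consider "Suc (block_of n) \<le> b" | "Suc b \<le> block_of n" by linarith
  then show False
  proof cases
    case 1
    then show False using block_start_mono[OF 1] block_of_less[of n] n by simp
  next
    case 2
    then show False using block_start_mono[OF 2] block_start_blk_le[of n] n by simp
  qed
qed

lemma block_len_le: "real (block_len b) \<le> 65 * (real b + 1) ^ 64"
proof -
  have "real (block_len b) = (real b + 1) ^ 65 - real b ^ 65"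
    using block_start_mono[of b "Suc b"] by (simp add: block_len_def block_start_def of_nat_diff add.commute)
  also have "\<dots> = (real b + 1 - real b) * (\<Sum>i<65. (real b + 1) ^ i * real b ^ (64 - i))"
    using power_diff_sumr2[of "real b + 1" 65 "real b"] by (simp add: mult.commute)
  also have "\<dots> \<le> (\<Sum>i<65::nat. (real b + 1) ^ 64)"
  proof -
    have "(real b + 1) ^ i * real b ^ (64 - i) \<le> (real b + 1) ^ 64" if "i < 65" for i :: nat
    proof -
      have "(real b + 1) ^ i * real b ^ (64 - i) \<le> (real b + 1) ^ i * (real b + 1) ^ (64 - i)"
        by (intro mult_left_mono power_mono) auto
      also have "\<dots> = (real b + 1) ^ 64" using that by (simp flip: power_add)
      finally show ?thesis .
    qed
    then have "(\<Sum>i<65. (real b + 1) ^ i * real b ^ (64 - i)) \<le> (\<Sum>i<65::nat. (real b + 1) ^ 64)"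
      by (intro sum_mono) simp
    then show ?thesis by simp
  qed
  finally show ?thesis by simp
qed

lemma sum_blocks: "(\<Sum>i<block_start b. f i) = (\<Sum>c<b. \<Sum>i\<in>block c. f i)" for f :: "nat \<Rightarrow> real"
proof (induction b)
  case (Suc b)
  have "{..<block_start (Suc b)} = {..<block_start b} \<union> block b" using block_start_strict[of b] by auto
  moreover have "sum f ({..<block_start b} \<union> block b) = sum f {..<block_start b} + sum f (block b)"
    by (rule sum.union_disjoint) auto
  ultimately have "sum f {..<block_start (Suc b)} = sum f {..<block_start b} + sum f (block b)" by (simp only:)
  then show ?case unfolding Suc.IH sum.lessThan_Suc .
qed (simp add: block_start_0)

text \<open>With \<open>b = block_of n\<close> we have \<open>(b + 1)^32 = O(n powr (32/65))\<close>, and \<open>32/65 + 1/200 < 498/1000\<close>.\<close>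

lemma block_rate:
  assumes n: "1 \<le> n"
  shows "(real (block_of n) + 1) ^ 32 * (real n + 1) powr (1 / 200) \<le> 2 ^ 33 * real n powr (498 / 1000)"
proof -
  define b where "b = block_of n"
  have "1 \<le> b"
  proof (rule ccontr)
    assume "\<not> 1 \<le> b"
    then have "block_of n = 0" by (simp add: b_def)
    then have "n < block_start (Suc 0)" using block_of_less[of n] by simp
    then show False using n by (simp add: block_start_def)
  qed
  have "real b ^ 65 \<le> real n" using block_start_blk_le[of n] unfolding block_start_def b_def[symmetric] by (simp flip: of_nat_power)
  then have "(real b ^ 65) powr (32 / 65) \<le> real n powr (32 / 65)" by (intro powr_mono2) auto
  moreover have "(real b ^ 65) powr (32 / 65) = real b ^ 32"
  proof -
    have b: "0 < real b" using \<open>1 \<le> b\<close> by simp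
    have "(real b ^ 65) powr (32 / 65) = (real b powr real 65) powr (32 / 65)" by (simp only: powr_realpow[OF b])
    also have "\<dots> = real b powr real 32" unfolding powr_powr by simp
    also have "\<dots> = real b ^ 32" by (rule powr_realpow[OF b])
    finally show ?thesis .
  qed
  ultimately have b32: "real b ^ 32 \<le> real n powr (32 / 65)" by simp
  have "(real b + 1) ^ 32 \<le> (2 * real b) ^ 32" using \<open>1 \<le> b\<close> by (intro power_mono) auto
  also have "\<dots> \<le> 2 ^ 32 * real n powr (32 / 65)" using b32 by (simp add: power_mult_distrib)
  finally have 1: "(real b + 1) ^ 32 \<le> 2 ^ 32 * real n powr (32 / 65)" .
  have "(real n + 1) powr (1 / 200) \<le> (2 * real n) powr (1 / 200)" using n by (intro powr_mono2) auto
  also have "\<dots> = 2 powr (1 / 200) * real n powr (1 / 200)" by (simp add: powr_mult)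
  also have "\<dots> \<le> 2 powr 1 * real n powr (1 / 200)" by (intro mult_right_mono powr_mono) auto
  finally have 2: "(real n + 1) powr (1 / 200) \<le> 2 * real n powr (1 / 200)" by simp
  have "(real b + 1) ^ 32 * (real n + 1) powr (1 / 200) \<le> (2 ^ 32 * real n powr (32 / 65)) * (2 * real n powr (1 / 200))"
    by (rule mult_mono[OF 1 2]) auto
  also have "\<dots> = 2 ^ 33 * (real n powr (32 / 65) * real n powr (1 / 200))" by simp
  also have "real n powr (32 / 65) * real n powr (1 / 200) = real n powr (32 / 65 + 1 / 200)" by (simp only: powr_add)
  also have "2 ^ 33 * real n powr (32 / 65 + 1 / 200) \<le> 2 ^ 33 * real n powr (498 / 1000)"
    using n by (intro mult_left_mono powr_mono) auto
  finally show ?thesis by (simp add: b_def)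
qed

subsection \<open>The coupled walk\<close>

lemma orthogonal_matrix_rows:
  fixes T :: "real ^ 'k::finite ^ 'k"
  assumes "orthogonal_matrix T"
  shows "(\<Sum>j\<in>UNIV. T $ u $ j * T $ v $ j) = (if u = v then 1 else 0)"
proof -
  have "(T ** transpose T) $ u $ v = mat 1 $ u $ v" using assms by (simp add: orthogonal_matrix_def)
  then show ?thesis by (simp add: matrix_matrix_mult_def transpose_def mat_def)
qed

lemma orthogonal_matrix_columns:
  fixes T :: "real ^ 'k::finite ^ 'k"
  assumes "orthogonal_matrix T"
  shows "(\<Sum>v\<in>UNIV. T $ v $ i * T $ v $ j) = (if i = j then 1 else 0)"
proof -
  have "orthogonal_matrix (transpose T)" using assms by (simp add: orthogonal_matrix_transpose)
  from orthogonal_matrix_rows[OF this, of i j] show ?thesis unfolding transpose_def vec_lambda_beta .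
qed

context prob_space
begin

text \<open>The form in which \<open>indep_vars_nested\<close> is applied: disjoint groups of
  coordinates of one independent family, with several independent functions of each group.\<close>

lemma indep_vars_grouped:
  fixes X :: "'i \<Rightarrow> 'a \<Rightarrow> real"
  assumes X: "indep_vars (\<lambda>_. borel) X UNIV" and K: "disjoint_family_on K I"
    and f: "\<And>i j. i \<in> I \<Longrightarrow> j \<in> J i \<Longrightarrow> f i j \<in> measurable (\<Pi>\<^sub>M k\<in>K i. borel) borel"
    and inner: "\<And>i. i \<in> I \<Longrightarrow> indep_vars (\<lambda>_. borel) (\<lambda>j \<omega>. f i j (restrict (\<lambda>k. X k \<omega>) (K i))) (J i)"
  shows "indep_vars (\<lambda>_. borel) (\<lambda>(i, j) \<omega>. f i j (restrict (\<lambda>k. X k \<omega>) (K i))) (Sigma I J)"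
proof -
  have "indep_vars (\<lambda>i. \<Pi>\<^sub>M k\<in>K i. borel) (\<lambda>i \<omega>. restrict (\<lambda>k. X k \<omega>) (K i)) I"
    by (rule indep_vars_restrict[OF X]) (use K in auto)
  then have "indep_vars (\<lambda>(i, j). borel) (\<lambda>(i, j) \<omega>. f i j (restrict (\<lambda>k. X k \<omega>) (K i))) (Sigma I J)"
    by (rule indep_vars_nested[where X="\<lambda>i \<omega>. restrict (\<lambda>k. X k \<omega>) (K i)"]) (rule f inner; assumption)+
  then show ?thesis by (simp add: case_prod_unfold)
qed

lemma indep_vars_comp_gauss:
  assumes X: "X \<in> borel_measurable M" "distr M borel X = gauss 1"
    and Y: "gauss1.indep_vars (\<lambda>_. borel) Y I"
  shows "indep_vars (\<lambda>_. borel) (\<lambda>i \<omega>. Y i (X \<omega>)) I"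
  unfolding indep_vars_def2
proof (intro conjI ballI indep_setsI)
  have Ym: "Y i \<in> measurable borel borel" if "i \<in> I" for i
    using Y that by (simp add: gauss1.indep_vars_def2 cong: measurable_cong_sets)
  show rv: "(\<lambda>\<omega>. Y i (X \<omega>)) \<in> borel_measurable M" if "i \<in> I" for i
    by (rule measurable_compose[OF X(1) Ym[OF that]])
  then show "{(\<lambda>\<omega>. Y i (X \<omega>)) -` A \<inter> space M |A. A \<in> sets borel} \<subseteq> events" if "i \<in> I" for i
    using that by auto
  have pr: "prob {\<omega> \<in> space M. X \<omega> \<in> B} = measure (gauss 1) B" if "B \<in> sets borel" for B
  proof -
    have "measure (distr M borel X) B = prob (X -` B \<inter> space M)" by (rule measure_distr[OF X(1) that])
    moreover have "X -` B \<inter> space M = {\<omega> \<in> space M. X \<omega> \<in> B}" by auto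
    ultimately show ?thesis by (simp add: X(2))
  qed
  fix A J assume J: "J \<noteq> {}" "J \<subseteq> I" "finite J"
    and A: "\<forall>i\<in>J. A i \<in> {(\<lambda>\<omega>. Y i (X \<omega>)) -` A \<inter> space M |A. A \<in> sets borel}"
  from A obtain B where B: "\<And>i. i \<in> J \<Longrightarrow> A i = (\<lambda>\<omega>. Y i (X \<omega>)) -` B i \<inter> space M" "\<And>i. i \<in> J \<Longrightarrow> B i \<in> sets borel"
    by simp metis
  have Bm: "Y i -` B i \<in> sets borel" if "i \<in> J" for i
    using measurable_sets[OF Ym B(2)[OF that], of i] that J by auto
  have "(\<Inter>i\<in>J. A i) = {\<omega> \<in> space M. X \<omega> \<in> (\<Inter>i\<in>J. Y i -` B i)}" using B(1) J by auto
  also have "prob \<dots> = measure (gauss 1) (\<Inter>i\<in>J. Y i -` B i)" by (rule pr) (use J Bm in auto)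
  also have "\<dots> = (\<Prod>i\<in>J. measure (gauss 1) (Y i -` B i))"
    using gauss1.indep_varsD[OF Y J(1) J(3) J(2), of B] B(2) by simp
  also have "\<dots> = (\<Prod>i\<in>J. prob (A i))"
  proof (rule prod.cong[OF refl])
    fix i assume i: "i \<in> J"
    have "A i = {\<omega> \<in> space M. X \<omega> \<in> Y i -` B i}" using B(1)[OF i] by auto
    then show "measure (gauss 1) (Y i -` B i) = prob (A i)" by (simp only: pr[OF Bm[OF i]])
  qed
  finally show "prob (\<Inter>i\<in>J. A i) = (\<Prod>i\<in>J. prob (A i))" .
qed

lemma distr_normalized:
  assumes X: "X \<in> borel_measurable M" "distr M borel X = gauss s" and s: "0 < s"
  shows "distr M borel (\<lambda>\<omega>. X \<omega> / s) = gauss 1"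
proof -
  have "distributed M lborel X (normal_density 0 s)" using X by (simp add: distributed_normal_iff)
  then have "distributed M lborel (\<lambda>\<omega>. 0 + (1 / s) * X \<omega>) (normal_density (0 + (1 / s) * 0) (\<bar>1 / s\<bar> * s))"
    using s by (intro normal_density_affine) auto
  then show ?thesis using s by (simp add: distributed_normal_iff)
qed

lemma distr_normalized_sum:
  assumes I: "finite I" "I \<noteq> {}" and X: "indep_vars (\<lambda>_. borel) X I"
    and law: "\<And>i. i \<in> I \<Longrightarrow> distr M borel (X i) = gauss 1"
  shows "distr M borel (\<lambda>\<omega>. (\<Sum>i\<in>I. X i \<omega>) / sqrt (real (card I))) = gauss 1"
proof (rule distr_normalized)
  have Xm: "X i \<in> borel_measurable M" if "i \<in> I" for i using indep_vars_measurable[OF X that] .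
  show "(\<lambda>\<omega>. \<Sum>i\<in>I. X i \<omega>) \<in> borel_measurable M" by (intro borel_measurable_sum Xm)
  show c: "0 < sqrt (real (card I))" using I by (simp add: card_gt_0_iff)
  have "distr M borel (\<lambda>\<omega>. \<Sum>i\<in>I. X i \<omega>) = scaled_gauss ((sqrt (real (card I)))\<^sup>2)"
    using distr_sum_gauss[OF I(1) X _ law] by simp
  then show "distr M borel (\<lambda>\<omega>. \<Sum>i\<in>I. X i \<omega>) = gauss (sqrt (real (card I)))"
    by (simp only: scaled_gauss_eq_gauss[OF c])
qed

lemma AE_normal_growth:
  fixes g :: "nat \<Rightarrow> 'a \<Rightarrow> real"
  assumes g: "\<And>n. g n \<in> borel_measurable M" "\<And>n. distr M borel (g n) = gauss 1" and p: "1 \<le> p"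
  shows "AE \<omega> in M. \<exists>C>0. \<forall>n. \<bar>g n \<omega>\<bar> \<le> C * (real n + 1) powr (1 / real p)"
  using AE_normal_bound[where p=p, OF g]
proof (rule eventually_mono)
  fix \<omega> assume "\<exists>K>0. \<forall>n. (g n \<omega>) ^ (2 * p) \<le> K * (real n + 1)\<^sup>2"
  then obtain K where K: "0 < K" "\<And>n. (g n \<omega>) ^ (2 * p) \<le> K * (real n + 1)\<^sup>2" by blast
  define s where "s = 1 / real (2 * p)"
  have s: "real (2 * p) * s = 1" "real 2 * s = 1 / real p" "0 \<le> s" using p by (auto simp: s_def)
  have "\<bar>g n \<omega>\<bar> \<le> K powr s * (real n + 1) powr (1 / real p)" for n
  proof (cases "g n \<omega> = 0")
    case True
    then show ?thesis by simp
  next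
    case False
    then have g0: "0 < \<bar>g n \<omega>\<bar>" by simp
    have n1: "0 < real n + 1" by simp
    have ev: "even (2 * p)" by simp
    have "\<bar>g n \<omega>\<bar> powr real (2 * p) = \<bar>g n \<omega>\<bar> ^ (2 * p)" by (rule powr_realpow[OF g0])
    also have "\<dots> = (g n \<omega>) ^ (2 * p)" by (rule power_even_abs[OF ev])
    also have "\<dots> \<le> K * (real n + 1)\<^sup>2" by (rule K(2))
    finally have "(\<bar>g n \<omega>\<bar> powr real (2 * p)) powr s \<le> (K * (real n + 1)\<^sup>2) powr s"
      using s(3) by (intro powr_mono2) auto
    also have "\<dots> = K powr s * ((real n + 1)\<^sup>2) powr s" by (rule powr_mult)
    also have "((real n + 1)\<^sup>2) powr s = ((real n + 1) powr real 2) powr s" by (simp only: powr_realpow[OF n1])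
    also have "\<dots> = (real n + 1) powr (1 / real p)" unfolding powr_powr s(2) ..
    also have "(\<bar>g n \<omega>\<bar> powr real (2 * p)) powr s = \<bar>g n \<omega>\<bar>" unfolding powr_powr s(1) by simp
    finally show ?thesis .
  qed
  then show "\<exists>C>0. \<forall>n. \<bar>g n \<omega>\<bar> \<le> C * (real n + 1) powr (1 / real p)"
    using K(1) by (intro exI[of _ "K powr s"]) auto
qed

end

text \<open>Index \<open>i\<close> belongs to step \<open>i + 1\<close>. \<open>Gh j i\<close> will
  be the normalized increment of the \<open>j\<close>-th Brownian motion over its clock step, and
  the \<open>U i v\<close> are further normals from which the uniforms for \<open>push\<close> are
  made.\<close>

locale normal_noise = prob_space M
  for M :: "'a measure" +
  fixes E :: "('k::finite \<times> 'k) set" and p q :: "'k \<Rightarrow> real" and T :: "real ^ 'k ^ 'k" and lam :: "'k \<Rightarrow> real"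
    and Gh :: "'k \<Rightarrow> nat \<Rightarrow> 'a \<Rightarrow> real" and U :: "nat \<Rightarrow> 'k \<Rightarrow> 'a \<Rightarrow> real"
  assumes p_range: "p v \<in> {0..1}" and q_range: "q v \<in> {0..1}"
    and T: "orthogonal_matrix T"
    and eig: "(\<Sum>v\<in>UNIV. (if (u, v) \<in> E then (2 * p v - 1) / real (in_deg E v) else 0) * T $ v $ j) = lam j * T $ u $ j"
    and lam_le: "lam j \<le> 1 / 2"
    and normal_indep: "indep_vars (\<lambda>_. borel) (\<lambda>(i, b, j). if b then Gh j i else U i j) (UNIV :: (nat \<times> bool \<times> 'k) set)"
    and Gh_law: "distr M borel (Gh j i) = gauss 1"
    and U_law: "distr M borel (U i v) = gauss 1"
begin

definition "base_normal k = (case k of (i, b, j) \<Rightarrow> if b then Gh j i else U i j)" for k :: "nat \<times> bool \<times> 'k"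

lemma base_normal_indep: "indep_vars (\<lambda>_. borel) base_normal UNIV"
  using normal_indep by (simp add: base_normal_def[abs_def])

lemma Gh_measurable[measurable]: "Gh j i \<in> borel_measurable M"
  and U_measurable[measurable]: "U i v \<in> borel_measurable M"
  using indep_vars_measurable[OF base_normal_indep, of "(i, True, j)"] indep_vars_measurable[OF base_normal_indep, of "(i, False, v)"]
  by (simp_all add: base_normal_def)

text \<open>Chosen so that projecting the vertex noise on column \<open>j\<close> of
  \<open>T\<close> returns \<open>Gh j i\<close>, as \<open>Gh_eq_G\<close> states: the signs follow
  \<open>G\<close> at the vertices, while the comparison with the Brownian motions takes place in
  the eigenbasis.\<close>

definition G :: "'k \<Rightarrow> nat \<Rightarrow> 'a \<Rightarrow> real" where
  "G v i \<omega> = (\<Sum>j\<in>UNIV. T $ v $ j * Gh j i \<omega>)"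

lemma G_measurable[measurable]: "G v i \<in> borel_measurable M"
  unfolding G_def by measurable

lemma Gh_eq_G: "Gh j i \<omega> = (\<Sum>v\<in>UNIV. G v i \<omega> * T $ v $ j)"
proof -
  have "(\<Sum>v\<in>UNIV. G v i \<omega> * T $ v $ j) = (\<Sum>l\<in>UNIV. Gh l i \<omega> * (\<Sum>v\<in>UNIV. T $ v $ l * T $ v $ j))"
    unfolding G_def sum_distrib_right sum_distrib_left by (subst sum.swap) (simp add: mult_ac)
  then show ?thesis by (simp add: orthogonal_matrix_columns[OF T] if_distrib cong: if_cong)
qed

lemma Gh_row:
  shows "indep_vars (\<lambda>_. borel) (\<lambda>j. Gh j i) UNIV" "distributed M lborel (Gh j i) (normal_density 0 1)"
proof -
  have "inj_on (\<lambda>j. (i, True, j)) UNIV" by (simp add: inj_on_def)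
  from indep_vars_reindex[OF this indep_vars_subset[OF base_normal_indep]]
  show "indep_vars (\<lambda>_. borel) (\<lambda>j. Gh j i) UNIV" by (simp add: base_normal_def)
qed (simp add: distributed_normal_iff Gh_law)

lemma G_law: "distr M borel (G v i) = gauss 1"
  using rotate_normals(2)[OF T _ Gh_row] by (simp add: distributed_normal_iff G_def[abs_def])

definition "rotated_normal = (\<lambda>((i, b), v). if b then G v i else U i v)"

text \<open>The rotation acts within one time index, so independence across times is inherited and
  independence across vertices is \<open>rotate_normals\<close>. The normals \<open>U\<close> pass
  unchanged.\<close>

lemma rotated_normal_indep: "indep_vars (\<lambda>_. borel) rotated_normal (UNIV :: ((nat \<times> bool) \<times> 'k) set)"
proof -
  define K where "K ib = (\<lambda>j. (fst ib, snd ib, j)) ` (UNIV :: 'k set)" for ib :: "nat \<times> bool"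
  define f :: "nat \<times> bool \<Rightarrow> 'k \<Rightarrow> (nat \<times> bool \<times> 'k \<Rightarrow> real) \<Rightarrow> real" where
    "f ib v c = (if snd ib then (\<Sum>j\<in>UNIV. T $ v $ j * c (fst ib, snd ib, j)) else c (fst ib, snd ib, v))" for ib v c
  have e: "f ib v (restrict (\<lambda>k. base_normal k \<omega>) (K ib)) = rotated_normal (ib, v) \<omega>" for ib v \<omega>
    by (cases ib) (simp add: f_def K_def rotated_normal_def base_normal_def G_def)
  have "indep_vars (\<lambda>_. borel) (\<lambda>(ib, v) \<omega>. f ib v (restrict (\<lambda>k. base_normal k \<omega>) (K ib))) (UNIV \<times> UNIV)"
  proof (rule indep_vars_grouped[OF base_normal_indep])
    show "disjoint_family_on K UNIV" by (auto simp: disjoint_family_on_def K_def)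
    show "f ib v \<in> borel_measurable (\<Pi>\<^sub>M k\<in>K ib. borel)" for ib v
    proof -
      have [measurable]: "(\<lambda>c. c (fst ib, snd ib, j)) \<in> borel_measurable (\<Pi>\<^sub>M k\<in>K ib. (borel :: real measure))" for j
        by (rule measurable_component_singleton) (simp add: K_def)
      show ?thesis unfolding f_def[abs_def] by measurable
    qed
    show "indep_vars (\<lambda>_. borel) (\<lambda>v \<omega>. f ib v (restrict (\<lambda>k. base_normal k \<omega>) (K ib))) UNIV" for ib
    proof (cases ib)
      case (Pair i b)
      show ?thesis
      proof (cases b)
        case True
        show ?thesis unfolding e using rotate_normals(1)[OF T _ Gh_row] by (simp add: rotated_normal_def Pair True G_def[abs_def])
      next
        case False
        have "inj_on (\<lambda>j. (i, False, j)) UNIV" by (simp add: inj_on_def)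
        from indep_vars_reindex[OF this indep_vars_subset[OF base_normal_indep]]
        show ?thesis unfolding e by (simp add: base_normal_def rotated_normal_def Pair False)
      qed
    qed
  qed
  then show ?thesis unfolding e by (simp add: case_prod_unfold)
qed

text \<open>The normals of a block act on its signs only through this normalized sum: one standard
  normal decides the whole vector of signs.\<close>

definition R :: "nat \<Rightarrow> 'k \<Rightarrow> 'a \<Rightarrow> real" where
  "R c v \<omega> = (\<Sum>i\<in>block c. G v i \<omega>) / sqrt (real (block_len c))"

lemma R_measurable[measurable]: "R c v \<in> borel_measurable M"
  unfolding R_def by measurable

lemma R_law: "distr M borel (R c v) = gauss 1"
proof -
  have inj: "inj_on (\<lambda>i. ((i, True), v)) (block c)" by (simp add: inj_on_def)
  have "indep_vars (\<lambda>_. borel) (\<lambda>i. rotated_normal ((i, True), v)) (block c)"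
    by (rule indep_vars_reindex[OF inj indep_vars_subset[OF rotated_normal_indep]]) simp
  then have "indep_vars (\<lambda>_. borel) (\<lambda>i. G v i) (block c)" by (simp add: rotated_normal_def)
  from distr_normalized_sum[OF _ _ this G_law] show ?thesis
    unfolding R_def[abs_def] card_block using block_start_strict[of c] by simp
qed

definition Y :: "nat \<Rightarrow> 'k \<Rightarrow> 'a \<Rightarrow> real" where
  "Y i v \<omega> = signs (block_len (block_of i)) (R (block_of i) v \<omega>) (i - block_start (block_of i))"

definition V :: "nat \<Rightarrow> 'k \<Rightarrow> 'a \<Rightarrow> real" where
  "V i v \<omega> = Phi (U i v \<omega>)"

lemma offset_less: "i - block_start (block_of i) < block_len (block_of i)"
  using block_of_less[of i] block_start_blk_le[of i] by (simp add: block_len_def)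

text \<open>Signs within a block are independent by \<open>signs_indep\<close>, although they come
  from one normal; different blocks, vertices and uniforms use disjoint sets of rotated
  normals.\<close>

lemma YV_indep: "indep_vars (\<lambda>_. borel) (\<lambda>(i, v, b). if b then Y i v else V i v) (UNIV :: (nat \<times> 'k \<times> bool) set)"
proof -
  \<comment> \<open>A group \<open>(True, c, v)\<close> carries the signs of block \<open>c\<close>
    at vertex \<open>v\<close>, indexed by their offsets, and \<open>(False, c, v)\<close> the
    single uniform at time \<open>c\<close>. The map \<open>h\<close> below finds each noise
    variable in its group.\<close>
  define I where "I = (UNIV :: (bool \<times> nat \<times> 'k) set)"
  define K where "K a = (case a of (b, c, v) \<Rightarrow> if b then (\<lambda>i. ((i, True), v)) ` block c else {((c, False), v)})" for a :: "bool \<times> nat \<times> 'k"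
  define J where "J a = (case a of (b, c, v) \<Rightarrow> if b then {..<block_len c} else {0})" for a :: "bool \<times> nat \<times> 'k"
  define f :: "bool \<times> nat \<times> 'k \<Rightarrow> nat \<Rightarrow> ((nat \<times> bool) \<times> 'k \<Rightarrow> real) \<Rightarrow> real" where
    "f a r x = (case a of (b, c, v) \<Rightarrow> if b then signs (block_len c) ((\<Sum>i\<in>block c. x ((i, True), v)) / sqrt (real (block_len c))) r
       else Phi (x ((c, False), v)))" for a r x
  have e1: "f (True, c, v) r (restrict (\<lambda>k. rotated_normal k \<omega>) (K (True, c, v))) = signs (block_len c) (R c v \<omega>) r" for c v r \<omega>
  proof -
    have "(\<Sum>i\<in>block c. restrict (\<lambda>k. rotated_normal k \<omega>) (K (True, c, v)) ((i, True), v)) = (\<Sum>i\<in>block c. G v i \<omega>)"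
      by (rule sum.cong[OF refl]) (simp add: K_def rotated_normal_def)
    then show ?thesis unfolding f_def prod.case if_True R_def by (simp only:)
  qed
  have e2: "f (False, c, v) r (restrict (\<lambda>k. rotated_normal k \<omega>) (K (False, c, v))) = V c v \<omega>" for c v r \<omega>
    by (simp add: f_def K_def rotated_normal_def V_def)
  have ind: "indep_vars (\<lambda>_. borel) (\<lambda>(a, r) \<omega>. f a r (restrict (\<lambda>k. rotated_normal k \<omega>) (K a))) (Sigma I J)"
  proof (rule indep_vars_grouped[OF rotated_normal_indep])
    show "disjoint_family_on K I"
      unfolding disjoint_family_on_def
    proof (intro ballI impI)
      fix a a' :: "bool \<times> nat \<times> 'k" assume ne: "a \<noteq> a'"
      obtain b c v b' c' v' where a: "a = (b, c, v)" "a' = (b', c', v')" by (cases a; cases a')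
      have "c = c'" if "i \<in> block c" "i \<in> block c'" for i using block_of_eq[OF that(1)] block_of_eq[OF that(2)] by simp
      then show "K a \<inter> K a' = {}" using ne unfolding a K_def prod.case by (cases b; cases b'; simp only: if_True if_False) blast+
    qed
    fix a assume "a \<in> I"
    obtain b c v where a: "a = (b, c, v)" by (cases a)
    have km: "(\<lambda>x. x k) \<in> borel_measurable (\<Pi>\<^sub>M k\<in>K a. (borel :: real measure))" if "k \<in> K a" for k
      using that by (rule measurable_component_singleton)
    show "f a r \<in> borel_measurable (\<Pi>\<^sub>M k\<in>K a. borel)" for r
    proof -
      consider (T) "b = True" | (F) "b = False" by blast
      then show ?thesis
      proof cases
      case T
      have "(\<lambda>x. (\<Sum>i\<in>block c. x ((i, True), v)) / sqrt (real (block_len c))) \<in> borel_measurable (\<Pi>\<^sub>M k\<in>K a. (borel :: real measure))"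
        by (intro borel_measurable_divide borel_measurable_sum km borel_measurable_const) (simp add: a T K_def)
      from measurable_compose[OF this signs_borel_measurable[of "\<lambda>y. y r" "block_len c"]]
      show ?thesis unfolding a T f_def[abs_def] prod.case if_True .
    next
      case F
      have "(\<lambda>x. x ((c, False), v)) \<in> borel_measurable (\<Pi>\<^sub>M k\<in>K a. (borel :: real measure))"
        by (rule km) (simp add: a F K_def)
      from measurable_compose[OF this borel_measurable_Phi]
      show ?thesis unfolding a F f_def[abs_def] prod.case if_False .
    qed
    qed
    show "indep_vars (\<lambda>_. borel) (\<lambda>r \<omega>. f a r (restrict (\<lambda>k. rotated_normal k \<omega>) (K a))) (J a)"
    proof -
      consider (T) "b = True" | (F) "b = False" by blast
      then show ?thesis
      proof cases
      case T
      show ?thesis unfolding a T e1 J_def prod.case if_True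
        by (rule indep_vars_comp_gauss[OF R_measurable R_law signs_indep])
    next
      case F
      have "V c v \<in> borel_measurable M" unfolding V_def by measurable
      then show ?thesis unfolding a F e2 J_def prod.case if_False by (intro indep_vars_singleton)
    qed
    qed
  qed
  define h :: "nat \<times> 'k \<times> bool \<Rightarrow> (bool \<times> nat \<times> 'k) \<times> nat"
    where "h = (\<lambda>(i, v, b). if b then ((True, block_of i, v), i - block_start (block_of i)) else ((False, i, v), 0 :: nat))"
  have inj: "inj_on h (UNIV :: (nat \<times> 'k \<times> bool) set)"
  proof (rule inj_onI)
    fix x y :: "nat \<times> 'k \<times> bool" assume h: "h x = h y"
    obtain i v b i' v' b' where xy: "x = (i, v, b)" "y = (i', v', b')" by (cases x; cases y)
    have "i = i'" if "block_of i = block_of i'" "i - block_start (block_of i) = i' - block_start (block_of i')"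
      using that block_start_blk_le[of i] block_start_blk_le[of i'] by simp
    then show "x = y" using h unfolding xy h_def prod.case by (cases b; cases b') auto
  qed
  have "h ` UNIV \<subseteq> Sigma I J" using offset_less by (auto simp: h_def I_def J_def split: if_splits)
  from indep_vars_reindex[OF inj indep_vars_subset[OF ind this]]
  have "indep_vars (\<lambda>_. borel) (\<lambda>k. case h k of (a, r) \<Rightarrow> \<lambda>\<omega>. f a r (restrict (\<lambda>k. rotated_normal k \<omega>) (K a))) UNIV" .
  moreover have "(case h k of (a, r) \<Rightarrow> \<lambda>\<omega>. f a r (restrict (\<lambda>k. rotated_normal k \<omega>) (K a))) = (case k of (i, v, b) \<Rightarrow> if b then Y i v else V i v)" for k
  proof -
    obtain i v b where k: "k = (i, v, b)" by (cases k)
    consider (T) "b = True" | (F) "b = False" by blast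
    then show ?thesis
    proof cases
      case T
      show ?thesis unfolding k h_def prod.case T if_True e1 by (rule ext) (simp only: Y_def)
    next
      case F
      show ?thesis unfolding k h_def prod.case F if_False e2 ..
    qed
  qed
  ultimately show ?thesis by simp
qed

lemma prob_gauss:
  assumes "Z \<in> borel_measurable M" "distr M borel Z = gauss 1" "B \<in> sets borel"
  shows "prob {\<omega> \<in> space M. Z \<omega> \<in> B} = measure (gauss 1) B"
proof -
  have "measure (distr M borel Z) B = prob (Z -` B \<inter> space M)" by (rule measure_distr[OF assms(1,3)])
  moreover have "Z -` B \<inter> space M = {\<omega> \<in> space M. Z \<omega> \<in> B}" by auto
  ultimately show ?thesis by (simp add: assms(2))
qed

sublocale driven_eig M E p q Y V "\<lambda>v j. T $ v $ j" lam
proof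
  show "Y i v \<omega> = 1 \<or> Y i v \<omega> = -1" for i v \<omega>
    unfolding Y_def by (rule signs_cases) (rule offset_less)
  show "prob {\<omega> \<in> space M. Y i v \<omega> = 1} = 1 / 2" for i v
  proof -
    have "{\<omega> \<in> space M. Y i v \<omega> = 1} = {\<omega> \<in> space M. R (block_of i) v \<omega> \<in> {g. signs (block_len (block_of i)) g (i - block_start (block_of i)) \<in> {1}}}"
      by (simp add: Y_def)
    also have "prob \<dots> = measure (gauss 1) {g. signs (block_len (block_of i)) g (i - block_start (block_of i)) \<in> {1}}"
      by (rule prob_gauss[OF R_measurable R_law signs_sets])
    also have "\<dots> = 1 / 2" by (subst signs_marginal[OF offset_less]) auto
    finally show ?thesis .
  qed
  show "0 \<le> V i v \<omega>" for i v \<omega> unfolding V_def using Phi_pos by (rule less_imp_le)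
  show "prob {\<omega> \<in> space M. V i v \<omega> < u} = u" if "0 \<le> u" "u \<le> 1" for i v u
  proof -
    have "{g. Phi g < u} \<in> sets borel" by measurable
    from prob_gauss[OF U_measurable U_law this] show ?thesis
      using gauss_Phi_less[OF that] by (simp add: V_def)
  qed
qed (use p_range q_range YV_indep eig orthogonal_matrix_rows[OF T] lam_le in auto)

end

section \<open>Size of the accumulated noise difference\<close>

context normal_noise
begin

text \<open>The order of sqrt of the block length times a small power of \<open>n\<close>. This
  power absorbs both the logarithm from the martingale bound and the growth of standard
  normals.\<close>

definition fluct :: "nat \<Rightarrow> real" where
  "fluct n = (real (block_of n) + 1) ^ 32 * (real n + 1) powr (1 / 200)"

lemma powr_ge_1: "1 \<le> (real n + 1) powr (1 / 200)"
  by (rule ge_one_powr_ge_zero) auto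

lemma fluct_ge: "(real (block_of n) + 1) ^ 32 \<le> fluct n"
  unfolding fluct_def using powr_ge_1[of n] by (simp add: mult_le_cancel_left1)

lemma fluct_pos: "0 < fluct n"
  unfolding fluct_def by (intro mult_pos_pos zero_less_power) auto

lemma sqrt_block_len_le: "sqrt (real (block_len b)) \<le> 9 * (real b + 1) ^ 32"
proof -
  have "real (block_len b) \<le> 81 * (real b + 1) ^ 64"
    using block_len_le[of b] zero_le_power[of "real b + 1" 64] by linarith
  also have "\<dots> = (9 * (real b + 1) ^ 32)\<^sup>2" by (simp add: power_mult_distrib flip: power_mult)
  finally show ?thesis by (rule real_le_lsqrt[rotated]) simp
qed

definition err :: "nat \<Rightarrow> 'k \<Rightarrow> 'a \<Rightarrow> real" where
  "err c v \<omega> = (\<Sum>i\<in>block c. Y i v \<omega> - G v i \<omega>)"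

lemma err_measurable[measurable]: "err c v \<in> borel_measurable M"
  unfolding err_def by measurable

lemma err_eq: "err c v \<omega> = (\<Sum>r<block_len c. signs (block_len c) (R c v \<omega>) r) - sqrt (real (block_len c)) * R c v \<omega>"
proof -
  have "(\<Sum>i\<in>block c. Y i v \<omega>) = (\<Sum>i\<in>block c. signs (block_len c) (R c v \<omega>) (i - block_start c))"
    by (rule sum.cong[OF refl]) (simp only: Y_def block_of_eq)
  also have "\<dots> = (\<Sum>r<block_len c. signs (block_len c) (R c v \<omega>) r)"
    by (rule sum.reindex_bij_witness[where i="\<lambda>r. r + block_start c" and j="\<lambda>i. i - block_start c"])
       (auto simp: block_len_def)
  finally have 1: "(\<Sum>i\<in>block c. Y i v \<omega>) = (\<Sum>r<block_len c. signs (block_len c) (R c v \<omega>) r)" .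
  have "(\<Sum>i\<in>block c. G v i \<omega>) = sqrt (real (block_len c)) * R c v \<omega>"
    using block_len_pos[of c] by (simp add: R_def)
  then show ?thesis unfolding err_def sum_subtractf 1 by simp
qed

text \<open>The block length is at most 65 (c+1)^64, and 64 (1/2 - 1/32) = 30; the constant is 16
  times 65.\<close>

lemma nn_integral_err: "(\<integral>\<^sup>+\<omega>. ennreal \<bar>err c v \<omega>\<bar> \<partial>M) \<le> ennreal (1040 * (real c + 1) ^ 30)"
proof -
  let ?h = "\<lambda>g. \<bar>(\<Sum>r<block_len c. signs (block_len c) g r) - sqrt (real (block_len c)) * g\<bar>"
  have hm: "?h \<in> borel_measurable borel"
  proof -
    have [measurable]: "(\<lambda>g. \<Sum>r<block_len c. signs (block_len c) g r) \<in> borel_measurable borel"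
      by (rule signs_borel_measurable)
    show ?thesis by measurable
  qed
  have "(\<integral>\<^sup>+\<omega>. ennreal \<bar>err c v \<omega>\<bar> \<partial>M) = (\<integral>\<^sup>+g. ennreal (?h g) \<partial>distr M borel (R c v))"
    unfolding err_eq by (rule nn_integral_distr[symmetric]) (use hm in \<open>auto intro: measurable_compose\<close>)
  also have "\<dots> \<le> ennreal (16 * real (block_len c) powr (1 / 2 - 1 / 32))"
    unfolding R_law by (rule signs_coupling) (use block_len_pos[of c] in simp)
  also have "16 * real (block_len c) powr (1 / 2 - 1 / 32) \<le> 1040 * (real c + 1) ^ 30"
  proof -
    have "real (block_len c) powr (1 / 2 - 1 / 32) \<le> (65 * (real c + 1) ^ 64) powr (1 / 2 - 1 / 32)"
      using block_len_le[of c] by (intro powr_mono2) auto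
    also have "\<dots> = 65 powr (1 / 2 - 1 / 32) * ((real c + 1) ^ 64) powr (1 / 2 - 1 / 32)"
      by (rule powr_mult)
    also have "((real c + 1) ^ 64) powr (1 / 2 - 1 / 32) = (real c + 1) ^ 30"
    proof -
      have c: "0 < real c + 1" by simp
      have "((real c + 1) ^ 64) powr (1 / 2 - 1 / 32) = ((real c + 1) powr real 64) powr (1 / 2 - 1 / 32)"
        by (simp only: powr_realpow[OF c])
      also have "\<dots> = (real c + 1) powr real 30" unfolding powr_powr by simp
      also have "\<dots> = (real c + 1) ^ 30" by (rule powr_realpow[OF c])
      finally show ?thesis .
    qed
    also have "65 powr (1 / 2 - 1 / 32) * (real c + 1) ^ 30 \<le> 65 powr 1 * (real c + 1) ^ 30"
      by (intro mult_right_mono powr_mono) auto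
    finally show ?thesis by simp
  qed
  finally show ?thesis by (simp add: ennreal_leI)
qed

text \<open>Mean errors of order c^30 divided by (c+1)^32 are summable, so the weighted series
  converges almost surely; replacing its weights by the last one gives the bound on partial
  sums.\<close>

lemma AE_sum_err: "AE \<omega> in M. \<exists>K>0. \<forall>b. \<bar>\<Sum>c<b. err c v \<omega>\<bar> \<le> K * (real b + 1) ^ 32"
proof -
  have "AE \<omega> in M. summable (\<lambda>c. \<bar>err c v \<omega>\<bar> / (real c + 1) ^ 32)"
  proof (rule AE_summable_of_nn_integral[where c="\<lambda>c. 1040 / (real c + 1)\<^sup>2"])
    fix c
    have pos: "0 < (real c + 1) ^ 32" by (rule zero_less_power) simp
    have "(\<integral>\<^sup>+\<omega>. ennreal (\<bar>err c v \<omega>\<bar> / (real c + 1) ^ 32) \<partial>M) = (\<integral>\<^sup>+\<omega>. ennreal (1 / (real c + 1) ^ 32) * ennreal \<bar>err c v \<omega>\<bar> \<partial>M)"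
      using pos by (intro nn_integral_cong) (simp flip: ennreal_mult)
    also have "\<dots> = ennreal (1 / (real c + 1) ^ 32) * (\<integral>\<^sup>+\<omega>. ennreal \<bar>err c v \<omega>\<bar> \<partial>M)"
      by (rule nn_integral_cmult) measurable
    also have "\<dots> \<le> ennreal (1 / (real c + 1) ^ 32) * ennreal (1040 * (real c + 1) ^ 30)"
      by (rule mult_left_mono[OF nn_integral_err]) simp
    also have "\<dots> = ennreal (1 / (real c + 1) ^ 32 * (1040 * (real c + 1) ^ 30))"
      by (rule ennreal_mult[symmetric]) auto
    also have "1 / (real c + 1) ^ 32 * (1040 * (real c + 1) ^ 30) = 1040 / (real c + 1)\<^sup>2"
    proof -
      have e: "(real c + 1) ^ 32 = (real c + 1) ^ 30 * (real c + 1)\<^sup>2" by (simp flip: power_add)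
      have cancel: "1 / (a * b) * (1040 * a) = 1040 / b" if "a \<noteq> 0" for a b :: real using that by simp
      show ?thesis unfolding e by (rule cancel) simp
    qed
    finally show "(\<integral>\<^sup>+\<omega>. ennreal (\<bar>err c v \<omega>\<bar> / (real c + 1) ^ 32) \<partial>M) \<le> ennreal (1040 / (real c + 1)\<^sup>2)" .
  next
    have "summable (\<lambda>c. 1040 * (1 / (real (Suc c))\<^sup>2))"
      using inverse_squares_sums by (intro summable_mult) (simp add: sums_iff add.commute)
    then show "summable (\<lambda>c. 1040 / (real c + 1)\<^sup>2)" by (simp add: add.commute)
  qed auto
  then show ?thesis
  proof (rule eventually_mono)
    fix \<omega> assume s: "summable (\<lambda>c. \<bar>err c v \<omega>\<bar> / (real c + 1) ^ 32)"
    define A where "A = (\<Sum>c. \<bar>err c v \<omega>\<bar> / (real c + 1) ^ 32)"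
    have A: "0 \<le> A" unfolding A_def by (rule suminf_nonneg[OF s]) simp
    have "\<bar>\<Sum>c<b. err c v \<omega>\<bar> \<le> (A + 1) * (real b + 1) ^ 32" for b
    proof -
      have "\<bar>\<Sum>c<b. err c v \<omega>\<bar> \<le> (\<Sum>c<b. \<bar>err c v \<omega>\<bar>)" by (rule sum_abs)
      also have "\<dots> \<le> (\<Sum>c<b. \<bar>err c v \<omega>\<bar> / (real c + 1) ^ 32 * (real b + 1) ^ 32)"
      proof (rule sum_mono)
        fix c assume c: "c \<in> {..<b}"
        have pos: "0 < (real c + 1) ^ 32" by (rule zero_less_power) simp
        have "(real c + 1) ^ 32 \<le> (real b + 1) ^ 32" using c by (intro power_mono) auto
        then have "\<bar>err c v \<omega>\<bar> / (real c + 1) ^ 32 * (real c + 1) ^ 32 \<le> \<bar>err c v \<omega>\<bar> / (real c + 1) ^ 32 * (real b + 1) ^ 32"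
          using pos by (intro mult_left_mono) auto
        then show "\<bar>err c v \<omega>\<bar> \<le> \<bar>err c v \<omega>\<bar> / (real c + 1) ^ 32 * (real b + 1) ^ 32" using pos by simp
      qed
      also have "\<dots> = (\<Sum>c<b. \<bar>err c v \<omega>\<bar> / (real c + 1) ^ 32) * (real b + 1) ^ 32" by (rule sum_distrib_right[symmetric])
      also have "\<dots> \<le> A * (real b + 1) ^ 32"
        unfolding A_def by (intro mult_right_mono sum_le_suminf[OF s]) auto
      also have "\<dots> \<le> (A + 1) * (real b + 1) ^ 32" by (intro mult_right_mono) auto
      finally show ?thesis .
    qed
    then show "\<exists>K>0. \<forall>b. \<bar>\<Sum>c<b. err c v \<omega>\<bar> \<le> K * (real b + 1) ^ 32"
      using A by (intro exI[of _ "A + 1"]) auto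
  qed
qed

lemma AE_Q: "AE \<omega> in M. \<exists>K>0. \<forall>b. \<bar>Q (block_start b) v \<omega>\<bar> \<le> K * (real b + 1) ^ 32"
proof -
  obtain K where K: "0 \<le> K" "\<And>n. 1 \<le> n \<Longrightarrow> expectation (\<lambda>\<omega>. (Q n v \<omega>)\<^sup>2) \<le> K * real n powr (3 / 4)"
    using second_moment_Q[of v] by blast
  \<comment> \<open>At time b^65 the second moment of \<open>Q\<close> is of order b^(195/4), below
    b^62. The almost sure bound adds (b+1)^2, so \<open>Q\<close> squared is at most of order b^64,
    the square of the target b^32.\<close>
  define f where "f b \<omega> = (Q (block_start b) v \<omega>)\<^sup>2 / (real b + 1) ^ 62" for b \<omega>
  have pos: "0 < (real b + 1) ^ 62" for b :: nat by (rule zero_less_power) simp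
  have "AE \<omega> in M. \<exists>K>0. \<forall>b. f b \<omega> \<le> K * (real b + 1)\<^sup>2"
  proof (rule AE_bounded_of_nn_integral[OF _ _ _ K(1)])
    show "f b \<in> borel_measurable M" for b unfolding f_def[abs_def] by measurable
    show "0 \<le> f b \<omega>" for b \<omega> by (simp add: f_def)
    fix b
    have bd: "\<bar>(Q (block_start b) v \<omega>)\<^sup>2\<bar> \<le> (real (block_start b) * 3)\<^sup>2" for \<omega>
      using sq_le_of_abs_le[OF Q_bound[of "block_start b" v \<omega>]] by simp
    have int: "integrable M (\<lambda>\<omega>. (Q (block_start b) v \<omega>)\<^sup>2)"
      by (rule integrable_bounded[OF _ bd]) measurable
    have "(\<integral>\<^sup>+\<omega>. ennreal (f b \<omega>) \<partial>M) = ennreal (expectation (f b))"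
      by (rule nn_integral_eq_integral) (use int in \<open>auto simp: f_def[abs_def]\<close>)
    also have "expectation (f b) = expectation (\<lambda>\<omega>. (Q (block_start b) v \<omega>)\<^sup>2) / (real b + 1) ^ 62"
      unfolding f_def by simp
    also have "\<dots> \<le> K"
    proof (cases "b = 0")
      case True
      have "Q (block_start b) v \<omega> = 0" for \<omega> by (simp add: True block_start_0 Q_def)
      then show ?thesis using K(1) by simp
    next
      case False
      then have b: "0 < real b" by simp
      have "expectation (\<lambda>\<omega>. (Q (block_start b) v \<omega>)\<^sup>2) \<le> K * real (block_start b) powr (3 / 4)"
        using False block_start_ge[of b] by (intro K(2)) simp
      also have "real (block_start b) powr (3 / 4) \<le> (real b + 1) ^ 62"
      proof -
        have "real (block_start b) powr (3 / 4) = (real b powr real 65) powr (3 / 4)"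
          unfolding block_start_def of_nat_power by (simp only: powr_realpow[OF b])
        also have "\<dots> = real b powr (195 / 4)" unfolding powr_powr by simp
        also have "\<dots> \<le> (real b + 1) powr (195 / 4)" by (intro powr_mono2) auto
        also have "\<dots> \<le> (real b + 1) powr real 62" by (intro powr_mono) auto
        also have "\<dots> = (real b + 1) ^ 62" by (rule powr_realpow) simp
        finally show ?thesis .
      qed
      finally have "expectation (\<lambda>\<omega>. (Q (block_start b) v \<omega>)\<^sup>2) \<le> K * (real b + 1) ^ 62"
        using K(1) by (simp add: mult_left_mono)
      then show ?thesis using pos[of b] by (simp add: pos_divide_le_eq)
    qed
    finally show "(\<integral>\<^sup>+\<omega>. ennreal (f b \<omega>) \<partial>M) \<le> ennreal K" by (simp add: ennreal_leI)
  qed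
  then show ?thesis
  proof (rule eventually_mono)
    fix \<omega> assume "\<exists>K>0. \<forall>b. f b \<omega> \<le> K * (real b + 1)\<^sup>2"
    then obtain A where A: "0 < A" "\<And>b. f b \<omega> \<le> A * (real b + 1)\<^sup>2" by blast
    have "\<bar>Q (block_start b) v \<omega>\<bar> \<le> sqrt A * (real b + 1) ^ 32" for b
    proof -
      have "(Q (block_start b) v \<omega>)\<^sup>2 \<le> A * (real b + 1)\<^sup>2 * (real b + 1) ^ 62"
        using A(2)[of b] unfolding f_def pos_divide_le_eq[OF pos] .
      also have "\<dots> = A * ((real b + 1) ^ 32)\<^sup>2"
        unfolding mult.assoc power_add[symmetric] power_mult[symmetric] by simp
      also have "\<dots> = (sqrt A * (real b + 1) ^ 32)\<^sup>2"
        unfolding power_mult_distrib real_sqrt_pow2[OF less_imp_le[OF A(1)]] ..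
      finally have "\<bar>Q (block_start b) v \<omega>\<bar>\<^sup>2 \<le> (sqrt A * (real b + 1) ^ 32)\<^sup>2" unfolding power2_abs .
      then show ?thesis
        by (rule power2_le_imp_le) (use A(1) in simp)
    qed
    then show "\<exists>K>0. \<forall>b. \<bar>Q (block_start b) v \<omega>\<bar> \<le> K * (real b + 1) ^ 32"
      using A(1) by (intro exI[of _ "sqrt A"]) auto
  qed
qed

lemma AE_block_eps: "AE \<omega> in M. \<exists>K>0. \<forall>n. \<bar>\<Sum>i=block_start (block_of n)..<n. eps i v \<omega>\<bar> \<le> K * fluct n"
proof -
  have "AE \<omega> in M. \<exists>K>0. \<forall>n. \<bar>\<Sum>i=block_start (block_of n)..<n. eps i v \<omega>\<bar> \<le> sqrt (real (block_len (block_of n))) * (K + 2 * ln (real n + 1))"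
  proof (rule AE_eps_fluctuation)
    show "block_start (block_of n) \<le> n" for n by (rule block_start_blk_le)
    show "real (n - block_start (block_of n)) \<le> real (block_len (block_of n))" for n using offset_less[of n] by simp
    show "0 < real (block_len (block_of n))" for n using block_len_pos[of "block_of n"] by simp
  qed
  then show ?thesis
  proof (rule eventually_mono)
    fix \<omega> assume "\<exists>K>0. \<forall>n. \<bar>\<Sum>i=block_start (block_of n)..<n. eps i v \<omega>\<bar> \<le> sqrt (real (block_len (block_of n))) * (K + 2 * ln (real n + 1))"
    then obtain K where K: "0 < K" "\<And>n. \<bar>\<Sum>i=block_start (block_of n)..<n. eps i v \<omega>\<bar> \<le> sqrt (real (block_len (block_of n))) * (K + 2 * ln (real n + 1))" by blast
    have "\<bar>\<Sum>i=block_start (block_of n)..<n. eps i v \<omega>\<bar> \<le> 9 * (K + 400) * fluct n" for n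
    proof -
      let ?e = "(real n + 1) powr (1 / 200)"
      have e1: "1 \<le> ?e" by (rule powr_ge_1)
      \<comment> \<open>Compares the logarithm with the power 1/200, using that ln x is at most x -
        1.\<close>
      have "ln ?e = 1 / 200 * ln (real n + 1)" by (rule ln_powr)
      then have "ln (real n + 1) = 200 * ln ?e" by linarith
      also have "\<dots> \<le> 200 * ?e" using ln_le_minus_one[of ?e] e1 by linarith
      finally have "K + 2 * ln (real n + 1) \<le> K * ?e + 400 * ?e"
        using mult_left_mono[OF e1, of K] K(1) by linarith
      then have 1: "K + 2 * ln (real n + 1) \<le> (K + 400) * ?e" by (simp only: distrib_right)
      have "sqrt (real (block_len (block_of n))) * (K + 2 * ln (real n + 1)) \<le> (9 * (real (block_of n) + 1) ^ 32) * ((K + 400) * ?e)"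
      proof (rule mult_mono[OF sqrt_block_len_le 1])
        have "0 \<le> ln (real n + 1)" by (rule ln_ge_zero) simp
        then show "0 \<le> K + 2 * ln (real n + 1)" using K(1) by linarith
      qed simp
      also have "\<dots> = 9 * (K + 400) * fluct n" unfolding fluct_def by (simp only: mult_ac)
      finally show ?thesis using K(2)[of n] by (rule order_trans[rotated])
    qed
    then show "\<exists>K>0. \<forall>n. \<bar>\<Sum>i=block_start (block_of n)..<n. eps i v \<omega>\<bar> \<le> K * fluct n"
      using K(1) by (intro exI[of _ "9 * (K + 400)"]) auto
  qed
qed

lemma AE_block_Gh: "AE \<omega> in M. \<exists>K>0. \<forall>n. \<bar>\<Sum>i=block_start (block_of n)..<n. Gh j i \<omega>\<bar> \<le> K * fluct n"
proof -
  define s where "s n = sqrt (real (n - block_start (block_of n)))" for n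
  \<comment> \<open>At the start of a block the window is empty. A single normal is substituted
    there so that every \<open>g n\<close> is standard normal and \<open>AE_normal_growth\<close>
    applies.\<close>
  define g where "g n \<omega> = (if n = block_start (block_of n) then Gh j 0 \<omega> else (\<Sum>i=block_start (block_of n)..<n. Gh j i \<omega>) / s n)" for n \<omega>
  have ind: "indep_vars (\<lambda>_. borel) (\<lambda>i. Gh j i) UNIV"
  proof -
    have "inj_on (\<lambda>i. (i, True, j)) UNIV" by (simp add: inj_on_def)
    from indep_vars_reindex[OF this indep_vars_subset[OF base_normal_indep]]
    show ?thesis by (simp add: base_normal_def)
  qed
  have "AE \<omega> in M. \<exists>C>0. \<forall>n. \<bar>g n \<omega>\<bar> \<le> C * (real n + 1) powr (1 / real 200)"
  proof (rule AE_normal_growth)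
    show "g n \<in> borel_measurable M" for n unfolding g_def[abs_def] by measurable
    show "distr M borel (g n) = gauss 1" for n
    proof (cases "n = block_start (block_of n)")
      case True
      have "g n = Gh j 0" unfolding g_def by (rule ext) (rule if_P[OF True])
      then show ?thesis by (simp only: Gh_law)
    next
      case False
      then have ne: "{block_start (block_of n)..<n} \<noteq> {}" using block_start_blk_le[of n] by simp
      have "g n = (\<lambda>\<omega>. (\<Sum>i\<in>{block_start (block_of n)..<n}. Gh j i \<omega>) / sqrt (real (card {block_start (block_of n)..<n})))"
        unfolding g_def s_def card_atLeastLessThan by (rule ext) (rule if_not_P[OF False])
      then show ?thesis using distr_normalized_sum[OF _ ne indep_vars_subset[OF ind] Gh_law] by simp
    qed
  qed simp
  then show ?thesis
  proof (rule eventually_mono)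
    fix \<omega> assume "\<exists>C>0. \<forall>n. \<bar>g n \<omega>\<bar> \<le> C * (real n + 1) powr (1 / real 200)"
    then obtain C where C: "0 < C" and gb: "\<And>n. \<bar>g n \<omega>\<bar> \<le> C * (real n + 1) powr (1 / 200)" by auto
    have "\<bar>\<Sum>i=block_start (block_of n)..<n. Gh j i \<omega>\<bar> \<le> 9 * C * fluct n" for n
    proof (cases "n = block_start (block_of n)")
      case True
      then have "{block_start (block_of n)..<n} = {}" by simp
      then show ?thesis using C fluct_pos[of n] by simp
    next
      case False
      then have s: "0 < s n" using block_start_blk_le[of n] by (simp add: s_def)
      have sl: "s n \<le> sqrt (real (block_len (block_of n)))" unfolding s_def using offset_less[of n] by simp
      have "\<bar>\<Sum>i=block_start (block_of n)..<n. Gh j i \<omega>\<bar> = s n * \<bar>g n \<omega>\<bar>"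
        using s False by (simp add: g_def)
      also have "\<dots> \<le> (9 * (real (block_of n) + 1) ^ 32) * (C * (real n + 1) powr (1 / 200))"
        by (rule mult_mono[OF order_trans[OF sl sqrt_block_len_le] gb]) auto
      finally show ?thesis by (simp add: fluct_def mult_ac)
    qed
    then show "\<exists>K>0. \<forall>n. \<bar>\<Sum>i=block_start (block_of n)..<n. Gh j i \<omega>\<bar> \<le> K * fluct n"
      using C by (intro exI[of _ "9 * C"]) auto
  qed
qed

definition H :: "'k \<Rightarrow> nat \<Rightarrow> 'a \<Rightarrow> real" where
  "H j n \<omega> = (\<Sum>i<n. (\<Sum>v\<in>UNIV. eps i v \<omega> * T $ v $ j) - Gh j i \<omega>)"

text \<open>On complete blocks the noise difference is (eps - Y) + (Y - G), that is \<open>Q\<close>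
  plus coupling errors. In the block still running, the coupling says nothing about partial sums, so
  both noises are bounded separately.\<close>

lemma H_decomposition:
  "H j n \<omega> = (\<Sum>v\<in>UNIV. (Q (block_start (block_of n)) v \<omega> + (\<Sum>c<block_of n. err c v \<omega>) + (\<Sum>i=block_start (block_of n)..<n. eps i v \<omega>)) * T $ v $ j)
     - (\<Sum>i=block_start (block_of n)..<n. Gh j i \<omega>)"
proof -
  define b where "b = block_start (block_of n)"
  have b: "b \<le> n" unfolding b_def by (rule block_start_blk_le)
  have e: "(\<Sum>c<block_of n. err c v \<omega>) = (\<Sum>i<b. Y i v \<omega> - G v i \<omega>)" for v
    unfolding err_def b_def by (rule sum_blocks[symmetric])
  have split: "(\<Sum>i<n. f i) = (\<Sum>i<b. f i) + (\<Sum>i=b..<n. f i)" for f :: "nat \<Rightarrow> real"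
    using b sum.atLeastLessThan_concat[of 0 b n f] by (simp add: atLeast0LessThan)
  have "(\<Sum>i<b. (\<Sum>v\<in>UNIV. eps i v \<omega> * T $ v $ j) - Gh j i \<omega>) = (\<Sum>i<b. \<Sum>v\<in>UNIV. (eps i v \<omega> - G v i \<omega>) * T $ v $ j)"
    by (simp add: Gh_eq_G left_diff_distrib sum_subtractf)
  also have "\<dots> = (\<Sum>v\<in>UNIV. (\<Sum>i<b. eps i v \<omega> - G v i \<omega>) * T $ v $ j)"
    unfolding sum_distrib_right by (rule sum.swap)
  also have "\<dots> = (\<Sum>v\<in>UNIV. (Q b v \<omega> + (\<Sum>i<b. Y i v \<omega> - G v i \<omega>)) * T $ v $ j)"
    unfolding Q_def by (simp flip: sum.distrib)
  finally have 1: "(\<Sum>i<b. (\<Sum>v\<in>UNIV. eps i v \<omega> * T $ v $ j) - Gh j i \<omega>) = \<dots>" .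
  have "(\<Sum>i=b..<n. (\<Sum>v\<in>UNIV. eps i v \<omega> * T $ v $ j) - Gh j i \<omega>)
    = (\<Sum>v\<in>UNIV. (\<Sum>i=b..<n. eps i v \<omega>) * T $ v $ j) - (\<Sum>i=b..<n. Gh j i \<omega>)"
    unfolding sum_subtractf sum_distrib_right by (subst sum.swap) (rule refl)
  then show ?thesis
    unfolding H_def split 1 b_def[symmetric] e by (simp add: distrib_right sum.distrib)
qed

lemma AE_H_bound: "AE \<omega> in M. \<exists>K>0. \<forall>n\<ge>1. \<bar>H j n \<omega>\<bar> \<le> K * real n powr (498 / 1000)"
proof -
  have 1: "AE \<omega> in M. \<forall>v. \<exists>K>0. \<forall>b. \<bar>\<Sum>c<b. err c v \<omega>\<bar> \<le> K * (real b + 1) ^ 32"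
    by (subst AE_all_countable) (rule allI, rule AE_sum_err)
  have 2: "AE \<omega> in M. \<forall>v. \<exists>K>0. \<forall>b. \<bar>Q (block_start b) v \<omega>\<bar> \<le> K * (real b + 1) ^ 32"
    by (subst AE_all_countable) (rule allI, rule AE_Q)
  have 3: "AE \<omega> in M. \<forall>v. \<exists>K>0. \<forall>n. \<bar>\<Sum>i=block_start (block_of n)..<n. eps i v \<omega>\<bar> \<le> K * fluct n"
    by (subst AE_all_countable) (rule allI, rule AE_block_eps)
  from 1 2 3 AE_block_Gh[of j] show ?thesis
  proof eventually_elim
    case (elim \<omega>)
    obtain K1 :: "'k \<Rightarrow> real" where K1: "\<And>v. 0 < K1 v" "\<And>v b. \<bar>\<Sum>c<b. err c v \<omega>\<bar> \<le> K1 v * (real b + 1) ^ 32"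
      using elim(1) by metis
    obtain K2 :: "'k \<Rightarrow> real" where K2: "\<And>v. 0 < K2 v" "\<And>v b. \<bar>Q (block_start b) v \<omega>\<bar> \<le> K2 v * (real b + 1) ^ 32"
      using elim(2) by metis
    obtain K3 :: "'k \<Rightarrow> real" where K3: "\<And>v. 0 < K3 v" "\<And>v n. \<bar>\<Sum>i=block_start (block_of n)..<n. eps i v \<omega>\<bar> \<le> K3 v * fluct n"
      using elim(3) by metis
    obtain K4 where K4: "0 < K4" "\<And>n. \<bar>\<Sum>i=block_start (block_of n)..<n. Gh j i \<omega>\<bar> \<le> K4 * fluct n"
      using elim(4) by blast
    define C where "C = (\<Sum>v\<in>UNIV. (K2 v + K1 v + K3 v) * \<bar>T $ v $ j\<bar>) + K4"
    have C: "0 < C" unfolding C_def using K1(1) K2(1) K3(1) K4(1)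
      by (intro add_nonneg_pos sum_nonneg mult_nonneg_nonneg add_nonneg_nonneg) (auto intro: less_imp_le)
    have HC: "\<bar>H j n \<omega>\<bar> \<le> C * fluct n" for n
    proof -
      let ?a = "\<lambda>v. Q (block_start (block_of n)) v \<omega> + (\<Sum>c<block_of n. err c v \<omega>) + (\<Sum>i=block_start (block_of n)..<n. eps i v \<omega>)"
      have a: "\<bar>?a v\<bar> \<le> (K2 v + K1 v + K3 v) * fluct n" for v
      proof -
        have "K2 v * (real (block_of n) + 1) ^ 32 \<le> K2 v * fluct n" "K1 v * (real (block_of n) + 1) ^ 32 \<le> K1 v * fluct n"
          using K1(1)[of v] K2(1)[of v] fluct_ge[of n] by (simp_all add: mult_left_mono)
        then have "\<bar>Q (block_start (block_of n)) v \<omega>\<bar> \<le> K2 v * fluct n" "\<bar>\<Sum>c<block_of n. err c v \<omega>\<bar> \<le> K1 v * fluct n"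
          using K2(2)[of "block_of n" v] K1(2)[of v "block_of n"] by linarith+
        then show ?thesis using K3(2)[of v n] unfolding distrib_right by linarith
      qed
      have "\<bar>H j n \<omega>\<bar> \<le> \<bar>\<Sum>v\<in>UNIV. ?a v * T $ v $ j\<bar> + \<bar>\<Sum>i=block_start (block_of n)..<n. Gh j i \<omega>\<bar>"
        unfolding H_decomposition by (rule abs_triangle_ineq4)
      also have "\<dots> \<le> (\<Sum>v\<in>UNIV. (K2 v + K1 v + K3 v) * fluct n * \<bar>T $ v $ j\<bar>) + K4 * fluct n"
      proof (rule add_mono[OF _ K4(2)])
        show "\<bar>\<Sum>v\<in>UNIV. ?a v * T $ v $ j\<bar> \<le> (\<Sum>v\<in>UNIV. (K2 v + K1 v + K3 v) * fluct n * \<bar>T $ v $ j\<bar>)"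
          by (rule order_trans[OF sum_abs], rule sum_mono, rule abs_mult_le[OF a], rule order_refl)
      qed
      also have "\<dots> = C * fluct n" unfolding C_def distrib_right sum_distrib_right by (simp only: mult_ac distrib_left distrib_right)
      finally show ?thesis .
    qed
    have "\<bar>H j n \<omega>\<bar> \<le> C * 2 ^ 33 * real n powr (498 / 1000)" if "1 \<le> n" for n
    proof -
      have "C * fluct n \<le> C * (2 ^ 33 * real n powr (498 / 1000))"
        using block_rate[OF that] C unfolding fluct_def by (intro mult_left_mono) auto
      then show ?thesis using HC[of n] by simp
    qed
    then show ?case using C by (intro exI[of _ "C * 2 ^ 33"]) auto
  qed
qed

end

subsection \<open>The clocks\<close>

definition clock :: "real \<Rightarrow> nat \<Rightarrow> real" where
  "clock l n = (\<Sum>i=1..n. real i powr (- 2 * l))"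

lemma clock_Suc: "clock l (Suc n) = clock l n + real (Suc n) powr (- 2 * l)"
  by (simp add: clock_def)

lemma clock_less: "clock l n < clock l (Suc n)"
  by (simp add: clock_Suc)

lemma clock_nonneg: "0 \<le> clock l n"
  unfolding clock_def by (rule sum_nonneg) simp

lemma inverse_sqrt_increment: "0 < x \<Longrightarrow> d / sqrt (x powr (- 2 * l)) = d * x powr l" for x d l :: real
proof -
  assume x: "0 < x"
  have "sqrt (x powr (- 2 * l)) = x powr (- l)"
    by (rule real_sqrt_unique) (simp_all add: power2_eq_square flip: powr_add)
  then show ?thesis using x by (simp add: powr_minus_divide)
qed

text \<open>Each 1/n is at most twice the increment of the square root. A square root in place of
  the logarithm keeps all growth bounds in powers.\<close>

lemma harmonic_le: "(\<Sum>i=1..n. 1 / real i) \<le> 2 * sqrt (real n)"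
proof (induction n)
  case (Suc n)
  have s: "0 < sqrt (real (Suc n))" "sqrt (real n) \<le> sqrt (real (Suc n))" "0 \<le> sqrt (real n)" by auto
  have "1 = (sqrt (real (Suc n)) - sqrt (real n)) * (sqrt (real (Suc n)) + sqrt (real n))"
    by (simp add: algebra_simps)
  also have "\<dots> \<le> (sqrt (real (Suc n)) - sqrt (real n)) * (2 * sqrt (real (Suc n)))"
    using s by (intro mult_left_mono) auto
  also have "\<dots> \<le> (sqrt (real (Suc n)) - sqrt (real n)) * (2 * real (Suc n))"
  proof (intro mult_left_mono)
    have "1 \<le> sqrt (real (Suc n))" by simp
    then have "sqrt (real (Suc n)) * 1 \<le> sqrt (real (Suc n)) * sqrt (real (Suc n))" by (intro mult_left_mono) auto
    then show "sqrt (real (Suc n)) \<le> real (Suc n)" by simp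
  qed (use s in auto)
  finally have "1 \<le> (sqrt (real (Suc n)) - sqrt (real n)) * 2 * real (Suc n)" by (simp only: mult.assoc)
  then have "1 / real (Suc n) \<le> (sqrt (real (Suc n)) - sqrt (real n)) * 2"
    by (rule mult_imp_div_pos_le[rotated]) simp
  then show ?case using Suc.IH by simp
qed simp

text \<open>The standard deviation of the Brownian term at time \<open>n\<close>. Its square is the
  sum of (n/i)^(2l), and each ratio is at least 1, so the exponent may be raised to 1, which leaves
  a harmonic sum.\<close>

lemma scaled_clock_le:
  assumes l: "l \<le> 1 / 2" and n: "1 \<le> n"
  shows "real n powr l * sqrt (clock l n) \<le> 2 * real n powr (3 / 4)"
proof (rule power2_le_imp_le)
  have n0: "0 < real n" using n by simp
  have "(real n powr l * sqrt (clock l n))\<^sup>2 = real n powr (2 * l) * clock l n"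
    using clock_nonneg[of l n] by (simp add: power_mult_distrib power2_eq_square[of "real n powr l"] flip: powr_add)
  also have "\<dots> = (\<Sum>i=1..n. real n powr (2 * l) * real i powr (- 2 * l))"
    unfolding clock_def by (rule sum_distrib_left)
  also have "\<dots> \<le> (\<Sum>i=1..n. real n * (1 / real i))"
  proof (rule sum_mono)
    fix i assume i: "i \<in> {1..n}"
    then have i0: "0 < real i" "1 \<le> real n / real i" by auto
    have "real n powr (2 * l) * real i powr (- 2 * l) = (real n / real i) powr (2 * l)"
      using i0 n0 by (simp add: powr_divide powr_minus_divide)
    also have "\<dots> \<le> (real n / real i) powr 1" using i0(2) l by (intro powr_mono) auto
    also have "\<dots> = real n * (1 / real i)" using i0 n0 by simp
    finally show "real n powr (2 * l) * real i powr (- 2 * l) \<le> real n * (1 / real i)" .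
  qed
  also have "\<dots> = real n * (\<Sum>i=1..n. 1 / real i)" by (rule sum_distrib_left[symmetric])
  also have "\<dots> \<le> real n * (2 * sqrt (real n))" by (intro mult_left_mono harmonic_le) simp
  also have "\<dots> = 2 * real n powr (3 / 2)"
  proof -
    have "real n * sqrt (real n) = real n powr 1 * real n powr (1 / 2)" using n0 by (simp add: powr_half_sqrt)
    also have "\<dots> = real n powr (3 / 2)" unfolding powr_add[symmetric] by simp
    finally show ?thesis by simp
  qed
  also have "\<dots> \<le> 4 * real n powr (3 / 2)" by simp
  also have "\<dots> = (2 * real n powr (3 / 4))\<^sup>2"
    unfolding power_mult_distrib power2_eq_square[of "real n powr (3 / 4)"] powr_add[symmetric] by simp
  finally show "(real n powr l * sqrt (clock l n))\<^sup>2 \<le> (2 * real n powr (3 / 4))\<^sup>2" .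
qed simp

context prob_space
begin

lemma indep_vars_finite_UNIV:
  assumes "\<And>n. indep_vars M' X {..<n :: nat}"
  shows "indep_vars M' X UNIV"
  unfolding indep_vars_def2
proof (intro conjI ballI)
  show "random_variable (M' i) (X i)" for i
    using assms[of "Suc i"] by (simp add: indep_vars_def2)
  show "indep_sets (\<lambda>i. {X i -` A \<inter> space M |A. A \<in> sets (M' i)}) UNIV"
    unfolding indep_sets_finite_index_sets[of _ UNIV]
  proof (intro allI impI)
    fix J :: "nat set" assume "finite J"
    then obtain n where "J \<subseteq> {..<n}" by (auto simp: finite_nat_iff_bounded)
    then show "indep_sets (\<lambda>i. {X i -` A \<inter> space M |A. A \<in> sets (M' i)}) J"
      using indep_vars_subset[OF assms] by (simp add: indep_vars_def2)
  qed
qed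

text \<open>The clock step has length (i+1)^(-2l), so the factor (i+1)^l normalizes the increment.
  These are the normals that the walk is built from.\<close>

lemma clock_increments:
  fixes l :: real
  assumes W: "standard_brownian_motion M W"
  defines "g \<equiv> \<lambda>i \<omega>. (W (clock l (Suc i)) \<omega> - W (clock l i) \<omega>) * real (Suc i) powr l"
  shows "indep_vars (\<lambda>_. borel) g UNIV" "distr M borel (g i) = gauss 1"
proof -
  have "indep_vars (\<lambda>_. borel) (\<lambda>i \<omega>. W (clock l (Suc i)) \<omega> - W (clock l i) \<omega>) {..<n}" for n
    using W clock_nonneg[of l] clock_less[of l] unfolding standard_brownian_motion_def by (simp add: less_imp_le)
  then have "indep_vars (\<lambda>_. borel) (\<lambda>i \<omega>. W (clock l (Suc i)) \<omega> - W (clock l i) \<omega>) UNIV"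
    by (rule indep_vars_finite_UNIV)
  then show "indep_vars (\<lambda>_. borel) g UNIV"
    unfolding g_def by (rule indep_vars_compose2[where Y="\<lambda>i d. d * real (Suc i) powr l"]) simp
  let ?s = "sqrt (clock l (Suc i) - clock l i)"
  have s: "?s = sqrt (real (Suc i) powr (- 2 * l))" by (simp only: clock_Suc add_diff_cancel_left')
  have "distributed M lborel (\<lambda>\<omega>. W (clock l (Suc i)) \<omega> - W (clock l i) \<omega>) (normal_density 0 ?s)"
    using W clock_nonneg[of l i] clock_less[of l i] unfolding standard_brownian_motion_def by blast
  then have "distr M borel (\<lambda>\<omega>. (W (clock l (Suc i)) \<omega> - W (clock l i) \<omega>) / ?s) = gauss 1"
    using clock_less[of l i] by (intro distr_normalized) (simp_all add: distributed_normal_iff)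
  then show "distr M borel (g i) = gauss 1"
    unfolding s g_def inverse_sqrt_increment[OF of_nat_0_less_iff[THEN iffD2, OF zero_less_Suc]] .
qed

text \<open>A standard deviation of order n^(3/4) times the growth n^(1/4) of standard normals.
  Linear growth is all that \<open>recursion_comparison\<close> asks of \<open>V\<close>.\<close>

lemma AE_scaled_bm_bound:
  assumes W: "standard_brownian_motion M W" and l: "l \<le> 1 / 2"
  shows "AE \<omega> in M. \<exists>K>0. \<forall>n\<ge>1. \<bar>real n powr l * W (clock l n) \<omega>\<bar> \<le> K * real n"
proof -
  have W0: "AE \<omega> in M. W 0 \<omega> = 0" using W by (simp add: standard_brownian_motion_def)
  \<comment> \<open>\<open>W 0\<close> is subtracted because the definition of Brownian motion gives
    laws of increments only, and \<open>W 0\<close> vanishes merely almost surely.\<close>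
  define g where "g n \<omega> = (W (clock l (Suc n)) \<omega> - W 0 \<omega>) / sqrt (clock l (Suc n))" for n \<omega>
  have pos: "0 < clock l (Suc n)" for n using clock_nonneg[of l n] clock_less[of l n] by linarith
  have dist: "distributed M lborel (\<lambda>\<omega>. W (clock l (Suc n)) \<omega> - W 0 \<omega>) (normal_density 0 (sqrt (clock l (Suc n))))" for n
  proof -
    have "distributed M lborel (\<lambda>\<omega>. W (clock l (Suc n)) \<omega> - W 0 \<omega>) (normal_density 0 (sqrt (clock l (Suc n) - 0)))"
      using W pos[of n] unfolding standard_brownian_motion_def by blast
    then show ?thesis by simp
  qed
  have "AE \<omega> in M. \<exists>C>0. \<forall>n. \<bar>g n \<omega>\<bar> \<le> C * (real n + 1) powr (1 / real 4)"
  proof (rule AE_normal_growth)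
    show "g n \<in> borel_measurable M" for n
      unfolding g_def[abs_def] using dist[of n]
      by (intro borel_measurable_divide borel_measurable_const) (simp add: distributed_normal_iff)
    show "distr M borel (g n) = gauss 1" for n
      unfolding g_def[abs_def] using dist[of n] pos[of n] by (intro distr_normalized) (simp_all add: distributed_normal_iff)
  qed simp
  from this W0 show ?thesis
  proof eventually_elim
    case (elim \<omega>)
    obtain C where C: "0 < C" "\<And>n. \<bar>g n \<omega>\<bar> \<le> C * (real n + 1) powr (1 / 4)" using elim(1) by auto
    have gb: "\<bar>g n \<omega>\<bar> \<le> C * real (Suc n) powr (1 / 4)" for n using C(2)[of n] by (simp add: add.commute)
    have "\<bar>real n powr l * W (clock l n) \<omega>\<bar> \<le> 2 * C * real n" if n: "1 \<le> n" for n
    proof -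
      obtain k where k: "n = Suc k" using n by (cases n) auto
      have "W (clock l n) \<omega> = sqrt (clock l n) * g k \<omega>" using elim(2) pos[of k] by (simp add: g_def k)
      then have "\<bar>real n powr l * W (clock l n) \<omega>\<bar> = real n powr l * sqrt (clock l n) * \<bar>g k \<omega>\<bar>"
        using clock_nonneg[of l n] by (simp add: abs_mult)
      also have "\<dots> \<le> (2 * real n powr (3 / 4)) * (C * real n powr (1 / 4))"
        by (rule mult_mono[OF scaled_clock_le[OF l n] gb[of k, folded k]]) auto
      also have "\<dots> = 2 * C * (real n powr (3 / 4) * real n powr (1 / 4))" by (simp only: mult_ac)
      also have "real n powr (3 / 4) * real n powr (1 / 4) = real n" unfolding powr_add[symmetric] using n by simp
      finally show ?thesis .
    qed
    then show ?case using C(1) by (intro exI[of _ "2 * C"]) auto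
  qed
qed

end

lemma scaled_bm_step:
  fixes w w' l :: real
  assumes "1 \<le> n"
  shows "real (Suc n) powr l * w' = (1 + 1 / real n) powr l * (real n powr l * w) + (w' - w) * real (Suc n) powr l"
proof -
  have n: "0 < real n" using assms by simp
  have "(1 + 1 / real n) powr l * real n powr l = ((1 + 1 / real n) * real n) powr l"
    using n by (intro powr_mult[symmetric])
  also have "(1 + 1 / real n) * real n = real (Suc n)" using n by (simp add: field_simps)
  finally have e: "(1 + 1 / real n) powr l * (real n powr l * w) = real (Suc n) powr l * w" by (simp only: mult.assoc[symmetric])
  show ?thesis unfolding e left_diff_distrib by (simp only: mult.commute)
qed

subsection \<open>Eigenvalues\<close>

context
  fixes B T :: "real ^ 'k::finite ^ 'k" and lam :: "'k \<Rightarrow> real"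
  assumes sym: "transpose B = B" and orth: "orthogonal_matrix T"
    and diag: "transpose T ** B ** T = diag_matrix lam"
begin

lemma diag_eigenvector: "(\<Sum>v\<in>UNIV. B $ u $ v * T $ v $ j) = lam j * T $ u $ j"
proof -
  have "B ** T = T ** (transpose T ** B ** T)"
    using orth by (simp add: orthogonal_matrix_def matrix_mul_assoc)
  then have "(B ** T) $ u $ j = (T ** diag_matrix lam) $ u $ j" by (simp only: diag)
  then show ?thesis by (simp add: matrix_matrix_mult_def diag_matrix_def if_distrib mult.commute cong: if_cong)
qed

text \<open>The eigenvalues are defined through complex eigenvectors. Expanded in the real
  orthonormal columns of \<open>T\<close>, such a vector has a nonzero coordinate, and there the
  eigenvalue must equal the corresponding \<open>lam j\<close>.\<close>

lemma eigenvalues_diag: "eigenvalues B = complex_of_real ` range lam"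
proof (intro equalityI subsetI)
  fix z assume "z \<in> eigenvalues B"
  then obtain x where x: "x \<noteq> 0" "map_matrix complex_of_real B *v x = z *s x"
    by (auto simp: eigenvalues_def)
  have xe: "(\<Sum>v\<in>UNIV. complex_of_real (B $ u $ v) * x $ v) = z * x $ u" for u
    using arg_cong[OF x(2), of "\<lambda>y. y $ u"] by (simp add: matrix_vector_mult_def)
  define w where "w j = (\<Sum>u\<in>UNIV. x $ u * complex_of_real (T $ u $ j))" for j
  have sy: "B $ u $ v = B $ v $ u" for u v
    using arg_cong[OF sym, of "\<lambda>C. C $ v $ u"] by (simp add: transpose_def)
  \<comment> \<open>Symmetry moves \<open>B\<close> from the complex eigenvector to column
    \<open>j\<close> of \<open>T\<close>.\<close>
  have zw: "z * w j = lam j * w j" for j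
  proof -
    have "z * w j = (\<Sum>u\<in>UNIV. \<Sum>v\<in>UNIV. complex_of_real (B $ u $ v) * x $ v * complex_of_real (T $ u $ j))"
      unfolding w_def sum_distrib_left mult.assoc[symmetric] xe[symmetric] sum_distrib_right ..
    also have "\<dots> = (\<Sum>v\<in>UNIV. x $ v * complex_of_real (\<Sum>u\<in>UNIV. B $ v $ u * T $ u $ j))"
      unfolding of_real_sum of_real_mult sum_distrib_left by (subst sum.swap) (simp only: sy mult_ac)
    also have "\<dots> = lam j * w j"
      unfolding diag_eigenvector w_def sum_distrib_left of_real_mult by (simp only: mult_ac)
    finally show ?thesis .
  qed
  have xw: "x $ u = (\<Sum>j\<in>UNIV. w j * complex_of_real (T $ u $ j))" for u
  proof -
    have "(\<Sum>j\<in>UNIV. w j * complex_of_real (T $ u $ j)) = (\<Sum>v\<in>UNIV. x $ v * complex_of_real (\<Sum>j\<in>UNIV. T $ v $ j * T $ u $ j))"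
      unfolding w_def sum_distrib_right of_real_sum of_real_mult sum_distrib_left
      by (subst sum.swap) (simp only: mult_ac)
    then show ?thesis by (simp add: orthogonal_matrix_rows[OF orth] if_distrib cong: if_cong)
  qed
  obtain u where "x $ u \<noteq> 0" using x(1) by (auto simp: vec_eq_iff)
  then have "\<exists>j. w j \<noteq> 0" using xw[of u] by (auto intro: ccontr)
  then obtain j where "w j \<noteq> 0" ..
  then have "z = lam j" using zw[of j] by simp
  then show "z \<in> complex_of_real ` range lam" by simp
next
  fix z assume "z \<in> complex_of_real ` range lam"
  then obtain j where z: "z = complex_of_real (lam j)" by auto
  define x where "x = (\<chi> v. complex_of_real (T $ v $ j))"
  have "x \<noteq> 0"
  proof
    assume x: "x = 0"
    have "T $ v $ j = 0" for v using arg_cong[OF x, of "\<lambda>y. y $ v"] by (simp add: x_def)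
    then show False using orthogonal_matrix_columns[OF orth, of j j] by simp
  qed
  moreover have "map_matrix complex_of_real B *v x = z *s x"
  proof (subst vec_eq_iff, rule allI)
    fix u
    have "(map_matrix complex_of_real B *v x) $ u = complex_of_real (\<Sum>v\<in>UNIV. B $ u $ v * T $ v $ j)"
      by (simp add: matrix_vector_mult_def x_def)
    then show "(map_matrix complex_of_real B *v x) $ u = (z *s x) $ u"
      unfolding diag_eigenvector by (simp add: z x_def)
  qed
  ultimately show "z \<in> eigenvalues B" by (auto simp: eigenvalues_def)
qed

lemma lam_le_max_Re: "lam j \<le> max_Re_eigenvalue B"
proof -
  have "Re ` eigenvalues B = range lam" by (simp add: eigenvalues_diag image_image)
  then show ?thesis by (simp add: max_Re_eigenvalue_def)
qed

end

subsection \<open>Construction on the sequence space\<close>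

text \<open>One sequence of independent standard normals supplies everything:
  \<open>Inl (j, m, r)\<close> feeds the Levy construction of the \<open>j\<close>-th Brownian
  motion, and \<open>Inr (i, v)\<close> is the separate normal behind the uniform of step
  \<open>i + 1\<close> at vertex \<open>v\<close>.\<close>

definition src :: "('k::finite \<times> nat \<times> nat) + (nat \<times> 'k) \<Rightarrow> (nat \<Rightarrow> real) \<Rightarrow> real" where
  "src a \<omega> = \<omega> (to_nat a)"

definition normal_space :: "(nat \<Rightarrow> real) measure" where
  "normal_space = (\<Pi>\<^sub>M i\<in>UNIV. gauss 1)"

definition bms :: "'k::finite \<Rightarrow> real \<Rightarrow> (nat \<Rightarrow> real) \<Rightarrow> real" where
  "bms j t \<omega> = levy_bm (\<lambda>m r. src (Inl (j, m, r)) \<omega>) t"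

interpretation NS: prob_space normal_space
  unfolding normal_space_def by (rule prob_space_PiM) (rule gauss1.prob_space_axioms)

lemma src_indep: "NS.indep_vars (\<lambda>_. borel) (src :: ('k::finite \<times> nat \<times> nat) + (nat \<times> 'k) \<Rightarrow> _) UNIV"
proof -
  have "NS.indep_vars (\<lambda>_. gauss 1) (\<lambda>i \<omega>. \<omega> i) UNIV"
    unfolding normal_space_def by (rule indep_vars_PiM_coordinates) (rule gauss1.prob_space_axioms)
  then have ind: "NS.indep_vars (\<lambda>_. borel) (\<lambda>i \<omega>. \<omega> i) UNIV"
    using NS.indep_vars_compose2[of "\<lambda>_. gauss 1" "\<lambda>i \<omega>. \<omega> i" UNIV "\<lambda>_ x. x" "\<lambda>_. borel"] by simp
  have "inj_on to_nat (UNIV :: (('k \<times> nat \<times> nat) + (nat \<times> 'k)) set)" by simp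
  from NS.indep_vars_reindex[OF this NS.indep_vars_subset[OF ind]]
  show ?thesis by (simp add: src_def[abs_def])
qed

lemma src_law: "distr normal_space borel (src a) = gauss 1"
proof -
  have "distr normal_space borel (\<lambda>\<omega>. \<omega> i) = distr normal_space (gauss 1) (\<lambda>\<omega>. \<omega> i)" for i
    by (rule distr_cong) auto
  then show ?thesis
    unfolding src_def[abs_def] normal_space_def
    using distr_PiM_component[of UNIV "\<lambda>_. gauss 1"] gauss1.prob_space_axioms by simp
qed

lemma bms_standard: "standard_brownian_motion normal_space (bms j)"
proof -
  have "inj_on (\<lambda>(m, r). Inl (j, m, r)) UNIV" by (auto simp: inj_on_def)
  from NS.indep_vars_reindex[OF this NS.indep_vars_subset[OF src_indep]]
  have "NS.indep_vars (\<lambda>_. borel) (\<lambda>(m, r). src (Inl (j, m, r))) UNIV" by (simp add: case_prod_unfold)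
  then have "NS.indep_vars (\<lambda>_. borel) (\<lambda>(m, r) \<omega>. src (Inl (j, m, r)) \<omega>) UNIV" by (simp add: case_prod_unfold)
  from NS.standard_brownian_motion_levy[OF this src_law]
  show ?thesis by (simp add: bms_def[abs_def])
qed

definition bm_of :: "'k \<Rightarrow> (('k \<times> nat \<times> nat) + (nat \<times> 'k) \<Rightarrow> real) \<Rightarrow> real \<Rightarrow> real" where
  "bm_of j c t = levy_bm (\<lambda>m r. c (Inl (j, m, r))) t"

definition bm_idx :: "'k \<Rightarrow> (('k \<times> nat \<times> nat) + (nat \<times> 'k)) set" where
  "bm_idx j = Inl ` ({j} \<times> UNIV)"

lemma bm_of_restrict: "bm_of j (restrict (\<lambda>k. src k \<omega>) (bm_idx j)) t = bms j t \<omega>"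
  by (simp add: bm_of_def bms_def bm_idx_def)

lemma bm_of_measurable: "(\<lambda>c. bm_of j c t) \<in> borel_measurable (\<Pi>\<^sub>M k\<in>bm_idx j. borel)"
  unfolding bm_of_def
proof (rule levy_path_measurable(2))
  show "(\<lambda>c. c (Inl (j, m, r))) \<in> borel_measurable (\<Pi>\<^sub>M k\<in>bm_idx j. borel)" for m r
    by (rule measurable_component_singleton) (simp add: bm_idx_def)
qed

lemma bms_independent: "independent_processes normal_space (bms :: 'k::finite \<Rightarrow> _)"
  unfolding independent_processes_def
proof -
  have "NS.indep_vars (\<lambda>j. \<Pi>\<^sub>M k\<in>bm_idx j. borel) (\<lambda>j \<omega>. restrict (\<lambda>k. src k \<omega>) (bm_idx j)) (UNIV :: 'k set)"
    by (rule NS.indep_vars_restrict[OF src_indep]) (auto simp: bm_idx_def disjoint_family_on_def)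
  then have "NS.indep_vars (\<lambda>_. \<Pi>\<^sub>M t\<in>{0..}. borel) (\<lambda>j \<omega>. restrict (bm_of j (restrict (\<lambda>k. src k \<omega>) (bm_idx j))) {0..}) (UNIV :: 'k set)"
    by (rule NS.indep_vars_compose2) (intro measurable_restrict bm_of_measurable)
  then show "NS.indep_vars (\<lambda>_. \<Pi>\<^sub>M t\<in>{0..}. borel) (\<lambda>j \<omega>. restrict (\<lambda>t. bms j t \<omega>) {0..}) (UNIV :: 'k set)"
    by (simp only: bm_of_restrict cong: restrict_cong)
qed

definition incr :: "('k::finite \<Rightarrow> real) \<Rightarrow> 'k \<Rightarrow> nat \<Rightarrow> (nat \<Rightarrow> real) \<Rightarrow> real" where
  "incr lam j i \<omega> = (bms j (clock (lam j) (Suc i)) \<omega> - bms j (clock (lam j) i) \<omega>) * real (Suc i) powr lam j"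

definition fresh :: "nat \<Rightarrow> 'k::finite \<Rightarrow> (nat \<Rightarrow> real) \<Rightarrow> real" where
  "fresh i v = src (Inr (i, v))"

text \<open>Each Brownian motion is a function of its own group of normals, and the separate normals
  form singleton groups; within the group of one motion the independence is
  \<open>clock_increments\<close>.\<close>

lemma incr_fresh_indep:
  "NS.indep_vars (\<lambda>_. borel) (\<lambda>(i, b, j). if b then incr lam j i else fresh i j) (UNIV :: (nat \<times> bool \<times> 'k::finite) set)"
proof -
  define K :: "'k + (nat \<times> 'k) \<Rightarrow> (('k \<times> nat \<times> nat) + (nat \<times> 'k)) set" where
    "K = case_sum bm_idx (\<lambda>x. {Inr x})"
  define J :: "'k + (nat \<times> 'k) \<Rightarrow> nat set" where "J = case_sum (\<lambda>_. UNIV) (\<lambda>_. {0})"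
  define f :: "'k + (nat \<times> 'k) \<Rightarrow> nat \<Rightarrow> (('k \<times> nat \<times> nat) + (nat \<times> 'k) \<Rightarrow> real) \<Rightarrow> real" where
    "f = case_sum (\<lambda>j i c. (bm_of j c (clock (lam j) (Suc i)) - bm_of j c (clock (lam j) i)) * real (Suc i) powr lam j)
       (\<lambda>x _ c. c (Inr x))"
  have e1: "f (Inl j) i (restrict (\<lambda>k. src k \<omega>) (K (Inl j))) = incr lam j i \<omega>" for j i \<omega>
    unfolding f_def K_def sum.case bm_of_restrict incr_def ..
  have e2: "f (Inr x) i (restrict (\<lambda>k. src k \<omega>) (K (Inr x))) = src (Inr x) \<omega>" for x i \<omega>
    by (simp add: f_def K_def)
  have ind: "NS.indep_vars (\<lambda>_. borel) (\<lambda>(a, i) \<omega>. f a i (restrict (\<lambda>k. src k \<omega>) (K a))) (Sigma UNIV J)"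
  proof (rule NS.indep_vars_grouped[OF src_indep])
    show "disjoint_family_on K UNIV"
      unfolding disjoint_family_on_def
    proof (intro ballI impI)
      fix a b :: "'k + (nat \<times> 'k)" assume "a \<noteq> b"
      then show "K a \<inter> K b = {}" by (cases a; cases b) (auto simp: K_def bm_idx_def)
    qed
    show "f a i \<in> borel_measurable (\<Pi>\<^sub>M k\<in>K a. borel)" for a i
    proof (cases a)
      case (Inl j)
      show ?thesis unfolding Inl f_def K_def sum.case
        by (intro borel_measurable_times borel_measurable_diff bm_of_measurable borel_measurable_const)
    next
      case (Inr x)
      show ?thesis unfolding Inr f_def K_def sum.case by (rule measurable_component_singleton) simp
    qed
    show "NS.indep_vars (\<lambda>_. borel) (\<lambda>i \<omega>. f a i (restrict (\<lambda>k. src k \<omega>) (K a))) (J a)" for a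
    proof (cases a)
      case (Inl j)
      show ?thesis
        using NS.clock_increments(1)[OF bms_standard[of j], of "lam j"]
        unfolding Inl e1 J_def sum.case incr_def .
    next
      case (Inr x)
      have "src (Inr x :: ('k \<times> nat \<times> nat) + (nat \<times> 'k)) \<in> borel_measurable normal_space"
        by (rule NS.indep_vars_measurable[OF src_indep]) simp
      then show ?thesis unfolding Inr e2 J_def sum.case by (intro NS.indep_vars_singleton)
    qed
  qed
  define h :: "nat \<times> bool \<times> 'k \<Rightarrow> ('k + (nat \<times> 'k)) \<times> nat" where
    "h = (\<lambda>(i, b, j). if b then (Inl j, i) else (Inr (i, j), 0))"
  have inj: "inj_on h UNIV" by (auto simp: inj_on_def h_def split: if_splits)
  have "h ` UNIV \<subseteq> Sigma UNIV J" by (auto simp: h_def J_def split: if_splits)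
  from NS.indep_vars_reindex[OF inj NS.indep_vars_subset[OF ind this]]
  have "NS.indep_vars (\<lambda>_. borel) (\<lambda>k. case h k of (a, i) \<Rightarrow> \<lambda>\<omega>. f a i (restrict (\<lambda>k. src k \<omega>) (K a))) UNIV" .
  moreover have "(case h k of (a, i) \<Rightarrow> \<lambda>\<omega>. f a i (restrict (\<lambda>k. src k \<omega>) (K a))) = (case k of (i, b, j) \<Rightarrow> if b then incr lam j i else fresh i j)" for k
  proof -
    obtain i b j where k: "k = (i, b, j)" by (cases k)
    consider (T) "b = True" | (F) "b = False" by blast
    then show ?thesis
    proof cases
      case T
      show ?thesis unfolding k h_def prod.case T if_True e1 ..
    next
      case F
      show ?thesis unfolding k h_def prod.case F if_False e2 fresh_def ..
    qed
  qed
  ultimately show ?thesis by simp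
qed

theorem corollary2:
  fixes M :: "'a measure"
    and E :: "('k::finite \<times> 'k) set"
    and p q :: "'k \<Rightarrow> real"
    and \<sigma> :: "'k \<Rightarrow> 'a \<Rightarrow> int"
    and \<xi> :: "nat \<Rightarrow> 'k \<Rightarrow> 'a \<Rightarrow> int"
    and D :: "nat \<Rightarrow> 'k \<Rightarrow> 'a \<Rightarrow> nat"
    and u :: "nat \<Rightarrow> 'k \<Rightarrow> 'a \<Rightarrow> 'k"
    and T :: "real ^ 'k ^ 'k"
    and lam :: "'k \<Rightarrow> real"
  assumes erwg: "erwg M E p q \<sigma> \<xi> D u"
    and sym: "transpose (memory_matrix E p) = memory_matrix E p"
    and orth: "orthogonal_matrix T"
    and diag: "transpose T ** memory_matrix E p ** T = diag_matrix lam"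
    and eta: "max_Re_eigenvalue (memory_matrix E p) \<le> 1 / 2"
  shows "\<exists>(N :: (nat \<Rightarrow> real) measure) (S :: nat \<Rightarrow> (nat \<Rightarrow> real) \<Rightarrow> real ^ 'k)
           (W :: 'k \<Rightarrow> real \<Rightarrow> (nat \<Rightarrow> real) \<Rightarrow> real)
           (\<epsilon> :: nat \<Rightarrow> (nat \<Rightarrow> real) \<Rightarrow> real ^ 'k) (\<delta> :: 'k \<Rightarrow> real).
      prob_space N \<and>
      same_process_law M (erwg_S \<sigma> \<xi> D u) N S \<and>
      (\<forall>j. standard_brownian_motion N (W j)) \<and>
      independent_processes N W \<and>
      (\<forall>n. \<epsilon> n \<in> borel_measurable N) \<and>
      (AE \<omega> in N. \<forall>n\<ge>1. S n \<omega> v* T =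
         (\<chi> j. real n powr lam j * W j (\<Sum>i = 1..n. real i powr (- 2 * lam j)) \<omega>) + \<epsilon> n \<omega>) \<and>
      (\<forall>j. (lam j < 1 / 2 \<longrightarrow> \<delta> j > 0) \<and> (lam j = 1 / 2 \<longrightarrow> \<delta> j = 0)) \<and>
      (\<forall>j. AE \<omega> in N. (\<lambda>n. \<epsilon> n \<omega> $ j) \<in> O(\<lambda>n. real n powr (1 / 2 - \<delta> j)))"
proof -
  interpret erwg M E p q \<sigma> \<xi> D u by (rule erwg)
  have lam: "lam j \<le> 1 / 2" for j
    using lam_le_max_Re[OF sym orth diag, of j] eta by linarith
  interpret nn: normal_noise normal_space E p q T lam "incr lam" fresh
  proof
    show "(\<Sum>v\<in>UNIV. (if (u, v) \<in> E then (2 * p v - 1) / real (in_deg E v) else 0) * T $ v $ j) = lam j * T $ u $ j" for u j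
      using diag_eigenvector[OF sym orth diag, of u j] unfolding memory_matrix_def vec_lambda_beta .
    show "distr normal_space borel (incr lam j i) = gauss 1" for j i
      unfolding incr_def[abs_def] by (rule NS.clock_increments(2)[OF bms_standard])
    show "distr normal_space borel (fresh i v) = gauss 1" for i v
      unfolding fresh_def by (rule src_law)
  qed (rule p_range q_range orth lam incr_fresh_indep)+
  define S where "S n \<omega> = (\<Sum>i=1..n. (\<chi> v. nn.X i v \<omega>))" for n \<omega>
  define V where "V n \<omega> = (\<chi> j. real n powr lam j * bms j (clock (lam j) n) \<omega>)" for n \<omega>
  \<comment> \<open>The error is the difference by definition, so the expansion is an identity at
    every sample point and only its growth has to be shown.\<close>
  define \<epsilon> where "\<epsilon> n \<omega> = S n \<omega> v* T - V n \<omega>" for n \<omega>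
  have Zc: "(S n \<omega> v* T) $ j = nn.Z n j \<omega>" for n \<omega> j
    by (simp add: vector_matrix_mult_def S_def nn.Z_def nn.S_def mult.commute)
  have law: "same_process_law M (erwg_S \<sigma> \<xi> D u) normal_space S"
    using drift_law_unique[OF prob_space_axioms erwg_has_drift_law NS.prob_space_axioms nn.driven_has_drift_law]
    by (simp add: S_def[abs_def] erwg_S_def[abs_def])
  have \<epsilon>m: "\<epsilon> n \<in> borel_measurable normal_space" for n
  proof -
    have bm: "bms j (clock (lam j) n) \<in> borel_measurable normal_space" for j
      using bms_standard[of j] clock_nonneg[of "lam j" n] by (simp add: standard_brownian_motion_def)
    have "\<epsilon> n = (\<lambda>\<omega>. \<chi> j. nn.Z n j \<omega> - real n powr lam j * bms j (clock (lam j) n) \<omega>)"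
      by (rule ext) (simp add: \<epsilon>_def V_def vec_eq_iff Zc)
    moreover have "(\<lambda>\<omega>. \<chi> j. nn.Z n j \<omega> - real n powr lam j * bms j (clock (lam j) n) \<omega>) \<in> borel_measurable normal_space"
      by (intro borel_measurable_vec borel_measurable_diff borel_measurable_times borel_measurable_const bm nn.Z_measurable)
    ultimately show ?thesis by (simp only:)
  qed
  have O: "AE \<omega> in normal_space. (\<lambda>n. \<epsilon> n \<omega> $ j) \<in> O(\<lambda>n. real n powr (1 / 2 - rate_gap (lam j)))" for j
    using nn.AE_H_bound[of j] NS.AE_scaled_bm_bound[OF bms_standard[of j] lam[of j]]
  proof eventually_elim
    case (elim \<omega>)
    obtain K1 where K1: "0 < K1" "\<And>n. 1 \<le> n \<Longrightarrow> \<bar>nn.H j n \<omega>\<bar> \<le> K1 * real n powr (498 / 1000)" using elim(1) by blast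
    obtain K2 where K2: "0 < K2" "\<And>n. 1 \<le> n \<Longrightarrow> \<bar>real n powr lam j * bms j (clock (lam j) n) \<omega>\<bar> \<le> K2 * real n" using elim(2) by blast
    have "(\<lambda>n. nn.Z n j \<omega> - real n powr lam j * bms j (clock (lam j) n) \<omega>) \<in> O(\<lambda>n. real n powr (1 / 2 - rate_gap (lam j)))"
    proof (rule recursion_comparison[OF lam[of j], where K="max K1 K2" and Z="\<lambda>n. nn.Z n j \<omega>" and V="\<lambda>n. real n powr lam j * bms j (clock (lam j) n) \<omega>" and H="\<lambda>n. nn.H j n \<omega>"
          and x="\<lambda>n. \<Sum>v\<in>UNIV. nn.eps n v \<omega> * T $ v $ j" and g="\<lambda>n. incr lam j n \<omega>"])
      show "nn.Z (Suc n) j \<omega> = (1 + lam j / real n) * nn.Z n j \<omega> + (\<Sum>v\<in>UNIV. nn.eps n v \<omega> * T $ v $ j)" if "1 \<le> n" for n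
        by (rule nn.Z_Suc[OF that])
      show "real (Suc n) powr lam j * bms j (clock (lam j) (Suc n)) \<omega>
        = (1 + 1 / real n) powr lam j * (real n powr lam j * bms j (clock (lam j) n) \<omega>) + incr lam j n \<omega>" if "1 \<le> n" for n
        unfolding incr_def by (rule scaled_bm_step[OF that])
      show "nn.H j (Suc n) \<omega> = nn.H j n \<omega> + ((\<Sum>v\<in>UNIV. nn.eps n v \<omega> * T $ v $ j) - incr lam j n \<omega>)" for n
        unfolding nn.H_def by (rule sum.lessThan_Suc)
      show "\<bar>nn.H j n \<omega>\<bar> \<le> max K1 K2 * real n powr (498 / 1000)" if "1 \<le> n" for n
        by (rule order_trans[OF K1(2)[OF that]], rule mult_right_mono[OF max.cobounded1]) simp
      show "\<bar>real n powr lam j * bms j (clock (lam j) n) \<omega>\<bar> \<le> max K1 K2 * real n" if "1 \<le> n" for n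
        by (rule order_trans[OF K2(2)[OF that]], rule mult_right_mono[OF max.cobounded2]) simp
    qed
    moreover have "(\<lambda>n. \<epsilon> n \<omega> $ j) = (\<lambda>n. nn.Z n j \<omega> - real n powr lam j * bms j (clock (lam j) n) \<omega>)"
      unfolding \<epsilon>_def vector_minus_component Zc V_def vec_lambda_beta ..
    ultimately show ?case by (simp only:)
  qed
  show ?thesis
  proof (rule exI[of _ normal_space], rule exI[of _ S], rule exI[of _ bms], rule exI[of _ \<epsilon>],
      rule exI[of _ "\<lambda>j. rate_gap (lam j)"], intro conjI allI)
    show "AE \<omega> in normal_space. \<forall>n\<ge>1. S n \<omega> v* T =
         (\<chi> j. real n powr lam j * bms j (\<Sum>i = 1..n. real i powr (- 2 * lam j)) \<omega>) + \<epsilon> n \<omega>"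
      by (rule AE_I2) (simp add: \<epsilon>_def V_def clock_def)
  qed (use NS.prob_space_axioms law bms_standard bms_independent \<epsilon>m O rate_gap in auto)
qed

end
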